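(* Let $p\in(1/2,1)$ and consider bond percolation on $\mathbb{Z}^2$ in which each nearest-neighbour edge is open independently with probability $p$. For each $p$ there is a deterministic constant $\mu_p$ such that, almost surely on the event $\{\mathbf{0}\leftrightarrow\infty\}$, \[ \mu_p=\lim_{\substack{n\to\infty\\ \mathbf{0}\leftrightarrow(n,0)}}\frac{D(n,0)}{n}, \] and, as $p\to 1$, \[ \mu_p = 1+\frac{1-p}{2}+\mathrm{o}(1-p). \]
   Context: Bond percolation on $\mathbb{Z}^2$: each edge between nearest neighbours is open with probability $p$ and closed with probability $1-p$, independently; $\mathbb{P}_p$ denotes this product measure. For $p>1/2$ there is almost surely a unique infinite connected component (cluster) of open edges. We write $x\leftrightarrow y$ if $x,y$ lie in the same open cluster and $x\leftrightarrow\infty$ if $x$ lies in the infinite cluster. $D(x)$ (also written $D(i,j)$ for $x=(i,j)$) is the graph distance from the origin $\mathbf{0}$ to $x$ in the graph of open edges (infinite if they are not connected). The limit along $n$ with $\mathbf{0}\leftrightarrow(n,0)$ means: if $(T_1(k),0)$ denotes the $k$-th point of $\{(i,0):i\ge 1\}$ belonging to the infinite cluster, the limit is $\lim_{k\to\infty} D(T_1(k),0)/T_1(k)$. *)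

theory Defs
  imports "HOL-Probability.Probability" "HOL-Library.Landau_Symbols"
begin

text \<open>Vertices of Z^2 and edges. An edge is indexed by its lower-left endpoint x and a
direction flag: (x, True) is the edge between x and x + (1,0), (x, False) the edge between
x and x + (0,1). A configuration assigns open (True) / closed (False) to each edge.\<close>

type_synonym vertex = "int \<times> int"
type_synonym edge = "vertex \<times> bool"
type_synonym config = "edge \<Rightarrow> bool"

definition perc :: "real \<Rightarrow> config measure" where
  "perc p = (\<Pi>\<^sub>M e\<in>(UNIV :: edge set). measure_pmf (bernoulli_pmf p))"

definition open_adj :: "config \<Rightarrow> vertex \<Rightarrow> vertex \<Rightarrow> bool" where
  "open_adj \<omega> x y \<longleftrightarrow>
     (y = (fst x + 1, snd x) \<and> \<omega> (x, True)) \<or> (x = (fst y + 1, snd y) \<and> \<omega> (y, True)) \<or>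
     (y = (fst x, snd x + 1) \<and> \<omega> (x, False)) \<or> (x = (fst y, snd y + 1) \<and> \<omega> (y, False))"

definition open_path :: "config \<Rightarrow> vertex list \<Rightarrow> bool" where
  "open_path \<omega> xs \<longleftrightarrow> xs \<noteq> [] \<and> (\<forall>i. Suc i < length xs \<longrightarrow> open_adj \<omega> (xs ! i) (xs ! Suc i))"

definition paths_between :: "config \<Rightarrow> vertex \<Rightarrow> vertex \<Rightarrow> vertex list set" where
  "paths_between \<omega> x y = {xs. open_path \<omega> xs \<and> hd xs = x \<and> last xs = y}"

definition connected_in :: "config \<Rightarrow> vertex \<Rightarrow> vertex \<Rightarrow> bool" where
  "connected_in \<omega> x y \<longleftrightarrow> paths_between \<omega> x y \<noteq> {}"

definition conn_inf :: "config \<Rightarrow> vertex \<Rightarrow> bool" where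
  "conn_inf \<omega> x \<longleftrightarrow> infinite {y. connected_in \<omega> x y}"

text \<open>Chemical (graph) distance in the open graph; \<infinity> if not connected.\<close>
definition chem_dist :: "config \<Rightarrow> vertex \<Rightarrow> vertex \<Rightarrow> enat" where
  "chem_dist \<omega> x y = (INF xs\<in>paths_between \<omega> x y. enat (length xs - 1))"

text \<open>T1 \<omega> k: the k-th (0-indexed) i \<ge> 1 with (i,0) in the infinite cluster.\<close>
definition T1 :: "config \<Rightarrow> nat \<Rightarrow> nat" where
  "T1 \<omega> k = enumerate {i::nat. 1 \<le> i \<and> conn_inf \<omega> (int i, 0)} k"

end

theory Submission
  imports Defs "HOL-Library.Transitive_Closure_Table"
begin

text \<open>Existence of the limit: for \<open>p > 1/2\<close> the closed dual clusters are subcritical and have finite mean size, so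
  detours around them bound the distance between cluster points of the axis, and Kingman's subadditive ergodic
  theorem applies. If there is no infinite cluster the limit statement is void and any value of \<open>\<mu>\<close> will do.

  Expansion: let \<open>x + h\<^sub>x(j)\<close> stand for the distance to \<open>(x, j)\<close>. The slopes of \<open>h\<^sub>x\<close> are \<open>\<plusminus>1\<close>, and crossing a
  column raises \<open>h\<close> by 2 where a local minimum meets a closed horizontal edge. This is a totally asymmetric exclusion
  process with jump rate \<open>1 - p\<close>. For a lower bound all closed vertical edges are opened; product measures are then
  stationary (with a small correction for discrete time) and give growth at least \<open>(1 - p)/2\<close> per column. For an
  upper bound the path is confined to \<open>K + 1\<close> rows: up to errors of order \<open>(1 - p)\<^sup>2\<close> from columns with two closed
  edges, this is the exclusion process with open boundaries, whose stationary measure is given by matrix product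
  weights and whose growth tends to \<open>(1 - p)/2\<close> as \<open>K\<close> grows.\<close>

subsection \<open>The product measure and finite dependence\<close>

text \<open>The coefficient 1/2 is twice the maximal current 1/4 of the exclusion process: at
  density 1/2 a row is a local minimum with probability 1/4, is hit with probability about
  \<open>1 - p\<close> per column, and each hit adds 2. In the upper bound two errors compete:
  finite width costs a multiple of \<open>(1 - p) / m\<close>, and columns with several closed edges
  cost a multiple of \<open>(1 - p)^2\<close> that grows with the width. The width is therefore
  fixed before \<open>p\<close> tends to 1. Kingman's theorem wants a process started from every
  axis point, but such a point may miss the infinite cluster, so distances run between the first
  cluster points to the right. The resulting entry costs are only known to be finite almost surely;
  they vanish on dividing by \<open>n\<close> inside truncated expectations, and for this reason
  both bounds on the limit go through truncation. Costs are attached to all lattice routes, which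
  may pass through points off the infinite cluster; a route is turned into an open path only once
  both its ends lie in infinite clusters.\<close>

definition upd :: "edge \<Rightarrow> bool \<Rightarrow> config \<Rightarrow> config" where
  "upd e b w = w(e := b)"

lemma upd_apply: "upd e b w e' = (if e' = e then b else w e')"
  by (simp add: upd_def)

lemma upd_same [simp]: "upd e b w e = b" and upd_other [simp]: "e' \<noteq> e \<Longrightarrow> upd e b w e' = w e'"
  by (simp_all add: upd_def)

lemma upd_triv [simp]: "upd e (w e) w = w"
  by (simp add: upd_def)

lemma upd_triv_True [simp]: "w e \<Longrightarrow> upd e True w = w" and upd_triv_False [simp]: "\<not> w e \<Longrightarrow> upd e False w = w"
  by (auto simp: upd_def fun_eq_iff)

lemma upd_twist: "e \<noteq> f \<Longrightarrow> upd e b (upd f c w) = upd f c (upd e b w)"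
  by (simp add: upd_def fun_upd_twist)

text \<open>Functions of finitely many edges are the working class: induction on \<open>J\<close>,
  one edge at a time, replaces computations with product measures.\<close>

definition dep :: "edge set \<Rightarrow> (config \<Rightarrow> 'a) \<Rightarrow> bool" where
  "dep J F \<longleftrightarrow> (\<forall>w w'. (\<forall>e\<in>J. w e = w' e) \<longrightarrow> F w = F w')"

lemma depD: "dep J F \<Longrightarrow> (\<And>e. e \<in> J \<Longrightarrow> w e = w' e) \<Longrightarrow> F w = F w'"
  by (auto simp: dep_def)

lemma dep_mono: "dep J F \<Longrightarrow> J \<subseteq> J' \<Longrightarrow> dep J' F"
  unfolding dep_def by blast

lemma dep_const [simp]: "dep J (\<lambda>_. c)"
  by (simp add: dep_def)

lemma dep_comp: "dep J F \<Longrightarrow> dep J (\<lambda>w. g (F w))"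
  unfolding dep_def by (intro allI impI arg_cong[where f = g]) blast

lemma dep_comp2:
  assumes "dep J F" "dep J G"
  shows "dep J (\<lambda>w. g (F w) (G w))"
  unfolding dep_def
proof (intro allI impI)
  fix w w' :: config assume "\<forall>e\<in>J. w e = w' e"
  then have "F w = F w'" "G w = G w'" using assms by (auto intro: depD)
  then show "g (F w) (G w) = g (F w') (G w')" by simp
qed

lemma dep_upd:
  assumes "dep (insert e J) F"
  shows "dep J (\<lambda>w. F (upd e b w))"
  unfolding dep_def by (intro allI impI depD[OF assms]) (auto simp: upd_apply)

lemma dep_upd_same:
  assumes "dep J F"
  shows "dep J (\<lambda>w. F (upd e b w))"
  unfolding dep_def by (intro allI impI depD[OF assms]) (auto simp: upd_apply)

lemma dep_upd_notin: "dep J F \<Longrightarrow> e \<notin> J \<Longrightarrow> F (upd e b w) = F w"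
  by (rule depD) (auto simp: upd_apply)

section \<open>The percolation measure and resampling of one edge\<close>

lemma prob_space_perc: "prob_space (perc p)"
  unfolding perc_def by (intro prob_space_PiM measure_pmf.prob_space_axioms)

lemma space_perc [simp]: "space (perc p) = UNIV"
  by (simp add: perc_def space_PiM PiE_def)

lemma measurable_coord [measurable]: "(\<lambda>w. w e) \<in> measurable (perc p) (count_space UNIV)"
proof -
  have "(\<lambda>w. w e) \<in> measurable (perc p) (measure_pmf (bernoulli_pmf p))"
    unfolding perc_def by (rule measurable_component_singleton) simp
  then show ?thesis by simp
qed

lemma measurable_into_perc:
  assumes "\<And>e. (\<lambda>x. f x e) \<in> measurable M (count_space UNIV)"
  shows "f \<in> measurable M (perc p)"
proof -
  have "f = (\<lambda>x. \<lambda>i\<in>UNIV. f x i)" by (simp add: restrict_def)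
  also have "\<dots> \<in> measurable M (perc p)"
    unfolding perc_def
    by (rule measurable_restrict) (use assms in simp)
  finally show ?thesis .
qed

lemma measurable_upd: "(\<lambda>w. upd e b w) \<in> measurable (perc p) (perc q)"
proof (rule measurable_into_perc)
  fix e' show "(\<lambda>w. upd e b w e') \<in> measurable (perc p) (count_space UNIV)"
    by (cases "e' = e") (auto intro: measurable_coord)
qed

lemma distr_upd:
  "distr (measure_pmf (bernoulli_pmf p) \<Otimes>\<^sub>M perc p) (perc p) (\<lambda>(x, X). upd i x X) = perc p"
  using distr_pair_PiM_eq_PiM[of "UNIV :: edge set" "\<lambda>_. measure_pmf (bernoulli_pmf p)" i]
  by (simp add: perc_def upd_def measure_pmf.prob_space_axioms)

lemma measurable_upd_pair:
  "(\<lambda>(x, X). upd i x X) \<in> measurable (measure_pmf (bernoulli_pmf p) \<Otimes>\<^sub>M perc p) (perc p)"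
proof (rule measurable_into_perc)
  fix e
  have "(\<lambda>x. snd x e) \<in> measurable (measure_pmf (bernoulli_pmf p) \<Otimes>\<^sub>M perc p) (count_space UNIV)"
    by (rule measurable_compose[OF measurable_snd measurable_coord])
  moreover have "fst \<in> measurable (measure_pmf (bernoulli_pmf p) \<Otimes>\<^sub>M perc p) (count_space UNIV)"
    using measurable_fst[of "measure_pmf (bernoulli_pmf p)" "perc p"] by simp
  ultimately show "(\<lambda>x. (case x of (x, X) \<Rightarrow> upd i x X) e) \<in> measurable (measure_pmf (bernoulli_pmf p) \<Otimes>\<^sub>M perc p) (count_space UNIV)"
    by (cases "e = i") (simp_all add: case_prod_unfold)
qed

text \<open>Redrawing one coordinate independently preserves the product measure
  (\<open>distr_upd\<close>); then integrate over the new value first.\<close>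

lemma nn_resample:
  assumes p: "0 \<le> p" "p \<le> 1" and [measurable]: "F \<in> borel_measurable (perc p)"
  shows "(\<integral>\<^sup>+w. F w \<partial>perc p) =
    ennreal p * (\<integral>\<^sup>+w. F (upd e True w) \<partial>perc p) + ennreal (1 - p) * (\<integral>\<^sup>+w. F (upd e False w) \<partial>perc p)"
proof -
  interpret P: prob_space "perc p" by (rule prob_space_perc)
  note [measurable] = measurable_upd_pair[of e p]
  have "(\<integral>\<^sup>+w. F w \<partial>perc p) = (\<integral>\<^sup>+z. F (case z of (x, X) \<Rightarrow> upd e x X) \<partial>(measure_pmf (bernoulli_pmf p) \<Otimes>\<^sub>M perc p))"
    by (subst distr_upd[of p e, symmetric], subst nn_integral_distr) auto
  also have "\<dots> = (\<integral>\<^sup>+b. (\<integral>\<^sup>+w. F (upd e b w) \<partial>perc p) \<partial>measure_pmf (bernoulli_pmf p))"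
    by (subst P.nn_integral_fst[symmetric]) auto
  also have "\<dots> = ennreal p * (\<integral>\<^sup>+w. F (upd e True w) \<partial>perc p) + ennreal (1 - p) * (\<integral>\<^sup>+w. F (upd e False w) \<partial>perc p)"
    using p by (subst nn_integral_bernoulli_pmf) (auto simp: mult.commute)
  finally show ?thesis .
qed

definition EE :: "real \<Rightarrow> (config \<Rightarrow> real) \<Rightarrow> real" where
  "EE p F = (\<integral>w. F w \<partial>perc p)"

lemma integrable_bdd:
  fixes F :: "config \<Rightarrow> real"
  assumes "F \<in> borel_measurable (perc p)" "\<And>w. \<bar>F w\<bar> \<le> B"
  shows "integrable (perc p) F"
proof -
  interpret P: prob_space "perc p" by (rule prob_space_perc)
  show ?thesis using assms by (intro P.integrable_const_bound[of _ B]) auto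
qed

text \<open>Adding the bound \<open>B\<close> makes the function nonnegative, which reduces the
  claim to \<open>nn_resample\<close>.\<close>

lemma resample:
  fixes F :: "config \<Rightarrow> real"
  assumes p: "0 \<le> p" "p \<le> 1" and F [measurable]: "F \<in> borel_measurable (perc p)" and B: "\<And>w. \<bar>F w\<bar> \<le> B"
  shows "EE p F = p * EE p (\<lambda>w. F (upd e True w)) + (1 - p) * EE p (\<lambda>w. F (upd e False w))"
proof -
  interpret P: prob_space "perc p" by (rule prob_space_perc)
  have B0: "B \<ge> 0" using B[of undefined] by linarith
  have m: "(\<lambda>w. F (upd e b w)) \<in> borel_measurable (perc p)" for b
    by (rule measurable_compose[OF measurable_upd]) fact
  have nn: "(\<integral>\<^sup>+w. ennreal (G w + B) \<partial>perc p) = ennreal (EE p G + B) \<and> EE p G + B \<ge> 0"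
    if Gm: "G \<in> borel_measurable (perc p)" and G: "\<And>w. \<bar>G w\<bar> \<le> B" for G
  proof -
    have i: "integrable (perc p) G" by (rule integrable_bdd[OF Gm G])
    have pos: "0 \<le> G w + B" for w using G[of w] by linarith
    have i': "integrable (perc p) (\<lambda>w. G w + B)" using i by (rule Bochner_Integration.integrable_add) simp
    have eq: "(\<integral>w. G w + B \<partial>perc p) = EE p G + B"
      unfolding EE_def using i P.prob_space by (subst Bochner_Integration.integral_add) simp_all
    have "(\<integral>\<^sup>+w. ennreal (G w + B) \<partial>perc p) = ennreal (\<integral>w. G w + B \<partial>perc p)"
      by (rule nn_integral_eq_integral[OF i']) (rule AE_I2, rule pos)
    moreover have "0 \<le> (\<integral>w. G w + B \<partial>perc p)" by (rule Bochner_Integration.integral_nonneg) (rule pos)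
    ultimately show ?thesis by (simp add: eq)
  qed
  note n0 = nn[OF F B] and nT = nn[OF m[of True] B] and nF = nn[OF m[of False] B]
  have "(\<integral>\<^sup>+w. ennreal (F w + B) \<partial>perc p) = ennreal p * (\<integral>\<^sup>+w. ennreal (F (upd e True w) + B) \<partial>perc p)
     + ennreal (1 - p) * (\<integral>\<^sup>+w. ennreal (F (upd e False w) + B) \<partial>perc p)"
    by (rule nn_resample[OF p, of "\<lambda>w. ennreal (F w + B)"]) measurable
  then have "ennreal (EE p F + B) = ennreal (p * (EE p (\<lambda>w. F (upd e True w)) + B) + (1 - p) * (EE p (\<lambda>w. F (upd e False w)) + B))"
    using p nT nF n0 by (subst ennreal_plus) (simp_all add: ennreal_mult)
  then have "EE p F + B = p * (EE p (\<lambda>w. F (upd e True w)) + B) + (1 - p) * (EE p (\<lambda>w. F (upd e False w)) + B)"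
    using n0 nT nF p by (subst (asm) ennreal_inj) auto
  then show ?thesis by (simp add: algebra_simps)
qed

lemma dep_finite_measurable:
  assumes "finite J" "dep J F" "space N = UNIV"
  shows "F \<in> measurable (perc p) N"
  using assms(1,2)
proof (induction J arbitrary: F rule: finite_induct)
  case empty
  then have "F = (\<lambda>_. F undefined)" by (auto simp: dep_def)
  moreover have "(\<lambda>_. F undefined) \<in> measurable (perc p) N" using assms(3) by simp
  ultimately show ?case by simp
next
  case (insert e J)
  have eq: "F = (\<lambda>w. if w e then F (upd e True w) else F (upd e False w))"
  proof
    fix w show "F w = (if w e then F (upd e True w) else F (upd e False w))"
      by (cases "w e") simp_all
  qed
  have [measurable]: "(\<lambda>w. F (upd e b w)) \<in> measurable (perc p) N" for b
    by (rule insert.IH[OF dep_upd[OF insert.prems]])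
  show ?case by (subst eq) measurable
qed

lemma dep_finite_bounded:
  fixes F :: "config \<Rightarrow> real"
  assumes "finite J" "dep J F"
  shows "\<exists>B. \<forall>w. \<bar>F w\<bar> \<le> B"
  using assms
proof (induction J arbitrary: F rule: finite_induct)
  case empty
  then have "F w = F undefined" for w by (auto simp: dep_def)
  then have "\<bar>F w\<bar> \<le> \<bar>F undefined\<bar>" for w by (rule eq_refl[OF arg_cong])
  then show ?case by blast
next
  case (insert e J)
  obtain B where B: "\<bar>F (upd e True w)\<bar> \<le> B" for w using insert.IH[OF dep_upd[OF insert.prems, of True]] by blast
  obtain C where C: "\<bar>F (upd e False w)\<bar> \<le> C" for w using insert.IH[OF dep_upd[OF insert.prems, of False]] by blast
  have "\<bar>F w\<bar> \<le> max B C" for w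
  proof (cases "w e")
    case True then have "upd e True w = w" by simp
    then show ?thesis using B[of w] by simp
  next
    case False then have "upd e False w = w" by simp
    then show ?thesis using C[of w] by simp
  qed
  then show ?case by blast
qed

lemma dep_finite_integrable:
  fixes F :: "config \<Rightarrow> real"
  assumes "finite J" "dep J F"
  shows "integrable (perc p) F"
proof -
  obtain B where "\<bar>F w\<bar> \<le> B" for w using dep_finite_bounded[OF assms] by blast
  then show ?thesis by (intro integrable_bdd dep_finite_measurable[OF assms]) auto
qed

lemma resample_fin:
  fixes F :: "config \<Rightarrow> real"
  assumes "finite J" "dep J F" "0 \<le> p" "p \<le> 1"
  shows "EE p F = p * EE p (\<lambda>w. F (upd e True w)) + (1 - p) * EE p (\<lambda>w. F (upd e False w))"
proof -
  obtain B where "\<bar>F w\<bar> \<le> B" for w using dep_finite_bounded[OF assms(1,2)] by blast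
  then show ?thesis by (intro resample assms dep_finite_measurable[OF assms(1,2)]) auto
qed

section \<open>Russo's formula, independence and the Harris-FKG inequality\<close>

lemma EE_const [simp]: "EE p (\<lambda>_. c) = c"
  using prob_space.prob_space[OF prob_space_perc, of p] by (simp add: EE_def)

text \<open>Russo's formula for arbitrary functions. Peeling off the edge \<open>e\<close> gives
  \<open>p * EE p (T True) + (1 - p) * EE p (T False)\<close>: the explicit \<open>p\<close>
  produces the term of \<open>e\<close>, and the induction hypothesis for both \<open>T b\<close>
  produces the others.\<close>

lemma russo:
  fixes F :: "config \<Rightarrow> real"
  assumes "finite J" "dep J F" "0 < p" "p < 1"
  shows "((\<lambda>p. EE p F) has_real_derivative (\<Sum>e\<in>J. EE p (\<lambda>w. F (upd e True w) - F (upd e False w)))) (at p)"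
  using assms(1,2)
proof (induction J arbitrary: F rule: finite_induct)
  case empty
  then have "F = (\<lambda>_. F undefined)" by (auto simp: dep_def)
  then obtain c where "F = (\<lambda>_. c)" by blast
  then show ?case by simp
next
  case (insert e J)
  define T where "T b = (\<lambda>w. F (upd e b w))" for b
  have dT: "dep J (T b)" for b unfolding T_def by (rule dep_upd[OF insert.prems])
  define S where "S b = (\<Sum>f\<in>J. EE p (\<lambda>w. T b (upd f True w) - T b (upd f False w)))" for b
  have fin: "finite (insert e J)" using insert by simp
  have d: "((\<lambda>p. EE p (T b)) has_real_derivative S b) (at p)" for b
    unfolding S_def by (rule insert.IH[OF dT])
  have "((\<lambda>p. p * EE p (T True) + (1 - p) * EE p (T False)) has_real_derivative
      (1 * EE p (T True) + S True * p + ((0 - 1) * EE p (T False) + S False * (1 - p)))) (at p)"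
    by (intro derivative_intros d)
  then have *: "((\<lambda>p. EE p F) has_real_derivative
      (1 * EE p (T True) + S True * p + ((0 - 1) * EE p (T False) + S False * (1 - p)))) (at p)"
    by (rule has_field_derivative_transform_within_open[where S = "{0<..<1}"])
       (use assms(3,4) in \<open>auto simp: T_def intro!: resample_fin[OF fin insert.prems, symmetric]\<close>)
  have fe: "f \<noteq> e" if "f \<in> J" for f using that insert by auto
  have step: "EE p (\<lambda>w. F (upd f True w) - F (upd f False w)) =
      p * EE p (\<lambda>w. T True (upd f True w) - T True (upd f False w)) +
      (1 - p) * EE p (\<lambda>w. T False (upd f True w) - T False (upd f False w))" if "f \<in> J" for f
  proof -
    have "dep (insert e J) (\<lambda>w. F (upd f True w) - F (upd f False w))"
      by (intro dep_comp2[where g = "(-)"] dep_upd_same insert.prems)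
    from resample_fin[OF fin this, of p e] show ?thesis
      using assms(3,4) fe[OF that] by (simp add: T_def upd_twist)
  qed
  have "EE p (\<lambda>w. F (upd e True w) - F (upd e False w)) = EE p (T True) - EE p (T False)"
    unfolding EE_def T_def
    by (intro Bochner_Integration.integral_diff)
       (use dT insert.hyps(1) in \<open>auto intro!: dep_finite_integrable simp: T_def\<close>)
  then have "(\<Sum>f\<in>insert e J. EE p (\<lambda>w. F (upd f True w) - F (upd f False w))) =
      (1 * EE p (T True) + S True * p + ((0 - 1) * EE p (T False) + S False * (1 - p)))"
    using insert.hyps step by (simp add: S_def sum.distrib sum_distrib_left mult.commute)
  with * show ?case by simp
qed

text \<open>Resampling an edge of \<open>J\<close> changes \<open>F\<close> but not
  \<open>G\<close>, so the factor of \<open>G\<close> is carried unchanged through the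
  induction.\<close>

lemma indep_finite:
  fixes F G :: "config \<Rightarrow> real"
  assumes "finite J" "dep J F" "dep (- J) G" "G \<in> borel_measurable (perc p)" "\<And>w. \<bar>G w\<bar> \<le> B" "0 \<le> p" "p \<le> 1"
  shows "EE p (\<lambda>w. F w * G w) = EE p F * EE p G"
proof -
  have "\<lbrakk>J' \<subseteq> J; dep J' F\<rbrakk> \<Longrightarrow> EE p (\<lambda>w. F w * G w) = EE p F * EE p G" if "finite J'" for J'
    using that
  proof (induction J' arbitrary: F rule: finite_induct)
    case empty
    then obtain c where "F = (\<lambda>_. c)" by (force simp: dep_def)
    then show ?case by (simp add: EE_def)
  next
    case (insert e J')
    have G: "G (upd e b w) = G w" for w b by (rule dep_upd_notin[OF assms(3)]) (use insert.prems in auto)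
    have fin: "finite (insert e J')" using insert by simp
    obtain C where C: "\<bar>F w\<bar> \<le> C" for w using dep_finite_bounded[OF fin insert.prems(2)] by blast
    have m: "(\<lambda>w. F w * G w) \<in> borel_measurable (perc p)"
      using dep_finite_measurable[OF fin insert.prems(2), of borel p] assms(4) by simp
    have b: "\<bar>F w * G w\<bar> \<le> C * B" for w
      unfolding abs_mult by (intro mult_mono C assms(5)) (use C[of w] in auto)
    have "EE p (\<lambda>w. F w * G w) = p * EE p (\<lambda>w. F (upd e True w) * G w) + (1 - p) * EE p (\<lambda>w. F (upd e False w) * G w)"
      using resample[OF assms(6,7) m b, of e] by (simp add: G)
    also have "\<dots> = (p * EE p (\<lambda>w. F (upd e True w)) + (1 - p) * EE p (\<lambda>w. F (upd e False w))) * EE p G"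
      by (subst (1 2) insert.IH) (use insert.prems in \<open>auto intro: dep_upd simp: algebra_simps\<close>)
    also have "\<dots> = EE p F * EE p G"
      using resample_fin[OF fin insert.prems(2) assms(6,7), of e] by simp
    finally show ?case .
  qed
  from this[OF assms(1) order_refl assms(2)] show ?thesis .
qed

lemma EE_mono:
  assumes "integrable (perc p) F" "integrable (perc p) G" "\<And>w. F w \<le> G w"
  shows "EE p F \<le> EE p G"
  unfolding EE_def using assms by (intro integral_mono) auto

text \<open>Condition on one edge. Both conditional means are larger when it is open, so on the
  two-point law of that edge the covariance \<open>p (1 - p)\<close> times the product of the
  increments is nonnegative; the conditional inequalities come from induction.\<close>

lemma fkg:
  fixes F G :: "config \<Rightarrow> real"
  assumes "finite J" "dep J F" "dep J G" "mono F" "mono G" "0 \<le> p" "p \<le> 1"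
  shows "EE p F * EE p G \<le> EE p (\<lambda>w. F w * G w)"
  using assms(1-5)
proof (induction J arbitrary: F G rule: finite_induct)
  case empty
  then obtain c where "F = (\<lambda>_. c)" by (force simp: dep_def)
  then show ?case by (simp add: EE_def)
next
  case (insert e J)
  have fin: "finite (insert e J)" using insert by simp
  define f g where "f b = EE p (\<lambda>w. F (upd e b w))" and "g b = EE p (\<lambda>w. G (upd e b w))" for b
  have up: "mono (\<lambda>w::config. upd e b w)" for b by (auto simp: mono_def le_fun_def upd_apply)
  have mF: "mono (\<lambda>w. F (upd e b w))" and mG: "mono (\<lambda>w. G (upd e b w))" for b
    using insert.prems(3,4) up by (auto simp: mono_def)
  have le: "f False \<le> f True" "g False \<le> g True"
  proof -
    have "upd e False w \<le> upd e True w" for w :: config by (auto simp: le_fun_def upd_apply)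
    then show "f False \<le> f True" "g False \<le> g True" unfolding f_def g_def
      by (auto intro!: EE_mono dep_finite_integrable[OF insert.hyps(1)] dep_upd insert.prems monoD[OF insert.prems(3)] monoD[OF insert.prems(4)])
  qed
  have dFG: "dep (insert e J) (\<lambda>w. F w * G w)" by (intro dep_comp2[where g = "(*)"] insert.prems)
  have "(p * f True + (1 - p) * f False) * (p * g True + (1 - p) * g False) =
    p * (f True * g True) + (1 - p) * (f False * g False) - p * (1 - p) * ((f True - f False) * (g True - g False))"
    by algebra
  also have "\<dots> \<le> p * (f True * g True) + (1 - p) * (f False * g False)"
    using le assms(6,7) by (simp add: mult_nonneg_nonneg)
  also have "\<dots> \<le> p * EE p (\<lambda>w. F (upd e True w) * G (upd e True w)) + (1 - p) * EE p (\<lambda>w. F (upd e False w) * G (upd e False w))"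
    unfolding f_def g_def
    by (intro add_mono mult_left_mono insert.IH dep_upd insert.prems mF mG) (use assms(6,7) in auto)
  also have "\<dots> = EE p (\<lambda>w. F w * G w)"
    using resample_fin[OF fin dFG assms(6,7), of e] by simp
  finally show ?case
    using resample_fin[OF fin insert.prems(1) assms(6,7), of e] resample_fin[OF fin insert.prems(2) assms(6,7), of e]
    by (simp add: f_def g_def)
qed

lemma EE_mono_p:
  fixes F :: "config \<Rightarrow> real"
  assumes "finite J" "dep J F" "mono F" "0 < p" "p \<le> p'" "p' < 1"
  shows "EE p F \<le> EE p' F"
proof (rule DERIV_nonneg_imp_nondecreasing[OF assms(5)])
  fix x assume x: "p \<le> x" "x \<le> p'"
  have "upd e False w \<le> upd e True w" for w :: config and e by (auto simp: le_fun_def upd_apply)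
  then have "0 \<le> EE x (\<lambda>w. F (upd e True w) - F (upd e False w))" for e
    unfolding EE_def by (intro Bochner_Integration.integral_nonneg) (simp add: monoD[OF assms(3)])
  then show "\<exists>y. ((\<lambda>p. EE p F) has_real_derivative y) (at x) \<and> 0 \<le> y"
    using russo[OF assms(1,2), of x] x assms(4,6) by (intro exI[of _ "\<Sum>e\<in>J. EE x (\<lambda>w. F (upd e True w) - F (upd e False w))"] conjI sum_nonneg) simp_all
qed

section \<open>Invariance under relabelling of edges and exchange of open and closed\<close>

lemma distr_reindex:
  assumes "inj g"
  shows "distr (perc p) (perc p) (\<lambda>w e. w (g e)) = perc p"
  using distr_PiM_reindex[of UNIV "\<lambda>_. measure_pmf (bernoulli_pmf p)" g UNIV] assms
  by (simp add: perc_def measure_pmf.prob_space_axioms restrict_def)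

lemma measurable_reindex: "(\<lambda>w e. w (g e)) \<in> measurable (perc p) (perc q)"
  by (rule measurable_into_perc) measurable

lemma EE_reindex:
  fixes F :: "config \<Rightarrow> real"
  assumes "inj g" "F \<in> borel_measurable (perc p)"
  shows "EE p (\<lambda>w. F (\<lambda>e. w (g e))) = EE p F"
  unfolding EE_def using assms
  by (subst (2) distr_reindex[OF assms(1), of p, symmetric], subst integral_distr) (auto intro: measurable_reindex)

lemma distr_flip:
  assumes "0 \<le> p" "p \<le> 1"
  shows "distr (perc p) (perc (1 - p)) (\<lambda>w e. \<not> w e) = perc (1 - p)"
proof -
  interpret P: product_prob_space "\<lambda>_. measure_pmf (bernoulli_pmf p)" "UNIV :: edge set" ..
  interpret Q: product_prob_space "\<lambda>_. measure_pmf (bernoulli_pmf (1 - p))" "UNIV :: edge set" ..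
  have b: "map_pmf Not (bernoulli_pmf p) = bernoulli_pmf (1 - p)"
  proof (rule pmf_eqI)
    fix i :: bool
    have "Not -` {i} = {\<not> i}" by auto
    then show "pmf (map_pmf Not (bernoulli_pmf p)) i = pmf (bernoulli_pmf (1 - p)) i"
      using assms by (cases i) (simp_all add: pmf_map measure_pmf_single)
  qed
  have c: "emeasure (measure_pmf (bernoulli_pmf (1 - p))) A = emeasure (measure_pmf (bernoulli_pmf p)) (Not -` A)" for A
    by (simp flip: b)
  have m: "(\<lambda>w e. \<not> w e) \<in> measurable (perc p) (perc (1 - p))"
    by (rule measurable_into_perc) measurable
  show ?thesis
    unfolding perc_def[of "1 - p"]
  proof (rule Q.PiM_eq)
    fix J :: "edge set" and F assume J: "finite J" "J \<subseteq> UNIV" "\<And>j. j \<in> J \<Longrightarrow> F j \<in> sets (measure_pmf (bernoulli_pmf (1 - p)))"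
    have "emeasure (distr (perc p) (perc (1 - p)) (\<lambda>w e. \<not> w e)) (prod_emb UNIV (\<lambda>_. measure_pmf (bernoulli_pmf (1 - p))) J (Pi\<^sub>E J F))
      = emeasure (perc p) ((\<lambda>w e. \<not> w e) -` prod_emb UNIV (\<lambda>_. measure_pmf (bernoulli_pmf (1 - p))) J (Pi\<^sub>E J F) \<inter> space (perc p))"
      using m J by (intro emeasure_distr) (auto simp: perc_def[of "1 - p"] intro!: sets_PiM_I)
    also have "(\<lambda>w e. \<not> w e) -` prod_emb UNIV (\<lambda>_. measure_pmf (bernoulli_pmf (1 - p))) J (Pi\<^sub>E J F) \<inter> space (perc p)
      = {w\<in>space (PiM UNIV (\<lambda>_. measure_pmf (bernoulli_pmf p))). \<forall>j\<in>J. w j \<in> Not -` F j}"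
      by (auto simp: prod_emb_def PiE_def space_PiM Pi_iff)
    also have "emeasure (perc p) \<dots> = (\<Prod>j\<in>J. emeasure (measure_pmf (bernoulli_pmf p)) (Not -` F j))"
      unfolding perc_def by (rule P.emeasure_PiM_Collect) (use J in auto)
    finally show "emeasure (distr (perc p) (PiM UNIV (\<lambda>_. measure_pmf (bernoulli_pmf (1 - p)))) (\<lambda>w e. \<not> w e)) (prod_emb UNIV (\<lambda>_. measure_pmf (bernoulli_pmf (1 - p))) J (Pi\<^sub>E J F))
       = (\<Prod>j\<in>J. emeasure (measure_pmf (bernoulli_pmf (1 - p))) (F j))"
      by (simp add: c perc_def)
  qed (simp add: perc_def)
qed

declare split_paired_All [simp del] split_paired_Ex [simp del]

subsection \<open>Open paths\<close>

definition tip :: "edge \<Rightarrow> vertex" where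
  "tip e = (if snd e then (fst (fst e) + 1, snd (fst e)) else (fst (fst e), snd (fst e) + 1))"

lemma tip_simps [simp]: "tip ((a, b), True) = (a + 1, b)" "tip ((a, b), False) = (a, b + 1)"
  by (simp_all add: tip_def)

lemma tip_neq [simp]: "tip e \<noteq> fst e" "fst e \<noteq> tip e"
  by (auto simp: tip_def prod_eq_iff)

lemma open_adj_iff:
  "open_adj w x y \<longleftrightarrow> (\<exists>e. w e \<and> (x = fst e \<and> y = tip e \<or> x = tip e \<and> y = fst e))"
proof
  assume "open_adj w x y"
  then consider "y = (fst x + 1, snd x)" "w (x, True)" | "x = (fst y + 1, snd y)" "w (y, True)"
    | "y = (fst x, snd x + 1)" "w (x, False)" | "x = (fst y, snd y + 1)" "w (y, False)"
    unfolding open_adj_def by blast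
  then show "\<exists>e. w e \<and> (x = fst e \<and> y = tip e \<or> x = tip e \<and> y = fst e)"
  proof cases
    case 1 then show ?thesis by (intro exI[of _ "(x, True)"]) (simp add: tip_def)
  next
    case 2 then show ?thesis by (intro exI[of _ "(y, True)"]) (simp add: tip_def)
  next
    case 3 then show ?thesis by (intro exI[of _ "(x, False)"]) (simp add: tip_def)
  next
    case 4 then show ?thesis by (intro exI[of _ "(y, False)"]) (simp add: tip_def)
  qed
next
  assume "\<exists>e. w e \<and> (x = fst e \<and> y = tip e \<or> x = tip e \<and> y = fst e)"
  then obtain v b where "w (v, b)" "x = v \<and> y = tip (v, b) \<or> x = tip (v, b) \<and> y = v" by auto
  then show "open_adj w x y" by (cases b) (auto simp: open_adj_def tip_def)
qed

lemma edge_eqI: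
  assumes "fst e = fst e' \<and> tip e = tip e' \<or> fst e = tip e' \<and> tip e = fst e'"
  shows "e = e'"
  using assms by (cases e; cases e') (auto simp: tip_def prod_eq_iff split: if_splits)

lemma open_adj_edge: "open_adj w (fst e) (tip e) \<longleftrightarrow> w e"
  unfolding open_adj_iff using edge_eqI[of e] by blast

lemma open_adj_sym: "open_adj w x y \<longleftrightarrow> open_adj w y x"
  unfolding open_adj_iff by blast

abbreviation conn :: "config \<Rightarrow> vertex \<Rightarrow> vertex \<Rightarrow> bool" where
  "conn w \<equiv> (open_adj w)\<^sup>*\<^sup>*"

lemma conn_sym: "conn w x y \<Longrightarrow> conn w y x"
proof (induction rule: rtranclp_induct)
  case (step y z)
  then show ?case using converse_rtranclp_into_rtranclp[of "open_adj w" z y x] by (simp add: open_adj_sym)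
qed simp

lemma open_adj_mono: "w \<le> w' \<Longrightarrow> open_adj w x y \<Longrightarrow> open_adj w' x y"
  unfolding open_adj_iff le_fun_def le_bool_def by blast

lemma conn_mono: "w \<le> w' \<Longrightarrow> conn w x y \<Longrightarrow> conn w' x y"
  by (erule rtranclp_mono[THEN predicate2D, rotated]) (auto intro: open_adj_mono)

lemma path_paths_between:
  "rtrancl_path (open_adj w) x xs y \<Longrightarrow> x # xs \<in> paths_between w x y"
proof (induction rule: rtrancl_path.induct)
  case (base x)
  then show ?case by (simp add: paths_between_def open_path_def)
next
  case (step x y ys z)
  have "open_adj w ((x # y # ys) ! i) ((x # y # ys) ! Suc i)" if "Suc i < length (x # y # ys)" for i
    using that step by (cases i) (auto simp: paths_between_def open_path_def)
  with step show ?case by (auto simp: paths_between_def open_path_def)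
qed

lemma open_path_conn:
  "open_path w xs \<Longrightarrow> conn w (hd xs) (last xs)"
proof (induction xs)
  case Nil then show ?case by (simp add: open_path_def)
next
  case (Cons x xs)
  show ?case
  proof (cases xs)
    case Nil then show ?thesis by simp
  next
    case (Cons y ys)
    with Cons.prems have "open_adj w x y" unfolding open_path_def by force
    moreover have "open_path w xs"
      using Cons.prems Cons unfolding open_path_def by force
    ultimately show ?thesis using Cons.IH Cons by (auto intro: converse_rtranclp_into_rtranclp)
  qed
qed

lemma connected_in_iff: "connected_in w x y \<longleftrightarrow> conn w x y"
proof
  assume "connected_in w x y"
  then obtain xs where "open_path w xs" "hd xs = x" "last xs = y"
    by (auto simp: connected_in_def paths_between_def)
  then show "conn w x y" using open_path_conn by blast
next
  assume "conn w x y"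
  then show "connected_in w x y"
    unfolding rtranclp_eq_rtrancl_path connected_in_def using path_paths_between by blast
qed

lemma conn_inf_iff: "conn_inf w x \<longleftrightarrow> infinite {y. conn w x y}"
  by (simp add: conn_inf_def connected_in_iff)

lemma conn_inf_conn: "conn_inf w x \<Longrightarrow> conn w x y \<Longrightarrow> conn_inf w y"
  unfolding conn_inf_iff by (erule contrapos_nn, erule rev_finite_subset)
    (auto intro: rtranclp_trans dest: conn_sym)

lemma conn_inf_mono: "w \<le> w' \<Longrightarrow> conn_inf w x \<Longrightarrow> conn_inf w' x"
  unfolding conn_inf_iff by (erule contrapos_nn, erule rev_finite_subset) (auto intro: conn_mono)

lemma chem_dist_le_path:
  "rtrancl_path (open_adj w) x xs y \<Longrightarrow> chem_dist w x y \<le> enat (length xs)"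
  unfolding chem_dist_def using path_paths_between by (intro INF_lower2[of "x # xs"]) auto

lemma chem_dist_path_iff:
  "chem_dist w x y \<le> enat n \<longleftrightarrow> (\<exists>xs\<in>paths_between w x y. length xs \<le> Suc n)"
proof
  assume le: "chem_dist w x y \<le> enat n"
  have "\<exists>xs\<in>paths_between w x y. enat (length xs - 1) < enat (Suc n)"
  proof (rule ccontr)
    assume "\<not> ?thesis"
    then have "enat (Suc n) \<le> chem_dist w x y" unfolding chem_dist_def by (intro INF_greatest) (auto simp: not_less)
    with le have "enat (Suc n) \<le> enat n" by (rule order_trans[rotated])
    then show False by simp
  qed
  then show "\<exists>xs\<in>paths_between w x y. length xs \<le> Suc n" by force
next
  assume "\<exists>xs\<in>paths_between w x y. length xs \<le> Suc n"
  then show "chem_dist w x y \<le> enat n"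
    unfolding chem_dist_def by (auto intro!: INF_lower2)
qed

subsection \<open>Restriction of a configuration\<close>

definition rs :: "edge set \<Rightarrow> config \<Rightarrow> config" where
  "rs J w e \<longleftrightarrow> e \<in> J \<and> w e"

definition Ein :: "vertex set \<Rightarrow> edge set" where
  "Ein S = {e. fst e \<in> S \<and> tip e \<in> S}"

lemma rs_le: "rs J w \<le> w"
  by (auto simp: rs_def le_fun_def)

lemma rs_mono: "J \<subseteq> J' \<Longrightarrow> w \<le> w' \<Longrightarrow> rs J w \<le> rs J' w'"
  by (auto simp: rs_def le_fun_def)

lemma dep_rs: "dep J (\<lambda>w. F (rs J w))"
proof -
  have "rs J w = rs J w'" if "\<forall>e\<in>J. w e = w' e" for w w'
    using that by (auto simp: rs_def fun_eq_iff)
  then show ?thesis unfolding dep_def by metis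
qed

lemma open_adj_rs_Ein: "open_adj (rs (Ein S) w) x y \<longleftrightarrow> open_adj w x y \<and> x \<in> S \<and> y \<in> S"
  unfolding open_adj_iff rs_def Ein_def by auto

lemma finite_nbrs: "finite {e. fst e \<in> S \<or> tip e \<in> S}" if "finite S"
proof -
  have "{e. fst e \<in> S \<or> tip e \<in> S} \<subseteq> (S \<union> (\<lambda>v. (fst v - 1, snd v)) ` S \<union> (\<lambda>v. (fst v, snd v - 1)) ` S) \<times> UNIV"
  proof safe
    fix a b :: int and d :: bool assume "tip ((a, b), d) \<in> S" "(a, b) \<notin> (\<lambda>v. (fst v, snd v - 1)) ` S"  "(a, b) \<notin> (\<lambda>v. (fst v - 1, snd v)) ` S"
    moreover have "(a, b) \<in> (\<lambda>v. (fst v, snd v - 1)) ` S" if "(a, b + 1) \<in> S" using that by force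
    moreover have "(a, b) \<in> (\<lambda>v. (fst v - 1, snd v)) ` S" if "(a + 1, b) \<in> S" using that by force
    ultimately show "(a, b) \<in> S" by (cases d) auto
  qed auto
  then show ?thesis by (rule finite_subset) (use that in auto)
qed

lemma finite_Ein: "finite S \<Longrightarrow> finite (Ein S)"
  by (rule finite_subset[OF _ finite_nbrs[of S]]) (auto simp: Ein_def)

text \<open>Stop the path at its first step out of \<open>S\<close>; what comes before uses only
  edges inside \<open>S\<close>.\<close>

lemma conn_exit:
  assumes "conn w x y" "x \<in> S" "y \<notin> S"
  obtains u v where "conn (rs (Ein S) w) x u" "u \<in> S" "v \<notin> S" "open_adj w u v" "conn w x v"
proof -
  have "y \<in> S \<and> conn (rs (Ein S) w) x y \<or> (\<exists>u v. conn (rs (Ein S) w) x u \<and> u \<in> S \<and> v \<notin> S \<and> open_adj w u v \<and> conn w x v)"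
    using assms(1)
  proof (induction rule: rtranclp_induct)
    case base then show ?case using assms by simp
  next
    case (step y z)
    show ?case
    proof (cases "y \<in> S \<and> conn (rs (Ein S) w) x y")
      case True
      show ?thesis
      proof (cases "z \<in> S")
        case True
        with step \<open>y \<in> S \<and> _\<close> have "open_adj (rs (Ein S) w) y z" by (simp add: open_adj_rs_Ein)
        with True \<open>y \<in> S \<and> _\<close> show ?thesis by auto
      next
        case False
        have "conn w x z" using step by auto
        with False \<open>y \<in> S \<and> _\<close> step(2) show ?thesis by blast
      qed
    next
      case False
      with step.IH show ?thesis by blast
    qed
  qed
  then show thesis using assms that by blast
qed

lemma conn_rs_in: "conn (rs (Ein S) w) x y \<Longrightarrow> x \<in> S \<Longrightarrow> y \<in> S"
  by (induction rule: rtranclp_induct) (auto simp: open_adj_rs_Ein)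

subsection \<open>Lattice automorphisms\<close>

text \<open>The disjunction allows \<open>h\<close> to reverse an edge, as a rotation does: an edge
  is stored at its lower-left endpoint, which a rotation may send to the other end.\<close>

lemma open_adj_auto:
  assumes "inj g" "surj h"
    "\<And>e. fst (h e) = g (fst e) \<and> tip (h e) = g (tip e) \<or> fst (h e) = g (tip e) \<and> tip (h e) = g (fst e)"
  shows "open_adj (\<lambda>e. w (h e)) x y \<longleftrightarrow> open_adj w (g x) (g y)"
proof
  assume "open_adj (\<lambda>e. w (h e)) x y"
  then obtain e where "w (h e)" "x = fst e \<and> y = tip e \<or> x = tip e \<and> y = fst e" unfolding open_adj_iff by auto
  then show "open_adj w (g x) (g y)" unfolding open_adj_iff using assms(3)[of e] by (intro exI[of _ "h e"]) auto
next
  assume "open_adj w (g x) (g y)"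
  then obtain e' where e': "w e'" "g x = fst e' \<and> g y = tip e' \<or> g x = tip e' \<and> g y = fst e'" unfolding open_adj_iff by auto
  obtain e where e: "e' = h e" using assms(2) by (metis surjD)
  have "x = fst e \<and> y = tip e \<or> x = tip e \<and> y = fst e"
    using assms(3)[of e] e'(2) inj_eq[OF assms(1)] unfolding e by metis
  then show "open_adj (\<lambda>e. w (h e)) x y" unfolding open_adj_iff using e' e by blast
qed

lemma conn_auto:
  assumes "bij g" "surj h"
    "\<And>e. fst (h e) = g (fst e) \<and> tip (h e) = g (tip e) \<or> fst (h e) = g (tip e) \<and> tip (h e) = g (fst e)"
  shows "conn (\<lambda>e. w (h e)) x y \<longleftrightarrow> conn w (g x) (g y)"
proof
  note oa = open_adj_auto[OF bij_is_inj[OF assms(1)] assms(2,3)]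
  assume "conn (\<lambda>e. w (h e)) x y"
  then show "conn w (g x) (g y)"
    by (induction rule: rtranclp_induct) (auto simp: oa intro: rtranclp.rtrancl_into_rtrancl)
next
  note oa = open_adj_auto[OF bij_is_inj[OF assms(1)] assms(2,3)]
  assume "conn w (g x) (g y)"
  then have "\<forall>y'. g y = g y' \<longrightarrow> conn (\<lambda>e. w (h e)) x y'"
  proof (induction rule: rtranclp_induct)
    case base then show ?case using bij_is_inj[OF assms(1)] by (auto dest: injD)
  next
    case (step a b)
    obtain a' where a': "a = g a'" using bij_is_surj[OF assms(1)] by (metis surjD)
    with step oa show ?case by (metis rtranclp.rtrancl_into_rtrancl)
  qed
  then show "conn (\<lambda>e. w (h e)) x y" by blast
qed

lemma conn_inf_auto:
  assumes "bij g" "surj h"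
    "\<And>e. fst (h e) = g (fst e) \<and> tip (h e) = g (tip e) \<or> fst (h e) = g (tip e) \<and> tip (h e) = g (fst e)"
  shows "conn_inf (\<lambda>e. w (h e)) x \<longleftrightarrow> conn_inf w (g x)"
proof -
  have "{y. conn w (g x) y} = g ` {y. conn (\<lambda>e. w (h e)) x y}"
  proof (intro equalityI subsetI)
    fix y assume y: "y \<in> {y. conn w (g x) y}"
    obtain y' where "y = g y'" using bij_is_surj[OF assms(1)] by (metis surjD)
    then show "y \<in> g ` {y. conn (\<lambda>e. w (h e)) x y}" using y by (simp add: conn_auto[OF assms])
  next
    fix y assume "y \<in> g ` {y. conn (\<lambda>e. w (h e)) x y}"
    then obtain y' where "y = g y'" "conn (\<lambda>e. w (h e)) x y'" by blast
    then show "y \<in> {y. conn w (g x) y}" by (simp add: conn_auto[OF assms])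
  qed
  then show ?thesis unfolding conn_inf_iff
    by (simp add: finite_image_iff[OF inj_on_subset[OF bij_is_inj[OF assms(1)] subset_UNIV]])
qed

definition sh :: "vertex \<Rightarrow> edge \<Rightarrow> edge" where
  "sh v e = ((fst (fst e) + fst v, snd (fst e) + snd v), snd e)"

lemma bij_sh: "bij (sh v)"
  by (rule bij_betw_byWitness[where f' = "sh (- fst v, - snd v)"]) (auto simp: sh_def)

lemma sh_props:
  "bij (\<lambda>x. (fst x + fst v, snd x + snd v) :: vertex)" "surj (sh v)"
  "fst (sh v e) = (fst (fst e) + fst v, snd (fst e) + snd v) \<and> tip (sh v e) = (fst (tip e) + fst v, snd (tip e) + snd v)"
proof -
  show "bij (\<lambda>x. (fst x + fst v, snd x + snd v) :: vertex)"
    by (rule bij_betw_byWitness[where f' = "\<lambda>x. (fst x - fst v, snd x - snd v) :: vertex"]) auto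
  show "surj (sh v)" by (rule bij_is_surj[OF bij_sh])
qed (simp add: sh_def tip_def)

lemma conn_sh: "conn (\<lambda>e. w (sh v e)) x y \<longleftrightarrow> conn w (fst x + fst v, snd x + snd v) (fst y + fst v, snd y + snd v)"
  by (rule conn_auto[OF sh_props(1,2)]) (use sh_props(3) in blast)

lemma conn_inf_sh: "conn_inf (\<lambda>e. w (sh v e)) x \<longleftrightarrow> conn_inf w (fst x + fst v, snd x + snd v)"
  by (rule conn_inf_auto[OF sh_props(1,2)]) (use sh_props(3) in blast)

subsection \<open>Planar duality\<close>

text \<open>The face with lower-left corner \<open>(a, b)\<close> is labelled \<open>(a, b)\<close>, so that faces form again a copy of the
  square lattice; its edge \<open>e\<close> crosses the primal edge \<open>dl e\<close>.\<close>

definition dl :: "edge \<Rightarrow> edge" where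
  "dl e = (if snd e then ((fst (fst e) + 1, snd (fst e)), False) else ((fst (fst e), snd (fst e) + 1), True))"

definition dual :: "config \<Rightarrow> config" where
  "dual w e = (\<not> w (dl e))"

text \<open>The inverse of \<open>dl\<close>: the dual edge that crosses \<open>e\<close>.\<close>

definition ud :: "edge \<Rightarrow> edge" where
  "ud e = (if snd e then ((fst (fst e), snd (fst e) - 1), False) else ((fst (fst e) - 1, snd (fst e)), True))"

lemma dl_ud [simp]: "dl (ud e) = e" and ud_dl [simp]: "ud (dl e) = e"
  by (auto simp: dl_def ud_def prod_eq_iff)

lemma bij_dl: "bij dl"
  by (rule bij_betw_byWitness[where f' = ud]) auto

lemma finite_edge_bound:
  assumes "finite (Z :: edge set)"
  obtains N where "N > 0" "\<And>a b d. ((a, b), d) \<in> Z \<Longrightarrow> \<bar>a\<bar> < N \<and> \<bar>b\<bar> < N"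
proof
  let ?N = "Max (insert 0 ((\<lambda>e. \<bar>fst (fst e)\<bar>) ` Z \<union> (\<lambda>e. \<bar>snd (fst e)\<bar>) ` Z)) + 1"
  show "?N > 0" using assms by (simp add: add_strict_increasing2 Max_ge le_imp_0_less)
  fix a b d assume "((a, b), d) \<in> Z"
  then have "\<bar>a\<bar> \<in> insert 0 ((\<lambda>e. \<bar>fst (fst e)\<bar>) ` Z \<union> (\<lambda>e. \<bar>snd (fst e)\<bar>) ` Z)" "\<bar>b\<bar> \<in> insert 0 ((\<lambda>e. \<bar>fst (fst e)\<bar>) ` Z \<union> (\<lambda>e. \<bar>snd (fst e)\<bar>) ` Z)"
    by force+
  then show "\<bar>a\<bar> < ?N \<and> \<bar>b\<bar> < ?N" using assms by (auto simp: Max_ge intro!: zle_add1_eq_le[THEN iffD2])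
qed

text \<open>A Jordan curve theorem modulo 2: an edge set that meets every face boundary evenly is
  the boundary of a finite vertex set. A vertex is coloured by the parity of the edges of
  \<open>Z\<close> on the horizontal ray to its left.\<close>

lemma potential:
  assumes fin: "finite (Z :: edge set)"
    and ev: "\<And>a b. ((((a, b), True) \<in> Z) \<noteq> (((a, b + 1), True) \<in> Z)) = ((((a, b), False) \<in> Z) \<noteq> (((a + 1, b), False) \<in> Z))"
  obtains c where "finite {v. c v}" "\<And>e. (c (fst e) \<noteq> c (tip e)) \<longleftrightarrow> e \<in> Z"
proof -
  define M where "M x y = {x'. x' < x \<and> ((x', y), True) \<in> Z}" for x y :: int
  have finM: "finite (M x y)" for x y
  proof (rule finite_subset)
    show "M x y \<subseteq> (\<lambda>e. fst (fst e)) ` Z" by (force simp: M_def)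
  qed (use fin in simp)
  define c where "c v = odd (card (M (fst v) (snd v)))" for v
  obtain N where N: "N > 0" "\<And>a b d. ((a, b), d) \<in> Z \<Longrightarrow> \<bar>a\<bar> < N \<and> \<bar>b\<bar> < N"
    using finite_edge_bound[OF fin] by blast
  have hor: "(c (x, y) \<noteq> c (x + 1, y)) \<longleftrightarrow> ((x, y), True) \<in> Z" for x y
  proof (cases "((x, y), True) \<in> Z")
    case True
    then have "M (x + 1) y = insert x (M x y)" by (auto simp: M_def)
    moreover have "x \<notin> M x y" by (simp add: M_def)
    ultimately show ?thesis using finM True by (simp add: c_def)
  next
    case False
    then have "M (x + 1) y = M x y" by (auto simp: M_def) (metis antisym_conv2)
    then show ?thesis using False by (simp add: c_def)
  qed
  have empt: "c (x, y) = False" if "x \<le> - N \<or> \<bar>y\<bar> \<ge> N" for x y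
  proof -
    have "M x y = {}" using that N(2) by (force simp: M_def)
    then show ?thesis by (simp add: c_def)
  qed
  have ver: "(c (x, y) \<noteq> c (x, y + 1)) \<longleftrightarrow> ((x, y), False) \<in> Z" for x y
  proof (cases "x \<le> - N")
    case True
    moreover have "((x, y), False) \<notin> Z" using True N by force
    ultimately show ?thesis by (simp add: empt)
  next
    case False
    then have "- N \<le> x" by simp
    then show ?thesis
    proof (induction x rule: int_ge_induct)
      case base
      have "((- N, y), False) \<notin> Z" using N by force
      then show ?case by (simp add: empt)
    next
      case (step x)
      then show ?case using hor[of x y] hor[of x "y + 1"] ev[of x y] by blast
    qed
  qed
  \<comment> \<open>To the right of \<open>Z\<close> the colour is constant along columns and false
    far below, hence false. This makes the colour class finite.\<close>
  have right: "c (x, y) = False" if "x \<ge> N" for x y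
  proof (cases "y \<ge> - N")
    case True
    then show ?thesis
    proof (induction y rule: int_ge_induct)
      case base then show ?case using N(1) by (simp add: empt)
    next
      case (step y)
      have "((x, y), False) \<notin> Z" using N(2)[of x y False] that by auto
      then show ?case using ver[of x y] step by simp
    qed
  next
    case False
    then show ?thesis by (intro empt) auto
  qed
  have "{v. c v} \<subseteq> {- N..N} \<times> {- N..N}"
  proof
    fix v assume "v \<in> {v. c v}"
    then obtain x y where v: "v = (x, y)" "c (x, y)" by (cases v) auto
    then show "v \<in> {- N..N} \<times> {- N..N}" using empt[of x y] right[of x y] by force
  qed
  then have "finite {v. c v}" by (rule finite_subset) simp
  moreover have "(c (fst e) \<noteq> c (tip e)) \<longleftrightarrow> e \<in> Z" for e
    using hor[of "fst (fst e)" "snd (fst e)"] ver[of "fst (fst e)" "snd (fst e)"]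
    by (cases e rule: prod.exhaust; cases "snd e") (simp_all add: tip_def)
  ultimately show thesis by (rule that)
qed

text \<open>The two faces beside \<open>e\<close> are labelled \<open>fst e\<close> and
  \<open>fa2 e\<close>; one of them shares its label with the base point of
  \<open>e\<close>.\<close>

definition fa2 :: "edge \<Rightarrow> vertex" where
  "fa2 e = fst (ud e)"

lemma tip_ud [simp]: "tip (ud e) = fst e"
  by (simp add: ud_def tip_def)

lemma fa2_simps [simp]: "fa2 ((a, b), True) = (a, b - 1)" "fa2 ((a, b), False) = (a - 1, b)"
  by (simp_all add: fa2_def ud_def)

lemma closed_dual_adj: "\<not> w e \<Longrightarrow> open_adj (dual w) (fa2 e) (fst e)"
  using open_adj_edge[of "dual w" "ud e"] by (simp add: fa2_def dual_def)

definition fe :: "vertex \<Rightarrow> edge set" where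
  "fe f = {(f, True), ((fst f, snd f + 1), True), (f, False), ((fst f + 1, snd f), False)}"

definition corners :: "vertex \<Rightarrow> vertex set" where
  "corners f = {f, (fst f, snd f + 1), (fst f + 1, snd f), (fst f + 1, snd f + 1)}"

lemma fe_iff: "e \<in> fe f \<longleftrightarrow> f = fst e \<or> f = fa2 e"
  by (cases e rule: prod.exhaust; cases "snd e") (auto simp: fe_def prod_eq_iff fa2_def ud_def)

lemma fe_corners: "e \<in> fe f \<Longrightarrow> fst e \<in> corners f \<and> tip e \<in> corners f"
  by (auto simp: fe_def corners_def tip_def)

lemma card_corners: "finite (corners f)" "card (corners f) \<le> 4"
  unfolding corners_def using card_length[of "[f, (fst f, snd f + 1), (fst f + 1, snd f), (fst f + 1, snd f + 1)]"]
  by simp_all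

lemma lattice_const:
  assumes "\<And>e. d (fst e) = d (tip e)"
  shows "d u = d (v :: vertex)"
proof -
  have h: "d (a, b) = d (a + 1, b)" for a b using assms[of "((a, b), True)"] by simp
  have v: "d (a, b) = d (a, b + 1)" for a b using assms[of "((a, b), False)"] by simp
  have 1: "d (a, b) = d (0, b)" for a b
  proof (induction a rule: int_induct[where k = 0])
    case (step1 i) then show ?case using h[of i b] by simp
  next
    case (step2 i) then show ?case using h[of "i - 1" b] by simp
  qed simp
  have 2: "d (0, b) = d (0, 0)" for b
  proof (induction b rule: int_induct[where k = 0])
    case (step1 i) then show ?case using v[of 0 i] by simp
  next
    case (step2 i) then show ?case using v[of 0 "i - 1"] by simp
  qed simp
  show ?thesis using 1 2 by (metis prod.collapse)
qed

lemma rtrancl_path_conn_set: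
  "rtrancl_path r x xs y \<Longrightarrow> v \<in> set (x # xs) \<Longrightarrow> r\<^sup>*\<^sup>* x v"
proof (induction rule: rtrancl_path.induct)
  case (step x y ys z)
  then show ?case by (cases "v = x") (auto intro: converse_rtranclp_into_rtranclp)
qed simp

text \<open>If \<open>x\<close> and \<open>y\<close> were not joined inside the allowed region, the boundary of the component \<open>B\<close> of \<open>y\<close>
  off the cluster \<open>A\<close> of \<open>x\<close> would, by a parity argument, consist of closed edges only; as \<open>B\<close> or its
  complement is finite, this contradicts the infinite clusters.\<close>

lemma detour:
  assumes lat: "\<And>i. Suc i < length g \<Longrightarrow> open_adj (\<lambda>_. True) (g ! i) (g ! Suc i)"
    and g: "g \<noteq> []" "hd g = x" "last g = y"
    and inf: "conn_inf w x" "conn_inf w y"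
    and F: "finite F"
    and clos: "\<And>f f'. f \<in> F \<Longrightarrow> open_adj (dual w) f f' \<Longrightarrow> f' \<in> F"
    and cov: "\<And>i e. Suc i < length g \<Longrightarrow> fst e = g ! i \<and> tip e = g ! Suc i \<or> fst e = g ! Suc i \<and> tip e = g ! i
      \<Longrightarrow> \<not> w e \<Longrightarrow> fst e \<in> F"
  shows "chem_dist w x y \<le> enat (length g - 1 + 4 * card F)"
proof -
  \<comment> \<open>\<open>E\<close> and \<open>V\<close> are the edges and vertices that the detour
    may use, those of \<open>g\<close> and those around the faces in \<open>F\<close>. A path
    without repetition in \<open>V\<close> has fewer steps than \<open>V\<close> has vertices, and
    each face contributes four corners.\<close>
  define E where "E = {e. \<exists>i. Suc i < length g \<and> (fst e = g ! i \<and> tip e = g ! Suc i \<or> fst e = g ! Suc i \<and> tip e = g ! i)} \<union> (\<Union>f\<in>F. fe f)"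
  define V where "V = set g \<union> (\<Union>f\<in>F. corners f)"
  have EV: "fst e \<in> V \<and> tip e \<in> V" if "e \<in> E" for e
    using that fe_corners[of e] unfolding E_def V_def by auto
  have finV: "finite V" unfolding V_def using F card_corners by auto
  have cardV: "card V \<le> length g + 4 * card F"
  proof -
    have "card V \<le> card (set g) + card (\<Union>f\<in>F. corners f)" unfolding V_def by (rule card_Un_le)
    also have "card (\<Union>f\<in>F. corners f) \<le> (\<Sum>f\<in>F. card (corners f))" by (rule card_UN_le[OF F])
    also have "\<dots> \<le> (\<Sum>f\<in>F. 4)" by (intro sum_mono card_corners)
    finally show ?thesis using card_length[of g] by simp
  qed
  define w' where "w' = rs E w"
  have w'E: "w' e \<longleftrightarrow> e \<in> E \<and> w e" for e by (simp add: w'_def rs_def)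
  have xg: "x = g ! 0" "y = g ! (length g - 1)" using g by (auto simp: hd_conv_nth last_conv_nth)
  have xV: "x \<in> V" using g by (auto simp: V_def)
  have connV: "v \<in> V" if "conn w' x v" for v
    using that
  proof (cases rule: rtranclp.cases)
    case (rtrancl_into_rtrancl b)
    then show ?thesis using EV unfolding open_adj_iff w'E by blast
  qed (use xV in simp)
  have main: "conn w' x y"
  proof (rule ccontr)
    assume nc: "\<not> conn w' x y"
    define A where "A = {v. conn w' x v}"
    define B where "B = {v. conn (rs (Ein (- A)) (\<lambda>_. True)) y v}"
    define Z where "Z = {e. (fst e \<in> B) \<noteq> (tip e \<in> B)}"
    have finA: "finite A" using connV finV by (auto simp: A_def intro: finite_subset[of _ V])
    have xA: "x \<in> A" and yA: "y \<notin> A" using nc by (auto simp: A_def)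
    have BA: "v \<notin> A" if "v \<in> B" for v
      using conn_rs_in[of "- A" "\<lambda>_. True" y v] that yA by (auto simp: B_def)
    have yB: "y \<in> B" by (simp add: B_def)
    have Bstep: "v \<in> B" if "u \<in> B" "v \<notin> A" "open_adj (\<lambda>_. True) u v" for u v
    proof -
      have "open_adj (rs (Ein (- A)) (\<lambda>_. True)) u v" using that BA by (simp add: open_adj_rs_Ein)
      then show ?thesis using that(1) by (auto simp: B_def intro: rtranclp.rtrancl_into_rtrancl)
    qed
    have adj: "open_adj (\<lambda>_. True) (fst e) (tip e)" "open_adj (\<lambda>_. True) (tip e) (fst e)" for e
      using open_adj_edge[of "\<lambda>_. True" e] by (simp_all add: open_adj_sym)
    have ZAB: "fst e \<in> B \<and> tip e \<in> A \<or> tip e \<in> B \<and> fst e \<in> A" if "e \<in> Z" for e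
      using that Bstep adj unfolding Z_def by blast
    have Aopen: "tip e \<in> A \<longleftrightarrow> fst e \<in> A" if "w' e" for e
    proof -
      have "open_adj w' (fst e) (tip e)" "open_adj w' (tip e) (fst e)"
        using that open_adj_edge[of w' e] by (simp_all add: open_adj_sym)
      then show ?thesis unfolding A_def by (auto intro: rtranclp.rtrancl_into_rtrancl)
    qed
    have ZE: "\<not> w e" if "e \<in> Z" "e \<in> E" for e
      using ZAB[OF that(1)] Aopen[of e] that(2) BA unfolding w'E by blast
    \<comment> \<open>The part of the boundary of \<open>B\<close> that runs beside
      \<open>F\<close>. It is even around every face: at a face of \<open>F\<close> it agrees with
      the boundary \<open>Z\<close>, and at any other face it has no edge, since \<open>F\<close> is
      closed under crossing closed edges.\<close>
    define Z1 where "Z1 = {e \<in> Z. fst e \<in> F \<or> fa2 e \<in> F}"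
    have Z1: "\<not> w e \<and> fst e \<in> F \<and> fa2 e \<in> F" if "e \<in> Z1" for e
    proof -
      from that have "e \<in> Z" and f: "fst e \<in> F \<or> fa2 e \<in> F" by (auto simp: Z1_def)
      moreover have "e \<in> E" using f fe_iff[of e] unfolding E_def by blast
      ultimately have c: "\<not> w e" using ZE by blast
      from closed_dual_adj[of w, OF c] have "open_adj (dual w) (fa2 e) (fst e)" "open_adj (dual w) (fst e) (fa2 e)"
        by (simp_all add: open_adj_sym)
      then show ?thesis using c f clos by blast
    qed
    have finZ1: "finite Z1"
    proof (rule finite_subset[OF _ finite_nbrs[OF finA]])
      show "Z1 \<subseteq> {e. fst e \<in> A \<or> tip e \<in> A}" using ZAB unfolding Z1_def by blast
    qed
    have ev: "((((a, b), True) \<in> Z1) \<noteq> (((a, b + 1), True) \<in> Z1)) = ((((a, b), False) \<in> Z1) \<noteq> (((a + 1, b), False) \<in> Z1))" for a b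
    proof (cases "(a, b) \<in> F")
      case True
      then show ?thesis by (simp add: Z1_def Z_def) blast
    next
      case False
      then show ?thesis using Z1[of "((a, b), True)"] Z1[of "((a, b + 1), True)"] Z1[of "((a, b), False)"] Z1[of "((a + 1, b), False)"]
        by auto
    qed
    obtain c where c: "finite {v. c v}" "\<And>e. (c (fst e) \<noteq> c (tip e)) \<longleftrightarrow> e \<in> Z1"
      using potential[OF finZ1 ev] by blast
    have cA: "c v = c x" if "v \<in> A" for v
    proof -
      have "conn w' x v" using that by (simp add: A_def)
      then show ?thesis
      proof (induction rule: rtranclp_induct)
        case (step u v)
        then obtain e where "w' e" "u = fst e \<and> v = tip e \<or> u = tip e \<and> v = fst e" unfolding open_adj_iff by blast
        then show ?case using step.IH c(2)[of e] Z1[of e] w'E[of e] by blast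
      qed simp
    qed
    have cB: "c v = c y" if "v \<in> B" for v
    proof -
      have "conn (rs (Ein (- A)) (\<lambda>_. True)) y v" using that by (simp add: B_def)
      then show ?thesis
      proof (induction rule: rtranclp_induct)
        case (step u v)
        then have "u \<in> B" "v \<in> B" by (auto simp: B_def intro: rtranclp.rtrancl_into_rtrancl)
        moreover from step obtain e where "u = fst e \<and> v = tip e \<or> u = tip e \<and> v = fst e" unfolding open_adj_iff by blast
        ultimately have "e \<notin> Z" "u = fst e \<and> v = tip e \<or> u = tip e \<and> v = fst e" by (auto simp: Z_def)
        then show ?case using step.IH c(2)[of e] by (auto simp: Z1_def)
      qed simp
    qed
    \<comment> \<open>Following \<open>g\<close> back from \<open>y\<close>, it has to step from
      \<open>B\<close> into \<open>A\<close> before it reaches \<open>x\<close>. The edge of that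
      step is closed and lies in \<open>Z1\<close>, so the colouring \<open>c\<close> separates
      \<open>A\<close> from \<open>B\<close>.\<close>
    have "\<exists>i. Suc i < length g \<and> g ! i \<in> A \<and> g ! Suc i \<in> B"
    proof (rule ccontr)
      assume no: "\<not> ?thesis"
      have "k < length g \<Longrightarrow> g ! (length g - 1 - k) \<in> B" for k
      proof (induction k)
        case 0 then show ?case using yB xg by simp
      next
        case (Suc k)
        let ?i = "length g - 1 - Suc k"
        have i: "Suc ?i < length g" "Suc ?i = length g - 1 - k" using Suc.prems by auto
        then have "g ! Suc ?i \<in> B" using Suc by simp
        moreover have "open_adj (\<lambda>_. True) (g ! Suc ?i) (g ! ?i)" using lat[OF i(1)] by (simp add: open_adj_sym)
        ultimately show ?case using no Bstep i(1) by blast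
      qed
      from this[of "length g - 1"] have "x \<in> B" using g xg by simp
      then show False using BA xA by blast
    qed
    then obtain i where i: "Suc i < length g" "g ! i \<in> A" "g ! Suc i \<in> B" by blast
    from lat[OF i(1)] obtain e1 where e1: "fst e1 = g ! i \<and> tip e1 = g ! Suc i \<or> fst e1 = g ! Suc i \<and> tip e1 = g ! i"
      unfolding open_adj_iff by metis
    have "e1 \<in> E" using e1 i(1) by (auto simp: E_def)
    moreover have "e1 \<in> Z" using e1 i BA[of "g ! i"] by (auto simp: Z_def)
    ultimately have "\<not> w e1" by (rule ZE[rotated])
    then have "e1 \<in> Z1" using cov[OF i(1) e1] \<open>e1 \<in> Z\<close> by (simp add: Z1_def)
    then have cxy: "c x \<noteq> c y" using c(2)[of e1] e1 cA[OF i(2)] cB[OF i(3)] by metis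
    have ZZ1: "e \<in> Z1" if "e \<in> Z" for e
      using ZAB[OF that] cA cB cxy c(2)[of e] by metis
    \<comment> \<open>All edges of \<open>Z\<close> join \<open>A\<close> to \<open>B\<close>, which
      \<open>c\<close> separates, so \<open>Z\<close> equals \<open>Z1\<close>. Then
      \<open>c\<close> and membership in \<open>B\<close> have the same boundary, and they agree
      everywhere or nowhere.\<close>
    have dd: "(c u = (u \<in> B)) = (c v = (v \<in> B))" for u v
    proof (rule lattice_const[where d = "\<lambda>u. c u = (u \<in> B)"])
      fix e
      have "e \<in> Z1 \<longleftrightarrow> e \<in> Z" using ZZ1 unfolding Z1_def by blast
      then show "(c (fst e) = (fst e \<in> B)) = (c (tip e) = (tip e \<in> B))" using c(2)[of e] by (simp add: Z_def) blast
    qed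
    have stay: "(v \<in> B) = (u \<in> B)" if "conn w u v" for u v
      using that
    proof (induction rule: rtranclp_induct)
      case (step u v)
      then obtain e where "w e" "u = fst e \<and> v = tip e \<or> u = tip e \<and> v = fst e" unfolding open_adj_iff by blast
      then show ?case using step.IH Z1[of e] ZZ1[of e] by (auto simp: Z_def)
    qed simp
    \<comment> \<open>Open clusters of \<open>w\<close> never cross \<open>Z\<close>. Either
      \<open>B\<close> is the finite colour class and contains the cluster of \<open>y\<close>, or
      its complement is, and contains the cluster of \<open>x\<close>.\<close>
    show False
    proof (cases "c x = (x \<in> B)")
      case True
      then have "{v. conn w y v} \<subseteq> {v. c v}" using stay yB dd[of x] by blast
      then show False using inf(2) c(1) by (auto simp: conn_inf_iff intro: finite_subset)
    next
      case False
      then have "{v. conn w x v} \<subseteq> {v. c v}" using stay[of x] BA xA dd[of x] by blast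
      then show False using inf(1) c(1) by (auto simp: conn_inf_iff intro: finite_subset)
    qed
  qed
  then obtain xs0 where "rtrancl_path (open_adj w') x xs0 y" unfolding rtranclp_eq_rtrancl_path by blast
  then obtain xs where xs: "rtrancl_path (open_adj w') x xs y" "distinct (x # xs)" by (rule rtrancl_path_distinct)
  have "set (x # xs) \<subseteq> V" using rtrancl_path_conn_set[OF xs(1)] connV by blast
  then have "card (set (x # xs)) \<le> card V" using finV by (intro card_mono)
  then have "Suc (length xs) \<le> length g + 4 * card F" using distinct_card[OF xs(2)] cardV by simp
  then have l: "length xs \<le> length g - 1 + 4 * card F" using g(1) by (cases g) auto
  have "rtrancl_path (open_adj w) x xs y"
    by (rule rtrancl_path_mono[OF xs(1)]) (auto intro: open_adj_mono[OF rs_le] simp: w'_def)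
  then have "chem_dist w x y \<le> enat (length xs)" by (rule chem_dist_le_path)
  also have "\<dots> \<le> enat (length g - 1 + 4 * card F)" using l by simp
  finally show ?thesis .
qed

text \<open>The degree of \<open>v\<close> in the edge set \<open>Z\<close> is odd.\<close>

definition dg :: "edge set \<Rightarrow> vertex \<Rightarrow> bool" where
  "dg Z v \<longleftrightarrow> (((v, True) \<in> Z) \<noteq> (((fst v - 1, snd v), True) \<in> Z)) \<noteq> (((v, False) \<in> Z) \<noteq> (((fst v, snd v - 1), False) \<in> Z))"

lemma dg_toggle:
  assumes "\<And>e'. e' \<in> Z' \<longleftrightarrow> ((e' \<in> Z) \<noteq> (e' = e))"
  shows "dg Z' v \<longleftrightarrow> (dg Z v \<noteq> (v = fst e \<or> v = tip e))"
proof -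
  obtain a b where v: "v = (a, b)" by (cases v)
  obtain a' b' d where e: "e = ((a', b'), d)" by (cases e) auto
  show ?thesis unfolding dg_def assms v e by (cases d) auto
qed

text \<open>Take the edges that a path uses an odd number of times: only its two ends can have odd
  degree.\<close>

lemma path_parity:
  "conn w x y \<Longrightarrow> \<exists>Z. finite Z \<and> (\<forall>e\<in>Z. w e) \<and> (\<forall>v. dg Z v = ((v = x) \<noteq> (v = y)))"
proof (induction rule: rtranclp_induct)
  case base
  have "\<not> dg {} v" for v by (simp add: dg_def)
  then show ?case by (intro exI[of _ "{}"]) auto
next
  case (step y z)
  then obtain Z where Z: "finite Z" "\<forall>e\<in>Z. w e" "\<forall>v. dg Z v = ((v = x) \<noteq> (v = y))" by blast
  obtain e where e: "w e" "y = fst e \<and> z = tip e \<or> y = tip e \<and> z = fst e" using step unfolding open_adj_iff by blast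
  define Z' where "Z' = {e'. (e' \<in> Z) \<noteq> (e' = e)}"
  have "Z' \<subseteq> insert e Z" by (auto simp: Z'_def)
  then have "finite Z'" by (rule finite_subset) (simp add: Z(1))
  moreover have "\<forall>e\<in>Z'. w e" using Z(2) e(1) by (auto simp: Z'_def)
  moreover have "dg Z' v = ((v = x) \<noteq> (v = z))" for v
  proof -
    have "dg Z' v = (dg Z v \<noteq> (v = fst e \<or> v = tip e))" by (rule dg_toggle) (simp add: Z'_def)
    then show ?thesis using Z(3)[rule_format, of v] e(2) tip_neq[of e] by (elim disjE conjE) auto
  qed
  ultimately show ?case by blast
qed

text \<open>An open path between the ends of the closed edge \<open>e\<close>, closed up by
  \<open>e\<close>, forms an even set, hence the boundary of a finite set of faces. Dual open paths
  can cross it only at \<open>ud e\<close>, which is deleted here, so the face of \<open>e\<close>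
  on the inner side has a finite dual cluster.\<close>

lemma dual_separate:
  assumes "\<not> w e" "conn w (fst e) (tip e)"
    "conn_inf (upd (ud e) False (dual w)) (fst e)" "conn_inf (upd (ud e) False (dual w)) (fa2 e)"
  shows False
proof -
  obtain Z where Z: "finite Z" "\<forall>e\<in>Z. w e" "\<forall>v. dg Z v = ((v = fst e) \<noteq> (v = tip e))"
    using path_parity[OF assms(2)] by blast
  define Z0 where "Z0 = insert e Z"
  have "e' \<in> Z0 \<longleftrightarrow> (e' \<in> Z) \<noteq> (e' = e)" for e' using Z(2) assms(1) by (auto simp: Z0_def)
  then have dg0: "\<not> dg Z0 v" for v using dg_toggle[of Z0 Z e v] Z(3) tip_neq[of e] by auto
  define Z' where "Z' = {d. dl d \<in> Z0}"
  have "Z' \<subseteq> ud ` Z0" 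
  proof
    fix d assume "d \<in> Z'"
    then have "ud (dl d) \<in> ud ` Z0" unfolding Z'_def by blast
    then show "d \<in> ud ` Z0" by simp
  qed
  then have fin: "finite Z'" by (rule finite_subset) (simp add: Z0_def Z(1))
  have ev: "((((a, b), True) \<in> Z') \<noteq> (((a, b + 1), True) \<in> Z')) = ((((a, b), False) \<in> Z') \<noteq> (((a + 1, b), False) \<in> Z'))" for a b
  proof -
    have m: "((a, b), True) \<in> Z' \<longleftrightarrow> ((a + 1, b), False) \<in> Z0" "((a, b + 1), True) \<in> Z' \<longleftrightarrow> ((a + 1, b + 1), False) \<in> Z0"
      "((a, b), False) \<in> Z' \<longleftrightarrow> ((a, b + 1), True) \<in> Z0" "((a + 1, b), False) \<in> Z' \<longleftrightarrow> ((a + 1, b + 1), True) \<in> Z0"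
      by (simp_all add: Z'_def dl_def)
    have d: "\<not> (((((a + 1, b + 1), True) \<in> Z0) \<noteq> (((a, b + 1), True) \<in> Z0)) \<noteq> ((((a + 1, b + 1), False) \<in> Z0) \<noteq> (((a + 1, b), False) \<in> Z0)))"
      using dg0[of "(a + 1, b + 1)"] unfolding dg_def by simp
    have "(p \<noteq> q) = (r \<noteq> s)" if "\<not> ((s \<noteq> r) \<noteq> (q \<noteq> p))" for p q r s :: bool using that by argo
    from this[OF d] show ?thesis unfolding m .
  qed
  then obtain c where c: "finite {v. c v}" "\<And>e. (c (fst e) \<noteq> c (tip e)) \<longleftrightarrow> e \<in> Z'"
    using potential[OF fin ev] by metis
  have "\<not> c f" if f: "conn_inf (upd (ud e) False (dual w)) f" for f
  proof
    assume cf: "c f"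
    have "c v" if "conn (upd (ud e) False (dual w)) f v" for v
      using that
    proof (induction rule: rtranclp_induct)
      case (step u v)
      then obtain d where d: "upd (ud e) False (dual w) d" "u = fst d \<and> v = tip d \<or> u = tip d \<and> v = fst d" unfolding open_adj_iff by blast
      then have "d \<noteq> ud e" "\<not> w (dl d)" by (auto simp: upd_apply dual_def split: if_splits)
      then have "d \<notin> Z'" using Z(2) by (auto simp: Z'_def Z0_def)
      then show ?case using c(2)[of d] step.IH d(2) by auto
    qed (rule cf)
    then have "{v. conn (upd (ud e) False (dual w)) f v} \<subseteq> {v. c v}" by blast
    then show False using f c(1) by (auto simp: conn_inf_iff intro: finite_subset)
  qed
  then have "\<not> c (fst e)" "\<not> c (fa2 e)" using assms by blast+
  moreover have "ud e \<in> Z'" by (simp add: Z'_def Z0_def)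
  ultimately show False using c(2)[of "ud e"] by (simp add: fa2_def)
qed

declare measurable_coord [measurable del]

section \<open>Probabilities of events and their monotone limits\<close>

abbreviation Pr :: "real \<Rightarrow> (config \<Rightarrow> bool) \<Rightarrow> real" where
  "Pr p Q \<equiv> EE p (\<lambda>w. of_bool (Q w))"

lemma dep_of_bool: "dep J Q \<Longrightarrow> dep J (\<lambda>w. of_bool (Q w) :: real)"
  by (rule dep_comp)

lemma pred_of_bool [measurable]:
  "Measurable.pred (perc p) Q \<Longrightarrow> (\<lambda>w. of_bool (Q w) :: real) \<in> borel_measurable (perc p)"
  unfolding of_bool_def by (rule measurable_If) (auto simp: pred_def)

lemma integrable_of_bool: "Measurable.pred (perc p) Q \<Longrightarrow> integrable (perc p) (\<lambda>w. of_bool (Q w) :: real)"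
  by (rule integrable_bdd[where B = 1]) auto

lemma pred_fin: "finite J \<Longrightarrow> dep J Q \<Longrightarrow> Measurable.pred (perc p) Q"
  by (rule dep_finite_measurable) auto

lemma Pr_mono:
  assumes "Measurable.pred (perc p) Q" "Measurable.pred (perc p) R" "\<And>w. Q w \<Longrightarrow> R w"
  shows "Pr p Q \<le> Pr p R"
  by (rule EE_mono) (use assms in \<open>auto intro: integrable_of_bool\<close>)

lemma Pr_nonneg: "0 \<le> Pr p Q"
  unfolding EE_def by (intro Bochner_Integration.integral_nonneg) auto

lemma Pr_measure:
  assumes "Measurable.pred (perc p) Q"
  shows "Pr p Q = measure (perc p) {w. Q w}"
proof -
  have "{w. Q w} \<in> sets (perc p)" using assms by (simp add: pred_def)
  moreover have "(\<lambda>w. of_bool (Q w) :: real) = indicator {w. Q w}" by (auto simp: indicator_def)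
  ultimately show ?thesis by (simp add: EE_def)
qed

lemma Pr_le1: "Measurable.pred (perc p) Q \<Longrightarrow> Pr p Q \<le> 1"
  using prob_space.prob_le_1[OF prob_space_perc] by (simp add: Pr_measure)

lemma Pr_not: "Measurable.pred (perc p) Q \<Longrightarrow> Pr p (\<lambda>w. \<not> Q w) = 1 - Pr p Q"
proof -
  assume m: "Measurable.pred (perc p) Q"
  interpret P: prob_space "perc p" by (rule prob_space_perc)
  have "(\<lambda>w. of_bool (\<not> Q w) :: real) = (\<lambda>w. 1 - of_bool (Q w))" by auto
  then show ?thesis using integrable_of_bool[OF m] P.prob_space by (simp add: EE_def)
qed

lemma EE_sum:
  assumes "finite I" "\<And>i. i \<in> I \<Longrightarrow> integrable (perc p) (f i)"
  shows "EE p (\<lambda>w. \<Sum>i\<in>I. f i w) = (\<Sum>i\<in>I. EE p (f i))"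
  unfolding EE_def using assms by (intro Bochner_Integration.integral_sum) auto

lemma Pr_dec_lim:
  assumes m: "\<And>n::nat. Measurable.pred (perc p) (Q n)" and dec: "\<And>n w. Q (Suc n) w \<Longrightarrow> Q n w"
  shows "(\<lambda>n. Pr p (Q n)) \<longlonglongrightarrow> Pr p (\<lambda>w. \<forall>n. Q n w)"
  unfolding EE_def
proof (rule integral_dominated_convergence[where w = "\<lambda>_. 1"])
  show "AE w in perc p. (\<lambda>n. of_bool (Q n w) :: real) \<longlonglongrightarrow> of_bool (\<forall>n. Q n w)"
  proof (rule AE_I2)
    fix w
    show "(\<lambda>n. of_bool (Q n w) :: real) \<longlonglongrightarrow> of_bool (\<forall>n. Q n w)"
    proof (cases "\<forall>n. Q n w")
      case False
      then obtain n0 where n0: "\<not> Q n0 w" by auto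
      have "\<not> Q n w" if "n \<ge> n0" for n using that by (induction rule: dec_induct) (use n0 dec in auto)
      then have "eventually (\<lambda>n. of_bool (Q n w) = (0::real)) sequentially"
        by (auto simp: eventually_sequentially)
      then show ?thesis using False by (simp add: tendsto_eventually)
    qed simp
  qed
  interpret P: prob_space "perc p" by (rule prob_space_perc)
  show "integrable (perc p) (\<lambda>_. 1 :: real)" by simp
qed (use m in \<open>auto\<close>)

lemma Pr_inc_lim:
  assumes m: "\<And>n::nat. Measurable.pred (perc p) (Q n)" and inc: "\<And>n w. Q n w \<Longrightarrow> Q (Suc n) w"
  shows "(\<lambda>n. Pr p (Q n)) \<longlonglongrightarrow> Pr p (\<lambda>w. \<exists>n. Q n w)"
proof -
  have m': "Measurable.pred (perc p) (\<lambda>w. \<exists>n. Q n w)" using m by measurable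
  have m'': "Measurable.pred (perc p) (\<lambda>w. \<not> Q n w)" for n using m by measurable
  have "(\<lambda>n. Pr p (\<lambda>w. \<not> Q n w)) \<longlonglongrightarrow> Pr p (\<lambda>w. \<forall>n. \<not> Q n w)"
    by (rule Pr_dec_lim) (use m'' inc in auto)
  moreover have "Pr p (\<lambda>w. \<forall>n. \<not> Q n w) = 1 - Pr p (\<lambda>w. \<exists>n. Q n w)" using Pr_not[OF m'] by simp
  ultimately have "(\<lambda>n. 1 - Pr p (Q n)) \<longlonglongrightarrow> 1 - Pr p (\<lambda>w. \<exists>n. Q n w)" using Pr_not[OF m] by simp
  from tendsto_diff[OF tendsto_const[of 1] this] show ?thesis by simp
qed

section \<open>Leaving a finite set as an event of finitely many edges\<close>

definition tch :: "vertex set \<Rightarrow> edge set" where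
  "tch V = {e. fst e \<in> V \<or> tip e \<in> V}"

lemma finite_tch: "finite V \<Longrightarrow> finite (tch V)"
  unfolding tch_def by (rule finite_nbrs)

text \<open>Restriction to the edges that touch \<open>V\<close> makes this an event of finitely
  many edges; by \<open>reach_iff\<close> the event itself is unaffected.\<close>

definition reach :: "vertex set \<Rightarrow> config \<Rightarrow> vertex \<Rightarrow> bool" where
  "reach V w x \<longleftrightarrow> (\<exists>y. y \<notin> V \<and> conn (rs (tch V) w) x y)"

lemma dep_reach: "dep (tch V) (\<lambda>w. reach V w x)"
  unfolding reach_def by (rule dep_rs[where F = "\<lambda>w. \<exists>y. y \<notin> V \<and> conn w x y"])

lemma reach_mono: "w \<le> w' \<Longrightarrow> reach V w x \<Longrightarrow> reach V w' x"
  unfolding reach_def using conn_mono[OF rs_mono[OF order_refl]] by blast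

lemma Ein_tch: "Ein V \<subseteq> tch V"
  by (auto simp: Ein_def tch_def)

lemma open_adj_rs_tch: "open_adj (rs (tch V) w) x y \<longleftrightarrow> open_adj w x y \<and> (x \<in> V \<or> y \<in> V)"
  unfolding open_adj_iff rs_def tch_def by auto

lemma reachI:
  assumes "conn w x y" "y \<notin> V"
  shows "reach V w x"
proof (cases "x \<in> V")
  case True
  obtain u v where uv: "conn (rs (Ein V) w) x u" "u \<in> V" "v \<notin> V" "open_adj w u v"
    using conn_exit[OF assms(1) True assms(2)] .
  have "conn (rs (tch V) w) x u" using uv(1) by (rule conn_mono[OF rs_mono[OF Ein_tch order_refl]])
  moreover have "open_adj (rs (tch V) w) u v" using uv by (simp add: open_adj_rs_tch)
  ultimately have "conn (rs (tch V) w) x v" by (rule rtranclp.rtrancl_into_rtrancl)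
  then show ?thesis using uv(3) unfolding reach_def by blast
qed (auto simp: reach_def)

lemma reach_iff: "reach V w x \<longleftrightarrow> (\<exists>y. y \<notin> V \<and> conn w x y)"
  using reachI conn_mono[OF rs_le] unfolding reach_def by blast

definition bx :: "nat \<Rightarrow> vertex set" where
  "bx N = {- int N..int N} \<times> {- int N..int N}"

lemma finite_bx [simp]: "finite (bx N)"
  by (simp add: bx_def)

lemma bx_mono: "m \<le> n \<Longrightarrow> bx m \<subseteq> bx n"
  by (auto simp: bx_def)

lemma finite_in_bx: "finite V \<Longrightarrow> \<exists>N. V \<subseteq> bx N"
proof (induction V rule: finite_induct)
  case (insert v V)
  then obtain N where N: "V \<subseteq> bx N" by auto
  let ?M = "max N (nat (\<bar>fst v\<bar> + \<bar>snd v\<bar>))"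
  have "v \<in> bx ?M" by (cases v) (auto simp: bx_def)
  moreover have "V \<subseteq> bx ?M" using N bx_mono[of N ?M] by auto
  ultimately show ?case by blast
qed auto

lemma conn_inf_reach: "conn_inf w x \<longleftrightarrow> (\<forall>N. reach (bx N) w x)"
proof
  assume "conn_inf w x"
  then have "\<not> {y. conn w x y} \<subseteq> bx N" for N using finite_subset[OF _ finite_bx] by (auto simp: conn_inf_iff)
  then show "\<forall>N. reach (bx N) w x" unfolding reach_iff by blast
next
  assume r: "\<forall>N. reach (bx N) w x"
  show "conn_inf w x" unfolding conn_inf_iff
  proof
    assume "finite {y. conn w x y}"
    then obtain N where "{y. conn w x y} \<subseteq> bx N" using finite_in_bx by blast
    then show False using r unfolding reach_iff by blast
  qed
qed

lemma pred_reach [measurable]: "finite V \<Longrightarrow> Measurable.pred (perc p) (\<lambda>w. reach V w x)"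
  by (rule pred_fin[OF finite_tch dep_reach])

lemma pred_conn_inf [measurable]: "Measurable.pred (perc p) (\<lambda>w. conn_inf w x)"
  unfolding conn_inf_reach by (intro pred_intros_countable pred_reach finite_bx)

lemma Pr_conn_inf: "(\<lambda>N. Pr p (\<lambda>w. reach (bx N) w x)) \<longlonglongrightarrow> Pr p (\<lambda>w. conn_inf w x)"
  unfolding conn_inf_reach
proof (rule Pr_dec_lim)
  fix n w assume "reach (bx (Suc n)) w x"
  then show "reach (bx n) w x" using bx_mono[of n "Suc n"] unfolding reach_iff by auto
qed simp

subsection \<open>The differential inequality of Duminil-Copin and Tassion\<close>

definition bd :: "vertex set \<Rightarrow> edge set" where
  "bd S = {e. (fst e \<in> S) \<noteq> (tip e \<in> S)}"

definition inn :: "vertex set \<Rightarrow> edge \<Rightarrow> vertex" where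
  "inn S e = (if fst e \<in> S then fst e else tip e)"

definition out :: "vertex set \<Rightarrow> edge \<Rightarrow> vertex" where
  "out S e = (if fst e \<in> S then tip e else fst e)"

lemma bd_inn_out: "e \<in> bd S \<Longrightarrow> inn S e \<in> S \<and> out S e \<notin> S"
  by (auto simp: bd_def inn_def out_def)

lemma open_adj_inn_out: "open_adj w (inn S e) (out S e) \<longleftrightarrow> w e"
  using open_adj_edge[of w e] by (auto simp: inn_def out_def open_adj_sym)

lemma bd_tch: "bd S \<subseteq> tch S"
  by (auto simp: bd_def tch_def)

lemma finite_bd: "finite S \<Longrightarrow> finite (bd S)"
  using bd_tch finite_tch by (rule finite_subset)

text \<open>The Duminil-Copin-Tassion functional without its factor \<open>p\<close> for the
  boundary edge; the factor is written separately as \<open>q * phi q S\<close>.\<close>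

definition phi :: "real \<Rightarrow> vertex set \<Rightarrow> real" where
  "phi p S = (\<Sum>e\<in>bd S. Pr p (\<lambda>w. conn (rs (Ein S) w) (0, 0) (inn S e)))"

lemma dep_conn_Ein: "dep (Ein S) (\<lambda>w. conn (rs (Ein S) w) x y)"
  by (rule dep_rs[where F = "\<lambda>w. conn w x y"])

lemma pred_conn_Ein [measurable]: "finite S \<Longrightarrow> Measurable.pred (perc p) (\<lambda>w. conn (rs (Ein S) w) x y)"
  by (rule pred_fin[OF finite_Ein dep_conn_Ein])

lemma phi_mono_p:
  assumes "finite S" "0 < p" "p \<le> p'" "p' < 1"
  shows "phi p S \<le> phi p' S"
  unfolding phi_def
proof (rule sum_mono)
  fix e
  have "mono (\<lambda>w. of_bool (conn (rs (Ein S) w) (0, 0) (inn S e)) :: real)"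
    unfolding mono_def by (auto intro: conn_mono[OF rs_mono[OF order_refl]])
  then show "Pr p (\<lambda>w. conn (rs (Ein S) w) (0, 0) (inn S e)) \<le> Pr p' (\<lambda>w. conn (rs (Ein S) w) (0, 0) (inn S e))"
    using assms by (intro EE_mono_p[OF finite_Ein dep_of_bool[OF dep_conn_Ein]]) auto
qed

definition unreach :: "vertex set \<Rightarrow> config \<Rightarrow> vertex set" where
  "unreach V w = {x\<in>V. \<not> reach V w x}"

text \<open>Explore all clusters that meet the complement of \<open>V\<close>. The exploration stops
  at closed edges leading into \<open>S\<close>, so edges with both ends in \<open>S\<close> are
  never examined. This gives the independence used in \<open>dct_derivative\<close>.\<close>

lemma unreach_stable:
  assumes ag: "\<And>e. e \<notin> Ein S \<Longrightarrow> w e = w' e" and S: "unreach V w = S"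
  shows "unreach V w' = S"
proof -
  have nin: "z \<notin> S" if "conn w z y" "y \<notin> V" for z y
    using that S reachI unfolding unreach_def by blast
  have 1: "conn w' z y" if "conn w z y" "y \<notin> V" for z y
    using that(1)
  proof (induction rule: converse_rtranclp_induct)
    case (step z z1)
    have "z \<notin> S" using step nin that(2) by (meson converse_rtranclp_into_rtranclp)
    then have "open_adj w' z z1" using step(1) ag unfolding open_adj_iff Ein_def by (smt (verit) mem_Collect_eq)
    then show ?case using step.IH by (rule converse_rtranclp_into_rtranclp)
  qed simp
  have 2: "\<not> reach V w' x" if xS: "x \<in> S" for x
  proof
    assume "reach V w' x"
    then obtain y where y: "y \<notin> V" "conn w' x y" unfolding reach_iff by blast
    have "y \<notin> S" using y S by (auto simp: unreach_def)
    then obtain u v where uv: "u \<in> S" "v \<notin> S" "open_adj w' u v" using conn_exit[OF y(2) xS \<open>y \<notin> S\<close>] by blast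
    then have o: "open_adj w u v" using ag unfolding open_adj_iff Ein_def by (smt (verit) mem_Collect_eq)
    have "reach V w v" using uv(2) S reachI[of w v v V] by (auto simp: unreach_def)
    then have "reach V w u" using o unfolding reach_iff by (meson converse_rtranclp_into_rtranclp)
    then show False using uv(1) S by (auto simp: unreach_def)
  qed
  show ?thesis
  proof (intro equalityI subsetI)
    fix x assume "x \<in> unreach V w'"
    then have "x \<in> V" "\<not> reach V w x" using 1 unfolding unreach_def reach_iff by blast+
    then show "x \<in> S" using S by (auto simp: unreach_def)
  next
    fix x assume "x \<in> S"
    then show "x \<in> unreach V w'" using 2 S by (auto simp: unreach_def)
  qed
qed

lemma dep_unreach: "dep (- Ein S) (\<lambda>w. unreach V w = S)"
  unfolding dep_def
proof (intro allI impI)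
  fix w w' :: config assume ag: "\<forall>e\<in>- Ein S. w e = w' e"
  show "(unreach V w = S) = (unreach V w' = S)"
    using unreach_stable[of S w w' V] unreach_stable[of S w' w V] ag by auto
qed

lemma dep_unreach': "dep (tch V) (\<lambda>w. unreach V w)"
  unfolding dep_def unreach_def using depD[OF dep_reach] by (intro allI impI Collect_cong) blast

lemma pivotal:
  assumes 0: "z \<in> unreach V w" and e: "e \<in> bd (unreach V w)"
    and c: "conn (rs (Ein (unreach V w)) w) z (inn (unreach V w) e)"
  shows "reach V (upd e True w) z" "\<not> reach V (upd e False w) z"
proof -
  let ?S = "unreach V w"
  note io = bd_inn_out[OF e]
  have le: "w \<le> upd e True w" "upd e False w \<le> w" by (auto simp: le_fun_def upd_apply)
  have "conn (upd e True w) z (inn ?S e)" using c conn_mono[OF order_trans[OF rs_le le(1)]] by blast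
  moreover have "open_adj (upd e True w) (inn ?S e) (out ?S e)" by (simp add: open_adj_inn_out)
  moreover have "reach V (upd e True w) (out ?S e)"
  proof -
    have "reach V w (out ?S e)" using io reachI[of w "out ?S e" "out ?S e" V] by (auto simp: unreach_def)
    then show ?thesis by (rule reach_mono[OF le(1)])
  qed
  ultimately show "reach V (upd e True w) z" unfolding reach_iff
    by (meson rtranclp.rtrancl_into_rtrancl rtranclp_trans)
  show "\<not> reach V (upd e False w) z" using 0 reach_mono[OF le(2), of V z] unfolding unreach_def by blast
qed

text \<open>Split according to the value \<open>S\<close> of \<open>unreach V w\<close>. Each
  boundary edge of \<open>S\<close> whose inner end is joined to the origin inside \<open>S\<close>
  is pivotal, and connections inside \<open>S\<close> are independent of the exploration. The
  expected number of such edges is therefore \<open>phi p S >= 1\<close> times the probability of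
  \<open>S\<close>; summing over the \<open>S\<close> that contain the origin gives the probability
  of not leaving \<open>V\<close>.\<close>

lemma dct_derivative:
  assumes V: "finite V" "(0, 0) \<in> V" and p: "0 < p" "p < 1"
    and phi: "\<And>S. finite S \<Longrightarrow> (0, 0) \<in> S \<Longrightarrow> phi p S \<ge> 1"
  shows "(\<Sum>e\<in>tch V. EE p (\<lambda>w. of_bool (reach V (upd e True w) (0, 0)) - of_bool (reach V (upd e False w) (0, 0))))
    \<ge> 1 - Pr p (\<lambda>w. reach V w (0, 0))"
proof -
  define D where "D e w = (of_bool (reach V (upd e True w) (0, 0)) - of_bool (reach V (upd e False w) (0, 0)) :: real)" for e w
  define SS where "SS = {S. S \<subseteq> V \<and> (0, 0) \<in> S}"
  define G where "G S e w = (of_bool (conn (rs (Ein S) w) (0, 0) (inn S e)) * of_bool (unreach V w = S) :: real)" for S e w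
  have finSS: "finite SS" using V by (simp add: SS_def)
  have finS: "finite S" if "S \<in> SS" for S using that V finite_subset by (auto simp: SS_def)
  have dD: "dep (tch V) (D e)" for e
    unfolding D_def by (intro dep_comp2[where g = "(-)"] dep_of_bool dep_upd_same[where F = "\<lambda>w. reach V w (0,0)"] dep_reach)
  have D0: "D e w \<ge> 0" for e w
  proof -
    have "upd e False w \<le> upd e True w" by (auto simp: le_fun_def upd_apply)
    then show ?thesis using reach_mono unfolding D_def by (auto simp: of_bool_def)
  qed
  have iD: "integrable (perc p) (D e)" for e by (rule dep_finite_integrable[OF finite_tch[OF V(1)] dD])
  have iU: "integrable (perc p) (\<lambda>w. of_bool (unreach V w = S) :: real)" for S
    by (rule dep_finite_integrable[OF finite_tch[OF V(1)]]) (rule dep_comp[OF dep_unreach'])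
  have mU: "(\<lambda>w. of_bool (unreach V w = S) :: real) \<in> borel_measurable (perc p)" for S
    using iU by (rule borel_measurable_integrable)
  have iG: "integrable (perc p) (G S e)" if "S \<in> SS" for S e
  proof -
    have "dep (Ein S \<union> tch V) (G S e)" unfolding G_def
      by (intro dep_comp2[where g = "(*)"] dep_mono[OF dep_of_bool[OF dep_conn_Ein]] dep_mono[OF dep_comp[OF dep_unreach']]) auto
    then show ?thesis using finite_Ein[OF finS[OF that]] finite_tch[OF V(1)] by (intro dep_finite_integrable) auto
  qed
  have pw: "(\<Sum>S\<in>SS. \<Sum>e\<in>bd S. G S e w) \<le> (\<Sum>e\<in>tch V. D e w)" for w
  proof (cases "unreach V w \<in> SS")
    case False
    then have "(\<Sum>S\<in>SS. \<Sum>e\<in>bd S. G S e w) = 0" by (intro sum.neutral ballI) (auto simp: G_def)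
    then show ?thesis using D0 by (simp add: sum_nonneg)
  next
    case True
    let ?S = "unreach V w"
    have "(\<Sum>S\<in>SS. \<Sum>e\<in>bd S. G S e w) = (\<Sum>S\<in>{?S}. \<Sum>e\<in>bd S. G S e w)"
      by (rule sum.mono_neutral_right) (use True finSS in \<open>auto simp: G_def\<close>)
    also have "\<dots> = (\<Sum>e\<in>bd ?S. G ?S e w)" by simp
    also have "\<dots> \<le> (\<Sum>e\<in>bd ?S. D e w)"
    proof (rule sum_mono)
      fix e assume e: "e \<in> bd ?S"
      show "G ?S e w \<le> D e w"
        using pivotal[of "(0,0)" V w e] e True D0[of e w] by (cases "conn (rs (Ein ?S) w) (0, 0) (inn ?S e)") (auto simp: G_def D_def SS_def)
    qed
    also have "\<dots> \<le> (\<Sum>e\<in>tch V. D e w)"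
    proof (rule sum_mono2)
      show "bd ?S \<subseteq> tch V" using True by (auto simp: SS_def bd_def tch_def)
    qed (use V finite_tch D0 in auto)
    finally show ?thesis .
  qed
  have "1 - Pr p (\<lambda>w. reach V w (0, 0)) = Pr p (\<lambda>w. \<not> reach V w (0, 0))"
    using Pr_not[OF pred_reach[OF V(1)]] by simp
  also have "\<dots> \<le> EE p (\<lambda>w. \<Sum>S\<in>SS. of_bool (unreach V w = S))"
  proof (rule EE_mono)
    show "integrable (perc p) (\<lambda>w. of_bool (\<not> reach V w (0, 0)) :: real)"
      using V(1) by (intro integrable_of_bool) measurable
    show "integrable (perc p) (\<lambda>w. \<Sum>S\<in>SS. of_bool (unreach V w = S) :: real)" by (intro Bochner_Integration.integrable_sum iU)
    fix w
    show "of_bool (\<not> reach V w (0, 0)) \<le> (\<Sum>S\<in>SS. of_bool (unreach V w = S) :: real)"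
    proof (cases "reach V w (0,0)")
      case False
      then have "unreach V w \<in> SS" using V by (auto simp: SS_def unreach_def)
      then have "of_bool (unreach V w = unreach V w) \<le> (\<Sum>S\<in>SS. of_bool (unreach V w = S) :: real)"
        by (intro member_le_sum finSS) auto
      then show ?thesis by simp
    qed (simp add: sum_nonneg)
  qed
  also have "\<dots> = (\<Sum>S\<in>SS. Pr p (\<lambda>w. unreach V w = S))" by (rule EE_sum[OF finSS iU])
  also have "\<dots> \<le> (\<Sum>S\<in>SS. phi p S * Pr p (\<lambda>w. unreach V w = S))"
    using phi finS mult_right_mono[OF phi Pr_nonneg] by (intro sum_mono) (auto simp: SS_def)
  also have "\<dots> = (\<Sum>S\<in>SS. \<Sum>e\<in>bd S. EE p (G S e))"
  proof (rule sum.cong[OF refl])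
    fix S assume S: "S \<in> SS"
    have "EE p (G S e) = Pr p (\<lambda>w. conn (rs (Ein S) w) (0, 0) (inn S e)) * Pr p (\<lambda>w. unreach V w = S)" for e
      unfolding G_def
      by (rule indep_finite[OF finite_Ein[OF finS[OF S]] dep_of_bool[OF dep_conn_Ein] dep_of_bool[OF dep_unreach] mU, where B = 1])
         (use p in auto)
    then show "phi p S * Pr p (\<lambda>w. unreach V w = S) = (\<Sum>e\<in>bd S. EE p (G S e))"
      by (simp add: phi_def sum_distrib_right)
  qed
  also have "\<dots> = EE p (\<lambda>w. \<Sum>S\<in>SS. \<Sum>e\<in>bd S. G S e w)"
    using finite_bd finS iG by (subst EE_sum[OF finSS]) (auto intro!: Bochner_Integration.integrable_sum sum.cong EE_sum[symmetric])
  also have "\<dots> \<le> EE p (\<lambda>w. \<Sum>e\<in>tch V. D e w)"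
    using pw iG iD by (intro EE_mono Bochner_Integration.integrable_sum) auto
  also have "\<dots> = (\<Sum>e\<in>tch V. EE p (D e))" by (rule EE_sum[OF finite_tch[OF V(1)] iD])
  finally show ?thesis unfolding D_def .
qed

text \<open>The previous lemma with Russo's formula says that the probability \<open>f\<close> of
  not leaving \<open>V\<close> satisfies \<open>f' <= - f\<close>, so \<open>f p * exp p\<close> is
  nonincreasing.\<close>

lemma dct_reach:
  assumes V: "finite V" "(0, 0) \<in> V" and q: "0 < q" "q \<le> p" "p < 1"
    and phi: "\<And>S. finite S \<Longrightarrow> (0, 0) \<in> S \<Longrightarrow> phi q S \<ge> 1"
  shows "Pr p (\<lambda>w. reach V w (0, 0)) \<ge> 1 - exp (- (p - q))"
proof -
  define f where "f p = 1 - Pr p (\<lambda>w. reach V w (0, 0))" for p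
  have f1: "f x \<le> 1" for x using Pr_nonneg by (simp add: f_def)
  have "f p * exp p \<le> f q * exp q"
  proof (rule DERIV_nonpos_imp_nonincreasing[OF q(2)])
    fix x assume x: "q \<le> x" "x \<le> p"
    then have x01: "0 < x" "x < 1" using q by auto
    define R where "R = (\<Sum>e\<in>tch V. EE x (\<lambda>w. of_bool (reach V (upd e True w) (0, 0)) - of_bool (reach V (upd e False w) (0, 0))))"
    have "((\<lambda>p. Pr p (\<lambda>w. reach V w (0, 0))) has_real_derivative R) (at x)"
      unfolding R_def by (rule russo[OF finite_tch[OF V(1)] dep_of_bool[OF dep_reach] x01])
    then have d: "(f has_real_derivative (0 - R)) (at x)" unfolding f_def by (intro derivative_intros)
    have "R \<ge> f x"
      unfolding R_def f_def
    proof (rule dct_derivative[OF V x01])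
      fix S :: "vertex set" assume S: "finite S" "(0, 0) \<in> S"
      show "1 \<le> phi x S" using phi[OF S] phi_mono_p[OF S(1) q(1) x(1) x01(2)] by linarith
    qed
    moreover have "((\<lambda>x. f x * exp x) has_real_derivative ((0 - R) * exp x + exp x * f x)) (at x)"
      using DERIV_mult'[OF d DERIV_exp] by (simp add: algebra_simps)
    moreover have "(0 - R) * exp x + exp x * f x = (f x - R) * exp x" by (simp add: algebra_simps)
    ultimately show "\<exists>y. ((\<lambda>x. f x * exp x) has_real_derivative y) (at x) \<and> y \<le> 0"
      by (metis diff_le_0_iff_le exp_ge_zero mult_nonpos_nonneg)
  qed
  also have "\<dots> \<le> exp q" using f1[of q] by simp
  finally have "f p \<le> exp q / exp p" by (simp add: field_simps)
  then show ?thesis by (simp add: f_def exp_diff)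
qed

lemma dct_percolation:
  assumes q: "0 < q" "q \<le> p" "p < 1"
    and phi: "\<And>S. finite S \<Longrightarrow> (0, 0) \<in> S \<Longrightarrow> phi q S \<ge> 1"
  shows "Pr p (\<lambda>w. conn_inf w (0, 0)) \<ge> 1 - exp (- (p - q))"
proof (rule LIMSEQ_le_const[OF Pr_conn_inf])
  have "(0, 0) \<in> bx n" for n by (simp add: bx_def)
  then show "\<exists>N. \<forall>n\<ge>N. 1 - exp (- (p - q)) \<le> Pr p (\<lambda>w. reach (bx n) w (0, 0))"
    using dct_reach[OF finite_bx _ q phi] by blast
qed

subsection \<open>Finite susceptibility\<close>

definition clu :: "vertex set \<Rightarrow> config \<Rightarrow> vertex \<Rightarrow> vertex set" where
  "clu R w x = {u. conn (rs (Ein R) w) x u}"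

lemma clu_stable:
  assumes ag: "\<And>e. e \<in> Ein R \<inter> tch C \<Longrightarrow> w e = w' e" and C: "clu R w x = C"
  shows "clu R w' x = C"
proof -
  have oa: "open_adj (rs (Ein R) w) u v = open_adj (rs (Ein R) w') u v" if "u \<in> C" for u v
    using ag that unfolding open_adj_iff rs_def tch_def by blast
  have 1: "conn (rs (Ein R) w') x u" if "conn (rs (Ein R) w) x u" for u
    using that
  proof (induction rule: rtranclp_induct)
    case (step u v)
    have "u \<in> C" using step(1) C by (auto simp: clu_def)
    then show ?case using step oa by (meson rtranclp.rtrancl_into_rtrancl)
  qed simp
  have 2: "u \<in> C" if "conn (rs (Ein R) w') x u" for u
    using that
  proof (induction rule: rtranclp_induct)
    case base then show ?case using C by (auto simp: clu_def)
  next
    case (step u v)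
    then have "open_adj (rs (Ein R) w) u v" using oa by blast
    then show ?case using step.IH C by (auto simp: clu_def intro: rtranclp.rtrancl_into_rtrancl)
  qed
  show ?thesis using 1 2 C by (auto simp: clu_def)
qed

lemma dep_clu: "dep (Ein R \<inter> tch C) (\<lambda>w. clu R w x = C)"
  unfolding dep_def
proof (intro allI impI)
  fix w w' :: config assume ag: "\<forall>e\<in>Ein R \<inter> tch C. w e = w' e"
  show "(clu R w x = C) = (clu R w' x = C)"
    using clu_stable[of R C w w' x] clu_stable[of R C w' w x] ag by auto
qed

section \<open>Translations of vertices, edges and clusters\<close>

definition tr :: "vertex \<Rightarrow> vertex \<Rightarrow> vertex" where
  "tr v u = (fst u + fst v, snd u + snd v)"

lemma tr_0 [simp]: "tr v (0, 0) = v"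
  by (simp add: tr_def)

lemma inj_tr: "inj (tr v)"
  by (auto simp: inj_def tr_def prod_eq_iff)

lemma fst_sh [simp]: "fst (sh v e) = tr v (fst e)" and tip_sh [simp]: "tip (sh v e) = tr v (tip e)"
  using sh_props(3)[of v e] by (simp_all add: tr_def)

lemma conn_tr: "conn (\<lambda>e. w (sh v e)) x y \<longleftrightarrow> conn w (tr v x) (tr v y)"
  by (simp add: conn_sh tr_def)

lemma conn_inf_tr: "conn_inf (\<lambda>e. w (sh v e)) x \<longleftrightarrow> conn_inf w (tr v x)"
  by (simp add: conn_inf_sh tr_def)

lemma sh_Ein: "sh v e \<in> Ein (tr v ` S) \<longleftrightarrow> e \<in> Ein S"
  by (simp add: Ein_def inj_image_mem_iff[OF inj_tr])

lemma sh_bd: "sh v e \<in> bd (tr v ` S) \<longleftrightarrow> e \<in> bd S"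
  by (simp add: bd_def inj_image_mem_iff[OF inj_tr])

lemma sh_inn: "inn (tr v ` S) (sh v e) = tr v (inn S e)"
  by (simp add: inn_def inj_image_mem_iff[OF inj_tr])

lemma rs_sh: "(\<lambda>e. rs (Ein (tr v ` S)) w (sh v e)) = rs (Ein S) (\<lambda>e. w (sh v e))"
  by (simp add: rs_def sh_Ein fun_eq_iff)

lemma conn_rs_tr: "conn (rs (Ein S) (\<lambda>e. w (sh v e))) x y \<longleftrightarrow> conn (rs (Ein (tr v ` S)) w) (tr v x) (tr v y)"
  using conn_tr[of "rs (Ein (tr v ` S)) w" v x y] by (simp add: rs_sh)

lemma inj_sh: "inj (sh v)"
  by (rule bij_is_inj[OF bij_sh])

lemma Pr_reindex:
  assumes "inj g" "Measurable.pred (perc p) Q"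
  shows "Pr p (\<lambda>w. Q (\<lambda>e. w (g e))) = Pr p Q"
  using EE_reindex[OF assms(1) pred_of_bool[OF assms(2)]] .

lemma phi_tr:
  assumes "finite S"
  shows "(\<Sum>e\<in>bd (tr v ` S). Pr p (\<lambda>w. conn (rs (Ein (tr v ` S)) w) v (inn (tr v ` S) e))) = phi p S"
proof -
  have b: "bd (tr v ` S) = sh v ` bd S"
  proof (intro equalityI subsetI)
    fix e assume e: "e \<in> bd (tr v ` S)"
    obtain e' where "e = sh v e'" using bij_is_surj[OF bij_sh] by (metis surjD)
    then show "e \<in> sh v ` bd S" using e by (auto simp: sh_bd)
  next
    fix e assume "e \<in> sh v ` bd S"
    then show "e \<in> bd (tr v ` S)" by (auto simp: sh_bd)
  qed
  have "Pr p (\<lambda>w. conn (rs (Ein (tr v ` S)) w) v (tr v (inn S e))) = Pr p (\<lambda>w. conn (rs (Ein S) w) (0, 0) (inn S e))" for e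
    using Pr_reindex[OF inj_sh[of v] pred_conn_Ein[OF assms, where p = p and x = "(0, 0)" and y = "inn S e"]]
    by (simp add: conn_rs_tr)
  then show ?thesis unfolding b phi_def
    by (subst sum.reindex) (auto simp: sh_inn intro: inj_on_subset[OF inj_sh])
qed

lemma Pr_coord: "0 \<le> p \<Longrightarrow> p \<le> 1 \<Longrightarrow> Pr p (\<lambda>w. w e) = p"
  using resample_fin[of "{e}" "\<lambda>w. of_bool (w e)" p e] by (simp add: dep_def)

text \<open>Let \<open>C\<close> be the cluster of \<open>x\<close> inside the translate of
  \<open>S\<close>. A path to a point beyond the translate leaves \<open>C\<close> for the last time
  through one of its boundary edges and continues in \<open>U - C\<close>; edge and continuation are
  independent of the event that the cluster is \<open>C\<close>. As \<open>U - C\<close> is smaller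
  than \<open>U\<close>, induction bounds the sum by \<open>card S + q * phi q S * K\<close>, and
  \<open>K\<close> is chosen as the fixed point of this bound.\<close>

lemma region_susceptibility:
  assumes q: "0 \<le> q" "q \<le> 1" and S: "finite S" "(0, 0) \<in> S" and phi: "q * phi q S < 1"
  shows "finite U \<Longrightarrow> x \<in> U \<Longrightarrow> (\<Sum>y\<in>U. Pr q (\<lambda>w. conn (rs (Ein U) w) x y)) \<le> card S / (1 - q * phi q S)"
proof (induction "card U" arbitrary: U x rule: less_induct)
  case less
  define K where "K = card S / (1 - q * phi q S)"
  have K0: "K \<ge> 0" using phi by (simp add: K_def)
  have IH: "(\<Sum>y\<in>U'. Pr q (\<lambda>w. conn (rs (Ein U') w) z y)) \<le> K" if "U' \<subset> U" "z \<in> U'" for U' z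
    unfolding K_def using that less.prems by (intro less.hyps psubset_card_mono) (auto intro: finite_subset)
  define Sx where "Sx = tr x ` S"
  have Sx: "finite Sx" "x \<in> Sx" "card Sx \<le> card S"
    using S image_eqI[of x "tr x" "(0,0)"] by (auto simp: Sx_def card_image_le)
  define R where "R = Sx \<inter> U"
  have R: "finite R" "x \<in> R" using Sx less.prems by (auto simp: R_def)
  define CC where "CC = {C. C \<subseteq> R \<and> x \<in> C}"
  have finCC: "finite CC" using R by (simp add: CC_def)
  define B where "B = bd Sx"
  have finB: "finite B" using finite_bd[OF Sx(1)] by (simp add: B_def)
  define G where "G C e y w = (of_bool (clu R w x = C) * (of_bool (w e) * of_bool (conn (rs (Ein (U - C)) w) (out Sx e) y)) :: real)" for C e y w
  define EC where "EC C = {e\<in>B. inn Sx e \<in> C \<and> out Sx e \<in> U - C}" for C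
  have finEC: "finite (EC C)" for C using finB by (simp add: EC_def)
  have cR: "clu R w x \<subseteq> R \<and> x \<in> clu R w x" for w
    using conn_rs_in[of R w x] R(2) by (auto simp: clu_def)
  have iG: "integrable (perc q) (G C e y)" for C e y
  proof -
    have "dep (insert e (Ein R \<union> Ein (U - C))) (G C e y)" unfolding G_def
      by (intro dep_comp2[where g = "(*)"] dep_of_bool dep_mono[OF dep_clu] dep_mono[OF dep_conn_Ein]) (auto simp: dep_def)
    then show ?thesis using finite_Ein[OF R(1)] finite_Ein[of "U - C"] less.prems by (intro dep_finite_integrable) auto
  qed
  have pw: "of_bool (conn (rs (Ein U) w) x y) \<le> (\<Sum>C\<in>CC. \<Sum>e\<in>EC C. G C e y w)" if y: "y \<in> U - Sx" for y w
  proof (cases "conn (rs (Ein U) w) x y")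
    case True
    let ?C = "clu R w x"
    \<comment> \<open>Read the path backwards from \<open>y\<close> and stop when it first meets
      \<open>?C\<close>: the part already traversed avoids \<open>?C\<close>.\<close>
    have "conn (rs (Ein U) w) y x" using True by (rule conn_sym)
    moreover have "y \<in> - ?C" "x \<notin> - ?C" using y cR[of w] by (auto simp: R_def)
    ultimately obtain u v where uv: "conn (rs (Ein (- ?C)) (rs (Ein U) w)) y u" "u \<in> - ?C" "v \<notin> - ?C" "open_adj (rs (Ein U) w) u v"
      using conn_exit by metis
    have vC: "v \<in> ?C" using uv by simp
    have uU: "u \<in> U" and ow: "open_adj w u v" using uv(4) by (auto simp: open_adj_rs_Ein)
    have "u \<notin> Sx"
    proof
      assume "u \<in> Sx"
      then have "open_adj (rs (Ein R) w) v u" using ow uU vC cR[of w] by (auto simp: open_adj_rs_Ein R_def open_adj_sym)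
      then have "u \<in> ?C" using vC by (auto simp: clu_def intro: rtranclp.rtrancl_into_rtrancl)
      then show False using uv by simp
    qed
    moreover have "v \<in> Sx" using vC cR[of w] by (auto simp: R_def)
    moreover obtain e where e: "w e" "u = fst e \<and> v = tip e \<or> u = tip e \<and> v = fst e" using ow unfolding open_adj_iff by blast
    ultimately have eB: "e \<in> B" "inn Sx e = v" "out Sx e = u" by (auto simp: B_def bd_def inn_def out_def)
    then have "e \<in> EC ?C" using vC uU uv(2) by (simp add: EC_def)
    have "conn (rs (Ein (U - ?C)) w) y u"
    proof (rule conn_mono[OF _ uv(1)])
      show "rs (Ein (- ?C)) (rs (Ein U) w) \<le> rs (Ein (U - ?C)) w" by (auto simp: rs_def le_fun_def Ein_def)
    qed
    then have "G ?C e y w = 1" using e(1) eB by (simp add: G_def conn_sym)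
    moreover have "G ?C e y w \<le> (\<Sum>e\<in>EC ?C. G ?C e y w)"
      by (rule member_le_sum[OF \<open>e \<in> EC ?C\<close> _ finEC]) (simp add: G_def)
    moreover have "(\<Sum>e\<in>EC ?C. G ?C e y w) \<le> (\<Sum>C\<in>CC. \<Sum>e\<in>EC C. G C e y w)"
      by (rule member_le_sum[where f = "\<lambda>C. \<Sum>e\<in>EC C. G C e y w"]) (use cR[of w] finCC in \<open>auto simp: CC_def G_def intro!: sum_nonneg\<close>)
    ultimately show ?thesis by simp
  qed (auto simp: G_def intro!: sum_nonneg)
  have fU: "finite U" by fact
  have EG: "EE q (G C e y) = Pr q (\<lambda>w. clu R w x = C) * (q * Pr q (\<lambda>w. conn (rs (Ein (U - C)) w) (out Sx e) y))"
    if "C \<in> CC" "e \<in> EC C" for C e y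
  proof -
    have eR: "e \<notin> Ein R" using that(2) by (auto simp: EC_def B_def bd_def Ein_def R_def)
    have eU: "e \<notin> Ein (U - C)" using that(2) unfolding EC_def Ein_def inn_def by (auto split: if_splits)
    have dc: "dep (Ein (U - C)) (\<lambda>w. of_bool (conn (rs (Ein (U - C)) w) (out Sx e) y) :: real)"
      by (rule dep_of_bool[OF dep_conn_Ein])
    have fc: "finite (Ein (U - C))" using fU by (intro finite_Ein) auto
    have mc: "(\<lambda>w. of_bool (conn (rs (Ein (U - C)) w) (out Sx e) y) :: real) \<in> borel_measurable (perc q)"
      using dep_finite_measurable[OF fc dc] by simp
    have de: "dep {e} (\<lambda>w. of_bool (w e) :: real)" by (simp add: dep_def)
    have me: "(\<lambda>w. of_bool (w e) :: real) \<in> borel_measurable (perc q)" by (rule dep_finite_measurable[OF _ de]) auto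
    have 1: "EE q (\<lambda>w. of_bool (w e) * of_bool (conn (rs (Ein (U - C)) w) (out Sx e) y))
      = q * Pr q (\<lambda>w. conn (rs (Ein (U - C)) w) (out Sx e) y)"
      using indep_finite[OF _ de dep_mono[OF dc] mc, where B = 1] eU q Pr_coord[of q e] by auto
    have "EE q (G C e y) = Pr q (\<lambda>w. clu R w x = C) * EE q (\<lambda>w. of_bool (w e) * of_bool (conn (rs (Ein (U - C)) w) (out Sx e) y))"
      unfolding G_def
    proof (rule indep_finite[OF _ dep_of_bool[OF dep_clu], where B = 1])
      show "dep (- (Ein R \<inter> tch C)) (\<lambda>w. of_bool (w e) * of_bool (conn (rs (Ein (U - C)) w) (out Sx e) y) :: real)"
        by (intro dep_comp2[where g = "(*)"] dep_mono[OF dc] dep_mono[OF de]) (use eR in \<open>auto simp: Ein_def tch_def\<close>)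
    qed (use R finite_Ein mc me q in auto)
    then show ?thesis by (simp add: 1)
  qed
  have iU: "integrable (perc q) (\<lambda>w. of_bool (conn (rs (Ein U) w) x y) :: real)" for y
    by (rule dep_finite_integrable[OF finite_Ein[OF fU] dep_of_bool[OF dep_conn_Ein]])
  have le1: "Pr q (\<lambda>w. conn (rs (Ein U) w) x y) \<le> 1" for y by (rule Pr_le1[OF pred_conn_Ein[OF fU]])
  have "(\<Sum>y\<in>U. Pr q (\<lambda>w. conn (rs (Ein U) w) x y)) = (\<Sum>y\<in>U \<inter> Sx. Pr q (\<lambda>w. conn (rs (Ein U) w) x y)) + (\<Sum>y\<in>U - Sx. Pr q (\<lambda>w. conn (rs (Ein U) w) x y))"
    using fU by (subst sum.union_disjoint[symmetric]) (auto intro!: sum.cong)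
  also have "(\<Sum>y\<in>U \<inter> Sx. Pr q (\<lambda>w. conn (rs (Ein U) w) x y)) \<le> card S"
  proof -
    have "(\<Sum>y\<in>U \<inter> Sx. Pr q (\<lambda>w. conn (rs (Ein U) w) x y)) \<le> (\<Sum>y\<in>U \<inter> Sx. 1)" by (intro sum_mono le1)
    also have "\<dots> \<le> card Sx" using card_mono[of Sx "U \<inter> Sx"] Sx by simp
    finally show ?thesis using Sx by linarith
  qed
  also have "(\<Sum>y\<in>U - Sx. Pr q (\<lambda>w. conn (rs (Ein U) w) x y)) \<le> (\<Sum>y\<in>U - Sx. \<Sum>C\<in>CC. \<Sum>e\<in>EC C. EE q (G C e y))"
  proof (rule sum_mono)
    fix y assume y: "y \<in> U - Sx"
    have "Pr q (\<lambda>w. conn (rs (Ein U) w) x y) \<le> EE q (\<lambda>w. \<Sum>C\<in>CC. \<Sum>e\<in>EC C. G C e y w)"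
      by (rule EE_mono[OF iU _ pw[OF y]]) (intro Bochner_Integration.integrable_sum iG)
    also have "\<dots> = (\<Sum>C\<in>CC. \<Sum>e\<in>EC C. EE q (G C e y))"
    proof -
      have "EE q (\<lambda>w. \<Sum>C\<in>CC. \<Sum>e\<in>EC C. G C e y w) = (\<Sum>C\<in>CC. EE q (\<lambda>w. \<Sum>e\<in>EC C. G C e y w))"
        by (rule EE_sum[OF finCC]) (intro Bochner_Integration.integrable_sum iG)
      also have "\<dots> = (\<Sum>C\<in>CC. \<Sum>e\<in>EC C. EE q (G C e y))"
        by (intro sum.cong refl EE_sum[OF finEC] iG)
      finally show ?thesis .
    qed
    finally show "Pr q (\<lambda>w. conn (rs (Ein U) w) x y) \<le> (\<Sum>C\<in>CC. \<Sum>e\<in>EC C. EE q (G C e y))" .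
  qed
  also have "\<dots> = (\<Sum>C\<in>CC. \<Sum>e\<in>EC C. \<Sum>y\<in>U - Sx. EE q (G C e y))"
    by (subst sum.swap) (intro sum.cong refl sum.swap)
  also have "\<dots> \<le> (\<Sum>C\<in>CC. \<Sum>e\<in>EC C. Pr q (\<lambda>w. clu R w x = C) * (q * K))"
  proof (intro sum_mono)
    fix C e assume C: "C \<in> CC" and e: "e \<in> EC C"
    have "(\<Sum>y\<in>U - Sx. EE q (G C e y)) = Pr q (\<lambda>w. clu R w x = C) * (q * (\<Sum>y\<in>U - Sx. Pr q (\<lambda>w. conn (rs (Ein (U - C)) w) (out Sx e) y)))"
      by (simp add: EG[OF C e] sum_distrib_left)
    also have "(\<Sum>y\<in>U - Sx. Pr q (\<lambda>w. conn (rs (Ein (U - C)) w) (out Sx e) y)) \<le> (\<Sum>y\<in>U - C. Pr q (\<lambda>w. conn (rs (Ein (U - C)) w) (out Sx e) y))"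
      by (rule sum_mono2) (use fU C Pr_nonneg in \<open>auto simp: CC_def R_def\<close>)
    also have "\<dots> \<le> K"
      by (rule IH) (use C e R less.prems in \<open>auto simp: CC_def EC_def\<close>)
    finally show "(\<Sum>y\<in>U - Sx. EE q (G C e y)) \<le> Pr q (\<lambda>w. clu R w x = C) * (q * K)"
      using q Pr_nonneg by (simp add: mult_left_mono)
  qed
  also have "\<dots> \<le> (\<Sum>e\<in>B. q * K * Pr q (\<lambda>w. conn (rs (Ein Sx) w) x (inn Sx e)))"
  proof -
    have "(\<Sum>C\<in>CC. \<Sum>e\<in>EC C. Pr q (\<lambda>w. clu R w x = C) * (q * K)) \<le> (\<Sum>C\<in>CC. \<Sum>e\<in>B. of_bool (inn Sx e \<in> C) * (Pr q (\<lambda>w. clu R w x = C) * (q * K)))"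
    proof (rule sum_mono)
      fix C
      have "(\<Sum>e\<in>EC C. Pr q (\<lambda>w. clu R w x = C) * (q * K)) = (\<Sum>e\<in>EC C. of_bool (inn Sx e \<in> C) * (Pr q (\<lambda>w. clu R w x = C) * (q * K)))"
        by (rule sum.cong) (auto simp: EC_def)
      also have "\<dots> \<le> (\<Sum>e\<in>B. of_bool (inn Sx e \<in> C) * (Pr q (\<lambda>w. clu R w x = C) * (q * K)))"
        by (rule sum_mono2) (use finB q K0 Pr_nonneg in \<open>auto simp: EC_def\<close>)
      finally show "(\<Sum>e\<in>EC C. Pr q (\<lambda>w. clu R w x = C) * (q * K)) \<le> (\<Sum>e\<in>B. of_bool (inn Sx e \<in> C) * (Pr q (\<lambda>w. clu R w x = C) * (q * K)))" .
    qed
    also have "\<dots> = (\<Sum>e\<in>B. q * K * (\<Sum>C\<in>CC. of_bool (inn Sx e \<in> C) * Pr q (\<lambda>w. clu R w x = C)))"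
      by (subst sum.swap) (simp add: sum_distrib_left mult_ac)
    also have "\<dots> \<le> (\<Sum>e\<in>B. q * K * Pr q (\<lambda>w. conn (rs (Ein Sx) w) x (inn Sx e)))"
    proof (intro sum_mono mult_left_mono)
      fix e
      have ic: "integrable (perc q) (\<lambda>w. of_bool (clu R w x = C) :: real)" for C
        by (rule dep_finite_integrable[OF _ dep_of_bool[OF dep_clu]]) (use R finite_Ein in auto)
      have "(\<Sum>C\<in>CC. of_bool (inn Sx e \<in> C) * Pr q (\<lambda>w. clu R w x = C)) = EE q (\<lambda>w. \<Sum>C\<in>CC. of_bool (inn Sx e \<in> C) * of_bool (clu R w x = C))"
        using ic by (subst EE_sum[OF finCC]) (auto simp: EE_def)
      also have "\<dots> \<le> Pr q (\<lambda>w. conn (rs (Ein Sx) w) x (inn Sx e))"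
      proof (rule EE_mono)
        show "integrable (perc q) (\<lambda>w. of_bool (conn (rs (Ein Sx) w) x (inn Sx e)) :: real)"
          by (rule integrable_of_bool[OF pred_conn_Ein[OF Sx(1)]])
        show "integrable (perc q) (\<lambda>w. \<Sum>C\<in>CC. of_bool (inn Sx e \<in> C) * of_bool (clu R w x = C) :: real)"
          by (intro Bochner_Integration.integrable_sum integrable_mult_right ic)
        fix w
        have "(\<Sum>C\<in>CC. of_bool (inn Sx e \<in> C) * of_bool (clu R w x = C)) = (of_bool (inn Sx e \<in> clu R w x) :: real)"
          using finCC cR[of w] by (subst sum.mono_neutral_right[of CC "{clu R w x}"]) (auto simp: CC_def)
        also have "\<dots> \<le> of_bool (conn (rs (Ein Sx) w) x (inn Sx e))"
        proof -
          have "rs (Ein R) w \<le> rs (Ein Sx) w" by (auto simp: rs_def le_fun_def R_def Ein_def)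
          then show ?thesis using conn_mono by (auto simp: clu_def)
        qed
        finally show "(\<Sum>C\<in>CC. of_bool (inn Sx e \<in> C) * of_bool (clu R w x = C)) \<le> (of_bool (conn (rs (Ein Sx) w) x (inn Sx e)) :: real)" .
      qed
      finally show "(\<Sum>C\<in>CC. of_bool (inn Sx e \<in> C) * Pr q (\<lambda>w. clu R w x = C)) \<le> Pr q (\<lambda>w. conn (rs (Ein Sx) w) x (inn Sx e))" .
    qed (use q K0 in auto)
    finally show ?thesis .
  qed
  also have "\<dots> = q * phi q S * K"
    using phi_tr[OF S(1), where v = x and p = q] by (simp add: B_def Sx_def sum_distrib_left[symmetric])
  also have "real (card S) + q * phi q S * K = K"
  proof -
    have "1 - q * phi q S \<noteq> 0" using phi by simp
    then show ?thesis by (simp add: K_def divide_simps) (simp add: algebra_simps)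
  qed
  finally show ?case by (simp add: K_def)
qed

definition cluster_size :: "config \<Rightarrow> vertex \<Rightarrow> ennreal" where
  "cluster_size w x = emeasure (count_space UNIV) {y. conn w x y}"

lemma conn_box: "conn w x y \<longleftrightarrow> (\<exists>N. conn (rs (Ein (bx N)) w) x y)"
proof
  assume "conn w x y"
  then show "\<exists>N. conn (rs (Ein (bx N)) w) x y"
  proof (induction rule: rtranclp_induct)
    case (step y z)
    then obtain N where N: "conn (rs (Ein (bx N)) w) x y" by blast
    obtain M where M: "{y, z} \<subseteq> bx M" using finite_in_bx[of "{y, z}"] by auto
    let ?L = "max N M"
    have "rs (Ein (bx N)) w \<le> rs (Ein (bx ?L)) w" using bx_mono[of N ?L] by (auto simp: rs_def le_fun_def Ein_def)
    then have "conn (rs (Ein (bx ?L)) w) x y" using N by (rule conn_mono)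
    moreover have "open_adj (rs (Ein (bx ?L)) w) y z" using step M bx_mono[of M ?L] by (auto simp: open_adj_rs_Ein)
    ultimately show ?case by (meson rtranclp.rtrancl_into_rtrancl)
  qed auto
qed (use conn_mono[OF rs_le] in blast)

lemma pred_conn [measurable]: "Measurable.pred (perc p) (\<lambda>w. conn w x y)"
proof -
  have eq: "(\<lambda>w. conn w x y) = (\<lambda>w. \<exists>N. conn (rs (Ein (bx N)) w) x y)"
    by (rule ext, rule conn_box)
  show ?thesis by (subst eq) (intro pred_intros_countable pred_conn_Ein finite_bx)
qed

lemma cluster_size_SUP: "cluster_size w x = (SUP N. \<Sum>y\<in>bx N. ennreal (of_bool (conn w x y)))"
proof -
  have "incseq (\<lambda>N. {y. conn w x y} \<inter> bx N)" using bx_mono by (fastforce simp: incseq_def)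
  moreover have "(\<Union>N. {y. conn w x y} \<inter> bx N) = {y. conn w x y}"
  proof -
    have "\<exists>N. y \<in> bx N" for y using finite_in_bx[of "{y}"] by auto
    then have "(\<Union>N. bx N) = UNIV" by blast
    then show ?thesis by (simp flip: Int_UN_distrib)
  qed
  ultimately have "cluster_size w x = (SUP N. emeasure (count_space UNIV) ({y. conn w x y} \<inter> bx N))"
    unfolding cluster_size_def by (subst SUP_emeasure_incseq) auto
  moreover have "emeasure (count_space UNIV) ({y. conn w x y} \<inter> bx N) = (\<Sum>y\<in>bx N. ennreal (of_bool (conn w x y)))" for N
  proof -
    have "(\<Sum>y\<in>bx N. ennreal (of_bool (conn w x y))) = (\<Sum>y\<in>{y. conn w x y} \<inter> bx N. 1)"
      by (intro sum.mono_neutral_cong_right) auto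
    then show ?thesis by (subst emeasure_count_space_finite) auto
  qed
  ultimately show ?thesis by simp
qed

lemma cluster_size_measurable [measurable]: "(\<lambda>w. cluster_size w x) \<in> borel_measurable (perc p)"
  unfolding cluster_size_SUP by measurable

text \<open>The bound for finite regions does not depend on the region, so it passes to the whole
  lattice by monotone convergence over boxes.\<close>

lemma susceptibility:
  assumes q: "0 \<le> q" "q \<le> 1" and S: "finite S" "(0, 0) \<in> S" and phi: "q * phi q S < 1"
  shows "(\<integral>\<^sup>+w. cluster_size w x \<partial>perc q) \<le> ennreal (card S / (1 - q * phi q S))"
proof -
  let ?K = "card S / (1 - q * phi q S)"
  have fin: "(\<Sum>y\<in>bx N. Pr q (\<lambda>w. conn w x y)) \<le> ?K" for N
  proof -
    obtain M0 where M0: "insert x (bx N) \<subseteq> bx M0" using finite_in_bx[of "insert x (bx N)"] by auto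
    define Q where "Q n w y = conn (rs (Ein (bx (M0 + n))) w) x y" for n w y
    have "conn w x y \<longleftrightarrow> (\<exists>n. Q n w y)" for w y
    proof
      assume "conn w x y"
      then obtain N where "conn (rs (Ein (bx N)) w) x y" using conn_box by blast
      moreover have "rs (Ein (bx N)) w \<le> rs (Ein (bx (M0 + N))) w" using bx_mono[of N "M0 + N"] by (auto simp: rs_def le_fun_def Ein_def)
      ultimately show "\<exists>n. Q n w y" unfolding Q_def using conn_mono by blast
    next
      assume "\<exists>n. Q n w y"
      then show "conn w x y" unfolding Q_def using conn_mono[OF rs_le] by blast
    qed
    moreover have "(\<lambda>n. Pr q (\<lambda>w. Q n w y)) \<longlonglongrightarrow> Pr q (\<lambda>w. \<exists>n. Q n w y)" for y
    proof (rule Pr_inc_lim)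
      fix n w assume "Q n w y"
      moreover have "rs (Ein (bx (M0 + n))) w \<le> rs (Ein (bx (M0 + Suc n))) w" using bx_mono[of "M0 + n" "M0 + Suc n"] by (auto simp: rs_def le_fun_def Ein_def)
      ultimately show "Q (Suc n) w y" unfolding Q_def using conn_mono by blast
    qed (simp add: Q_def)
    ultimately have "(\<lambda>n. \<Sum>y\<in>bx N. Pr q (\<lambda>w. Q n w y)) \<longlonglongrightarrow> (\<Sum>y\<in>bx N. Pr q (\<lambda>w. conn w x y))"
      by (intro tendsto_sum) simp
    then show ?thesis
    proof (rule LIMSEQ_le_const2)
      have "(\<Sum>y\<in>bx N. Pr q (\<lambda>w. Q n w y)) \<le> ?K" for n
      proof -
        have sub: "insert x (bx N) \<subseteq> bx (M0 + n)" using M0 bx_mono[of M0 "M0 + n"] by auto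
        then have "(\<Sum>y\<in>bx N. Pr q (\<lambda>w. Q n w y)) \<le> (\<Sum>y\<in>bx (M0 + n). Pr q (\<lambda>w. Q n w y))"
          by (intro sum_mono2 Pr_nonneg) auto
        also have "\<dots> \<le> ?K" unfolding Q_def by (rule region_susceptibility[OF q S phi]) (use sub in auto)
        finally show ?thesis .
      qed
      then show "\<exists>M. \<forall>n\<ge>M. (\<Sum>y\<in>bx N. Pr q (\<lambda>w. Q n w y)) \<le> ?K" by blast
    qed
  qed
  have "(\<integral>\<^sup>+w. cluster_size w x \<partial>perc q) = (SUP N. \<integral>\<^sup>+w. (\<Sum>y\<in>bx N. ennreal (of_bool (conn w x y))) \<partial>perc q)"
    unfolding cluster_size_SUP
  proof (rule nn_integral_monotone_convergence_SUP)
    show "incseq (\<lambda>N w. \<Sum>y\<in>bx N. ennreal (of_bool (conn w x y)))"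
      unfolding incseq_def le_fun_def by (intro allI impI sum_mono2 bx_mono finite_bx) auto
  qed measurable
  also have "\<dots> \<le> ennreal ?K"
  proof (rule SUP_least)
    fix N
    have "(\<integral>\<^sup>+w. (\<Sum>y\<in>bx N. ennreal (of_bool (conn w x y))) \<partial>perc q) = (\<Sum>y\<in>bx N. \<integral>\<^sup>+w. ennreal (of_bool (conn w x y)) \<partial>perc q)"
      by (rule nn_integral_sum) measurable
    also have "\<dots> = (\<Sum>y\<in>bx N. ennreal (Pr q (\<lambda>w. conn w x y)))"
      unfolding EE_def by (intro sum.cong refl nn_integral_eq_integral integrable_of_bool) auto
    also have "\<dots> = ennreal (\<Sum>y\<in>bx N. Pr q (\<lambda>w. conn w x y))" by (intro sum_ennreal Pr_nonneg)
    also have "\<dots> \<le> ennreal ?K" using fin by (intro ennreal_leI)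
    finally show "(\<integral>\<^sup>+w. (\<Sum>y\<in>bx N. ennreal (of_bool (conn w x y))) \<partial>perc q) \<le> ennreal ?K" .
  qed
  finally show ?thesis .
qed

subsection \<open>The shift along the axis\<close>

definition sft :: "nat \<Rightarrow> config \<Rightarrow> config" where
  "sft n w = (\<lambda>e. w (sh (int n, 0) e))"

lemma sft_0 [simp]: "sft 0 w = w"
  by (simp add: sft_def sh_def)

lemma sft_add: "sft m (sft n w) = sft (m + n) w"
  by (simp add: sft_def sh_def fun_eq_iff algebra_simps)

lemma measurable_sft [measurable]: "sft n \<in> measurable (perc p) (perc p)"
  unfolding sft_def by (rule measurable_reindex)

lemma distr_sft: "distr (perc p) (perc p) (sft n) = perc p"
  unfolding sft_def by (rule distr_reindex[OF inj_sh])

lemma EE_sft: "F \<in> borel_measurable (perc p) \<Longrightarrow> EE p (\<lambda>w. F (sft n w)) = EE p F"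
  unfolding sft_def by (rule EE_reindex[OF inj_sh])

lemma nn_sft: "F \<in> borel_measurable (perc p) \<Longrightarrow> (\<integral>\<^sup>+w. F (sft n w) \<partial>perc p) = (\<integral>\<^sup>+w. F w \<partial>perc p)"
  by (subst (2) distr_sft[of p n, symmetric]) (simp add: nn_integral_distr)

lemma integrable_sft: "integrable (perc p) (F :: config \<Rightarrow> real) \<Longrightarrow> integrable (perc p) (\<lambda>w. F (sft n w))"
  by (rule integrable_distr[OF measurable_sft]) (simp add: distr_sft)

lemma measure_sft: "A \<in> sets (perc p) \<Longrightarrow> measure (perc p) (sft n -` A) = measure (perc p) A"
  using measure_distr[OF measurable_sft[where n = n and p = p], where S = A] by (simp add: distr_sft)

lemma sets_sft: "A \<in> sets (perc p) \<Longrightarrow> sft n -` A \<in> sets (perc p)"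
  using measurable_sets[OF measurable_sft, of A p n] by simp

lemma finite_dep_set: "finite J \<Longrightarrow> dep J (\<lambda>w. w \<in> B) \<Longrightarrow> B \<in> sets (perc p)"
  using pred_fin[of J "\<lambda>w. w \<in> B" p] by (simp add: pred_def)

text \<open>The approximable sets form a sigma-algebra. For a countable union half of the error is
  spent on cutting it off and half on approximating the finitely many remaining sets.\<close>

lemma cylinder_approx:
  assumes "A \<in> sets (perc p)" "\<epsilon> > 0"
  shows "\<exists>J B. finite J \<and> dep J (\<lambda>w. w \<in> B) \<and> measure (perc p) (sym_diff A B) < \<epsilon>"
proof -
  interpret P: prob_space "perc p" by (rule prob_space_perc)
  let ?G = "{{f \<in> \<Pi>\<^sub>E i\<in>UNIV. space (measure_pmf (bernoulli_pmf p)). f i \<in> A} |(i::edge) A. i \<in> UNIV \<and> A \<in> sets (measure_pmf (bernoulli_pmf p))}"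
  have "A \<in> sigma_sets (\<Pi>\<^sub>E i\<in>(UNIV::edge set). space (measure_pmf (bernoulli_pmf p))) ?G"
    using assms(1) unfolding perc_def sets_PiM_single .
  then have "A \<in> sets (perc p) \<and> (\<forall>\<epsilon>>0. \<exists>J B. finite J \<and> dep J (\<lambda>w. w \<in> B) \<and> measure (perc p) (sym_diff A B) < \<epsilon>)"
  proof (induction rule: sigma_sets.induct)
    case (Basic a)
    then obtain i A' where a: "a = {f. f i \<in> A'}" by (auto simp: PiE_def)
    have "dep {i} (\<lambda>w. w \<in> a)" by (simp add: dep_def a)
    then have "a \<in> sets (perc p)" by (rule finite_dep_set[rotated]) simp
    moreover have "measure (perc p) (sym_diff a a) = 0" by simp
    ultimately show ?case using \<open>dep {i} (\<lambda>w. w \<in> a)\<close> by (metis finite.emptyI finite_insert)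
  next
    case Empty
    have "dep {} (\<lambda>w. w \<in> {})" by (simp add: dep_def)
    then show ?case by (auto intro!: exI[of _ "{}"])
  next
    case (Compl a)
    have s: "(\<Pi>\<^sub>E i\<in>(UNIV::edge set). space (measure_pmf (bernoulli_pmf p))) - a = - a" by (auto simp: PiE_def)
    have "- a \<in> sets (perc p)" using Compl sets.compl_sets[of a "perc p"] by (simp add: Compl_eq_Diff_UNIV)
    moreover have "\<exists>J B. finite J \<and> dep J (\<lambda>w. w \<in> B) \<and> measure (perc p) (sym_diff (- a) B) < \<epsilon>" if e0: "\<epsilon> > 0" for \<epsilon>
    proof -
      obtain J B where JB: "finite J" "dep J (\<lambda>w. w \<in> B)" "measure (perc p) (sym_diff a B) < \<epsilon>"
        using Compl.IH[THEN conjunct2, rule_format, OF e0] by (elim exE conjE)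
      have "sym_diff (- a) (- B) = sym_diff a B" by auto
      moreover have "dep J (\<lambda>w. w \<in> - B)" using dep_comp[OF JB(2), of Not] by simp
      ultimately show ?thesis using JB by metis
    qed
    ultimately show ?case unfolding s by blast
  next
    case (Union a)
    have a: "a i \<in> sets (perc p)" for i using Union by blast
    have "\<exists>J B. finite J \<and> dep J (\<lambda>w. w \<in> B) \<and> measure (perc p) (sym_diff (\<Union>i. a i) B) < \<epsilon>" if e: "\<epsilon> > 0" for \<epsilon>
    proof -
      have "(\<lambda>N. measure (perc p) (\<Union>i<N. a i)) \<longlonglongrightarrow> measure (perc p) (\<Union>N. \<Union>i<N. a i)"
        by (rule P.finite_Lim_measure_incseq) (use a in \<open>auto simp: incseq_def, fastforce\<close>)
      moreover have "(\<Union>N. \<Union>i<N. a i) = (\<Union>i. a i)" by blast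
      ultimately have "eventually (\<lambda>N. measure (perc p) (\<Union>i<N. a i) > measure (perc p) (\<Union>i. a i) - \<epsilon> / 2) sequentially"
        using e by (intro order_tendstoD) auto
      then obtain N where N: "measure (perc p) (\<Union>i<N. a i) > measure (perc p) (\<Union>i. a i) - \<epsilon> / 2" by (auto simp: eventually_sequentially)
      define \<delta> where "\<delta> = \<epsilon> / (2 * (real N + 1))"
      have "\<delta> > 0" using e by (simp add: \<delta>_def)
      then have "\<forall>i. \<exists>J B. finite J \<and> dep J (\<lambda>w. w \<in> B) \<and> measure (perc p) (sym_diff (a i) B) < \<delta>" using Union by blast
      then obtain J B where JB: "\<And>i. finite (J i)" "\<And>i. dep (J i) (\<lambda>w. w \<in> B i)" "\<And>i. measure (perc p) (sym_diff (a i) (B i)) < \<delta>" by metis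
      have Bs: "B i \<in> sets (perc p)" for i by (rule finite_dep_set[OF JB(1,2)])
      let ?B = "\<Union>i<N. B i" and ?J = "\<Union>i<N. J i"
      have "dep ?J (\<lambda>w. w \<in> ?B)"
        unfolding dep_def
      proof (intro allI impI)
        fix w w' :: config assume ag: "\<forall>e\<in>?J. w e = w' e"
        have "w \<in> B i \<longleftrightarrow> w' \<in> B i" if "i < N" for i by (rule depD[OF JB(2)]) (use ag that in auto)
        then show "(w \<in> ?B) = (w' \<in> ?B)" by auto
      qed
      moreover have "measure (perc p) (sym_diff (\<Union>i. a i) ?B) < \<epsilon>"
      proof -
        have "measure (perc p) (sym_diff (\<Union>i. a i) ?B) \<le> measure (perc p) (((\<Union>i. a i) - (\<Union>i<N. a i)) \<union> (\<Union>i<N. sym_diff (a i) (B i)))"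
          by (rule P.finite_measure_mono) (use a Bs in \<open>auto\<close>)
        also have "\<dots> \<le> measure (perc p) ((\<Union>i. a i) - (\<Union>i<N. a i)) + measure (perc p) (\<Union>i<N. sym_diff (a i) (B i))"
          by (rule measure_Un_le) (use a Bs in auto)
        also have "measure (perc p) (\<Union>i<N. sym_diff (a i) (B i)) \<le> (\<Sum>i<N. measure (perc p) (sym_diff (a i) (B i)))"
          by (rule measure_UNION_le) (use a Bs in auto)
        also have "\<dots> \<le> (\<Sum>i<N. \<delta>)" using JB(3) by (intro sum_mono) (simp add: less_imp_le)
        also have "\<dots> \<le> \<epsilon> / 2" using e by (simp add: \<delta>_def field_simps)
        also have "measure (perc p) ((\<Union>i. a i) - (\<Union>i<N. a i)) = measure (perc p) (\<Union>i. a i) - measure (perc p) (\<Union>i<N. a i)"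
          by (rule P.finite_measure_Diff) (use a in auto)
        finally show ?thesis using N by linarith
      qed
      ultimately show ?thesis using JB(1) by (intro exI[of _ ?J] exI[of _ ?B]) auto
    qed
    then show ?case using a by auto
  qed
  then show ?thesis using assms(2) by blast
qed

text \<open>For cylinder sets independence is exact as soon as the shift has carried one edge set
  past the other; general sets are approximated.\<close>

lemma mixing:
  assumes p: "0 \<le> p" "p \<le> 1" and A: "A \<in> sets (perc p)" and B: "B \<in> sets (perc p)"
  shows "(\<lambda>n. measure (perc p) (A \<inter> sft n -` B)) \<longlonglongrightarrow> measure (perc p) A * measure (perc p) B"
proof (rule LIMSEQ_I)
  interpret P: prob_space "perc p" by (rule prob_space_perc)
  fix r :: real assume r: "0 < r"
  obtain J A' where A': "finite J" "dep J (\<lambda>w. w \<in> A')" "measure (perc p) (sym_diff A A') < r / 4"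
    using cylinder_approx[OF A, of "r / 4"] r by auto
  obtain I B' where B': "finite I" "dep I (\<lambda>w. w \<in> B')" "measure (perc p) (sym_diff B B') < r / 4"
    using cylinder_approx[OF B, of "r / 4"] r by auto
  have sA: "A' \<in> sets (perc p)" and sB: "B' \<in> sets (perc p)" using finite_dep_set A' B' by auto
  obtain N where N: "\<And>a b d. ((a, b), d) \<in> J \<union> I \<Longrightarrow> \<bar>a\<bar> < N \<and> \<bar>b\<bar> < N"
  proof (rule finite_edge_bound[of "J \<union> I"])
    show "finite (J \<union> I)" using A'(1) B'(1) by simp
  qed (rule that)
  have dif: "\<bar>measure (perc p) C - measure (perc p) C'\<bar> \<le> measure (perc p) (sym_diff C C')"
    if "C \<in> sets (perc p)" "C' \<in> sets (perc p)" for C C'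
  proof -
    have "measure (perc p) C \<le> measure (perc p) (C' \<union> sym_diff C C')" by (rule P.finite_measure_mono) (use that in auto)
    also have "\<dots> \<le> measure (perc p) C' + measure (perc p) (sym_diff C C')" by (rule measure_Un_le) (use that in auto)
    finally have 1: "measure (perc p) C \<le> measure (perc p) C' + measure (perc p) (sym_diff C C')" .
    have "measure (perc p) C' \<le> measure (perc p) (C \<union> sym_diff C C')" by (rule P.finite_measure_mono) (use that in auto)
    also have "\<dots> \<le> measure (perc p) C + measure (perc p) (sym_diff C C')" by (rule measure_Un_le) (use that in auto)
    finally show ?thesis using 1 by linarith
  qed
  have "norm (measure (perc p) (A \<inter> sft n -` B) - measure (perc p) A * measure (perc p) B) < r" if n: "n \<ge> nat (2 * N)" for n
  proof -
    have "dep (- J) (\<lambda>w. sft n w \<in> B')"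
      unfolding dep_def
    proof (intro allI impI depD[OF B'(2)])
      fix w w' e assume ag: "\<forall>e\<in>- J. w e = (w' :: config) e" and e: "e \<in> I"
      obtain a b d where abd: "e = ((a, b), d)" by (metis prod.collapse)
      have "\<bar>a\<bar> < N" using N[of a b d] e unfolding abd by blast
      moreover have "\<not> \<bar>a + int n\<bar> < N" using \<open>\<bar>a\<bar> < N\<close> n by linarith
      moreover have "sh (int n, 0) e = ((a + int n, b), d)" by (simp add: abd sh_def)
      ultimately have "sh (int n, 0) e \<notin> J" using N[of "a + int n" b d] by auto
      then show "sft n w e = sft n w' e" using ag by (simp add: sft_def)
    qed
    then have "EE p (\<lambda>w. of_bool (w \<in> A') * of_bool (sft n w \<in> B')) = Pr p (\<lambda>w. w \<in> A') * Pr p (\<lambda>w. sft n w \<in> B')"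
      using sB sets_sft[OF sB, of n] p
      by (intro indep_finite[OF A'(1) dep_of_bool[OF A'(2)] dep_of_bool, where B = 1] pred_of_bool) (auto simp: pred_def vimage_def)
    then have "Pr p (\<lambda>w. w \<in> A' \<inter> sft n -` B') = Pr p (\<lambda>w. w \<in> A') * Pr p (\<lambda>w. w \<in> sft n -` B')"
      by (simp add: of_bool_conj)
    then have ind: "measure (perc p) (A' \<inter> sft n -` B') = measure (perc p) A' * measure (perc p) B'"
      using sA sB sets_sft[OF sB, of n] measure_sft[OF sB, of n] by (subst (asm) (1 2 3) Pr_measure) (auto simp: pred_def vimage_def Int_def)
    have "measure (perc p) (sym_diff (A \<inter> sft n -` B) (A' \<inter> sft n -` B')) \<le> measure (perc p) (sym_diff A A' \<union> sft n -` (sym_diff B B'))"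
      by (rule P.finite_measure_mono) (use A B sA sB sets_sft in auto)
    also have "\<dots> \<le> measure (perc p) (sym_diff A A') + measure (perc p) (sft n -` (sym_diff B B'))"
      by (rule measure_Un_le) (use A B sA sB sets_sft in auto)
    also have "measure (perc p) (sft n -` (sym_diff B B')) = measure (perc p) (sym_diff B B')"
      by (rule measure_sft) (use B sB in auto)
    finally have 1: "\<bar>measure (perc p) (A \<inter> sft n -` B) - measure (perc p) A' * measure (perc p) B'\<bar> < r / 2"
      using dif[of "A \<inter> sft n -` B" "A' \<inter> sft n -` B'"] ind A'(3) B'(3) A B sA sB sets_sft[OF B, of n] sets_sft[OF sB, of n] by (simp add: sets.Int)
    have "\<bar>measure (perc p) A * measure (perc p) B - measure (perc p) A' * measure (perc p) B'\<bar>
       = \<bar>(measure (perc p) A - measure (perc p) A') * measure (perc p) B + measure (perc p) A' * (measure (perc p) B - measure (perc p) B')\<bar>"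
      by (simp add: algebra_simps)
    also have "\<dots> \<le> \<bar>measure (perc p) A - measure (perc p) A'\<bar> * measure (perc p) B + measure (perc p) A' * \<bar>measure (perc p) B - measure (perc p) B'\<bar>"
      by (rule order_trans[OF abs_triangle_ineq]) (simp add: abs_mult)
    also have "\<dots> \<le> \<bar>measure (perc p) A - measure (perc p) A'\<bar> * 1 + 1 * \<bar>measure (perc p) B - measure (perc p) B'\<bar>"
      by (intro add_mono mult_mono) auto
    also have "\<dots> < r / 2" using dif[OF A sA] dif[OF B sB] A'(3) B'(3) unfolding mult_1 mult_1_right by linarith
    finally have 2: "\<bar>measure (perc p) A * measure (perc p) B - measure (perc p) A' * measure (perc p) B'\<bar> < r / 2" .
    have "\<bar>x - z\<bar> < r" if "\<bar>x - y\<bar> < r / 2" "\<bar>z - y\<bar> < r / 2" for x y z :: real using that by linarith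
    from this[OF 1 2] show ?thesis by (simp only: real_norm_def)
  qed
  then show "\<exists>no. \<forall>n\<ge>no. norm (measure (perc p) (A \<inter> sft n -` B) - measure (perc p) A * measure (perc p) B) < r" by blast
qed

text \<open>One inclusion is assumed because the limsup events below pass to the shifted
  configuration in one direction only. It suffices: \<open>A\<close> meets each of its preimages in
  a set of the measure of \<open>A\<close>, and mixing then gives \<open>m = m * m\<close>.\<close>

lemma zero_one:
  assumes p: "0 \<le> p" "p \<le> 1" and N: "N \<ge> 1" and A: "A \<in> sets (perc p)"
    and inv: "sft N -` A \<subseteq> A \<or> A \<subseteq> sft N -` A"
  shows "measure (perc p) A = 0 \<or> measure (perc p) A = 1"
proof -
  let ?m = "measure (perc p)"
  have "?m (A \<inter> sft (k * N) -` A) = ?m A" for k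
    using inv
  proof
    assume i: "sft N -` A \<subseteq> A"
    have "sft (k * N) -` A \<subseteq> A"
    proof (induction k)
      case (Suc k)
      have "sft (Suc k * N) -` A = sft (k * N) -` (sft N -` A)" by (simp add: vimage_def sft_add)
      also have "\<dots> \<subseteq> sft (k * N) -` A" using i by (rule vimage_mono)
      finally show ?case using Suc by (rule order_trans)
    qed simp
    then have "A \<inter> sft (k * N) -` A = sft (k * N) -` A" by (rule Int_absorb1)
    then show ?thesis by (simp add: measure_sft[OF A])
  next
    assume i: "A \<subseteq> sft N -` A"
    have "A \<subseteq> sft (k * N) -` A"
    proof (induction k)
      case (Suc k)
      have "sft (Suc k * N) -` A = sft (k * N) -` (sft N -` A)" by (simp add: vimage_def sft_add)
      moreover have "sft (k * N) -` A \<subseteq> sft (k * N) -` (sft N -` A)" using i by (rule vimage_mono)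
      ultimately show ?case using order_trans[OF Suc] by simp
    qed simp
    then have "A \<inter> sft (k * N) -` A = A" by (rule Int_absorb2)
    then show ?thesis by simp
  qed
  moreover have "(\<lambda>k. ?m (A \<inter> sft (k * N) -` A)) \<longlonglongrightarrow> ?m A * ?m A"
    by (rule LIMSEQ_subseq_LIMSEQ[OF mixing[OF p A A], of "\<lambda>k. k * N", unfolded o_def])
       (use N in \<open>auto simp: strict_mono_def\<close>)
  ultimately have "?m A = ?m A * ?m A" by (simp add: LIMSEQ_const_iff)
  then show ?thesis by auto
qed

text \<open>The configurations whose shifts avoid \<open>A\<close> from time \<open>m\<close> on
  form a set \<open>N\<close>; mixing forces the product of the measures of \<open>N\<close> and
  \<open>A\<close> to vanish.\<close>

lemma recurrence:
  assumes p: "0 \<le> p" "p \<le> 1" and A: "A \<in> sets (perc p)" and pos: "measure (perc p) A > 0"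
  shows "AE w in perc p. \<forall>m. \<exists>n\<ge>m. sft n w \<in> A"
proof -
  interpret P: prob_space "perc p" by (rule prob_space_perc)
  have "AE w in perc p. \<exists>n\<ge>m. sft n w \<in> A" for m
  proof -
    define N where "N = (\<Inter>n\<in>{m..}. - (sft n -` A))"
    have Ns: "N \<in> sets (perc p)" unfolding N_def
    proof (rule sets.countable_INT')
      show "(\<lambda>n. - sft n -` A) ` {m..} \<subseteq> sets (perc p)"
        using sets.compl_sets[OF sets_sft[OF A]] by (auto simp: Compl_eq_Diff_UNIV)
    qed auto
    have "N \<inter> sft n -` A = {}" if "n \<ge> m" for n using that by (auto simp: N_def)
    then have "eventually (\<lambda>n. measure (perc p) (N \<inter> sft n -` A) = 0) sequentially"
      by (auto simp: eventually_sequentially intro!: exI[of _ m])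
    then have "(\<lambda>n. measure (perc p) (N \<inter> sft n -` A)) \<longlonglongrightarrow> 0" by (rule tendsto_eventually)
    then have "measure (perc p) N * measure (perc p) A = 0"
      using mixing[OF p Ns A] LIMSEQ_unique by blast
    then have "measure (perc p) N = 0" using pos by simp
    then have "N \<in> null_sets (perc p)" using Ns by (simp add: P.emeasure_eq_measure null_sets_def)
    then show ?thesis by (rule AE_I') (auto simp: N_def)
  qed
  then show ?thesis by (simp add: AE_all_countable)
qed

lemma pred_meas_1:
  assumes "A \<in> sets (perc p)" "measure (perc p) A = 1"
  shows "AE w in perc p. w \<in> A"
proof -
  interpret P: prob_space "perc p" by (rule prob_space_perc)
  show ?thesis using assms by (simp add: P.prob_eq_1)
qed

lemma pred_meas_0:
  assumes "A \<in> sets (perc p)" "measure (perc p) A = 0"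
  shows "AE w in perc p. w \<notin> A"
proof -
  interpret P: prob_space "perc p" by (rule prob_space_perc)
  show ?thesis using assms by (simp add: P.prob_eq_0)
qed

subsection \<open>Subadditive ergodic theorem\<close>

text \<open>If the averages returned above \<open>a\<close> infinitely often almost surely, most of
  a long interval could be covered by disjoint blocks of bounded length with average at least
  \<open>a\<close>, and integrating would give \<open>EE p f >= a\<close>.\<close>

lemma birkhoff_aux:
  assumes p: "0 \<le> p" "p \<le> 1" and N: "N \<ge> 1" and int: "integrable (perc p) f" and nn: "\<And>w. f w \<ge> 0" and a: "EE p f < a"
  shows "AE w in perc p. \<forall>m::nat. eventually (\<lambda>k. (\<Sum>i<k. f (sft (i * N) w)) \<le> (a + 1 / Suc m) * real k) sequentially"
proof -
  interpret P: prob_space "perc p" by (rule prob_space_perc)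
  have [measurable]: "f \<in> borel_measurable (perc p)" using int by simp
  define A where "A k w = (\<Sum>i<k. f (sft (i * N) w))" for k w
  have [measurable]: "A k \<in> borel_measurable (perc p)" for k unfolding A_def by measurable
  have A0: "A k w \<ge> 0" for k w unfolding A_def by (intro sum_nonneg nn)
  have Aadd: "A (m + n) w = A m w + A n (sft (m * N) w)" for m n w
    by (induction n) (simp_all add: A_def sft_add algebra_simps)
  have EA: "EE p (A L) = L * EE p f" for L
  proof -
    have "EE p (A L) = (\<Sum>i<L. EE p (\<lambda>w. f (sft (i * N) w)))"
      unfolding A_def using int by (intro EE_sum integrable_sft) auto
    then show ?thesis by (simp add: EE_sft)
  qed
  have iA: "integrable (perc p) (A L)" for L unfolding A_def by (intro Bochner_Integration.integrable_sum integrable_sft int)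
  \<comment> \<open>Deleting the first summand lowers the averages slightly. The slack
    \<open>1 / Suc m\<close> may shrink under the shift, which absorbs this loss and makes the event
    invariant up to inclusion.\<close>
  define Bad where "Bad = {w. \<exists>m::nat. \<forall>K::nat. \<exists>k\<ge>K. A k w \<ge> (a + 1 / Suc m) * real k}"
  have Bs: "Bad \<in> sets (perc p)"
  proof -
    have "Measurable.pred (perc p) (\<lambda>w. \<exists>m::nat. \<forall>K::nat. \<exists>k\<ge>K. A k w \<ge> (a + 1 / Suc m) * real k)" by measurable
    then show ?thesis by (simp add: Bad_def pred_def)
  qed
  have "Bad \<subseteq> sft N -` Bad"
  proof
    fix w assume "w \<in> Bad"
    then obtain m where m: "\<And>K. \<exists>k\<ge>K. A k w \<ge> (a + 1 / Suc m) * real k" by (auto simp: Bad_def)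
    define d where "d = 1 / real (Suc m) - 1 / real (Suc (Suc m))"
    have "1 / real (Suc (Suc m)) < 1 / real (Suc m)" by (rule divide_strict_left_mono) auto
    then have d: "d > 0" by (simp add: d_def)
    have "\<exists>k\<ge>K. A k (sft N w) \<ge> (a + 1 / Suc (Suc m)) * real k" for K
    proof -
      obtain K0 :: nat where K0: "real K0 \<ge> (f w + \<bar>a\<bar>) / d" using real_arch_simple by blast
      obtain k where k: "k \<ge> Suc (max K K0)" "A k w \<ge> (a + 1 / Suc m) * real k" using m by blast
      then obtain k' where k': "k = Suc k'" by (cases k) auto
      have "A k w = f w + A k' (sft N w)" using Aadd[of 1 k' w] by (simp add: k' A_def)
      then have "A k' (sft N w) \<ge> (a + 1 / Suc m) * real k - f w" using k(2) by simp
      moreover have "d * real k' \<ge> f w + \<bar>a\<bar>"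
      proof -
        have "real k' \<ge> real K0" using k(1) k' by simp
        then have "real k' \<ge> (f w + \<bar>a\<bar>) / d" using K0 by linarith
        then show ?thesis using d by (simp add: pos_divide_le_eq mult.commute)
      qed
      moreover have "(a + 1 / Suc m) * real k = (a + 1 / Suc (Suc m)) * real k' + d * real k' + a + 1 / Suc m"
        by (simp add: k' d_def algebra_simps add_divide_distrib)
      moreover have "1 / real (Suc m) > 0" by simp
      ultimately have "A k' (sft N w) \<ge> (a + 1 / Suc (Suc m)) * real k'" by linarith
      then show ?thesis using k(1) k' by (intro exI[of _ k']) simp
    qed
    then show "w \<in> sft N -` Bad" unfolding Bad_def by blast
  qed
  then consider "measure (perc p) Bad = 0" | "measure (perc p) Bad = 1" using zero_one[OF p N Bs] by blast
  then show ?thesis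
  proof cases
    case 1
    have "AE w in perc p. w \<notin> Bad" by (rule pred_meas_0[OF Bs 1])
    then show ?thesis
    proof eventually_elim
      case (elim w)
      show ?case
      proof
        fix m :: nat
        obtain K where "\<And>k. k \<ge> K \<Longrightarrow> \<not> A k w \<ge> (a + 1 / Suc m) * real k" using elim unfolding Bad_def by blast
        then show "eventually (\<lambda>k. (\<Sum>i<k. f (sft (i * N) w)) \<le> (a + 1 / Suc m) * real k) sequentially"
          unfolding eventually_sequentially A_def by (intro exI[of _ K]) (auto simp: not_le intro: less_imp_le)
      qed
    qed
  next
    case 2
    then have AE: "AE w in perc p. w \<in> Bad" by (rule pred_meas_1[OF Bs])
    define Q where "Q M w \<longleftrightarrow> (\<exists>k\<in>{1..M}. A k w \<ge> a * real k)" for M w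
    have Qm [measurable]: "Measurable.pred (perc p) (Q M)" for M unfolding Q_def by measurable
    \<comment> \<open>Greedy covering: at a point of \<open>Q M\<close> jump over a block of length
      at most \<open>M\<close> with average at least \<open>a\<close>, elsewhere advance by one step
      at no gain. The last \<open>M\<close> points are given up.\<close>
    have cover: "A L w \<ge> a * ((\<Sum>i<L. of_bool (Q M (sft (i * N) w))) - real M)" if a0: "a \<ge> 0" for L M w
    proof (induction L arbitrary: w rule: less_induct)
      case (less L)
      define c where "c L v = (\<Sum>i<L. of_bool (Q M (sft (i * N) v)) :: real)" for L v
      have cadd: "c (m + n) v = c m v + c n (sft (m * N) v)" for m n v
        by (induction n) (simp_all add: c_def sft_add algebra_simps)
      have cle: "c L v \<le> real L" for L v
        unfolding c_def using sum_mono[of "{..<L}" "\<lambda>i. of_bool (Q M (sft (i * N) v))" "\<lambda>_. 1 :: real"] by simp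
      have "A L w \<ge> a * (c L w - real M)"
      proof (cases "L \<le> M")
        case True
        moreover have "c L w \<le> real L" by (rule cle)
        ultimately have "c L w - real M \<le> 0" by linarith
        then have "a * (c L w - real M) \<le> 0" using a0 by (rule mult_nonneg_nonpos[rotated])
        then show ?thesis using A0[of L w] by linarith
      next
        case False
        show ?thesis
        proof (cases "Q M w")
          case True
          then obtain k where k: "1 \<le> k" "k \<le> M" "A k w \<ge> a * real k" by (auto simp: Q_def)
          define L' where "L' = L - k"
          have L: "L = k + L'" using k False by (simp add: L'_def)
          have "A L' (sft (k * N) w) \<ge> a * (c L' (sft (k * N) w) - real M)" unfolding c_def by (rule less.IH) (use k L in auto)
          moreover have "a * real k \<ge> a * c k w" using cle a0 by (rule mult_left_mono)
          ultimately show ?thesis using k(3) Aadd[of k L' w] cadd[of k L' w] unfolding L by (simp add: algebra_simps)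
        next
          case nQ: False
          obtain L' where L: "L = 1 + L'" using False by (cases L) auto
          have "A L' (sft (1 * N) w) \<ge> a * (c L' (sft (1 * N) w) - real M)" unfolding c_def by (rule less.IH) (use L in auto)
          moreover have "c 1 w = 0" using nQ by (simp add: c_def)
          ultimately show ?thesis using A0[of 1 w] Aadd[of 1 L' w] cadd[of 1 L' w] unfolding L by simp
        qed
      qed
      then show ?case by (simp add: c_def)
    qed
    have a0: "a \<ge> 0" 
    proof -
      have "0 \<le> EE p f" unfolding EE_def by (intro Bochner_Integration.integral_nonneg nn)
      then show ?thesis using a by linarith
    qed
    have lim: "(\<lambda>M. Pr p (Q M)) \<longlonglongrightarrow> Pr p (\<lambda>w. \<exists>M. Q M w)"
    proof (rule Pr_inc_lim[OF Qm])
      fix M w assume "Q M w"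
      then show "Q (Suc M) w" unfolding Q_def by (auto intro: le_SucI)
    qed
    have one: "Pr p (\<lambda>w. \<exists>M. Q M w) = 1"
    proof -
      have "AE w in perc p. \<exists>M. Q M w"
        using AE
      proof eventually_elim
        case (elim w)
        then obtain m k where k: "k \<ge> 1" "A k w \<ge> (a + 1 / Suc m) * real k" unfolding Bad_def by blast
        then have "A k w \<ge> a * real k" by (auto simp: algebra_simps intro: order_trans[rotated])
        then show ?case using k unfolding Q_def by (intro exI[of _ k]) auto
      qed
      moreover have mE: "Measurable.pred (perc p) (\<lambda>w. \<exists>M. Q M w)" by measurable
      ultimately have "measure (perc p) {w. \<exists>M. Q M w} = 1" by (subst P.prob_eq_1) (auto simp: pred_def)
      moreover note mE
      ultimately show ?thesis by (simp add: Pr_measure)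
    qed
    have "a * Pr p (Q M) \<le> EE p f" for M
    proof -
      have "a * (real L * Pr p (Q M) - real M) \<le> real L * EE p f" for L
      proof -
        have iQ: "integrable (perc p) (\<lambda>w. of_bool (Q M (sft (i * N) w)) :: real)" for i by (rule integrable_sft[OF integrable_of_bool[OF Qm]])
        define g where "g w = (\<Sum>i<L. of_bool (Q M (sft (i * N) w)) :: real)" for w
        have ig: "integrable (perc p) g" unfolding g_def by (intro Bochner_Integration.integrable_sum iQ)
        have "EE p (\<lambda>w. a * (g w - real M)) \<le> EE p (A L)"
        proof (rule EE_mono[OF _ iA])
          show "a * (g w - real M) \<le> A L w" for w unfolding g_def by (rule cover[OF a0])
        qed (use ig in auto)
        moreover have "EE p (\<lambda>w. a * (g w - real M)) = a * (EE p g - real M)"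
          unfolding EE_def using ig P.prob_space by simp
        moreover have "EE p g = real L * Pr p (Q M)"
          unfolding g_def using EE_sft[OF pred_of_bool[OF Qm]] by (subst EE_sum[OF _ iQ]) simp_all
        ultimately show ?thesis by (simp add: EA)
      qed
      then have *: "real L * (a * Pr p (Q M) - EE p f) \<le> a * real M" for L by (simp add: algebra_simps)
      show ?thesis
      proof (rule ccontr)
        assume "\<not> ?thesis"
        then have "a * Pr p (Q M) - EE p f > 0" by simp
        then obtain L :: nat where "a * real M < real L * (a * Pr p (Q M) - EE p f)" using reals_Archimedean3 by blast
        then show False using *[of L] by simp
      qed
    qed
    then have "a * 1 \<le> EE p f"
      using lim unfolding one by (intro LIMSEQ_le_const2[OF tendsto_mult_left]) auto
    then show ?thesis using a by simp
  qed
qed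

lemma birkhoff_upper:
  assumes p: "0 \<le> p" "p \<le> 1" and N: "N \<ge> 1" and int: "integrable (perc p) f" and nn: "\<And>w. f w \<ge> 0" and a: "EE p f < a"
  shows "AE w in perc p. eventually (\<lambda>k. (\<Sum>i<k. f (sft (i * N) w)) \<le> a * real k) sequentially"
proof -
  define b where "b = (EE p f + a) / 2"
  have b: "EE p f < b" "b < a" using a by (auto simp: b_def)
  obtain m :: nat where m: "1 / real (Suc m) < a - b" using b nat_approx_posE[of "a - b"] by auto
  have "AE w in perc p. \<forall>m::nat. eventually (\<lambda>k. (\<Sum>i<k. f (sft (i * N) w)) \<le> (b + 1 / Suc m) * real k) sequentially"
    by (rule birkhoff_aux[OF p N int nn b(1)])
  then show ?thesis
  proof eventually_elim
    case (elim w)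
    from elim[rule_format, of m] show ?case
    proof eventually_elim
      case (elim k)
      have "(b + 1 / real (Suc m)) * real k \<le> a * real k" using m by (intro mult_right_mono) auto
      then show ?case using elim by linarith
    qed
  qed
qed

section \<open>Kingman's theorem for nonnegative subadditive processes\<close>

locale subadditive =
  fixes p :: real and X :: "nat \<Rightarrow> config \<Rightarrow> real"
  assumes p: "0 \<le> p" "p \<le> 1"
    and Xm [measurable]: "\<And>n. X n \<in> borel_measurable (perc p)"
    and X0: "\<And>n w. X n w \<ge> 0"
    and Xz: "\<And>w. X 0 w = 0"
    and Xadd: "\<And>m n w. X (m + n) w \<le> X m w + X n (sft m w)"
    and X1: "integrable (perc p) (X 1)"
begin

lemma X_le_sum: "X n w \<le> (\<Sum>i<n. X 1 (sft i w))"
proof (induction n)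
  case (Suc n)
  then show ?case using Xadd[of n 1 w] by simp
qed (simp add: Xz)

lemma integrable_X: "integrable (perc p) (X n)"
proof (rule Bochner_Integration.integrable_bound)
  show "integrable (perc p) (\<lambda>w. \<Sum>i<n. X 1 (sft i w))"
    by (intro Bochner_Integration.integrable_sum integrable_sft X1)
  show "AE w in perc p. norm (X n w) \<le> norm (\<Sum>i<n. X 1 (sft i w))"
    using X_le_sum X0 by (intro AE_I2) (auto intro: order_trans[OF _ abs_ge_self])
qed measurable

lemma EE_X0: "EE p (X n) \<ge> 0"
  unfolding EE_def by (intro Bochner_Integration.integral_nonneg X0)

definition gam :: real where
  "gam = (INF n. EE p (X (Suc n)) / real (Suc n))"

lemma gam_bdd: "bdd_below (range (\<lambda>n. EE p (X (Suc n)) / real (Suc n)))"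
  using EE_X0 by (intro bdd_belowI2[where m = 0]) simp

lemma gam_le: "n \<ge> 1 \<Longrightarrow> gam * real n \<le> EE p (X n)"
proof -
  assume n: "n \<ge> 1"
  then obtain m where m: "n = Suc m" by (cases n) auto
  have "gam \<le> EE p (X (Suc m)) / real (Suc m)" unfolding gam_def by (rule cINF_lower[OF gam_bdd]) simp
  then show ?thesis unfolding m by (simp add: pos_le_divide_eq)
qed

text \<open>Borel-Cantelli: by stationarity the relevant probabilities are tails of
  \<open>X 1\<close> along an arithmetic progression, and their sum is at most the mean of
  \<open>X 1 / \<kappa>\<close>.\<close>

lemma single_small:
  assumes k: "\<kappa> > 0"
  shows "AE w in perc p. eventually (\<lambda>n. X 1 (sft n w) \<le> \<kappa> * (real n + 1)) sequentially"
proof -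
  interpret P: prob_space "perc p" by (rule prob_space_perc)
  define Q where "Q n w \<longleftrightarrow> X 1 w > \<kappa> * (real n + 1)" for n w
  have Qm [measurable]: "Measurable.pred (perc p) (Q n)" for n unfolding Q_def by measurable
  define A where "A n = {w. Q n (sft n w)}" for n
  have As: "A n \<in> sets (perc p)" for n
  proof -
    have "Measurable.pred (perc p) (\<lambda>w. Q n (sft n w))" by measurable
    then show ?thesis by (simp add: A_def pred_def)
  qed
  have mA: "measure (perc p) (A n) = Pr p (Q n)" for n
  proof -
    have "measure (perc p) (A n) = Pr p (\<lambda>w. Q n (sft n w))"
      unfolding A_def by (rule Pr_measure[symmetric]) measurable
    also have "\<dots> = Pr p (Q n)" using EE_sft[OF pred_of_bool[OF Qm]] .
    finally show ?thesis .
  qed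
  have cnt: "(\<Sum>n<m. of_bool (Q n w)) \<le> X 1 w / \<kappa>" for m w
  proof -
    have "(\<Sum>n<m. of_bool (Q n w)) = real (card {n. n < m \<and> Q n w})"
      by (simp add: Int_def)
    also have "\<dots> \<le> real (card {..<nat \<lfloor>X 1 w / \<kappa>\<rfloor>})"
    proof (intro of_nat_mono card_mono)
      show "{n. n < m \<and> Q n w} \<subseteq> {..<nat \<lfloor>X 1 w / \<kappa>\<rfloor>}"
      proof
        fix n assume "n \<in> {n. n < m \<and> Q n w}"
        then have "real n + 1 < X 1 w / \<kappa>" using k by (simp add: Q_def field_simps)
        then show "n \<in> {..<nat \<lfloor>X 1 w / \<kappa>\<rfloor>}" by simp linarith
      qed
    qed simp
    also have "\<dots> \<le> X 1 w / \<kappa>" using X0[of 1 w] k by simp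
    finally show ?thesis .
  qed
  have sm: "summable (\<lambda>n. measure (perc p) (A n))"
  proof (rule summableI_nonneg_bounded[where x = "EE p (\<lambda>w. X 1 w / \<kappa>)"])
    fix m
    have "(\<Sum>n<m. measure (perc p) (A n)) = EE p (\<lambda>w. \<Sum>n<m. of_bool (Q n w))"
      unfolding mA by (rule EE_sum[symmetric]) (auto intro: integrable_of_bool Qm)
    also have "\<dots> \<le> EE p (\<lambda>w. X 1 w / \<kappa>)"
    proof (rule EE_mono)
      show "integrable (perc p) (\<lambda>w. \<Sum>n<m. of_bool (Q n w) :: real)"
        by (intro Bochner_Integration.integrable_sum integrable_of_bool Qm)
    qed (use X1 cnt in auto)
    finally show "(\<Sum>n<m. measure (perc p) (A n)) \<le> EE p (\<lambda>w. X 1 w / \<kappa>)" .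
  qed simp
  have "AE w in perc p. eventually (\<lambda>n. w \<in> space (perc p) - A n) sequentially"
    by (rule borel_cantelli_AE1[OF As _ sm]) (simp add: P.emeasure_eq_measure)
  then show ?thesis
    by eventually_elim (auto elim!: eventually_mono simp: A_def Q_def not_less)
qed

text \<open>Choose \<open>N\<close> with mean of \<open>X N\<close> below \<open>b * N\<close>, cut
  the interval into blocks of length \<open>N\<close> and apply Birkhoff's bound to the blocks. The
  incomplete last block is controlled by \<open>single_small\<close>.\<close>

lemma upper:
  assumes a: "gam < a"
  shows "AE w in perc p. eventually (\<lambda>n. X n w \<le> a * real n) sequentially"
proof -
  define b where "b = (gam + a) / 2"
  have b: "gam < b" "b < a" using a by (auto simp: b_def)
  obtain N0 where N0: "EE p (X (Suc N0)) / real (Suc N0) < b"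
    using b(1) unfolding gam_def by (subst (asm) cINF_less_iff[OF _ gam_bdd]) auto
  define N where "N = Suc N0"
  have N: "N \<ge> 1" "EE p (X N) < b * real N" using N0 by (auto simp: N_def field_simps)
  have b0: "b \<ge> 0" using EE_X0[of N] N by (smt (verit) mult_nonpos_nonneg of_nat_0_le_iff)
  \<comment> \<open>Fewer than \<open>N\<close> leftover steps at \<open>\<kappa> * n\<close> each
    cost at most \<open>(a - b) / 2 * n\<close>.\<close>
  define \<kappa> where "\<kappa> = (a - b) / (2 * real N)"
  have k: "\<kappa> > 0" using b N by (simp add: \<kappa>_def)
  have "AE w in perc p. eventually (\<lambda>k. (\<Sum>i<k. X N (sft (i * N) w)) \<le> (b * real N) * real k) sequentially"
    by (rule birkhoff_upper[OF p N(1) integrable_X X0 N(2)])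
  moreover have "AE w in perc p. eventually (\<lambda>n. X 1 (sft n w) \<le> \<kappa> * (real n + 1)) sequentially"
    by (rule single_small[OF k])
  ultimately show ?thesis
  proof eventually_elim
    case (elim w)
    obtain K1 where K1: "\<And>k. k \<ge> K1 \<Longrightarrow> (\<Sum>i<k. X N (sft (i * N) w)) \<le> (b * real N) * real k"
      using elim(1) by (auto simp: eventually_sequentially)
    obtain K2 where K2: "\<And>n. n \<ge> K2 \<Longrightarrow> X 1 (sft n w) \<le> \<kappa> * (real n + 1)"
      using elim(2) by (auto simp: eventually_sequentially)
    have blk: "X (k * N) w \<le> (\<Sum>i<k. X N (sft (i * N) w))" for k
    proof (induction k)
      case (Suc k)
      then show ?case using Xadd[of "k * N" N w] by (simp add: add.commute)
    qed (simp add: Xz)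
    have "X n w \<le> a * real n" if n: "n \<ge> (K1 + K2 + 1) * N" for n
    proof -
      define k where "k = n div N"
      define r where "r = n mod N"
      have nkr: "n = k * N + r" "r < N" using N by (auto simp: k_def r_def)
      have "(K1 + K2 + 1) * N div N \<le> k" unfolding k_def by (rule div_le_mono[OF n])
      then have kK: "k \<ge> K1 + K2 + 1" using N by simp
      have "k \<le> k * N" using N by simp
      then have kN: "k * N \<ge> K2" using kK by linarith
      have "X n w \<le> X (k * N) w + X r (sft (k * N) w)" unfolding nkr(1) by (rule Xadd)
      also have "X r (sft (k * N) w) \<le> (\<Sum>i<r. X 1 (sft i (sft (k * N) w)))" by (rule X_le_sum)
      also have "\<dots> \<le> (\<Sum>i<r. \<kappa> * real n)"
      proof (rule sum_mono)
        fix i assume "i \<in> {..<r}"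
        then have i: "i + k * N + 1 \<le> n" using nkr by simp
        have "X 1 (sft (i + k * N) w) \<le> \<kappa> * (real (i + k * N) + 1)" using kN by (intro K2) simp
        also have "real (i + k * N) + 1 \<le> real n" using of_nat_mono[OF i, where 'a = real] by simp
        finally show "X 1 (sft i (sft (k * N) w)) \<le> \<kappa> * real n" using k by (simp add: sft_add)
      qed
      also have "\<dots> = real r * (\<kappa> * real n)" by simp
      also have "\<dots> \<le> real N * (\<kappa> * real n)" using nkr(2) k by (intro mult_right_mono) auto
      also have "\<dots> = (a - b) / 2 * real n" using N by (simp add: \<kappa>_def)
      also have "X (k * N) w \<le> b * real N * real k" using blk[of k] K1[of k] kK by linarith
      also have "\<dots> \<le> b * real n"
      proof -
        have "real N * real k \<le> real n" using nkr(1) by (simp add: mult.commute flip: of_nat_mult)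
        then show ?thesis using b0 by (simp add: mult.assoc mult_left_mono)
      qed
      finally have "X n w \<le> b * real n + (a - b) / 2 * real n" by simp
      also have "\<dots> \<le> a * real n"
      proof -
        have "b + (a - b) / 2 \<le> a" using b by (simp add: field_simps)
        then show ?thesis by (metis distrib_right mult_right_mono of_nat_0_le_iff)
      qed
      finally show ?thesis .
    qed
    then show ?case by (auto simp: eventually_sequentially)
  qed
qed

text \<open>If \<open>X k <= b * k\<close> held for infinitely many \<open>k\<close> almost surely,
  cover an interval greedily by such blocks of length at most \<open>M\<close>. The uncovered points
  are paid with \<open>X 1\<close>, and their mean cost per step tends to 0 with growing
  \<open>M\<close>. This would give \<open>gam <= b\<close>.\<close>

lemma lower:
  assumes a: "a < gam"
  shows "AE w in perc p. eventually (\<lambda>n. X n w \<ge> a * real n) sequentially"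
proof (cases "a \<ge> 0")
  case False
  then have "a * real n \<le> X n w" for n w using X0[of n w] by (smt (verit) mult_nonpos_nonneg of_nat_0_le_iff)
  then show ?thesis by simp
next
  case a0: True
  interpret P: prob_space "perc p" by (rule prob_space_perc)
  define b where "b = (gam + a) / 2"
  have b: "a < b" "b < gam" using a by (auto simp: b_def)
  define Bad where "Bad = {w. \<exists>m::nat. \<forall>K::nat. \<exists>k\<ge>K. X k w \<le> (b - 1 / Suc m) * real k}"
  have Bs: "Bad \<in> sets (perc p)"
  proof -
    have "Measurable.pred (perc p) (\<lambda>w. \<exists>m::nat. \<forall>K::nat. \<exists>k\<ge>K. X k w \<le> (b - 1 / Suc m) * real k)" by measurable
    then show ?thesis by (simp add: Bad_def pred_def)
  qed
  have "sft 1 -` Bad \<subseteq> Bad"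
  proof
    fix w assume "w \<in> sft 1 -` Bad"
    then obtain m where m: "\<And>K. \<exists>k\<ge>K. X k (sft 1 w) \<le> (b - 1 / Suc m) * real k" by (auto simp: Bad_def)
    define d where "d = 1 / real (Suc m) - 1 / real (Suc (Suc m))"
    have "1 / real (Suc (Suc m)) < 1 / real (Suc m)" by (rule divide_strict_left_mono) auto
    then have d: "d > 0" by (simp add: d_def)
    have "\<exists>k\<ge>K. X k w \<le> (b - 1 / Suc (Suc m)) * real k" for K
    proof -
      obtain K0 :: nat where K0: "real K0 \<ge> (X 1 w + \<bar>b\<bar> + 1) / d" using real_arch_simple by blast
      obtain k where k: "k \<ge> max K K0" "X k (sft 1 w) \<le> (b - 1 / Suc m) * real k" using m by blast
      have "X (Suc k) w \<le> X 1 w + X k (sft 1 w)" using Xadd[of 1 k w] by simp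
      also have "\<dots> \<le> X 1 w + (b - 1 / Suc m) * real k" using k(2) by simp
      also have "\<dots> \<le> (b - 1 / Suc (Suc m)) * real (Suc k)"
      proof -
        have "real k \<ge> (X 1 w + \<bar>b\<bar> + 1) / d" using K0 k(1) by linarith
        then have 1: "d * real k \<ge> X 1 w + \<bar>b\<bar> + 1" using d by (simp add: pos_divide_le_eq mult.commute)
        have 2: "(b - 1 / Suc (Suc m)) * real (Suc k) = (b - 1 / Suc m) * real k + d * real k + b - 1 / Suc (Suc m)"
          by (simp add: d_def algebra_simps add_divide_distrib)
        have 3: "1 / real (Suc (Suc m)) \<le> 1" by simp
        have "- b \<le> \<bar>b\<bar>" by simp
        then show ?thesis using 1 2 3 by linarith
      qed
      finally show ?thesis using k(1) by (intro exI[of _ "Suc k"]) simp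
    qed
    then show "w \<in> Bad" unfolding Bad_def by blast
  qed
  then consider "measure (perc p) Bad = 0" | "measure (perc p) Bad = 1" using zero_one[OF p _ Bs, of 1] by blast
  then show ?thesis
  proof cases
    case 1
    obtain m :: nat where m: "1 / real (Suc m) < b - a" using b nat_approx_posE[of "b - a"] by auto
    have "AE w in perc p. w \<notin> Bad" by (rule pred_meas_0[OF Bs 1])
    then show ?thesis
    proof eventually_elim
      case (elim w)
      obtain K where K: "\<And>k. k \<ge> K \<Longrightarrow> \<not> X k w \<le> (b - 1 / Suc m) * real k" using elim unfolding Bad_def by blast
      have "a * real k \<le> X k w" if "k \<ge> K" for k
      proof -
        have "a * real k \<le> (b - 1 / real (Suc m)) * real k" using m by (intro mult_right_mono) auto
        then show ?thesis using K[OF that] by linarith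
      qed
      then show ?case by (auto simp: eventually_sequentially)
    qed
  next
    case 2
    then have AE: "AE w in perc p. w \<in> Bad" by (rule pred_meas_1[OF Bs])
    have b0: "b \<ge> 0" using a0 b by simp
    define Q where "Q M w \<longleftrightarrow> (\<exists>k\<in>{1..M}. X k w \<le> b * real k)" for M w
    have Qm [measurable]: "Measurable.pred (perc p) (Q M)" for M unfolding Q_def by measurable
    \<comment> \<open>Price of a point from which no favourable block of length at most
      \<open>M\<close> starts.\<close>
    define f where "f M w = of_bool (\<not> Q M w) * X 1 w" for M w
    have f: "f M w \<ge> 0" "f M w \<le> X 1 w" for M w using X0[of 1 w] by (auto simp: f_def)
    have fm [measurable]: "f M \<in> borel_measurable (perc p)" for M unfolding f_def by measurable
    have fi: "integrable (perc p) (f M)" for M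
      by (rule Bochner_Integration.integrable_bound[OF X1]) (use f X0 in \<open>auto intro!: AE_I2\<close>)
    have cover: "X L w \<le> b * real L + (\<Sum>i<L. f M (sft i w)) + (\<Sum>i\<in>{L - M..<L}. X 1 (sft i w))" for L M w
    proof (induction L arbitrary: w rule: less_induct)
      case (less L)
      show ?case
      proof (cases "L \<le> M")
        case True
        then have "X L w \<le> (\<Sum>i\<in>{L - M..<L}. X 1 (sft i w))" using X_le_sum[of L w] by (simp add: lessThan_atLeast0)
        moreover have "b * real L \<ge> 0" using b0 by simp
        moreover have "(\<Sum>i<L. f M (sft i w)) \<ge> 0" by (intro sum_nonneg f)
        ultimately show ?thesis by linarith
      next
        case False
        have key: ?thesis if k: "1 \<le> k" "k \<le> M \<or> k = 1" "X k w \<le> b * real k + (\<Sum>i<k. f M (sft i w))" "L = k + L'" for k L'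
        proof -
          have "X L' (sft k w) \<le> b * real L' + (\<Sum>i<L'. f M (sft i (sft k w))) + (\<Sum>i\<in>{L' - M..<L'}. X 1 (sft i (sft k w)))"
            by (rule less.IH) (use k in auto)
          moreover have "(\<Sum>i<L. f M (sft i w)) = (\<Sum>i<k. f M (sft i w)) + (\<Sum>i<L'. f M (sft i (sft k w)))"
            unfolding k(4) by (induction L') (simp_all add: sft_add algebra_simps)
          moreover have "(\<Sum>i\<in>{L' - M..<L'}. X 1 (sft i (sft k w))) \<le> (\<Sum>i\<in>{L - M..<L}. X 1 (sft i w))"
          proof -
            have "(\<Sum>i\<in>{L' - M..<L'}. X 1 (sft i (sft k w))) = (\<Sum>i\<in>{L' - M + k..<L' + k}. X 1 (sft i w))"
              by (simp add: sum.shift_bounds_nat_ivl sft_add)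
            also have "\<dots> \<le> (\<Sum>i\<in>{L - M..<L}. X 1 (sft i w))"
              by (rule sum_mono2) (use X0 k(4) in auto)
            finally show ?thesis .
          qed
          ultimately show ?thesis using Xadd[of k L' w] k(3) unfolding k(4) by (simp add: algebra_simps)
        qed
        show ?thesis
        proof (cases "Q M w")
          case True
          then obtain k where k: "1 \<le> k" "k \<le> M" "X k w \<le> b * real k" by (auto simp: Q_def)
          have "(\<Sum>i<k. f M (sft i w)) \<ge> 0" by (intro sum_nonneg f)
          then show ?thesis using key[of k "L - k"] k False by simp
        next
          case nQ: False
          have "f M (sft 0 w) = X 1 w" using nQ by (simp add: f_def)
          then show ?thesis using key[of 1 "L - 1"] b0 False by simp
        qed
      qed
    qed
    have gM: "gam \<le> b + EE p (f M)" for M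
    proof (rule ccontr)
      assume neg: "\<not> ?thesis"
      have "real L * (gam - b - EE p (f M)) \<le> real M * EE p (X 1)" if "L \<ge> 1" for L
      proof -
        have if': "integrable (perc p) (\<lambda>w. f M (sft i w))" and ix: "integrable (perc p) (\<lambda>w. X 1 (sft i w))" for i
          using integrable_sft fi X1 by auto
        have i1: "integrable (perc p) (\<lambda>w. \<Sum>i<L. f M (sft i w))" by (intro Bochner_Integration.integrable_sum if')
        have i2: "integrable (perc p) (\<lambda>w. \<Sum>i\<in>{L - M..<L}. X 1 (sft i w))" by (intro Bochner_Integration.integrable_sum ix)
        have "EE p (X L) \<le> EE p (\<lambda>w. b * real L + (\<Sum>i<L. f M (sft i w)) + (\<Sum>i\<in>{L - M..<L}. X 1 (sft i w)))"
          by (rule EE_mono[OF integrable_X _ cover]) (intro Bochner_Integration.integrable_add i1 i2, simp)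
        also have "\<dots> = b * real L + EE p (\<lambda>w. \<Sum>i<L. f M (sft i w)) + EE p (\<lambda>w. \<Sum>i\<in>{L - M..<L}. X 1 (sft i w))"
          unfolding EE_def using i1 i2 P.prob_space by (simp del: One_nat_def)
        also have "EE p (\<lambda>w. \<Sum>i<L. f M (sft i w)) = real L * EE p (f M)"
          by (subst EE_sum) (auto intro!: if' simp: EE_sft)
        also have "EE p (\<lambda>w. \<Sum>i\<in>{L - M..<L}. X 1 (sft i w)) = real (L - (L - M)) * EE p (X 1)"
          using EE_sft[OF Xm, of 1] by (subst EE_sum[OF _ ix]) simp_all
        also have "\<dots> \<le> real M * EE p (X 1)" using EE_X0 by (intro mult_right_mono) auto
        finally show ?thesis using gam_le[OF that] by (simp add: algebra_simps)
      qed
      moreover obtain L :: nat where "real M * EE p (X 1) < real L * (gam - b - EE p (f M))"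
        using neg reals_Archimedean3[of "gam - b - EE p (f M)"] by auto
      moreover have "L \<ge> 1" using calculation(2) EE_X0[of 1] by (cases L) (auto simp: mult_less_0_iff zero_le_mult_iff not_less[symmetric])
      ultimately show False by fastforce
    qed
    have "(\<lambda>M. EE p (f M)) \<longlonglongrightarrow> EE p (\<lambda>_. 0)"
      unfolding EE_def
    proof (rule integral_dominated_convergence[where w = "X 1"])
      show "AE w in perc p. (\<lambda>M. f M w) \<longlonglongrightarrow> 0"
        using AE
      proof eventually_elim
        case (elim w)
        then obtain m k where k: "k \<ge> 1" "X k w \<le> (b - 1 / Suc m) * real k" unfolding Bad_def by blast
        have "(b - 1 / Suc m) * real k \<le> b * real k" by (rule mult_right_mono) auto
        then have "X k w \<le> b * real k" using k by linarith
        then have "Q M w" if "M \<ge> k" for M using k(1) that unfolding Q_def by (intro bexI[of _ k]) auto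
        then have "eventually (\<lambda>M. f M w = 0) sequentially" by (auto simp: eventually_sequentially f_def)
        then show ?case by (rule tendsto_eventually)
      qed
    qed (use X1 f X0 in auto)
    then have "(\<lambda>M. b + EE p (f M)) \<longlonglongrightarrow> b + 0" by (intro tendsto_intros) simp
    then have "gam \<le> b + 0" by (rule LIMSEQ_le_const) (use gM in auto)
    then show ?thesis using b by simp
  qed
qed

theorem kingman: "AE w in perc p. (\<lambda>n. X n w / real n) \<longlonglongrightarrow> gam"
proof -
  have "AE w in perc p. \<forall>m::nat. eventually (\<lambda>n. X n w \<le> (gam + 1 / Suc m) * real n) sequentially
      \<and> eventually (\<lambda>n. X n w \<ge> (gam - 1 / Suc m) * real n) sequentially"
    using upper lower by (auto simp: AE_all_countable)
  then show ?thesis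
  proof eventually_elim
    case (elim w)
    show ?case
    proof (rule LIMSEQ_I)
      fix r :: real assume "r > 0"
      then obtain m :: nat where m: "1 / real (Suc m) < r" using nat_approx_posE by auto
      from elim have "eventually (\<lambda>n. X n w \<le> (gam + 1 / Suc m) * real n \<and> X n w \<ge> (gam - 1 / Suc m) * real n \<and> n \<ge> 1) sequentially"
        by (auto intro!: eventually_conj eventually_ge_at_top)
      then obtain n0 where n0: "\<And>n. n \<ge> n0 \<Longrightarrow> X n w \<le> (gam + 1 / Suc m) * real n \<and> X n w \<ge> (gam - 1 / Suc m) * real n \<and> n \<ge> 1"
        unfolding eventually_sequentially by blast
      have "norm (X n w / real n - gam) < r" if "n \<ge> n0" for n
      proof -
        have n: "real n > 0" using n0[OF that] by simp
        have "X n w / real n \<le> gam + 1 / Suc m" "X n w / real n \<ge> gam - 1 / Suc m"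
          using n0[OF that] n by (auto simp: pos_divide_le_eq pos_le_divide_eq)
        then show ?thesis using m by (simp add: abs_less_iff)
      qed
      then show "\<exists>no. \<forall>n\<ge>no. norm (X n w / real n - gam) < r" by blast
    qed
  qed
qed

end

subsection \<open>Correlation inequality for decreasing events\<close>

text \<open>Increasing limits of decreasing events of finitely many edges. Absence of an infinite
  cluster is of this form, and the finite FKG inequality and monotonicity in \<open>p\<close> pass
  to the limit.\<close>

definition gdec :: "(config \<Rightarrow> bool) \<Rightarrow> bool" where
  "gdec D \<longleftrightarrow> (\<exists>DN J. (\<forall>N::nat. finite (J N) \<and> dep (J N) (DN N) \<and> (\<forall>w w'. w \<le> w' \<longrightarrow> DN N w' \<longrightarrow> DN N w) \<and>
     (\<forall>w. DN N w \<longrightarrow> DN (Suc N) w)) \<and> (\<forall>w. D w \<longleftrightarrow> (\<exists>N. DN N w)))"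

lemma gdec_obtain:
  assumes "gdec D"
  obtains DN J where "\<And>N::nat. finite (J N)" "\<And>N. dep (J N) (DN N)" "\<And>N w w'. w \<le> w' \<Longrightarrow> DN N w' \<Longrightarrow> DN N w"
    "\<And>N w. DN N w \<Longrightarrow> DN (Suc N) w" "D = (\<lambda>w. \<exists>N. DN N w)"
proof -
  from assms obtain DN J where d: "\<forall>N::nat. finite (J N) \<and> dep (J N) (DN N) \<and> (\<forall>w w'. w \<le> w' \<longrightarrow> DN N w' \<longrightarrow> DN N w) \<and>
     (\<forall>w. DN N w \<longrightarrow> DN (Suc N) w)" "\<forall>w. D w \<longleftrightarrow> (\<exists>N. DN N w)" unfolding gdec_def by (elim exE conjE)
  show thesis by (rule that[of J DN]) (use d in \<open>auto simp: fun_eq_iff\<close>)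
qed

lemma suc_mono:
  assumes "\<And>N::nat. P N \<Longrightarrow> P (Suc N)" "P N" "N \<le> M"
  shows "P M"
  using assms(3,2) by (induction rule: dec_induct) (auto intro: assms(1))

lemma gdecI:
  assumes "\<And>N::nat. finite (J N)" "\<And>N. dep (J N) (DN N)" "\<And>N w w'. w \<le> w' \<Longrightarrow> DN N w' \<Longrightarrow> DN N w"
    "\<And>N w. DN N w \<Longrightarrow> DN (Suc N) w" "\<And>w. D w \<longleftrightarrow> (\<exists>N. DN N w)"
  shows "gdec D"
  unfolding gdec_def
proof (intro exI conjI allI impI)
  show "finite (J N)" for N by (rule assms)
  show "dep (J N) (DN N)" for N by (rule assms)
  show "DN N w" if "w \<le> w'" "DN N w'" for N w w' using that by (rule assms(3))
  show "DN (Suc N) w" if "DN N w" for N w using that by (rule assms(4))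
  show "D w \<longleftrightarrow> (\<exists>N. DN N w)" for w by (rule assms)
qed

lemma gdec_conj:
  assumes "gdec D" "gdec D'"
  shows "gdec (\<lambda>w. D w \<and> D' w)"
proof -
  obtain DN J where d: "\<And>N::nat. finite (J N)" "\<And>N. dep (J N) (DN N)" "\<And>N w w'. w \<le> w' \<Longrightarrow> DN N w' \<Longrightarrow> DN N w"
    "\<And>N w. DN N w \<Longrightarrow> DN (Suc N) w" "D = (\<lambda>w. \<exists>N. DN N w)" by (rule gdec_obtain[OF assms(1)]) (rule that)
  obtain DN' J' where d': "\<And>N::nat. finite (J' N)" "\<And>N. dep (J' N) (DN' N)" "\<And>N w w'. w \<le> w' \<Longrightarrow> DN' N w' \<Longrightarrow> DN' N w"
    "\<And>N w. DN' N w \<Longrightarrow> DN' (Suc N) w" "D' = (\<lambda>w. \<exists>N. DN' N w)" by (rule gdec_obtain[OF assms(2)]) (rule that)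
  have m: "DN N w \<Longrightarrow> N \<le> M \<Longrightarrow> DN M w" for N M w using suc_mono[of "\<lambda>N. DN N w"] d(4) by blast
  have m': "DN' N w \<Longrightarrow> N \<le> M \<Longrightarrow> DN' M w" for N M w using suc_mono[of "\<lambda>N. DN' N w"] d'(4) by blast
  have "D w \<and> D' w \<longleftrightarrow> (\<exists>N. DN N w \<and> DN' N w)" for w
  proof
    assume "D w \<and> D' w"
    then obtain N N' where "DN N w" "DN' N' w" unfolding d(5) d'(5) by blast
    then have "DN (max N N') w" "DN' (max N N') w" using m m' by auto
    then show "\<exists>N. DN N w \<and> DN' N w" by blast
  qed (auto simp: d(5) d'(5))
  moreover have "dep (J N \<union> J' N) (\<lambda>w. DN N w \<and> DN' N w)" for N
    by (intro dep_comp2[where g = "(\<and>)"] dep_mono[OF d(2)] dep_mono[OF d'(2)]) auto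
  moreover have "DN N w \<and> DN' N w" if "w \<le> w'" "DN N w' \<and> DN' N w'" for N w w'
    using that d(3) d'(3) by metis
  ultimately show ?thesis
    using d(1,4) d'(1,4) by (intro gdecI[of "\<lambda>N. J N \<union> J' N" "\<lambda>N w. DN N w \<and> DN' N w"]) simp_all
qed

lemma gdec_True: "gdec (\<lambda>w. True)"
  unfolding gdec_def by (intro exI[of _ "\<lambda>N w. True"] exI[of _ "\<lambda>N. {}"]) auto

lemma gdec_ball: "finite I \<Longrightarrow> (\<And>i. i \<in> I \<Longrightarrow> gdec (D i)) \<Longrightarrow> gdec (\<lambda>w. \<forall>i\<in>I. D i w)"
proof (induction I rule: finite_induct)
  case empty then show ?case by (simp add: gdec_True)
next
  case (insert i I)
  then show ?case using gdec_conj[of "D i" "\<lambda>w. \<forall>i\<in>I. D i w"] by simp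
qed

lemma gdec_conn_inf: "gdec (\<lambda>w. \<not> (w e \<and> conn_inf (rs K w) u))"
proof -
  let ?DN = "\<lambda>N w. \<not> (w e \<and> reach (bx N) (rs K w) u)"
  have d: "dep (insert e (tch (bx N))) (?DN N)" for N
  proof -
    have 1: "dep (tch (bx N)) (\<lambda>w. reach (bx N) (rs K w) u)"
      unfolding dep_def by (intro allI impI depD[OF dep_reach]) (simp add: rs_def)
    have 2: "dep {e} (\<lambda>w. w e)" by (simp add: dep_def)
    have "dep (insert e (tch (bx N))) (\<lambda>w. w e \<and> reach (bx N) (rs K w) u)"
      by (rule dep_comp2[where g = "(\<and>)", OF dep_mono[OF 2] dep_mono[OF 1]]) auto
    then show ?thesis by (rule dep_comp)
  qed
  have m: "w \<le> w' \<Longrightarrow> ?DN N w' \<Longrightarrow> ?DN N w" for N w w'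
  proof -
    assume le: "w \<le> w'" and n: "?DN N w'"
    have "w e \<Longrightarrow> w' e" using le by (auto simp: le_fun_def)
    moreover have "reach (bx N) (rs K w) u \<Longrightarrow> reach (bx N) (rs K w') u" by (rule reach_mono[OF rs_mono[OF order_refl le]])
    ultimately show "?DN N w" using n by blast
  qed
  have s: "?DN N w \<Longrightarrow> ?DN (Suc N) w" for N w
    using bx_mono[of N "Suc N"] unfolding reach_iff by auto
  have "\<not> (w e \<and> conn_inf (rs K w) u) \<longleftrightarrow> (\<exists>N. ?DN N w)" for w
    unfolding conn_inf_reach by blast
  moreover have "finite (insert e (tch (bx N)))" for N using finite_tch by simp
  ultimately show ?thesis
    using d m s by (intro gdecI[of "\<lambda>N. insert e (tch (bx N))" ?DN])
qed

lemma gdec_measurable: "gdec D \<Longrightarrow> Measurable.pred (perc p) D"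
proof (elim gdec_obtain)
  fix DN J assume d: "\<And>N::nat. finite (J N)" "\<And>N. dep (J N) (DN N)" and D: "D = (\<lambda>w. \<exists>N. DN N w)"
  show ?thesis unfolding D by (intro pred_intros_countable pred_fin[OF d])
qed

lemma gdec_fkg:
  assumes p: "0 \<le> p" "p \<le> 1" and "gdec D" "gdec D'"
  shows "Pr p D * Pr p D' \<le> Pr p (\<lambda>w. D w \<and> D' w)"
proof -
  obtain DN J where d: "\<And>N::nat. finite (J N)" "\<And>N. dep (J N) (DN N)" "\<And>N w w'. w \<le> w' \<Longrightarrow> DN N w' \<Longrightarrow> DN N w"
    "\<And>N w. DN N w \<Longrightarrow> DN (Suc N) w" "D = (\<lambda>w. \<exists>N. DN N w)" by (rule gdec_obtain[OF assms(3)]) (rule that)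
  obtain DN' J' where d': "\<And>N::nat. finite (J' N)" "\<And>N. dep (J' N) (DN' N)" "\<And>N w w'. w \<le> w' \<Longrightarrow> DN' N w' \<Longrightarrow> DN' N w"
    "\<And>N w. DN' N w \<Longrightarrow> DN' (Suc N) w" "D' = (\<lambda>w. \<exists>N. DN' N w)" by (rule gdec_obtain[OF assms(4)]) (rule that)
  have m: "DN N w \<Longrightarrow> N \<le> M \<Longrightarrow> DN M w" for N M w using suc_mono[of "\<lambda>N. DN N w"] d(4) by blast
  have m': "DN' N w \<Longrightarrow> N \<le> M \<Longrightarrow> DN' M w" for N M w using suc_mono[of "\<lambda>N. DN' N w"] d'(4) by blast
  have e: "D w \<and> D' w \<longleftrightarrow> (\<exists>N. DN N w \<and> DN' N w)" for w
    unfolding d(5) d'(5) using m m' by (meson max.cobounded1 max.cobounded2)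
  have l1: "(\<lambda>N. Pr p (DN N)) \<longlonglongrightarrow> Pr p D" unfolding d(5) by (rule Pr_inc_lim, rule pred_fin[OF d(1,2)], rule d(4))
  have l2: "(\<lambda>N. Pr p (DN' N)) \<longlonglongrightarrow> Pr p D'" unfolding d'(5) by (rule Pr_inc_lim, rule pred_fin[OF d'(1,2)], rule d'(4))
  have dd: "dep (J N \<union> J' N) (\<lambda>w. DN N w \<and> DN' N w)" for N
    by (intro dep_comp2[where g = "(\<and>)"] dep_mono[OF d(2)] dep_mono[OF d'(2)]) auto
  have fin: "finite (J N \<union> J' N)" for N using d(1) d'(1) by simp
  have l3: "(\<lambda>N. Pr p (\<lambda>w. DN N w \<and> DN' N w)) \<longlonglongrightarrow> Pr p (\<lambda>w. D w \<and> D' w)"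
    unfolding e
  proof (rule Pr_inc_lim[where Q = "\<lambda>N w. DN N w \<and> DN' N w"])
    show "Measurable.pred (perc p) (\<lambda>w. DN N w \<and> DN' N w)" for N by (rule pred_fin[OF fin dd])
  qed (use d(4) d'(4) in blast)
  show ?thesis
  proof (rule LIMSEQ_le[OF tendsto_mult[OF l1 l2] l3], intro exI allI impI)
    fix N
    have "EE p (\<lambda>w. - of_bool (DN N w)) * EE p (\<lambda>w. - of_bool (DN' N w)) \<le> EE p (\<lambda>w. (- of_bool (DN N w)) * (- of_bool (DN' N w)))"
    proof (rule fkg[OF fin[of N] _ _ _ _ p])
      show "dep (J N \<union> J' N) (\<lambda>w. - of_bool (DN N w) :: real)" by (rule dep_comp[OF dep_mono[OF d(2)]]) auto
      show "dep (J N \<union> J' N) (\<lambda>w. - of_bool (DN' N w) :: real)" by (rule dep_comp[OF dep_mono[OF d'(2)]]) auto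
      show "mono (\<lambda>w. - of_bool (DN N w) :: real)" unfolding mono_def using d(3) by (auto simp: of_bool_def)
      show "mono (\<lambda>w. - of_bool (DN' N w) :: real)" unfolding mono_def using d'(3) by (auto simp: of_bool_def)
    qed
    then show "Pr p (DN N) * Pr p (DN' N) \<le> Pr p (\<lambda>w. DN N w \<and> DN' N w)"
      by (simp add: EE_def of_bool_conj)
  qed
qed

lemma gdec_mono_p:
  assumes "gdec D" "0 < p" "p \<le> p'" "p' < 1"
  shows "Pr p' D \<le> Pr p D"
proof -
  obtain DN J where d: "\<And>N::nat. finite (J N)" "\<And>N. dep (J N) (DN N)" "\<And>N w w'. w \<le> w' \<Longrightarrow> DN N w' \<Longrightarrow> DN N w"
    "\<And>N w. DN N w \<Longrightarrow> DN (Suc N) w" "D = (\<lambda>w. \<exists>N. DN N w)" by (rule gdec_obtain[OF assms(1)]) (rule that)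
  have l: "(\<lambda>N. Pr p (DN N)) \<longlonglongrightarrow> Pr p D" for p unfolding d(5) by (rule Pr_inc_lim, rule pred_fin[OF d(1,2)], rule d(4))
  show ?thesis
  proof (rule LIMSEQ_le[OF l l], intro exI allI impI)
    fix N
    have "EE p (\<lambda>w. - of_bool (DN N w)) \<le> EE p' (\<lambda>w. - of_bool (DN N w))"
      by (rule EE_mono_p[OF d(1) dep_comp[OF d(2)]]) (use assms d(3) in \<open>auto simp: mono_def of_bool_def\<close>)
    then show "Pr p' (DN N) \<le> Pr p (DN N)" by (simp add: EE_def)
  qed
qed

subsection \<open>Arms leaving a box\<close>

text \<open>One definition serves both lattices. The face labelled \<open>(a, b)\<close> has its
  centre half a unit up and to the right, so in face labels \<open>s = 1\<close> gives a box centred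
  at the origin, as \<open>s = 0\<close> does for vertices.\<close>

definition Bx :: "int \<Rightarrow> int \<Rightarrow> vertex set" where
  "Bx s M = {- M - s..M} \<times> {- M - s..M}"

definition armR :: "int \<Rightarrow> int \<Rightarrow> config \<Rightarrow> bool" where
  "armR s M w \<longleftrightarrow> (\<exists>y\<in>{- M - s..M}. w ((M, y), True) \<and> conn_inf (rs (Ein (- Bx s M)) w) (M + 1, y))"
definition armT :: "int \<Rightarrow> int \<Rightarrow> config \<Rightarrow> bool" where
  "armT s M w \<longleftrightarrow> (\<exists>x\<in>{- M - s..M}. w ((x, M), False) \<and> conn_inf (rs (Ein (- Bx s M)) w) (x, M + 1))"
definition armL :: "int \<Rightarrow> int \<Rightarrow> config \<Rightarrow> bool" where
  "armL s M w \<longleftrightarrow> (\<exists>y\<in>{- M - s..M}. w ((- M - s - 1, y), True) \<and> conn_inf (rs (Ein (- Bx s M)) w) (- M - s - 1, y))"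
definition armB :: "int \<Rightarrow> int \<Rightarrow> config \<Rightarrow> bool" where
  "armB s M w \<longleftrightarrow> (\<exists>x\<in>{- M - s..M}. w ((x, - M - s - 1), False) \<and> conn_inf (rs (Ein (- Bx s M)) w) (x, - M - s - 1))"

text \<open>Outside the box the cluster falls into finitely many pieces, each containing an outer
  neighbour of the box; one of the pieces is infinite.\<close>

lemma arms_exist:
  assumes inf: "conn_inf w v" and v: "v \<in> Bx s M"
  shows "armR s M w \<or> armT s M w \<or> armL s M w \<or> armB s M w"
proof -
  let ?X = "Bx s M"
  let ?c = "\<lambda>u. {y. conn (rs (Ein (- ?X)) w) u y}"
  define U where "U = {u. u \<notin> ?X \<and> (\<exists>v'\<in>?X. open_adj w u v')}"
  have finX: "finite ?X" by (simp add: Bx_def)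
  have finU: "finite U"
  proof (rule finite_subset)
    show "U \<subseteq> fst ` tch ?X \<union> tip ` tch ?X" unfolding U_def open_adj_iff tch_def by blast
  qed (use finite_tch[OF finX] in auto)
  have "{y. conn w v y} \<subseteq> ?X \<union> (\<Union>u\<in>U. ?c u)"
  proof
    fix y assume "y \<in> {y. conn w v y}"
    then have y: "conn w y v" by (simp add: conn_sym)
    show "y \<in> ?X \<union> (\<Union>u\<in>U. ?c u)"
    proof (cases "y \<in> ?X")
      case False
      then have "y \<in> - ?X" "v \<notin> - ?X" using v by auto
      from conn_exit[OF y this] obtain u v' where "conn (rs (Ein (- ?X)) w) y u" "u \<notin> ?X" "v' \<in> ?X" "open_adj w u v'"
        by (metis ComplD Compl_iff)
      then show ?thesis by (auto simp: U_def intro: conn_sym)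
    qed simp
  qed
  moreover have "infinite {y. conn w v y}" using inf by (simp add: conn_inf_iff)
  ultimately have "\<not> finite (\<Union>u\<in>U. ?c u)" using finX finite_subset by blast
  then obtain u where u: "u \<in> U" "infinite (?c u)" using finU by blast
  then obtain v' where v': "u \<notin> ?X" "v' \<in> ?X" "open_adj w u v'" by (auto simp: U_def)
  have ui: "conn_inf (rs (Ein (- ?X)) w) u" using u by (simp add: conn_inf_iff)
  obtain a b where ab: "v' = (a, b)" by (cases v')
  have abX: "- M - s \<le> a" "a \<le> M" "- M - s \<le> b" "b \<le> M" using v'(2) by (auto simp: Bx_def ab)
  from v'(3) consider "v' = (fst u + 1, snd u)" "w (u, True)" | "u = (a + 1, b)" "w (v', True)"
    | "v' = (fst u, snd u + 1)" "w (u, False)" | "u = (a, b + 1)" "w (v', False)"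
    unfolding open_adj_def ab by auto
  then show ?thesis
  proof cases
    case 1
    then have u': "u = (a - 1, b)" by (simp add: ab prod_eq_iff)
    then have "a = - M - s" using v'(1) abX by (auto simp: Bx_def)
    then have "armL s M w" unfolding armL_def using 1(2) ui abX u' by (intro bexI[of _ b]) auto
    then show ?thesis by simp
  next
    case 2
    then have "a = M" using v'(1) abX by (auto simp: Bx_def)
    then have "armR s M w" unfolding armR_def using 2 ui abX ab by (intro bexI[of _ b]) auto
    then show ?thesis by simp
  next
    case 3
    then have u': "u = (a, b - 1)" by (simp add: ab prod_eq_iff)
    then have "b = - M - s" using v'(1) abX by (auto simp: Bx_def)
    then have "armB s M w" unfolding armB_def using 3(2) ui abX u' by (intro bexI[of _ a]) auto
    then show ?thesis by simp
  next
    case 4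
    then have "b = M" using v'(1) abX by (auto simp: Bx_def)
    then have "armT s M w" unfolding armT_def using 4 ui abX ab by (intro bexI[of _ a]) auto
    then show ?thesis by simp
  qed
qed

text \<open>The quarter turn about the centre \<open>(- s / 2, - s / 2)\<close> of
  \<open>Bx s M\<close>.\<close>

definition rotv :: "int \<Rightarrow> vertex \<Rightarrow> vertex" where
  "rotv s v = (- snd v - s, fst v)"
definition rote :: "int \<Rightarrow> edge \<Rightarrow> edge" where
  "rote s e = (if snd e then (rotv s (fst e), False) else (rotv s (tip e), True))"

lemma rot_props: "bij (rotv s)" "bij (rote s)"
  "fst (rote s e) = rotv s (fst e) \<and> tip (rote s e) = rotv s (tip e) \<or> fst (rote s e) = rotv s (tip e) \<and> tip (rote s e) = rotv s (fst e)"
proof -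
  show "bij (rotv s)" by (rule bij_betw_byWitness[where f' = "\<lambda>v. (snd v, - fst v - s)"]) (auto simp: rotv_def)
  show "bij (rote s)"
    by (rule bij_betw_byWitness[where f' = "\<lambda>e. if snd e then ((snd (fst e), - fst (fst e) - s - 1), False) else ((snd (fst e), - fst (fst e) - s), True)"])
       (auto simp: rote_def rotv_def tip_def)
qed (cases "snd e"; simp add: rote_def rotv_def tip_def)

lemma rot_Ein: "rote s e \<in> Ein (- Bx s M) \<longleftrightarrow> e \<in> Ein (- Bx s M)"
proof -
  have "rotv s v \<in> Bx s M \<longleftrightarrow> v \<in> Bx s M" for v by (cases v) (auto simp: rotv_def Bx_def)
  then show ?thesis using rot_props(3)[of s e] unfolding Ein_def by (elim disjE conjE) (simp_all add: conj_commute)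
qed

lemma rot_conn_inf: "conn_inf (rs (Ein (- Bx s M)) (\<lambda>e. w (rote s e))) x \<longleftrightarrow> conn_inf (rs (Ein (- Bx s M)) w) (rotv s x)"
proof -
  have "(\<lambda>e. rs (Ein (- Bx s M)) w (rote s e)) = rs (Ein (- Bx s M)) (\<lambda>e. w (rote s e))"
    by (simp add: rs_def rot_Ein fun_eq_iff)
  then show ?thesis
    using conn_inf_auto[OF rot_props(1) bij_is_surj[OF rot_props(2)] rot_props(3), of "rs (Ein (- Bx s M)) w" s x] by simp
qed

lemma rot_bex: "(\<exists>y\<in>{- M - s..M}. Q (- y - s)) \<longleftrightarrow> (\<exists>x\<in>{- M - s..M::int}. Q x)"
proof
  assume "\<exists>x\<in>{- M - s..M}. Q x"
  then obtain x where "x \<in> {- M - s..M}" "Q x" by blast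
  then show "\<exists>y\<in>{- M - s..M}. Q (- y - s)" by (intro bexI[of _ "- x - s"]) auto
next
  assume "\<exists>y\<in>{- M - s..M}. Q (- y - s)"
  then obtain y where "y \<in> {- M - s..M}" "Q (- y - s)" by blast
  then show "\<exists>x\<in>{- M - s..M}. Q x" by (intro bexI[of _ "- y - s"]) auto
qed

lemma rot_arms:
  "armR s M (\<lambda>e. w (rote s e)) = armT s M w"
  "armT s M (\<lambda>e. w (rote s e)) = armL s M w"
  "armL s M (\<lambda>e. w (rote s e)) = armB s M w"
proof -
  show "armR s M (\<lambda>e. w (rote s e)) = armT s M w"
    unfolding armR_def armT_def rot_conn_inf
    using rot_bex[of M s "\<lambda>x. w ((x, M), False) \<and> conn_inf (rs (Ein (- Bx s M)) w) (x, M + 1)"]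
    by (simp add: rote_def rotv_def)
  show "armT s M (\<lambda>e. w (rote s e)) = armL s M w"
  proof -
    have "(w (rote s ((x, M), False)) \<and> conn_inf (rs (Ein (- Bx s M)) w) (rotv s (x, M + 1))) =
      (w ((- M - s - 1, x), True) \<and> conn_inf (rs (Ein (- Bx s M)) w) (- M - s - 1, x))" for x
    proof -
      have q: "- (M + 1) - s = - M - s - 1" by simp
      show ?thesis by (simp only: rote_def rotv_def tip_simps fst_conv snd_conv if_False q)
    qed
    then show ?thesis unfolding armT_def armL_def rot_conn_inf by simp
  qed
  show "armL s M (\<lambda>e. w (rote s e)) = armB s M w"
    unfolding armL_def armB_def rot_conn_inf
    using rot_bex[of M s "\<lambda>x. w ((x, - M - s - 1), False) \<and> conn_inf (rs (Ein (- Bx s M)) w) (x, - M - s - 1)"]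
    by (simp add: rote_def rotv_def)
qed

lemma not_bex: "(\<not> (\<exists>y\<in>A. P y)) \<longleftrightarrow> (\<forall>y\<in>A. \<not> P y)"
  by blast

lemma gdec_arms: "gdec (\<lambda>w. \<not> armR s M w)" "gdec (\<lambda>w. \<not> armT s M w)" "gdec (\<lambda>w. \<not> armL s M w)" "gdec (\<lambda>w. \<not> armB s M w)"
  unfolding armR_def armT_def armL_def armB_def not_bex
  by (intro gdec_ball gdec_conn_inf finite_atLeastAtMost_int)+

lemma pred_arms:
  "Measurable.pred (perc p) (armR s M)" "Measurable.pred (perc p) (armT s M)"
  "Measurable.pred (perc p) (armL s M)" "Measurable.pred (perc p) (armB s M)"
  using pred_intros_logic(2)[OF gdec_measurable[OF gdec_arms(1)[of s M], of p]]
    pred_intros_logic(2)[OF gdec_measurable[OF gdec_arms(2)[of s M], of p]]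
    pred_intros_logic(2)[OF gdec_measurable[OF gdec_arms(3)[of s M], of p]]
    pred_intros_logic(2)[OF gdec_measurable[OF gdec_arms(4)[of s M], of p]] by simp_all

lemma Pr_arms:
  "Pr p (\<lambda>w. \<not> armT s M w) = Pr p (\<lambda>w. \<not> armR s M w)"
  "Pr p (\<lambda>w. \<not> armL s M w) = Pr p (\<lambda>w. \<not> armR s M w)"
  "Pr p (\<lambda>w. \<not> armB s M w) = Pr p (\<lambda>w. \<not> armR s M w)"
proof -
  show 1: "Pr p (\<lambda>w. \<not> armT s M w) = Pr p (\<lambda>w. \<not> armR s M w)"
    using Pr_reindex[OF bij_is_inj[OF rot_props(2)[of s]] gdec_measurable[OF gdec_arms(1)[of s M], of p]] by (simp add: rot_arms)
  show 2: "Pr p (\<lambda>w. \<not> armL s M w) = Pr p (\<lambda>w. \<not> armR s M w)"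
    using Pr_reindex[OF bij_is_inj[OF rot_props(2)[of s]] gdec_measurable[OF gdec_arms(2)[of s M], of p]] by (simp add: rot_arms 1)
  show 3: "Pr p (\<lambda>w. \<not> armB s M w) = Pr p (\<lambda>w. \<not> armR s M w)"
    using Pr_reindex[OF bij_is_inj[OF rot_props(2)[of s]] gdec_measurable[OF gdec_arms(3)[of s M], of p]] by (simp add: rot_arms 2)
qed

lemma pred_ex_conn_inf: "finite V \<Longrightarrow> Measurable.pred (perc p) (\<lambda>w. \<exists>v\<in>V. conn_inf w v)"
  by (intro pred_intros_finite) auto

text \<open>The square-root trick: the four events of a missing arm are decreasing and by rotation
  equally likely, so the fourth power of their probability is at most the probability that all four
  arms are missing. Then the box meets no infinite cluster.\<close>

lemma four_arm_bound:
  assumes p: "0 \<le> p" "p \<le> 1" and pr: "Pr p (\<lambda>w. \<exists>v\<in>Bx s M. conn_inf w v) \<ge> 1 - (1 / 8) ^ 4"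
  shows "Pr p (\<lambda>w. \<not> armR s M w) \<le> 1 / 8"
proof -
  have finX: "finite (Bx s M)" by (simp add: Bx_def)
  let ?r = "Pr p (\<lambda>w. \<not> armR s M w)"
  note g = gdec_arms[of s M]
  have "?r ^ 4 = ?r * (?r * (?r * ?r))" by (simp add: power4_eq_xxxx)
  also have "\<dots> \<le> ?r * (?r * Pr p (\<lambda>w. \<not> armL s M w \<and> \<not> armB s M w))"
    using gdec_fkg[OF p g(3,4)] Pr_nonneg by (intro mult_left_mono) (simp_all add: Pr_arms)
  also have "\<dots> \<le> ?r * Pr p (\<lambda>w. \<not> armT s M w \<and> \<not> armL s M w \<and> \<not> armB s M w)"
    using gdec_fkg[OF p g(2) gdec_conj[OF g(3,4)]] Pr_nonneg by (intro mult_left_mono) (simp_all add: Pr_arms)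
  also have "\<dots> \<le> Pr p (\<lambda>w. \<not> armR s M w \<and> \<not> armT s M w \<and> \<not> armL s M w \<and> \<not> armB s M w)"
    by (rule gdec_fkg[OF p g(1) gdec_conj[OF g(2) gdec_conj[OF g(3,4)]]])
  also have "\<dots> \<le> Pr p (\<lambda>w. \<not> (\<exists>v\<in>Bx s M. conn_inf w v))"
  proof (rule Pr_mono)
    show "Measurable.pred (perc p) (\<lambda>w. \<not> armR s M w \<and> \<not> armT s M w \<and> \<not> armL s M w \<and> \<not> armB s M w)"
      by (rule gdec_measurable[OF gdec_conj[OF g(1) gdec_conj[OF g(2) gdec_conj[OF g(3,4)]]]])
    show "Measurable.pred (perc p) (\<lambda>w. \<not> (\<exists>v\<in>Bx s M. conn_inf w v))"
      by (rule pred_intros_logic(2)[OF pred_ex_conn_inf[OF finX]])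
  qed (use arms_exist in blast)
  also have "\<dots> \<le> (1 / 8) ^ 4" using pr Pr_not[OF pred_ex_conn_inf[OF finX], of p] by simp
  finally show ?thesis by (rule power_le_imp_le_base[where n = 3, simplified]) simp
qed

lemma large_box:
  assumes p: "0 \<le> p" "p \<le> 1" and pos: "Pr p (\<lambda>w. conn_inf w (0, 0)) > 0" and e: "e > 0"
  shows "\<exists>M\<ge>1. \<forall>s\<in>{0, 1}. Pr p (\<lambda>w. \<exists>v\<in>Bx s M. conn_inf w v) \<ge> 1 - e"
proof -
  define A where "A = {w. conn_inf w (0, 0)}"
  have As: "A \<in> sets (perc p)" using pred_conn_inf[where p = p and x = "(0, 0)"] by (simp add: A_def pred_def)
  have "measure (perc p) A > 0" using pos by (simp add: Pr_measure A_def)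
  from recurrence[OF p As this] have ae: "AE w in perc p. \<exists>n. conn_inf w (int n, 0)"
    by eventually_elim (auto simp: A_def sft_def conn_inf_tr)
  define Q where "Q N w \<longleftrightarrow> (\<exists>n\<in>{..N}. conn_inf w (int n, 0))" for N :: nat and w
  have Qm: "Measurable.pred (perc p) (Q N)" for N unfolding Q_def by (intro pred_intros_finite) auto
  have "(\<lambda>N. Pr p (Q N)) \<longlonglongrightarrow> Pr p (\<lambda>w. \<exists>N. Q N w)"
  proof (rule Pr_inc_lim[OF Qm])
    show "Q (Suc n) w" if "Q n w" for n w using that unfolding Q_def by (meson atMost_iff le_SucI)
  qed
  moreover have "Pr p (\<lambda>w. \<exists>N. Q N w) = 1"
  proof -
    have "Pr p (\<lambda>w. \<exists>N. Q N w) = EE p (\<lambda>_. 1)" unfolding EE_def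
    proof (rule integral_cong_AE)
      show "AE w in perc p. of_bool (\<exists>N. Q N w) = (1::real)" using ae by eventually_elim (auto simp: Q_def)
      show "(\<lambda>w. of_bool (\<exists>N. Q N w) :: real) \<in> borel_measurable (perc p)"
        by (intro pred_of_bool pred_intros_countable Qm)
    qed simp
    then show ?thesis by simp
  qed
  ultimately have "eventually (\<lambda>N. Pr p (Q N) > 1 - e) sequentially" using e by (intro order_tendstoD) auto
  then obtain N where N: "Pr p (Q N) > 1 - e" by (auto simp: eventually_sequentially)
  have "Pr p (\<lambda>w. \<exists>v\<in>Bx s (int N + 1). conn_inf w v) \<ge> 1 - e" if s: "s \<in> {0, 1}" for s
  proof -
    have "Pr p (Q N) \<le> Pr p (\<lambda>w. \<exists>v\<in>Bx s (int N + 1). conn_inf w v)"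
    proof (rule Pr_mono[OF Qm pred_ex_conn_inf])
      fix w assume "Q N w"
      then obtain n where n: "n \<le> N" "conn_inf w (int n, 0)" by (auto simp: Q_def)
      moreover have "(int n, 0) \<in> Bx s (int N + 1)" using n(1) s by (auto simp: Bx_def)
      ultimately show "\<exists>v\<in>Bx s (int N + 1). conn_inf w v" by blast
    qed (simp add: Bx_def)
    then show ?thesis using N by simp
  qed
  then show ?thesis by (intro exI[of _ "int N + 1"]) auto
qed

section \<open>The law of the dual configuration and fixed finite patterns\<close>

lemma Pr_dual:
  assumes p: "0 \<le> p" "p \<le> 1" and Q: "Measurable.pred (perc (1 - p)) Q"
  shows "Pr p (\<lambda>w. Q (dual w)) = Pr (1 - p) Q"
proof -
  define Q' where "Q' w = Q (\<lambda>e. w (dl e))" for w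
  have Q': "Measurable.pred (perc (1 - p)) Q'" unfolding Q'_def
    by (rule measurable_compose[OF measurable_reindex Q])
  have m: "(\<lambda>w e. \<not> w e) \<in> measurable (perc p) (perc (1 - p))"
  proof (rule measurable_into_perc)
    fix e show "(\<lambda>w. \<not> w e) \<in> measurable (perc p) (count_space UNIV)"
      by (intro pred_intros_logic(2) measurable_coord)
  qed
  have "Pr p (\<lambda>w. Q (dual w)) = Pr p (\<lambda>w. Q' (\<lambda>e. \<not> w e))" by (simp add: Q'_def dual_def[abs_def])
  also have "\<dots> = Pr (1 - p) Q'"
    unfolding EE_def using distr_flip[OF p] integral_distr[OF m pred_of_bool[OF Q']] by simp
  also have "\<dots> = Pr (1 - p) Q" unfolding Q'_def by (rule Pr_reindex[OF bij_is_inj[OF bij_dl] Q])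
  finally show ?thesis .
qed

lemma measurable_dual: "dual \<in> measurable (perc p) (perc q)"
proof (rule measurable_into_perc)
  fix e show "(\<lambda>w. dual w e) \<in> measurable (perc p) (count_space UNIV)"
    unfolding dual_def by (intro pred_intros_logic(2) measurable_coord)
qed

lemma pred_dual:
  assumes "\<And>p. Measurable.pred (perc p) Q"
  shows "Measurable.pred (perc p) (\<lambda>w. Q (dual w))"
  by (rule measurable_compose[OF measurable_dual assms])

lemma pattern_prob:
  assumes "finite J" "0 \<le> c" "c \<le> p" "c \<le> 1 - p"
  shows "Pr p (\<lambda>w. \<forall>e\<in>J. w e = \<eta> e) \<ge> c ^ card J"
  using assms(1)
proof (induction J rule: finite_induct)
  case (insert e J)
  have d: "dep (insert e J) (\<lambda>w. of_bool (\<forall>e\<in>insert e J. w e = \<eta> e) :: real)"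
    by (rule dep_of_bool) (simp add: dep_def)
  have fin: "finite (insert e J)" using insert by simp
  have u: "(\<forall>e'\<in>insert e J. upd e b w e' = \<eta> e') \<longleftrightarrow> b = \<eta> e \<and> (\<forall>e\<in>J. w e = \<eta> e)" for b w
    using insert.hyps by (auto simp: upd_apply)
  have "Pr p (\<lambda>w. \<forall>e\<in>insert e J. w e = \<eta> e) = (if \<eta> e then p else 1 - p) * Pr p (\<lambda>w. \<forall>e\<in>J. w e = \<eta> e)"
    using resample_fin[OF fin d, of p e] assms(2-4) unfolding u by (cases "\<eta> e") auto
  also have "\<dots> \<ge> c * c ^ card J"
    using assms(2-4) insert.IH by (intro mult_mono) auto
  finally show ?case using insert.hyps by simp
qed simp

subsection \<open>Gluing the four arms\<close>

text \<open>A double column on the left side joined to the origin along the axis; \<open>UR\<close>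
  is its counterpart ending at \<open>(1, 0)\<close>. The double column lets a primal arm arrive at
  any height. The pattern \<open>eta\<close> closes all other edges touching the box, which leaves
  room for dual paths from above and below.\<close>

definition UL :: "int \<Rightarrow> vertex set" where
  "UL M = {v. (- M - 1 \<le> fst v \<and> fst v \<le> - M \<and> \<bar>snd v\<bar> \<le> M) \<or> (- M \<le> fst v \<and> fst v \<le> 0 \<and> snd v = 0)}"
definition UR :: "int \<Rightarrow> vertex set" where
  "UR M = {v. (M \<le> fst v \<and> fst v \<le> M + 1 \<and> \<bar>snd v\<bar> \<le> M) \<or> (1 \<le> fst v \<and> fst v \<le> M \<and> snd v = 0)}"
definition eta :: "int \<Rightarrow> edge \<Rightarrow> bool" where
  "eta M e \<longleftrightarrow> e \<in> Ein (UL M) \<or> e \<in> Ein (UR M)"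

lemma conn_segment_h:
  assumes "\<And>x. a \<le> x \<Longrightarrow> x < b \<Longrightarrow> w ((x, y), True)" "a \<le> (b::int)"
  shows "conn w (a, y) (b, y)"
  using assms(2,1)
proof (induction b rule: int_ge_induct)
  case (step b)
  have "open_adj w (b, y) (b + 1, y)" using step.prems[of b] step.hyps by (simp add: open_adj_def)
  then show ?case using step by (auto intro: rtranclp.rtrancl_into_rtrancl)
qed simp

lemma conn_segment_v:
  assumes "\<And>y. a \<le> y \<Longrightarrow> y < b \<Longrightarrow> w ((x, y), False)" "a \<le> (b::int)"
  shows "conn w (x, a) (x, b)"
  using assms(2,1)
proof (induction b rule: int_ge_induct)
  case (step b)
  have "open_adj w (x, b) (x, b + 1)" using step.prems[of b] step.hyps by (simp add: open_adj_def)
  then show ?case using step by (auto intro: rtranclp.rtrancl_into_rtrancl)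
qed simp

lemma conn_segment_h':
  assumes "\<And>x. lo \<le> x \<Longrightarrow> x < hi \<Longrightarrow> w ((x, y), True)" "lo \<le> a" "a \<le> hi" "lo \<le> b" "b \<le> (hi::int)"
  shows "conn w (a, y) (b, y)"
proof (cases "a \<le> b")
  case True then show ?thesis using assms by (intro conn_segment_h) auto
next
  case False then show ?thesis using assms by (intro conn_sym[OF conn_segment_h]) auto
qed

lemma conn_segment_v':
  assumes "\<And>y. lo \<le> y \<Longrightarrow> y < hi \<Longrightarrow> w ((x, y), False)" "lo \<le> a" "a \<le> hi" "lo \<le> b" "b \<le> (hi::int)"
  shows "conn w (x, a) (x, b)"
proof (cases "a \<le> b")
  case True then show ?thesis using assms by (intro conn_segment_v) auto
next
  case False then show ?thesis using assms by (intro conn_sym[OF conn_segment_v]) auto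
qed

text \<open>The four arms without the primal edges that enter the box: \<open>eta\<close> prescribes
  those, and by \<open>dep_tails\<close> what remains is independent of the pattern.\<close>

definition tails :: "int \<Rightarrow> config \<Rightarrow> bool" where
  "tails M w \<longleftrightarrow> (\<exists>y\<in>{- M..M}. conn_inf (rs (Ein (- Bx 0 M)) w) (M + 1, y)) \<and>
     (\<exists>y\<in>{- M..M}. conn_inf (rs (Ein (- Bx 0 M)) w) (- M - 1, y)) \<and> armT 1 M (dual w) \<and> armB 1 M (dual w)"

definition split :: "edge \<Rightarrow> config \<Rightarrow> bool" where
  "split e w \<longleftrightarrow> \<not> w e \<and> conn_inf w (fst e) \<and> conn_inf w (tip e) \<and> \<not> conn w (fst e) (tip e)"

text \<open>The pattern extends the left arm to \<open>(0, 0)\<close>, the right arm to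
  \<open>(1, 0)\<close> and the two dual arms to the faces beside the closed edge between them;
  \<open>dual_separate\<close> then excludes an open connection.\<close>

lemma glue:
  assumes M: "M \<ge> 1" and t: "tails M w" and eta: "\<forall>e\<in>tch (Bx 0 M). w e = eta M e"
  shows "split ((0, 0), True) w"
proof -
  let ?e = "((0, 0), True) :: edge"
  have inX: "(a, b) \<in> Bx 0 M \<longleftrightarrow> \<bar>a\<bar> \<le> M \<and> \<bar>b\<bar> \<le> M" for a b by (auto simp: Bx_def)
  have w: "w e = eta M e" if "fst e \<in> Bx 0 M \<or> tip e \<in> Bx 0 M" for e using eta that by (auto simp: tch_def)
  have ce: "\<not> w ?e" using w[of ?e] M by (auto simp: inX eta_def Ein_def UL_def UR_def)
  obtain yl yr where yl: "yl \<in> {- M..M}" "conn_inf (rs (Ein (- Bx 0 M)) w) (- M - 1, yl)"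
    and yr: "yr \<in> {- M..M}" "conn_inf (rs (Ein (- Bx 0 M)) w) (M + 1, yr)" using t unfolding tails_def by blast
  have L: "conn_inf w (0, 0)"
  proof -
    have 1: "conn w (0, 0) (- M, 0)"
    proof (rule conn_segment_h'[of "- M" 0])
      fix x assume "- M \<le> x" "x < 0"
      then show "w ((x, 0), True)" using w[of "((x, 0), True)"] M by (auto simp: inX eta_def Ein_def UL_def)
    qed (use M in auto)
    have 2: "conn w (- M, 0) (- M, yl)"
    proof (rule conn_segment_v'[of "- M" M])
      fix y assume "- M \<le> y" "y < M"
      then have "\<bar>y\<bar> \<le> M" "\<bar>y + 1\<bar> \<le> M" by auto
      then show "w ((- M, y), False)" using w[of "((- M, y), False)"] M by (auto simp: inX eta_def Ein_def UL_def)
    qed (use M yl in auto)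
    have 3: "conn w (- M, yl) (- M - 1, yl)"
    proof (rule conn_segment_h'[of "- M - 1" "- M"])
      fix x assume "- M - 1 \<le> x" "x < - M"
      then have "x = - M - 1" by simp
      then show "w ((x, yl), True)" using w[of "((x, yl), True)"] M yl by (auto simp: inX eta_def Ein_def UL_def)
    qed (use M yl in auto)
    have "conn w (- M - 1, yl) (0, 0)" using 1 2 3 by (meson conn_sym rtranclp_trans)
    then show ?thesis using conn_inf_conn[OF conn_inf_mono[OF rs_le yl(2)]] by blast
  qed
  have Rr: "conn_inf w (1, 0)"
  proof -
    have 1: "conn w (1, 0) (M, 0)"
    proof (rule conn_segment_h'[of 1 M])
      fix x assume "1 \<le> x" "x < M"
      then show "w ((x, 0), True)" using w[of "((x, 0), True)"] M by (auto simp: inX eta_def Ein_def UR_def)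
    qed (use M in auto)
    have 2: "conn w (M, 0) (M, yr)"
    proof (rule conn_segment_v'[of "- M" M])
      fix y assume "- M \<le> y" "y < M"
      then have "\<bar>y\<bar> \<le> M" "\<bar>y + 1\<bar> \<le> M" by auto
      then show "w ((M, y), False)" using w[of "((M, y), False)"] M by (auto simp: inX eta_def Ein_def UR_def)
    qed (use M yr in auto)
    have 3: "conn w (M, yr) (M + 1, yr)"
    proof (rule conn_segment_h'[of M "M + 1"])
      fix x assume "M \<le> x" "x < M + 1"
      then have "x = M" by simp
      then show "w ((x, yr), True)" using w[of "((x, yr), True)"] M yr by (auto simp: inX eta_def Ein_def UR_def)
    qed (use M yr in auto)
    have "conn w (M + 1, yr) (1, 0)" using 1 2 3 by (meson conn_sym rtranclp_trans)
    then show ?thesis using conn_inf_conn[OF conn_inf_mono[OF rs_le yr(2)]] by blast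
  qed
  let ?d = "upd (ud ?e) False (dual w)"
  have d: "?d e \<longleftrightarrow> e \<noteq> ((0, - 1), False) \<and> \<not> w (dl e)" for e by (simp add: upd_apply ud_def dual_def)
  have rsd: "rs (Ein (- Bx 1 M)) (dual w) \<le> ?d"
    using M by (auto simp: le_fun_def rs_def upd_apply ud_def Ein_def Bx_def)
  obtain xt where xt: "xt \<in> {- M - 1..M}" "dual w ((xt, M), False)" "conn_inf (rs (Ein (- Bx 1 M)) (dual w)) (xt, M + 1)"
    using t unfolding tails_def armT_def by blast
  obtain xb where xb: "xb \<in> {- M - 1..M}" "dual w ((xb, - M - 2), False)" "conn_inf (rs (Ein (- Bx 1 M)) (dual w)) (xb, - M - 2)"
  proof -
    have e: "- M - 1 - 1 = - M - 2" by simp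
    show thesis using t that unfolding tails_def armB_def e by blast
  qed
  have T: "conn_inf ?d (0, 0)"
  proof -
    have 1: "conn ?d (0, 0) (0, M)"
    proof (rule conn_segment_v'[of 0 M])
      fix y assume y: "0 \<le> y" "y < M"
      have "w ((0, y + 1), True) = eta M ((0, y + 1), True)" using y by (intro w) (simp add: inX)
      then show "?d ((0, y), False)" using y M by (auto simp: d dl_def eta_def Ein_def UL_def UR_def)
    qed (use M in auto)
    have 2: "conn ?d (0, M) (xt, M)"
    proof (rule conn_segment_h'[of "- M - 1" M])
      fix x assume x: "- M - 1 \<le> x" "x < M"
      have "w ((x + 1, M), False) = eta M ((x + 1, M), False)" using x by (intro w) (simp add: inX)
      then show "?d ((x, M), True)" using x M by (auto simp: d dl_def eta_def Ein_def UL_def UR_def)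
    qed (use M xt in auto)
    have "?d ((xt, M), False)" using xt(2) M by (auto simp: upd_apply ud_def)
    then have "open_adj ?d (xt, M) (xt, M + 1)" by (simp add: open_adj_def)
    then have "conn ?d (xt, M + 1) (0, 0)" using 1 2 by (meson conn_sym rtranclp_trans r_into_rtranclp)
    then show ?thesis using conn_inf_conn[OF conn_inf_mono[OF rsd xt(3)]] by blast
  qed
  have B: "conn_inf ?d (0, - 1)"
  proof -
    have 1: "conn ?d (0, - 1) (0, - M - 1)"
    proof (rule conn_segment_v'[of "- M - 1" "- 1"])
      fix y assume y: "- M - 1 \<le> y" "y < - 1"
      have "w ((0, y + 1), True) = eta M ((0, y + 1), True)" using y by (intro w) (simp add: inX)
      then show "?d ((0, y), False)" using y M by (auto simp: d dl_def eta_def Ein_def UL_def UR_def)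
    qed (use M in auto)
    have 2: "conn ?d (0, - M - 1) (xb, - M - 1)"
    proof (rule conn_segment_h'[of "- M - 1" M])
      fix x assume x: "- M - 1 \<le> x" "x < M"
      have "w ((x + 1, - M - 1), False) = eta M ((x + 1, - M - 1), False)" using x by (intro w) (simp add: inX)
      then show "?d ((x, - M - 1), True)" using x M by (auto simp: d dl_def eta_def Ein_def UL_def UR_def)
    qed (use M xb in auto)
    have "?d ((xb, - M - 2), False)" using xb(2) M by (auto simp: upd_apply ud_def)
    then have "open_adj ?d (xb, - M - 1) (xb, - M - 2)" by (simp add: open_adj_def)
    then have "conn ?d (xb, - M - 2) (0, - 1)" using 1 2 by (meson conn_sym rtranclp_trans r_into_rtranclp)
    then show ?thesis using conn_inf_conn[OF conn_inf_mono[OF rsd xb(3)]] by blast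
  qed
  have "\<not> conn w (0, 0) (1, 0)" using dual_separate[of w ?e] ce T B by auto
  then show ?thesis using ce L Rr by (simp add: split_def)
qed

lemma dep_tails: "dep (- tch (Bx 0 M)) (tails M)"
proof -
  have E0: "Ein (- Bx 0 M) = - tch (Bx 0 M)" by (auto simp: Ein_def tch_def)
  have "tails M w = tails M w'" if ag: "\<And>e. e \<notin> tch (Bx 0 M) \<Longrightarrow> w e = w' e" for w w'
  proof -
    have 1: "rs (Ein (- Bx 0 M)) w = rs (Ein (- Bx 0 M)) w'"
      unfolding E0 using ag by (auto simp: rs_def fun_eq_iff)
    have out: "dl e \<notin> tch (Bx 0 M)" if "fst e \<notin> Bx 1 M \<or> tip e \<notin> Bx 1 M" for e
    proof -
      obtain a b c where e: "e = ((a, b), c)" by (metis prod.collapse)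
      show ?thesis using that unfolding e tch_def Bx_def dl_def by (cases c) auto
    qed
    have dd: "dual w e = dual w' e" if "fst e \<notin> Bx 1 M \<or> tip e \<notin> Bx 1 M" for e
      using ag[OF out[OF that]] by (simp add: dual_def)
    have 2: "rs (Ein (- Bx 1 M)) (dual w) = rs (Ein (- Bx 1 M)) (dual w')"
      using dd by (auto simp: rs_def fun_eq_iff Ein_def)
    have 3: "dual w ((x, M), False) = dual w' ((x, M), False)" for x by (rule dd) (simp add: Bx_def)
    have 4: "dual w ((x, - M - 1 - 1), False) = dual w' ((x, - M - 1 - 1), False)" for x by (rule dd) (simp add: Bx_def)
    show ?thesis unfolding tails_def armT_def armB_def 1 2 3 4 ..
  qed
  then show ?thesis unfolding dep_def by blast
qed

lemma measurable_rs: "(\<lambda>w. rs J w) \<in> measurable (perc p) (perc q)"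
proof (rule measurable_into_perc)
  fix e show "(\<lambda>w. rs J w e) \<in> measurable (perc p) (count_space UNIV)"
    unfolding rs_def by (intro pred_intros_logic measurable_coord) simp
qed

lemma pred_tails: "Measurable.pred (perc p) (tails M)"
  unfolding tails_def
  by (intro pred_intros_logic pred_intros_finite pred_dual pred_arms measurable_compose[OF measurable_rs pred_conn_inf]) auto

lemma pred_split: "Measurable.pred (perc p) (split e)"
  unfolding split_def by (intro pred_intros_logic measurable_coord pred_conn_inf pred_conn)

text \<open>Four failures of probability at most 1/8 leave 1/2 for \<open>tails\<close>; the pattern
  costs a power of \<open>p0\<close>. The bound is uniform because both \<open>p\<close> and the
  density \<open>1 - p\<close> of the dual are at least \<open>p0\<close>.\<close>

lemma split_prob:
  assumes p0: "0 < p0" "p0 < 1 / 2" and pos: "Pr p0 (\<lambda>w. conn_inf w (0, 0)) > 0"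
  shows "\<exists>c>0. \<forall>p. p0 \<le> p \<longrightarrow> p \<le> 1 - p0 \<longrightarrow> Pr p (split ((0, 0), True)) \<ge> c"
proof -
  have p01: "0 \<le> p0" "p0 \<le> 1" using p0 by auto
  obtain M where M: "M \<ge> 1" "\<And>s. s \<in> {0, 1} \<Longrightarrow> Pr p0 (\<lambda>w. \<exists>v\<in>Bx s M. conn_inf w v) \<ge> 1 - (1 / 8) ^ 4"
    using large_box[OF p01 pos, of "(1/8)^4"] by auto
  have R: "Pr p (\<lambda>w. \<not> armR s M w) \<le> 1 / 8" if "s \<in> {0, 1}" "p0 \<le> p" "p < 1" for s p
    using gdec_mono_p[OF gdec_arms(1) p0(1) that(2,3), of s M] four_arm_bound[OF p01 M(2)[OF that(1)]] by simp
  let ?J = "tch (Bx 0 M)"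
  have finJ: "finite ?J" by (rule finite_tch) (simp add: Bx_def)
  have "Pr p (split ((0, 0), True)) \<ge> p0 ^ card ?J * (1 / 2)" if p: "p0 \<le> p" "p \<le> 1 - p0" for p
  proof -
    have p': "0 \<le> p" "p \<le> 1" "p < 1" "1 - p < 1" "p0 \<le> 1 - p" using p p0 by auto
    have dT: "Pr p (\<lambda>w. \<not> armT 1 M (dual w)) \<le> 1 / 8"
      using Pr_dual[OF p'(1,2) gdec_measurable[OF gdec_arms(2)[of 1 M]]] R[of 1 "1 - p"] p' by (simp add: Pr_arms)
    have dB: "Pr p (\<lambda>w. \<not> armB 1 M (dual w)) \<le> 1 / 8"
      using Pr_dual[OF p'(1,2) gdec_measurable[OF gdec_arms(4)[of 1 M]]] R[of 1 "1 - p"] p' by (simp add: Pr_arms)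
    have dL: "Pr p (\<lambda>w. \<not> armL 0 M w) \<le> 1 / 8" and dR: "Pr p (\<lambda>w. \<not> armR 0 M w) \<le> 1 / 8"
      using R[of 0 p] p p' by (simp_all add: Pr_arms)
    have mT: "Measurable.pred (perc p) (\<lambda>w. \<not> armT 1 M (dual w))" and mB: "Measurable.pred (perc p) (\<lambda>w. \<not> armB 1 M (dual w))"
      by (intro pred_intros_logic(2) pred_dual pred_arms)+
    have imp: "tails M w" if "armR 0 M w" "armL 0 M w" "armT 1 M (dual w)" "armB 1 M (dual w)" for w
      using that unfolding tails_def armR_def armL_def by auto
    have "1 \<le> EE p (\<lambda>w. of_bool (tails M w) + of_bool (\<not> armR 0 M w) + of_bool (\<not> armL 0 M w) + of_bool (\<not> armT 1 M (dual w)) + of_bool (\<not> armB 1 M (dual w)))"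
    proof -
      have "EE p (\<lambda>_. 1) \<le> EE p (\<lambda>w. of_bool (tails M w) + of_bool (\<not> armR 0 M w) + of_bool (\<not> armL 0 M w) + of_bool (\<not> armT 1 M (dual w)) + of_bool (\<not> armB 1 M (dual w)))"
      proof (rule EE_mono)
        show "integrable (perc p) (\<lambda>_. 1 :: real)" by (rule integrable_bdd[where B = 1]) auto
        show "integrable (perc p) (\<lambda>w. of_bool (tails M w) + of_bool (\<not> armR 0 M w) + of_bool (\<not> armL 0 M w) + of_bool (\<not> armT 1 M (dual w)) + of_bool (\<not> armB 1 M (dual w)) :: real)"
          by (intro Bochner_Integration.integrable_add integrable_of_bool pred_tails gdec_measurable gdec_arms mT mB)
        show "1 \<le> (of_bool (tails M w) + of_bool (\<not> armR 0 M w) + of_bool (\<not> armL 0 M w) + of_bool (\<not> armT 1 M (dual w)) + of_bool (\<not> armB 1 M (dual w)) :: real)" for w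
          using imp[of w] by (cases "armR 0 M w"; cases "armL 0 M w"; cases "armT 1 M (dual w)"; cases "armB 1 M (dual w)") simp_all
      qed
      then show ?thesis by simp
    qed
    also have "\<dots> = Pr p (tails M) + Pr p (\<lambda>w. \<not> armR 0 M w) + Pr p (\<lambda>w. \<not> armL 0 M w) + Pr p (\<lambda>w. \<not> armT 1 M (dual w)) + Pr p (\<lambda>w. \<not> armB 1 M (dual w))"
      unfolding EE_def
      using integrable_of_bool[OF pred_tails] integrable_of_bool[OF gdec_measurable[OF gdec_arms(1)]] integrable_of_bool[OF gdec_measurable[OF gdec_arms(3)]]
        integrable_of_bool[OF mT] integrable_of_bool[OF mB] by simp
    finally have T: "Pr p (tails M) \<ge> 1 / 2" using dT dB dL dR by simp
    have C: "Pr p (\<lambda>w. \<forall>e\<in>?J. w e = eta M e) \<ge> p0 ^ card ?J" by (rule pattern_prob[OF finJ]) (use p p0 in auto)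
    have dC: "dep ?J (\<lambda>w. of_bool (\<forall>e\<in>?J. w e = eta M e) :: real)" by (rule dep_of_bool) (simp add: dep_def)
    have "p0 ^ card ?J * (1 / 2) \<le> Pr p (\<lambda>w. \<forall>e\<in>?J. w e = eta M e) * Pr p (tails M)"
      using C T p0 by (intro mult_mono Pr_nonneg) auto
    also have "\<dots> = EE p (\<lambda>w. of_bool (\<forall>e\<in>?J. w e = eta M e) * of_bool (tails M w))"
      by (rule indep_finite[OF finJ dC dep_of_bool[OF dep_tails] pred_of_bool[OF pred_tails], symmetric, where B = 1]) (use p' in auto)
    also have "\<dots> \<le> Pr p (split ((0, 0), True))"
    proof (rule EE_mono)
      show "integrable (perc p) (\<lambda>w. of_bool (\<forall>e\<in>?J. w e = eta M e) * of_bool (tails M w) :: real)"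
        by (rule integrable_bdd[where B = 1])
           (auto intro!: borel_measurable_times pred_of_bool[OF pred_tails] dep_finite_measurable[OF finJ dC])
      show "integrable (perc p) (\<lambda>w. of_bool (split ((0, 0), True) w) :: real)" by (rule integrable_of_bool[OF pred_split])
      show "of_bool (\<forall>e\<in>?J. w e = eta M e) * of_bool (tails M w) \<le> (of_bool (split ((0, 0), True) w) :: real)" for w
        using glue[OF M(1), of w] by (cases "tails M w"; cases "\<forall>e\<in>?J. w e = eta M e") auto
    qed
    finally show ?thesis .
  qed
  then show ?thesis using p0 by (intro exI[of _ "p0 ^ card ?J * (1 / 2)"]) auto
qed

subsection \<open>Counting boundary clusters\<close>

definition rim :: "vertex set \<Rightarrow> vertex set" where
  "rim B = {v\<in>B. \<exists>u. u \<notin> B \<and> open_adj (\<lambda>_. True) v u}"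

definition ncl :: "vertex set \<Rightarrow> config \<Rightarrow> nat" where
  "ncl B w = card (clu B w ` rim B)"

lemma clu_eqI: "u \<in> clu B w v \<Longrightarrow> clu B w u = clu B w v"
  unfolding clu_def by (auto intro: rtranclp_trans conn_sym)

lemma clu_self: "v \<in> clu B w v"
  by (simp add: clu_def)

lemma clu_le: "w \<le> w' \<Longrightarrow> clu B w v \<subseteq> clu B w' v"
  unfolding clu_def using conn_mono[OF rs_mono[OF order_refl]] by blast

lemma clu_image:
  assumes "w \<le> w'"
  shows "clu B w' v = (\<Union>u\<in>clu B w v. clu B w' u)"
proof -
  have "clu B w' u = clu B w' v" if "u \<in> clu B w v" for u
    using clu_eqI clu_le[OF assms] that by blast
  then have "(\<Union>u\<in>clu B w v. clu B w' u) = (\<Union>u\<in>clu B w v. clu B w' v)" by (intro SUP_cong refl)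
  moreover have "clu B w v \<noteq> {}" using clu_self by blast
  ultimately show ?thesis by simp
qed

lemma ncl_mono:
  assumes "w \<le> w'" "finite B"
  shows "ncl B w' \<le> ncl B w"
proof -
  have "clu B w' ` rim B = (\<lambda>A. \<Union>u\<in>A. clu B w' u) ` (clu B w ` rim B)"
    unfolding image_image by (intro image_cong refl clu_image[OF assms(1)])
  then show ?thesis unfolding ncl_def using assms(2) by (simp add: card_image_le rim_def)
qed

text \<open>Both clusters are infinite, so their pieces inside \<open>B\<close> that contain the
  ends of \<open>e\<close> reach the rim and are counted separately; opening \<open>e\<close>
  identifies them.\<close>

lemma ncl_split:
  assumes B: "finite B" and e: "e \<in> Ein B" and s: "split e w"
  shows "ncl B (upd e True w) < ncl B (upd e False w)"
proof -
  have w: "upd e False w = w" using s by (simp add: split_def)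
  let ?w = "upd e True w"
  have le: "w \<le> ?w" by (auto simp: le_fun_def upd_apply)
  let ?g = "\<lambda>A. \<Union>u\<in>A. clu B ?w u"
  have reach: "clu B w x \<in> clu B w ` rim B" if x: "x \<in> B" "conn_inf w x" for x
  proof -
    have "\<not> {y. conn w x y} \<subseteq> B" using x(2) B finite_subset by (auto simp: conn_inf_iff)
    then obtain y where y: "conn w x y" "y \<notin> B" by blast
    obtain u v where uv: "conn (rs (Ein B) w) x u" "u \<in> B" "v \<notin> B" "open_adj w u v"
      using conn_exit[OF y(1) x(1) y(2)] by metis
    have "u \<in> rim B" using uv open_adj_mono[of w "\<lambda>_. True" u v] by (auto simp: rim_def le_fun_def)
    moreover have "clu B w u = clu B w x" using uv(1) by (intro clu_eqI) (simp add: clu_def)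
    ultimately show ?thesis by (metis imageI)
  qed
  have eB: "fst e \<in> B" "tip e \<in> B" using e by (auto simp: Ein_def)
  have r: "clu B w (fst e) \<in> clu B w ` rim B" "clu B w (tip e) \<in> clu B w ` rim B"
    using reach eB s by (auto simp: split_def)
  have ne: "clu B w (fst e) \<noteq> clu B w (tip e)"
  proof
    assume "clu B w (fst e) = clu B w (tip e)"
    then have "conn (rs (Ein B) w) (fst e) (tip e)" using clu_self[of "tip e" B w] by (auto simp: clu_def)
    then show False using s conn_mono[OF rs_le] by (auto simp: split_def)
  qed
  have "tip e \<in> clu B ?w (fst e)"
    using open_adj_edge[of ?w e] eB by (auto simp: clu_def open_adj_rs_Ein)
  then have same: "?g (clu B w (fst e)) = ?g (clu B w (tip e))"
    using clu_eqI[of "tip e" B ?w "fst e"] clu_image[OF le, of B] by metis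
  have img: "clu B ?w ` rim B = ?g ` (clu B w ` rim B)"
    unfolding image_image by (intro image_cong refl clu_image[OF le])
  have fin: "finite (clu B w ` rim B)" using B by (simp add: rim_def)
  have "\<not> inj_on ?g (clu B w ` rim B)" using same ne r unfolding inj_on_def by blast
  then have "card (?g ` (clu B w ` rim B)) \<noteq> card (clu B w ` rim B)" using eq_card_imp_inj_on[OF fin] by blast
  then have "card (?g ` (clu B w ` rim B)) < card (clu B w ` rim B)" using card_image_le[OF fin, of ?g] by simp
  then show ?thesis by (simp add: ncl_def img w)
qed

lemma card_rim: "card (rim (bx R)) \<le> 4 * (2 * R + 1)"
proof -
  let ?I = "{- int R..int R}"
  have "rim (bx R) \<subseteq> ((\<lambda>y. (int R, y)) ` ?I \<union> (\<lambda>y. (- int R, y)) ` ?I) \<union> ((\<lambda>x. (x, int R)) ` ?I \<union> (\<lambda>x. (x, - int R)) ` ?I)"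
  proof
    fix v assume "v \<in> rim (bx R)"
    then obtain a b u where v: "v = (a, b)" "(a, b) \<in> bx R" "u \<notin> bx R" "open_adj (\<lambda>_. True) (a, b) u"
      by (cases v) (auto simp: rim_def)
    then have "a = int R \<or> a = - int R \<or> b = int R \<or> b = - int R"
      unfolding open_adj_def by (cases u) (auto simp: bx_def)
    then show "v \<in> ((\<lambda>y. (int R, y)) ` ?I \<union> (\<lambda>y. (- int R, y)) ` ?I) \<union> ((\<lambda>x. (x, int R)) ` ?I \<union> (\<lambda>x. (x, - int R)) ` ?I)"
      using v(1,2) by (auto simp: bx_def)
  qed
  then have "card (rim (bx R)) \<le> card (((\<lambda>y. (int R, y)) ` ?I \<union> (\<lambda>y. (- int R, y)) ` ?I) \<union> ((\<lambda>x. (x, int R)) ` ?I \<union> (\<lambda>x. (x, - int R)) ` ?I))"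
    by (intro card_mono) auto
  also have "\<dots> \<le> (card ?I + card ?I) + (card ?I + card ?I)"
    by (intro order_trans[OF card_Un_le] add_mono card_image_le) auto
  finally show ?thesis by simp
qed

text \<open>Otherwise both the open and the closed dual edges percolate throughout \<open>[q, 1 - q]\<close>, and gluing four arms
  makes an edge separate two infinite clusters with probability bounded below. By Russo's formula the mean number
  of clusters touching the boundary of a box then changes by the order of its area, but it is at most its perimeter.\<close>

theorem subcritical_phi:
  assumes q: "0 < q" "q < 1 / 2"
  shows "\<exists>S. finite S \<and> (0, 0) \<in> S \<and> q * phi q S < 1"
proof (rule ccontr)
  assume neg: "\<not> ?thesis"
  have ph: "phi q S \<ge> 1" if "finite S" "(0, 0) \<in> S" for S
  proof -
    have "1 \<le> q * phi q S" using neg that by force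
    moreover have "phi q S \<ge> 0" unfolding phi_def by (intro sum_nonneg Pr_nonneg)
    ultimately show ?thesis using q mult_right_mono[of q 1 "phi q S"] by simp
  qed
  \<comment> \<open>Strictly above \<open>q\<close>, so that integrating the differential inequality
    from \<open>q\<close> gives percolation at \<open>p0\<close>; strictly below 1/2, so that the
    interval from \<open>p0\<close> to \<open>1 - p0\<close> has positive length.\<close>
  define p0 where "p0 = (q + 1 / 2) / 2"
  have p0: "q < p0" "p0 < 1 / 2" "0 < p0" using q by (auto simp: p0_def)
  have "Pr p0 (\<lambda>w. conn_inf w (0, 0)) \<ge> 1 - exp (- (p0 - q))"
    by (rule dct_percolation) (use q p0 ph in auto)
  moreover have "exp (- (p0 - q)) < 1" using p0 by simp
  ultimately have "Pr p0 (\<lambda>w. conn_inf w (0, 0)) > 0" by linarith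
  from split_prob[OF p0(3,2) this] obtain c where c: "c > 0" "\<And>p. p0 \<le> p \<Longrightarrow> p \<le> 1 - p0 \<Longrightarrow> Pr p (split ((0, 0), True)) \<ge> c" by blast
  have main: "real R * (c * (1 - 2 * p0)) \<le> 4" for R :: nat
  proof -
    let ?B = "bx R"
    define K where "K w = real (ncl ?B w)" for w
    have dK: "dep (Ein ?B) K"
      unfolding K_def ncl_def clu_def by (rule dep_rs[where F = "\<lambda>w. real (card ((\<lambda>x. {u. conn w x u}) ` rim ?B))"])
    have finE: "finite (Ein ?B)" by (simp add: finite_Ein)
    have iK: "integrable (perc p) K" for p by (rule dep_finite_integrable[OF finE dK])
    have iKu: "integrable (perc p) (\<lambda>w. K (upd e b w))" for p e b
      by (rule dep_finite_integrable[OF finE dep_upd_same[OF dK]])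
    have Kb: "0 \<le> K w" "K w \<le> 4 * (2 * real R + 1)" for w
    proof -
      have "ncl ?B w \<le> card (rim ?B)" unfolding ncl_def by (rule card_image_le) (simp add: rim_def)
      also have "\<dots> \<le> 4 * (2 * R + 1)" by (rule card_rim)
      finally have "real (ncl ?B w) \<le> real (4 * (2 * R + 1))" by (rule of_nat_mono)
      then show "K w \<le> 4 * (2 * real R + 1)" by (simp add: K_def)
    qed (simp add: K_def)
    define dv where "dv p = (\<Sum>e\<in>Ein ?B. EE p (\<lambda>w. K (upd e True w) - K (upd e False w)))" for p
    \<comment> \<open>The horizontal edges of the box, translates of the edge in
      \<open>split_prob\<close>. Their number is of the order of the area; the remaining edges
      contribute terms of the same sign.\<close>
    define V where "V = (\<lambda>v. sh v ((0, 0), True)) ` ({- int R..int R - 1} \<times> {- int R..int R})"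
    have VE: "V \<subseteq> Ein ?B" by (auto simp: V_def sh_def Ein_def bx_def)
    have cV: "card V = 2 * R * (2 * R + 1)"
      unfolding V_def by (subst card_image) (auto simp: inj_on_def sh_def nat_add_distrib nat_mult_distrib)
    have sV: "Pr p (split e) = Pr p (split ((0, 0), True))" if "e \<in> V" for e p
    proof -
      obtain v where v: "e = sh v ((0, 0), True)" using \<open>e \<in> V\<close> by (auto simp: V_def)
      have "split ((0, 0), True) (\<lambda>e. w (sh v e)) = split e w" for w
        by (simp add: split_def conn_inf_tr conn_tr v)
      then show ?thesis using Pr_reindex[OF inj_sh[of v] pred_split[where p = p and e = "((0, 0), True)"]] by simp
    qed
    have dvb: "dv p \<le> - (real (2 * R * (2 * R + 1)) * c)" if p: "p0 \<le> p" "p \<le> 1 - p0" for p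
    proof -
      have term0: "EE p (\<lambda>w. K (upd e True w) - K (upd e False w)) \<le> 0" for e
      proof -
        have "EE p (\<lambda>w. K (upd e True w) - K (upd e False w)) \<le> EE p (\<lambda>_. 0)"
        proof (rule EE_mono)
          fix w have "upd e False w \<le> upd e True w" by (auto simp: le_fun_def upd_apply)
          then show "K (upd e True w) - K (upd e False w) \<le> 0" using ncl_mono[of "upd e False w" "upd e True w" ?B] by (simp add: K_def)
        qed (use iKu in auto)
        then show ?thesis by simp
      qed
      have termV: "EE p (\<lambda>w. K (upd e True w) - K (upd e False w)) \<le> - c" if e: "e \<in> V" for e
      proof -
        have "EE p (\<lambda>w. K (upd e True w) - K (upd e False w)) \<le> EE p (\<lambda>w. - of_bool (split e w))"
        proof (rule EE_mono)
          fix w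
          have le: "upd e False w \<le> upd e True w" by (auto simp: le_fun_def upd_apply)
          show "K (upd e True w) - K (upd e False w) \<le> - of_bool (split e w)"
            using ncl_split[of ?B e w] e VE ncl_mono[OF le, of ?B] by (cases "split e w") (auto simp: K_def)
          show "integrable (perc p) (\<lambda>w. - of_bool (split e w) :: real)" using integrable_of_bool[OF pred_split] by simp
        qed (use iKu in auto)
        also have "\<dots> = - Pr p (split e)" by (simp add: EE_def)
        finally show ?thesis using c(2)[OF p] sV[OF e] by simp
      qed
      have "dv p = (\<Sum>e\<in>V. EE p (\<lambda>w. K (upd e True w) - K (upd e False w))) + (\<Sum>e\<in>Ein ?B - V. EE p (\<lambda>w. K (upd e True w) - K (upd e False w)))"
        unfolding dv_def using sum.subset_diff[OF VE finE] by (simp add: add.commute)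
      also have "\<dots> \<le> (\<Sum>e\<in>V. - c) + 0" by (intro add_mono sum_mono sum_nonpos termV term0)
      finally show ?thesis by (simp add: cV)
    qed
    have "\<exists>z. p0 < z \<and> z < 1 - p0 \<and> EE (1 - p0) K - EE p0 K = (1 - p0 - p0) * dv z"
    proof (rule MVT2)
      show "p0 < 1 - p0" using p0 by simp
      fix x assume "p0 \<le> x" "x \<le> 1 - p0"
      then show "((\<lambda>p. EE p K) has_real_derivative dv x) (at x)"
        unfolding dv_def using p0 by (intro russo[OF finE dK]) auto
    qed
    then obtain z where z: "p0 < z" "z < 1 - p0" "EE (1 - p0) K - EE p0 K = (1 - p0 - p0) * dv z" by blast
    have "(1 - 2 * p0) * (real (2 * R * (2 * R + 1)) * c) \<le> (1 - 2 * p0) * (- dv z)"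
      using dvb[of z] z p0 by (intro mult_left_mono) auto
    also have "\<dots> = EE p0 K - EE (1 - p0) K" using z(3) by (simp add: algebra_simps)
    also have "\<dots> \<le> 4 * (2 * real R + 1)"
    proof -
      have "EE p0 K \<le> EE p0 (\<lambda>_. 4 * (2 * real R + 1))" by (rule EE_mono[OF iK]) (use Kb in \<open>auto intro: integrable_bdd\<close>)
      moreover have "EE (1 - p0) K \<ge> 0" unfolding EE_def by (intro Bochner_Integration.integral_nonneg Kb)
      ultimately show ?thesis by simp
    qed
    finally have "(2 * real R + 1) * (2 * real R * (c * (1 - 2 * p0))) \<le> (2 * real R + 1) * 4" by (simp add: algebra_simps)
    then have "2 * real R * (c * (1 - 2 * p0)) \<le> 4" by (subst (asm) mult_le_cancel_left_pos) auto
    moreover have "0 \<le> real R * (c * (1 - 2 * p0))" using c p0 by simp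
    ultimately show ?thesis by linarith
  qed
  have "c * (1 - 2 * p0) > 0" using c p0 by simp
  then obtain R :: nat where "4 < real R * (c * (1 - 2 * p0))" using reals_Archimedean3 by blast
  then show False using main[of R] by simp
qed

subsection \<open>The chemical distance\<close>

lemma paths_between_rtrancl_path:
  "open_path w xs \<Longrightarrow> rtrancl_path (open_adj w) (hd xs) (tl xs) (last xs)"
proof (induction xs)
  case Nil then show ?case by (simp add: open_path_def)
next
  case (Cons x xs)
  show ?case
  proof (cases xs)
    case Nil then show ?thesis by (simp add: rtrancl_path.base)
  next
    case (Cons y ys)
    with Cons.prems have "open_adj w x y" unfolding open_path_def by force
    moreover have "open_path w xs" using Cons.prems Cons unfolding open_path_def by force
    ultimately show ?thesis using Cons.IH Cons by (auto intro: rtrancl_path.step)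
  qed
qed

lemma chem_dist_rp:
  "chem_dist w x y \<le> enat n \<longleftrightarrow> (\<exists>xs. rtrancl_path (open_adj w) x xs y \<and> length xs \<le> n)"
proof
  assume "chem_dist w x y \<le> enat n"
  then obtain xs where xs: "open_path w xs" "hd xs = x" "last xs = y" "length xs \<le> Suc n"
    unfolding chem_dist_path_iff paths_between_def by blast
  then show "\<exists>xs. rtrancl_path (open_adj w) x xs y \<and> length xs \<le> n"
    using paths_between_rtrancl_path[OF xs(1)] by (intro exI[of _ "tl xs"]) auto
next
  assume "\<exists>xs. rtrancl_path (open_adj w) x xs y \<and> length xs \<le> n"
  then obtain xs where "rtrancl_path (open_adj w) x xs y" "length xs \<le> n" by blast
  then show "chem_dist w x y \<le> enat n" using chem_dist_le_path[of w x xs y] by (meson enat_ord_simps(1) order_trans)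
qed

lemma chem_dist_obtain:
  assumes "chem_dist w x y = enat n"
  obtains xs where "rtrancl_path (open_adj w) x xs y" "length xs = n"
proof -
  from assms have "chem_dist w x y \<le> enat n" by simp
  then obtain xs where xs: "rtrancl_path (open_adj w) x xs y" "length xs \<le> n" unfolding chem_dist_rp by blast
  have "enat n \<le> enat (length xs)" using chem_dist_le_path[OF xs(1)] assms by simp
  then show thesis using that xs by force
qed

lemma chem_dist_triangle: "chem_dist w x z \<le> chem_dist w x y + chem_dist w y z"
proof (cases "chem_dist w x y"; cases "chem_dist w y z")
  fix m n assume mn: "chem_dist w x y = enat m" "chem_dist w y z = enat n"
  obtain xs where xs: "rtrancl_path (open_adj w) x xs y" "length xs = m" using chem_dist_obtain[OF mn(1)] .
  obtain ys where ys: "rtrancl_path (open_adj w) y ys z" "length ys = n" using chem_dist_obtain[OF mn(2)] .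
  have "rtrancl_path (open_adj w) x (xs @ ys) z" using xs ys by (intro rtrancl_path_trans)
  from chem_dist_le_path[OF this] show ?thesis using mn xs ys by simp
qed auto

lemma chem_dist_refl [simp]: "chem_dist w x x = 0"
proof -
  have "chem_dist w x x \<le> enat 0" unfolding chem_dist_rp by (intro exI[of _ "[]"]) (simp add: rtrancl_path.base)
  then show ?thesis by (simp add: zero_enat_def[symmetric])
qed

lemma the_enat_zero [simp]: "the_enat 0 = 0"
  by (simp add: zero_enat_def)

lemma chem_dist_tr_le: "chem_dist w (tr v x) (tr v y) \<le> chem_dist (\<lambda>e. w (sh v e)) x y"
proof (cases "chem_dist (\<lambda>e. w (sh v e)) x y")
  case (enat n)
  obtain xs where xs: "rtrancl_path (open_adj (\<lambda>e. w (sh v e))) x xs y" "length xs = n" using chem_dist_obtain[OF enat] .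
  have oa: "open_adj (\<lambda>e. w (sh v e)) a b \<Longrightarrow> open_adj w (tr v a) (tr v b)" for a b
    unfolding open_adj_iff by (metis fst_sh tip_sh)
  have "rtrancl_path (open_adj w) (tr v x) (map (tr v) xs) (tr v y)"
    using xs(1) by (induction rule: rtrancl_path.induct) (auto intro: rtrancl_path.intros oa)
  from chem_dist_le_path[OF this] show ?thesis using enat xs by simp
qed simp

lemma chem_dist_tr: "chem_dist (\<lambda>e. w (sh v e)) x y = chem_dist w (tr v x) (tr v y)"
proof (rule antisym)
  let ?u = "(- fst v, - snd v)"
  have 1: "tr ?u (tr v z) = z" for z by (simp add: tr_def)
  have 2: "sh v (sh ?u e) = e" for e by (simp add: sh_def)
  show "chem_dist (\<lambda>e. w (sh v e)) x y \<le> chem_dist w (tr v x) (tr v y)"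
    using chem_dist_tr_le[of "\<lambda>e. w (sh v e)" ?u "tr v x" "tr v y"] by (simp add: 1 2)
qed (rule chem_dist_tr_le)

lemma rtrancl_path_Cons_iff: "rtrancl_path r x (y # ys) z \<longleftrightarrow> r x y \<and> rtrancl_path r y ys z"
  by (auto intro: rtrancl_path.step elim: rtrancl_path.cases)

lemma rtrancl_path_Nil_iff: "rtrancl_path r x [] z \<longleftrightarrow> x = z"
  by (auto intro: rtrancl_path.base elim: rtrancl_path.cases)

lemma pred_open_adj: "Measurable.pred (perc p) (\<lambda>w. open_adj w x y)"
  unfolding open_adj_def by (intro pred_intros_logic measurable_coord) auto

lemma pred_rp: "Measurable.pred (perc p) (\<lambda>w. rtrancl_path (open_adj w) x xs y)"
proof (induction xs arbitrary: x)
  case (Cons a xs)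
  then show ?case unfolding rtrancl_path_Cons_iff by (intro pred_intros_logic pred_open_adj)
qed (simp add: rtrancl_path_Nil_iff)

lemma pred_chem_dist: "Measurable.pred (perc p) (\<lambda>w. chem_dist w x y \<le> enat n)"
  unfolding chem_dist_rp by (intro pred_intros_countable pred_intros_logic pred_rp) auto

lemma measurable_chem_dist: "(\<lambda>w. chem_dist w x y) \<in> measurable (perc p) (count_space UNIV)"
proof (subst measurable_count_space_eq2_countable, intro conjI ballI)
  fix d :: enat
  have "Measurable.pred (perc p) (\<lambda>w. chem_dist w x y = d)"
  proof (cases d)
    case (enat n)
    have "chem_dist w x y = enat n \<longleftrightarrow> chem_dist w x y \<le> enat n \<and> (\<forall>m\<in>{..<n}. \<not> chem_dist w x y \<le> enat m)" for w
    proof (cases "chem_dist w x y")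
      case (enat k)
      then show ?thesis by (auto simp: not_le)
    qed auto
    then show ?thesis unfolding enat
      by (simp only:) (intro pred_intros_logic pred_intros_finite pred_chem_dist finite_lessThan)
  next
    case infinity
    have "chem_dist w x y = \<infinity> \<longleftrightarrow> (\<forall>n. \<not> chem_dist w x y \<le> enat n)" for w
      by (cases "chem_dist w x y") auto
    then show ?thesis unfolding infinity
      by (simp only:) (intro pred_intros_logic pred_intros_countable pred_chem_dist)
  qed
  then show "(\<lambda>w. chem_dist w x y) -` {d} \<inter> space (perc p) \<in> sets (perc p)"
    by (simp add: pred_def vimage_def)
qed auto

subsection \<open>Detours around closed dual clusters\<close>

text \<open>For neighbours this is the base point of their edge, and hence the label of a face
  beside it.\<close>

definition basept :: "vertex \<Rightarrow> vertex \<Rightarrow> vertex" where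
  "basept u v = (min (fst u) (fst v), min (snd u) (snd v))"

definition detour_cost :: "config \<Rightarrow> vertex \<Rightarrow> vertex \<Rightarrow> ennreal" where
  "detour_cost w u v = (if open_adj w u v then 0 else cluster_size (dual w) (basept u v))"

lemma basept_edge: "fst e = u \<and> tip e = v \<or> fst e = v \<and> tip e = u \<Longrightarrow> basept u v = fst e"
  by (cases "snd e") (auto simp: basept_def tip_def prod_eq_iff min_def)

text \<open>A lattice path pays 1 for each step and, when the step is closed, four times the size of the closed dual
  cluster that blocks it: an open detour along that cluster is at most this long.\<close>

inductive route_cost :: "config \<Rightarrow> vertex \<Rightarrow> vertex \<Rightarrow> ennreal \<Rightarrow> bool" for w where
  route_cost_refl: "route_cost w x x c"
| route_cost_step: "route_cost w x y c \<Longrightarrow> open_adj (\<lambda>_. True) y z \<Longrightarrow> c + (1 + 4 * detour_cost w y z) \<le> d \<Longrightarrow> route_cost w x z d"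

lemma route_cost_mono: "route_cost w x y c \<Longrightarrow> c \<le> d \<Longrightarrow> route_cost w x y d"
  by (induction arbitrary: d rule: route_cost.induct) (auto intro: route_cost.intros order_trans)

lemma route_cost_trans: "route_cost w y z d \<Longrightarrow> route_cost w x y c \<Longrightarrow> route_cost w x z (c + d)"
proof (induction rule: route_cost.induct)
  case (route_cost_refl y e)
  then show ?case by (rule route_cost_mono) simp
next
  case (route_cost_step y z e z' e')
  then have "route_cost w x z (c + e)" by blast
  moreover have "(c + e) + (1 + 4 * detour_cost w z z') \<le> c + e'" using route_cost_step.hyps(3) by (simp add: add.assoc add_left_mono)
  ultimately show ?case using route_cost_step.hyps(2) route_cost.route_cost_step by blast
qed

lemma route_cost_adj: "open_adj (\<lambda>_. True) x y \<Longrightarrow> 1 + 4 * detour_cost w x y \<le> c \<Longrightarrow> route_cost w x y c"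
  using route_cost_step[OF route_cost_refl[of w x 0]] by simp

lemma cluster_size_finite: "cluster_size w x < \<infinity> \<Longrightarrow> finite {y. conn w x y} \<and> cluster_size w x = ennreal (real (card {y. conn w x y}))"
  unfolding cluster_size_def by (cases "finite {y. conn w x y}") (auto simp: emeasure_count_space_infinite ennreal_of_nat_eq_real_of_nat)

definition route :: "config \<Rightarrow> vertex \<Rightarrow> vertex \<Rightarrow> vertex list \<Rightarrow> vertex set \<Rightarrow> bool" where
  "route w x y g F \<longleftrightarrow> (\<forall>i. Suc i < length g \<longrightarrow> open_adj (\<lambda>_. True) (g ! i) (g ! Suc i)) \<and> g \<noteq> [] \<and> hd g = x \<and> last g = y
    \<and> finite F \<and> (\<forall>f f'. f \<in> F \<longrightarrow> open_adj (dual w) f f' \<longrightarrow> f' \<in> F)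
    \<and> (\<forall>i e. Suc i < length g \<longrightarrow> (fst e = g ! i \<and> tip e = g ! Suc i \<or> fst e = g ! Suc i \<and> tip e = g ! i) \<longrightarrow> \<not> w e \<longrightarrow> fst e \<in> F)"

lemma routeD:
  assumes "route w x y g F"
  shows "\<And>i. Suc i < length g \<Longrightarrow> open_adj (\<lambda>_. True) (g ! i) (g ! Suc i)" "g \<noteq> []" "hd g = x" "last g = y"
    "finite F" "\<And>f f'. f \<in> F \<Longrightarrow> open_adj (dual w) f f' \<Longrightarrow> f' \<in> F"
    "\<And>i e. Suc i < length g \<Longrightarrow> fst e = g ! i \<and> tip e = g ! Suc i \<or> fst e = g ! Suc i \<and> tip e = g ! i \<Longrightarrow> \<not> w e \<Longrightarrow> fst e \<in> F"
  using assms unfolding route_def by blast+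

text \<open>Collect the dual clusters blocking the closed steps of the route. Their union is closed
  under dual adjacency, which is what \<open>detour\<close> asks of \<open>F\<close>; overlaps only
  reduce its size.\<close>

lemma route_cost_data:
  assumes "route_cost w x y c" and fin: "\<And>f. cluster_size (dual w) f < \<infinity>"
  shows "\<exists>g F. route w x y g F \<and> ennreal (real (length g - 1 + 4 * card F)) \<le> c"
  using assms(1)
proof (induction rule: route_cost.induct)
  case (route_cost_refl x c)
  have "route w x x [x] {}" by (simp add: route_def)
  then show ?case by (intro exI[of _ "[x]"] exI[of _ "{}"]) simp
next
  case (route_cost_step x y c z d)
  then obtain g F where rt: "route w x y g F" and c: "ennreal (real (length g - 1 + 4 * card F)) \<le> c" by blast
  note g = routeD(1-4)[OF rt] and F = routeD(5,6)[OF rt] and cov = routeD(7)[OF rt]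
  define C where "C = (if open_adj w y z then {} else {f. conn (dual w) (basept y z) f})"
  have C: "finite C" "detour_cost w y z = ennreal (real (card C))"
    using cluster_size_finite[OF fin[of "basept y z"]] by (auto simp: C_def detour_cost_def)
  let ?g = "g @ [z]" and ?F = "F \<union> C"
  have nth: "?g ! i = (if i < length g then g ! i else z)" if "i < length ?g" for i using that by (auto simp: nth_append)
  have lastg: "g ! (length g - 1) = y" using g by (simp add: last_conv_nth)
  have split: "Suc i < length g \<or> i = length g - 1 \<and> Suc i = length g" if "Suc i < length ?g" for i using that by auto
  have 1: "open_adj (\<lambda>_. True) (?g ! i) (?g ! Suc i)" if i: "Suc i < length ?g" for i
    using split[OF i] i g(1)[of i] route_cost_step.hyps(2) lastg by (auto simp: nth_append)
  have 2: "f' \<in> ?F" if "f \<in> ?F" "open_adj (dual w) f f'" for f f'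
  proof (cases "f \<in> F")
    case True then show ?thesis using F(2) that(2) by blast
  next
    case False
    then have "\<not> open_adj w y z" "conn (dual w) (basept y z) f" using that(1) by (auto simp: C_def split: if_splits)
    then show ?thesis using that(2) unfolding C_def by (auto intro: rtranclp.rtrancl_into_rtrancl)
  qed
  have 3: "fst e \<in> ?F" if i: "Suc i < length ?g" and e: "fst e = ?g ! i \<and> tip e = ?g ! Suc i \<or> fst e = ?g ! Suc i \<and> tip e = ?g ! i" "\<not> w e" for i e
    using split[OF i]
  proof
    assume "Suc i < length g"
    then show ?thesis using cov[of i e] e by (auto simp: nth_append)
  next
    assume "i = length g - 1 \<and> Suc i = length g"
    then have yz: "fst e = y \<and> tip e = z \<or> fst e = z \<and> tip e = y" using e lastg by (auto simp: nth_append)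
    then have "\<not> open_adj w y z" using open_adj_edge[of w e] e(2) by (auto simp: open_adj_sym)
    then show ?thesis using basept_edge[OF yz] by (simp add: C_def)
  qed
  have 4: "ennreal (real (length ?g - 1 + 4 * card ?F)) \<le> d"
  proof -
    have "length ?g - 1 + 4 * card ?F \<le> (length g - 1 + 4 * card F) + (1 + 4 * card C)"
      using card_Un_le[of F C] g(2) by (cases g) auto
    then have "ennreal (real (length ?g - 1 + 4 * card ?F)) \<le> ennreal (real (length g - 1 + 4 * card F) + (1 + 4 * real (card C)))"
      by (intro ennreal_leI) (metis (mono_tags) of_nat_1 of_nat_add of_nat_le_iff of_nat_mult of_nat_numeral)
    also have "\<dots> = ennreal (real (length g - 1 + 4 * card F)) + (1 + 4 * detour_cost w y z)"
      unfolding C(2) by (subst ennreal_plus) (auto simp: ennreal_mult)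
    also have "\<dots> \<le> c + (1 + 4 * detour_cost w y z)" using c by (rule add_right_mono)
    finally show ?thesis using route_cost_step.hyps(3) by (rule order_trans)
  qed
  have "route w x z ?g ?F" unfolding route_def
  proof (intro conjI allI impI)
    show "hd ?g = x" using g by (cases g) auto
    show "finite ?F" using F(1) C(1) by simp
  qed (use 1 2 3 in \<open>simp_all\<close>, (blast+)?)
  then show ?case using 4 by blast
qed

lemma route_cost_chem_dist:
  assumes route_cost: "route_cost w x y c" and fin: "\<And>f. cluster_size (dual w) f < \<infinity>" and inf: "conn_inf w x" "conn_inf w y"
  shows "\<exists>N. chem_dist w x y = enat N \<and> ennreal (real N) \<le> c"
proof -
  from route_cost_data[OF route_cost fin] obtain g F where rt: "route w x y g F" and c: "ennreal (real (length g - 1 + 4 * card F)) \<le> c" by blast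
  note g = routeD(1-4)[OF rt] and F = routeD(5,6)[OF rt] and cov = routeD(7)[OF rt]
  have le: "chem_dist w x y \<le> enat (length g - 1 + 4 * card F)"
    by (rule detour[OF g inf F cov])
  then obtain N where N: "chem_dist w x y = enat N" by (cases "chem_dist w x y") auto
  then have "N \<le> length g - 1 + 4 * card F" using le by simp
  then have "ennreal (real N) \<le> ennreal (real (length g - 1 + 4 * card F))" by (intro ennreal_leI) simp
  then show ?thesis using c N by (intro exI[of _ N]) (auto intro: order_trans)
qed

text \<open>Bounds the price of one step along the axis, whether its edge is open or closed.\<close>

definition Y :: "config \<Rightarrow> ennreal" where
  "Y w = 1 + 4 * cluster_size (dual w) (0, 0)"

lemma dual_sh: "dual (\<lambda>e. w (sh v e)) = (\<lambda>e. dual w (sh v e))"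
  by (auto simp: dual_def dl_def sh_def fun_eq_iff ac_simps)

lemma cluster_size_tr: "cluster_size (\<lambda>e. w (sh v e)) x = cluster_size w (tr v x)"
proof -
  have "{y. conn w (tr v x) y} = tr v ` {y. conn (\<lambda>e. w (sh v e)) x y}"
  proof (intro equalityI subsetI)
    fix y assume y: "y \<in> {y. conn w (tr v x) y}"
    have "y = tr v (fst y - fst v, snd y - snd v)" by (simp add: tr_def)
    moreover have "conn (\<lambda>e. w (sh v e)) x (fst y - fst v, snd y - snd v)" using y calculation by (simp add: conn_tr)
    ultimately show "y \<in> tr v ` {y. conn (\<lambda>e. w (sh v e)) x y}" by blast
  qed (auto simp: conn_tr)
  then show ?thesis unfolding cluster_size_def
    by (cases "finite {y. conn (\<lambda>e. w (sh v e)) x y}")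
       (simp_all add: card_image inj_on_subset[OF inj_tr] finite_image_iff emeasure_count_space_infinite)
qed

lemma Y_sft: "Y (sft i w) = 1 + 4 * cluster_size (dual w) (int i, 0)"
  unfolding Y_def sft_def dual_sh cluster_size_tr by simp

lemma route_cost_row: "route_cost w (int a, 0) (int (a + k), 0) (\<Sum>i<k. Y (sft (a + i) w))"
proof (induction k)
  case 0 show ?case by (simp add: route_cost_refl)
next
  case (Suc k)
  have "detour_cost w (int (a + k), 0) (int (a + Suc k), 0) \<le> cluster_size (dual w) (int (a + k), 0)"
    by (simp add: detour_cost_def basept_def)
  then have "1 + 4 * detour_cost w (int (a + k), 0) (int (a + Suc k), 0) \<le> Y (sft (a + k) w)"
    unfolding Y_sft by (intro add_left_mono mult_left_mono) auto
  then have le: "(\<Sum>i<k. Y (sft (a + i) w)) + (1 + 4 * detour_cost w (int (a + k), 0) (int (a + Suc k), 0)) \<le> (\<Sum>i<Suc k. Y (sft (a + i) w))"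
    unfolding sum.lessThan_Suc by (rule add_left_mono)
  have adj: "open_adj (\<lambda>_. True) (int (a + k), 0) (int (a + Suc k), 0)" by (simp add: open_adj_def)
  show ?case by (rule route_cost_step[OF Suc.IH adj le])
qed

lemma distr_dual: "0 \<le> p \<Longrightarrow> p \<le> 1 \<Longrightarrow> distr (perc p) (perc (1 - p)) dual = perc (1 - p)"
proof -
  assume p: "0 \<le> p" "p \<le> 1"
  have m: "(\<lambda>w e. \<not> w e) \<in> measurable (perc p) (perc (1 - p))"
  proof (rule measurable_into_perc)
    fix e show "(\<lambda>w. \<not> w e) \<in> measurable (perc p) (count_space UNIV)"
      by (intro pred_intros_logic(2) measurable_coord)
  qed
  have "perc (1 - p) = distr (perc (1 - p)) (perc (1 - p)) (\<lambda>w e. w (dl e))"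
    by (rule distr_reindex[OF bij_is_inj[OF bij_dl], symmetric])
  also have "\<dots> = distr (distr (perc p) (perc (1 - p)) (\<lambda>w e. \<not> w e)) (perc (1 - p)) (\<lambda>w e. w (dl e))"
    by (simp only: distr_flip[OF p])
  also have "\<dots> = distr (perc p) (perc (1 - p)) ((\<lambda>w e. w (dl e)) \<circ> (\<lambda>w e. \<not> w e))"
    by (rule distr_distr[OF measurable_reindex m])
  also have "(\<lambda>w e. w (dl e)) \<circ> (\<lambda>w e. \<not> w e) = dual" by (auto simp: dual_def fun_eq_iff)
  finally show ?thesis by simp
qed

lemma nn_dual:
  assumes p: "0 \<le> p" "p \<le> 1" and F: "F \<in> borel_measurable (perc (1 - p))"
  shows "(\<integral>\<^sup>+w. F (dual w) \<partial>perc p) = (\<integral>\<^sup>+w. F w \<partial>perc (1 - p))"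
  using nn_integral_distr[OF measurable_dual[of p "1 - p"], of F] F by (simp add: distr_dual[OF p])

lemma measurable_cluster_size_dual [measurable]: "(\<lambda>w. cluster_size (dual w) x) \<in> borel_measurable (perc p)"
  by (rule measurable_compose[OF measurable_dual cluster_size_measurable])

lemma measurable_Y [measurable]: "Y \<in> borel_measurable (perc p)"
  unfolding Y_def by measurable

lemma cluster_size_dual_bound:
  assumes p: "1 / 2 < p" "p < 1"
  shows "\<exists>b. \<forall>x. (\<integral>\<^sup>+w. cluster_size (dual w) x \<partial>perc p) \<le> ennreal b"
proof -
  obtain S where S: "finite S" "(0, 0) \<in> S" "(1 - p) * phi (1 - p) S < 1" using subcritical_phi[of "1 - p"] p by auto
  have "(\<integral>\<^sup>+w. cluster_size (dual w) x \<partial>perc p) \<le> ennreal (card S / (1 - (1 - p) * phi (1 - p) S))" for x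
    using nn_dual[of p "\<lambda>w. cluster_size w x"] susceptibility[OF _ _ S, of x] p by (simp add: cluster_size_measurable)
  then show ?thesis by blast
qed

subsection \<open>The subadditive process\<close>

text \<open>Finite dual clusters make every route finite in cost; cluster points arbitrarily far to
  the right make \<open>first_cluster\<close> meaningful for every shift.\<close>

definition good :: "config \<Rightarrow> bool" where
  "good w \<longleftrightarrow> (\<forall>f. cluster_size (dual w) f < \<infinity>) \<and> (\<forall>m. \<exists>n\<ge>m. conn_inf w (int n, 0))"

definition first_cluster :: "config \<Rightarrow> nat" where
  "first_cluster w = (LEAST k. conn_inf w (int k, 0))"

text \<open>The truncation to \<open>0\<close> off the shift invariant event \<open>good\<close> keeps the process subadditive everywhere.\<close>

definition cluster_dist :: "nat \<Rightarrow> config \<Rightarrow> real" where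
  "cluster_dist n w = (if good w then real (the_enat (chem_dist w (int (first_cluster w), 0) (int (n + first_cluster (sft n w)), 0))) else 0)"

lemma conn_inf_sft: "conn_inf (sft n w) (int k, 0) \<longleftrightarrow> conn_inf w (int (n + k), 0)"
  unfolding sft_def conn_inf_tr by (simp add: tr_def add.commute)

lemma good_sft: "good (sft n w) \<longleftrightarrow> good w"
proof -
  have "(\<forall>f. cluster_size (dual (sft n w)) f < \<infinity>) \<longleftrightarrow> (\<forall>f. cluster_size (dual w) (tr (int n, 0) f) < \<infinity>)"
    unfolding sft_def dual_sh cluster_size_tr ..
  also have "\<dots> \<longleftrightarrow> (\<forall>f. cluster_size (dual w) f < \<infinity>)"
  proof
    assume a: "\<forall>f. cluster_size (dual w) (tr (int n, 0) f) < \<infinity>"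
    show "\<forall>f. cluster_size (dual w) f < \<infinity>"
    proof
      fix f
      have "f = tr (int n, 0) (fst f - int n, snd f)" by (simp add: tr_def)
      then show "cluster_size (dual w) f < \<infinity>" using a by metis
    qed
  qed auto
  finally have 1: "(\<forall>f. cluster_size (dual (sft n w)) f < \<infinity>) \<longleftrightarrow> (\<forall>f. cluster_size (dual w) f < \<infinity>)" .
  have 2: "(\<forall>m. \<exists>k\<ge>m. conn_inf (sft n w) (int k, 0)) \<longleftrightarrow> (\<forall>m. \<exists>k\<ge>m. conn_inf w (int k, 0))"
    unfolding conn_inf_sft
  proof (intro iffI allI)
    fix m assume "\<forall>m. \<exists>k\<ge>m. conn_inf w (int (n + k), 0)"
    then obtain k where "k \<ge> m" "conn_inf w (int (n + k), 0)" by blast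
    then show "\<exists>k\<ge>m. conn_inf w (int k, 0)" by (intro exI[of _ "n + k"]) auto
  next
    fix m assume "\<forall>m. \<exists>k\<ge>m. conn_inf w (int k, 0)"
    then obtain k where "k \<ge> n + m" "conn_inf w (int k, 0)" by blast
    then show "\<exists>k\<ge>m. conn_inf w (int (n + k), 0)" by (intro exI[of _ "k - n"]) auto
  qed
  show ?thesis unfolding good_def 1 2 ..
qed

lemma conn_inf_first_cluster: "good w \<Longrightarrow> conn_inf w (int (first_cluster w), 0)"
  unfolding first_cluster_def good_def by (metis LeastI)

lemma conn_inf_first_cluster_sft: "good w \<Longrightarrow> conn_inf w (int (n + first_cluster (sft n w)), 0)"
  using conn_inf_first_cluster[of "sft n w"] by (simp add: good_sft conn_inf_sft)

lemma first_cluster_0: "conn_inf w (0, 0) \<Longrightarrow> first_cluster w = 0"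
  unfolding first_cluster_def by (rule Least_eq_0) simp

lemma row_dist:
  assumes g: "good w" and ci: "conn_inf w (int a, 0)" "conn_inf w (int (a + k), 0)"
  shows "\<exists>N. chem_dist w (int a, 0) (int (a + k), 0) = enat N \<and> ennreal (real N) \<le> (\<Sum>i<k. Y (sft (a + i) w))"
  using g by (intro route_cost_chem_dist[OF route_cost_row _ ci]) (simp add: good_def)

lemma row_finite:
  assumes g: "good w" and ci: "conn_inf w (int a, 0)" "conn_inf w (int b, 0)"
  shows "chem_dist w (int a, 0) (int b, 0) \<noteq> \<infinity>"
proof (cases "a \<le> b")
  case True
  then show ?thesis using row_dist[OF g ci(1), of "b - a"] ci by auto
next
  case False
  have "chem_dist w (int b, 0) (int a, 0) \<noteq> \<infinity>" using row_dist[OF g ci(2), of "a - b"] ci False by auto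
  then obtain n where n: "chem_dist w (int b, 0) (int a, 0) = enat n" by auto
  then obtain xs where xs: "rtrancl_path (open_adj w) (int b, 0) xs (int a, 0)" using chem_dist_obtain by blast
  then have "conn w (int b, 0) (int a, 0)" unfolding rtranclp_eq_rtrancl_path by blast
  then have "conn w (int a, 0) (int b, 0)" by (rule conn_sym)
  then obtain ys where "rtrancl_path (open_adj w) (int a, 0) ys (int b, 0)" unfolding rtranclp_eq_rtrancl_path by blast
  from chem_dist_le_path[OF this] show ?thesis by (cases "chem_dist w (int a, 0) (int b, 0)") auto
qed

lemma cluster_dist_eq: "good w \<Longrightarrow> chem_dist w (int (first_cluster w), 0) (int (n + first_cluster (sft n w)), 0) = enat (the_enat (chem_dist w (int (first_cluster w), 0) (int (n + first_cluster (sft n w)), 0)))"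
  using row_finite[of w "first_cluster w" "n + first_cluster (sft n w)"] conn_inf_first_cluster[of w] conn_inf_first_cluster_sft[of w n] by (cases "chem_dist w (int (first_cluster w), 0) (int (n + first_cluster (sft n w)), 0)") auto

lemma cluster_dist_sub: "cluster_dist (m + n) w \<le> cluster_dist m w + cluster_dist n (sft m w)"
proof (cases "good w")
  case True
  have g': "good (sft m w)" using True by (simp add: good_sft)
  let ?a = "(int (first_cluster w), 0) :: vertex" and ?b = "(int (m + first_cluster (sft m w)), 0) :: vertex" and ?c = "(int (m + n + first_cluster (sft (m + n) w)), 0) :: vertex"
  have s: "sft n (sft m w) = sft (m + n) w" by (simp add: sft_add add.commute)
  have "chem_dist (sft m w) (int (first_cluster (sft m w)), 0) (int (n + first_cluster (sft n (sft m w))), 0) = chem_dist w ?b ?c"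
    unfolding s unfolding sft_def[of m w] chem_dist_tr by (simp add: tr_def sft_def algebra_simps)
  then have x2: "chem_dist w ?b ?c = enat (the_enat (chem_dist w ?b ?c))" "cluster_dist n (sft m w) = real (the_enat (chem_dist w ?b ?c))"
    using cluster_dist_eq[OF g', of n] g' by (simp_all add: cluster_dist_def)
  have x1: "chem_dist w ?a ?b = enat (the_enat (chem_dist w ?a ?b))" "cluster_dist m w = real (the_enat (chem_dist w ?a ?b))"
    using cluster_dist_eq[OF True, of m] True by (simp_all add: cluster_dist_def)
  have x3: "chem_dist w ?a ?c = enat (the_enat (chem_dist w ?a ?c))" "cluster_dist (m + n) w = real (the_enat (chem_dist w ?a ?c))"
    using cluster_dist_eq[OF True, of "m + n"] True by (simp_all add: cluster_dist_def)
  have "enat (the_enat (chem_dist w ?a ?c)) \<le> enat (the_enat (chem_dist w ?a ?b)) + enat (the_enat (chem_dist w ?b ?c))"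
    using chem_dist_triangle[of w ?a ?c ?b] x1(1) x2(1) x3(1) by simp
  then show ?thesis unfolding x1(2) x2(2) x3(2) by simp
qed (simp add: cluster_dist_def good_sft)

lemma pred_good [measurable]: "Measurable.pred (perc p) good"
proof -
  have "Measurable.pred (perc p) (\<lambda>w. cluster_size (dual w) f < \<infinity>)" for f by measurable
  then show ?thesis unfolding good_def
    by (intro pred_intros_logic pred_intros_countable pred_conn_inf) auto
qed

lemma measurable_first_cluster: "first_cluster \<in> measurable (perc p) (count_space UNIV)"
  unfolding first_cluster_def by (rule measurable_Least) (rule pred_conn_inf)

lemma measurable_cluster_dist: "cluster_dist n \<in> borel_measurable (perc p)"
proof -
  have f: "first_cluster \<in> measurable (perc p) (count_space UNIV)" by (rule measurable_first_cluster)
  have f2: "(\<lambda>w. first_cluster (sft n w)) \<in> measurable (perc p) (count_space UNIV)"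
    by (rule measurable_compose[OF measurable_sft measurable_first_cluster])
  have "(\<lambda>w. real (the_enat (chem_dist w (int a, 0) (int (n + b), 0)))) \<in> borel_measurable (perc p)" for a b
    by (rule measurable_compose[OF measurable_chem_dist]) simp
  then have "(\<lambda>w. real (the_enat (chem_dist w (int a, 0) (int (n + first_cluster (sft n w)), 0)))) \<in> borel_measurable (perc p)" for a
    by (rule measurable_compose_countable[OF _ f2])
  then have "(\<lambda>w. real (the_enat (chem_dist w (int (first_cluster w), 0) (int (n + first_cluster (sft n w)), 0)))) \<in> borel_measurable (perc p)"
    by (rule measurable_compose_countable[OF _ f])
  then show ?thesis unfolding cluster_dist_def by (intro measurable_If) (use pred_good[of p] in \<open>auto simp: pred_def\<close>)
qed

text \<open>Kac's argument: the excursion between consecutive cluster points on the axis is charged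
  to the columns it covers, so its expected cost is at most that of a single column.\<close>

lemma kac: "(\<integral>\<^sup>+w. ennreal (cluster_dist 1 w) \<partial>perc p) \<le> (\<integral>\<^sup>+w. Y w \<partial>perc p)"
proof -
  \<comment> \<open>\<open>A i\<close>: the origin is a cluster point and column \<open>i\<close>
    belongs to the excursion that starts there. \<open>B i\<close> is the same event seen from
    column \<open>i\<close>. For a given configuration at most one \<open>B i\<close> holds, since
    \<open>i\<close> is the distance back to the last cluster point.\<close>
  define A where "A i w \<longleftrightarrow> conn_inf w (0, 0) \<and> (\<forall>j\<in>{1..i}. \<not> conn_inf w (int j, 0))" for i :: nat and w
  define B where "B i w \<longleftrightarrow> conn_inf w (- int i, 0) \<and> (\<forall>j\<in>{1..i}. \<not> conn_inf w (int j - int i, 0))" for i :: nat and w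
  have Bm: "Measurable.pred (perc p) (B i)" for i
    unfolding B_def by (intro pred_intros_logic pred_intros_finite pred_conn_inf) auto
  have AB: "A i w \<longleftrightarrow> B i (sft i w)" for i w
    unfolding A_def B_def sft_def conn_inf_tr by (simp add: tr_def)
  define f where "f i w = indicator {w. B i w} w * Y w" for i w
  have fm [measurable]: "f i \<in> borel_measurable (perc p)" for i
    unfolding f_def using Bm[of i] by (intro borel_measurable_times_ennreal measurable_Y borel_measurable_indicator) (simp add: pred_def)
  have le: "ennreal (cluster_dist 1 w) \<le> (\<Sum>i. f i (sft i w))" for w
  proof (cases "good w \<and> conn_inf w (0, 0)")
    case True
    then have g: "good w" and c0: "conn_inf w (0, 0)" by auto
    define k where "k = 1 + first_cluster (sft 1 w)"
    have ck: "conn_inf w (int k, 0)" using conn_inf_first_cluster_sft[OF g, of 1] by (simp add: k_def)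
    have Ai: "A i w" if "i < k" for i
      unfolding A_def
    proof (intro conjI ballI c0)
      fix j assume j: "j \<in> {1..i}"
      have "\<not> conn_inf (sft 1 w) (int (j - 1), 0)"
        unfolding first_cluster_def by (rule not_less_Least) (use j that in \<open>auto simp: k_def first_cluster_def\<close>)
      then show "\<not> conn_inf w (int j, 0)" using j by (simp add: conn_inf_sft)
    qed
    obtain N where N: "chem_dist w (int 0, 0) (int (0 + k), 0) = enat N" "ennreal (real N) \<le> (\<Sum>i<k. Y (sft (0 + i) w))"
      using row_dist[OF g, of 0 k] c0 ck by auto
    have "ennreal (cluster_dist 1 w) = ennreal (real N)" using g N(1) by (simp add: cluster_dist_def first_cluster_0[OF c0] k_def)
    also have "\<dots> \<le> (\<Sum>i<k. Y (sft i w))" using N(2) by simp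
    also have "\<dots> = (\<Sum>i<k. f i (sft i w))" using Ai by (intro sum.cong) (auto simp: f_def AB)
    also have "\<dots> \<le> (\<Sum>i. f i (sft i w))" by (rule sum_le_suminf) auto
    finally show ?thesis .
  next
    case False
    \<comment> \<open>If the origin is not a cluster point, the first cluster points to the right of
      0 and of 1 coincide.\<close>
    have "cluster_dist 1 w = 0"
    proof (cases "good w")
      case True
      then have n0: "\<not> conn_inf w (0, 0)" using False by simp
      have "first_cluster w = Suc (LEAST k. conn_inf w (int (Suc k), 0))"
        unfolding first_cluster_def using conn_inf_first_cluster[OF True] n0 by (intro Least_Suc[of _ "first_cluster w"]) auto
      also have "\<dots> = 1 + first_cluster (sft 1 w)" by (simp add: first_cluster_def conn_inf_sft)
      finally show ?thesis by (simp add: cluster_dist_def)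
    qed (simp add: cluster_dist_def)
    then show ?thesis by simp
  qed
  have sB: "(\<Sum>i. indicator {w. B i w} w) \<le> (1 :: ennreal)" for w
  proof (rule suminf_le_const)
    show "summable (\<lambda>i. indicator {w. B i w} w :: ennreal)" by (rule summableI)
    fix n
    have u: "i = i'" if "B i w" "B i' w" for i i'
    proof -
      have aux: False if "B i w" "B i' w" "i < i'" for i i'
      proof -
        have "i' - i \<in> {1..i'}" using that by auto
        then have "\<not> conn_inf w (int (i' - i) - int i', 0)" using that(2) unfolding B_def by blast
        moreover have "int (i' - i) - int i' = - int i" using that(3) by simp
        ultimately show False using that(1) by (simp add: B_def)
      qed
      show ?thesis using that aux by (metis nat_neq_iff)
    qed
    show "(\<Sum>i<n. indicator {w. B i w} w) \<le> (1 :: ennreal)"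
    proof (cases "\<exists>i<n. B i w")
      case True
      then obtain i where i: "i < n" "B i w" by blast
      have "(\<Sum>i<n. indicator {w. B i w} w) = (\<Sum>j\<in>{i}. indicator {w. B j w} w :: ennreal)"
        by (rule sum.mono_neutral_right) (use i u in \<open>auto simp: indicator_def\<close>)
      also have "\<dots> = 1" using i by simp
      finally show ?thesis by simp
    next
      case False
      then have "(\<Sum>i<n. indicator {w. B i w} w) = (0 :: ennreal)" by (intro sum.neutral) (auto simp: indicator_def)
      then show ?thesis by simp
    qed
  qed
  have "(\<integral>\<^sup>+w. ennreal (cluster_dist 1 w) \<partial>perc p) \<le> (\<integral>\<^sup>+w. (\<Sum>i. f i (sft i w)) \<partial>perc p)"
    by (rule nn_integral_mono) (rule le)
  also have "\<dots> = (\<Sum>i. \<integral>\<^sup>+w. f i (sft i w) \<partial>perc p)"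
    by (rule nn_integral_suminf) measurable
  also have "\<dots> = (\<Sum>i. \<integral>\<^sup>+w. f i w \<partial>perc p)" by (simp add: nn_sft)
  also have "\<dots> = (\<integral>\<^sup>+w. (\<Sum>i. f i w) \<partial>perc p)"
    by (rule nn_integral_suminf[symmetric]) measurable
  also have "\<dots> \<le> (\<integral>\<^sup>+w. Y w \<partial>perc p)"
  proof (rule nn_integral_mono)
    fix w
    have "(\<Sum>i. f i w) = (\<Sum>i. indicator {w. B i w} w) * Y w" unfolding f_def by (rule ennreal_suminf_multc)
    also have "\<dots> \<le> 1 * Y w" using sB by (rule mult_right_mono) simp
    finally show "(\<Sum>i. f i w) \<le> Y w" by simp
  qed
  finally show ?thesis .
qed

lemma Y_finite:
  assumes p: "1 / 2 < p" "p < 1"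
  shows "(\<integral>\<^sup>+w. Y w \<partial>perc p) < \<infinity>"
proof -
  obtain b where b: "(\<integral>\<^sup>+w. cluster_size (dual w) (0, 0) \<partial>perc p) \<le> ennreal b" using cluster_size_dual_bound[OF p] by blast
  interpret P: prob_space "perc p" by (rule prob_space_perc)
  have "(\<integral>\<^sup>+w. Y w \<partial>perc p) = 1 + 4 * (\<integral>\<^sup>+w. cluster_size (dual w) (0, 0) \<partial>perc p)"
    unfolding Y_def using P.emeasure_space_1 by (subst nn_integral_add) (auto simp: nn_integral_cmult)
  also have "\<dots> \<le> 1 + 4 * ennreal b" using b by (intro add_left_mono mult_left_mono) auto
  also have "\<dots> < \<infinity>" by (simp add: ennreal_mult_less_top)
  finally show ?thesis .
qed

lemma cluster_dist_subadditive:
  assumes p: "1 / 2 < p" "p < 1"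
  shows "subadditive p cluster_dist"
proof
  show "0 \<le> p" "p \<le> 1" using p by auto
  show "cluster_dist n \<in> borel_measurable (perc p)" for n by (rule measurable_cluster_dist)
  show "cluster_dist n w \<ge> 0" for n w by (simp add: cluster_dist_def)
  show "cluster_dist 0 w = 0" for w by (simp add: cluster_dist_def)
  show "cluster_dist (m + n) w \<le> cluster_dist m w + cluster_dist n (sft m w)" for m n w by (rule cluster_dist_sub)
  show "integrable (perc p) (cluster_dist 1)"
  proof (rule integrableI_bounded[OF measurable_cluster_dist])
    have "(\<integral>\<^sup>+w. ennreal (norm (cluster_dist 1 w)) \<partial>perc p) = (\<integral>\<^sup>+w. ennreal (cluster_dist 1 w) \<partial>perc p)" by (simp add: cluster_dist_def)
    then show "(\<integral>\<^sup>+w. ennreal (norm (cluster_dist 1 w)) \<partial>perc p) < \<infinity>" using kac[of p] Y_finite[OF p] by simp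
  qed
qed

lemma AE_good:
  assumes p: "1 / 2 < p" "p < 1" and pos: "Pr p (\<lambda>w. conn_inf w (0, 0)) > 0"
  shows "AE w in perc p. good w"
proof -
  have 1: "AE w in perc p. cluster_size (dual w) f < \<infinity>" for f
  proof -
    obtain b where b: "(\<integral>\<^sup>+w. cluster_size (dual w) f \<partial>perc p) \<le> ennreal b" using cluster_size_dual_bound[OF p] by blast
    then have "(\<integral>\<^sup>+w. cluster_size (dual w) f \<partial>perc p) \<noteq> \<infinity>" by (auto simp: top_unique)
    then have "AE w in perc p. cluster_size (dual w) f \<noteq> \<infinity>" by (intro nn_integral_PInf_AE) auto
    then show ?thesis by (simp add: less_top)
  qed
  define A where "A = {w. conn_inf w (0, 0)}"
  have As: "A \<in> sets (perc p)" using pred_conn_inf[where p = p and x = "(0, 0)"] by (simp add: A_def pred_def)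
  have "measure (perc p) A > 0" using pos by (simp add: Pr_measure A_def)
  from recurrence[OF _ _ As this] have "AE w in perc p. \<forall>m. \<exists>n\<ge>m. sft n w \<in> A" using p by auto
  then have 2: "AE w in perc p. \<forall>m. \<exists>n\<ge>m. conn_inf w (int n, 0)"
    by eventually_elim (auto simp: A_def sft_def conn_inf_tr)
  have "AE w in perc p. \<forall>f. cluster_size (dual w) f < \<infinity>" using 1 by (simp add: AE_all_countable)
  with 2 show ?thesis by eventually_elim (auto simp: good_def)
qed

text \<open>At a cluster point no search to the right is needed, so along the subsequence
  \<open>T1 w\<close> the process equals the distance from the origin.\<close>

lemma T1_limit:
  assumes g: "good w" and c0: "conn_inf w (0, 0)" and lim: "(\<lambda>n. cluster_dist n w / real n) \<longlonglongrightarrow> \<mu>"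
  shows "(\<lambda>k. ereal_of_enat (chem_dist w (0, 0) (int (T1 w k), 0)) / ereal (real (T1 w k))) \<longlonglongrightarrow> ereal \<mu>"
proof -
  let ?S = "{i::nat. 1 \<le> i \<and> conn_inf w (int i, 0)}"
  have infS: "infinite ?S"
  proof -
    have "\<exists>n>m. n \<in> ?S" for m
    proof -
      obtain n where "n \<ge> Suc m" "conn_inf w (int n, 0)" using g unfolding good_def by blast
      then show ?thesis by (intro exI[of _ n]) auto
    qed
    then show ?thesis by (auto simp: infinite_nat_iff_unbounded)
  qed
  have T1in: "T1 w k \<in> ?S" for k unfolding T1_def by (rule enumerate_in_set[OF infS])
  have T1m: "strict_mono (T1 w)" unfolding T1_def by (rule strict_mono_enumerate[OF infS])
  have eq: "ereal_of_enat (chem_dist w (0, 0) (int (T1 w k), 0)) / ereal (real (T1 w k)) = ereal (cluster_dist (T1 w k) w / real (T1 w k))" for k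
  proof -
    have c: "conn_inf w (int (T1 w k), 0)" and k1: "T1 w k \<ge> 1" using T1in[of k] by auto
    have f: "first_cluster (sft (T1 w k) w) = 0" using c conn_inf_sft[of "T1 w k" w 0] by (intro first_cluster_0) simp
    have "chem_dist w (0, 0) (int (T1 w k), 0) = enat (the_enat (chem_dist w (0, 0) (int (T1 w k), 0)))"
      using cluster_dist_eq[OF g, of "T1 w k"] by (simp add: first_cluster_0[OF c0] f)
    then have "ereal_of_enat (chem_dist w (0, 0) (int (T1 w k), 0)) = ereal (cluster_dist (T1 w k) w)"
      using g by (cases "chem_dist w (0, 0) (int (T1 w k), 0)") (simp_all add: cluster_dist_def first_cluster_0[OF c0] f)
    then show ?thesis using k1 by simp
  qed
  have "(\<lambda>k. cluster_dist (T1 w k) w / real (T1 w k)) \<longlonglongrightarrow> \<mu>"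
    using LIMSEQ_subseq_LIMSEQ[OF lim T1m] by (simp add: o_def)
  then show ?thesis unfolding eq by simp
qed

subsection \<open>Product weights on finite sets of slopes\<close>

text \<open>The mean of \<open>f\<close> over a random subset of \<open>W\<close> that contains each
  \<open>i\<close> independently with probability \<open>q i\<close>.\<close>

definition slope_mean :: "int set \<Rightarrow> (int \<Rightarrow> real) \<Rightarrow> (int set \<Rightarrow> real) \<Rightarrow> real" where
  "slope_mean W q f = (\<Sum>A\<in>Pow W. (\<Prod>i\<in>W. if i \<in> A then q i else 1 - q i) * f A)"

lemma slope_mean_insert:
  assumes "finite W" "x \<notin> W"
  shows "slope_mean (insert x W) q f = q x * slope_mean W q (\<lambda>A. f (insert x A)) + (1 - q x) * slope_mean W q f"
proof -
  let ?t = "\<lambda>V A. \<Prod>i\<in>V. if i \<in> A then q i else 1 - q i"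
  have d: "Pow W \<inter> insert x ` Pow W = {}" using assms(2) by auto
  have i: "inj_on (insert x) (Pow W)" using assms(2) by (intro inj_onI) (metis Diff_insert_absorb PowD in_mono)
  have t1: "?t (insert x W) A = (1 - q x) * ?t W A" if "A \<in> Pow W" for A
    using assms that by (subst prod.insert) auto
  have t2: "?t (insert x W) (insert x A) = q x * ?t W A" if "A \<in> Pow W" for A
  proof -
    have "?t W (insert x A) = ?t W A" using assms(2) by (intro prod.cong) auto
    then show ?thesis using assms by (subst prod.insert) auto
  qed
  have "slope_mean (insert x W) q f = (\<Sum>A\<in>Pow W. ?t (insert x W) A * f A) + (\<Sum>A\<in>insert x ` Pow W. ?t (insert x W) A * f A)"
    unfolding slope_mean_def Pow_insert using assms d by (subst sum.union_disjoint) auto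
  also have "(\<Sum>A\<in>insert x ` Pow W. ?t (insert x W) A * f A) = (\<Sum>A\<in>Pow W. ?t (insert x W) (insert x A) * f (insert x A))"
    by (simp add: sum.reindex[OF i])
  also have "\<dots> = (\<Sum>A\<in>Pow W. q x * ?t W A * f (insert x A))" by (rule sum.cong[OF refl]) (simp only: t2)
  also have "(\<Sum>A\<in>Pow W. ?t (insert x W) A * f A) = (\<Sum>A\<in>Pow W. (1 - q x) * ?t W A * f A)"
    by (rule sum.cong[OF refl]) (simp only: t1)
  finally show ?thesis unfolding slope_mean_def by (simp add: sum_distrib_left mult.assoc)
qed

lemma slope_mean_cong:
  assumes "\<And>i. i \<in> W \<Longrightarrow> q i = q' i" "\<And>A. A \<subseteq> W \<Longrightarrow> f A = f' A"
  shows "slope_mean W q f = slope_mean W q' f'"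
  unfolding slope_mean_def by (intro sum.cong refl arg_cong2[where f = "(*)"] prod.cong) (use assms in auto)

lemma slope_mean_lin: "slope_mean W q (\<lambda>A. a * f A + b * g A) = a * slope_mean W q f + b * slope_mean W q g"
  unfolding slope_mean_def by (simp add: sum_distrib_left sum.distrib algebra_simps)

lemma slope_mean_const: "finite W \<Longrightarrow> slope_mean W q (\<lambda>_. c) = c"
proof (induction W rule: finite_induct)
  case empty show ?case by (simp add: slope_mean_def)
next
  case (insert x W)
  then show ?case by (simp add: slope_mean_insert algebra_simps)
qed

text \<open>An element \<open>j\<close> of a slope set stands for an up step from row
  \<open>j\<close> to row \<open>j + 1\<close>. Raising a local minimum at row \<open>r\<close>
  turns the steps down, up around it into up, down.\<close>

definition swp :: "int \<Rightarrow> int set \<Rightarrow> int set" where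
  "swp r A = insert (r - 1) (A - {r})"

definition lmin :: "int \<Rightarrow> int set \<Rightarrow> bool" where
  "lmin r A \<longleftrightarrow> r - 1 \<notin> A \<and> r \<in> A"

text \<open>The Burke property of the exclusion process: it keeps the slopes independent, so that the expected
  growth can be computed in every column.\<close>

lemma burke:
  assumes W: "finite W" "r - 1 \<in> W" "r \<in> W" and q: "q (r - 1) = al" "q r = rh"
    and bal: "(1 - al) * rh * (1 - e) = al * (1 - rh)"
  shows "slope_mean W q (\<lambda>A. (1 - e) * c A + e * (if lmin r A then c (swp r A) else c A)) = slope_mean W (q(r - 1 := rh, r := al)) c"
    and "slope_mean W q (\<lambda>A. of_bool (lmin r A)) = (1 - al) * rh"
proof -
  define W0 where "W0 = W - {r - 1, r}"
  have W0: "W = insert (r - 1) (insert r W0)" "finite W0" "r \<notin> W0" "r - 1 \<notin> insert r W0"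
    using W by (auto simp: W0_def)
  let ?q = "q(r - 1 := rh, r := al)"
  have X: "slope_mean W q' f = q' (r - 1) * (q' r * slope_mean W0 q' (\<lambda>A. f (insert (r - 1) (insert r A))) + (1 - q' r) * slope_mean W0 q' (\<lambda>A. f (insert (r - 1) A)))
      + (1 - q' (r - 1)) * (q' r * slope_mean W0 q' (\<lambda>A. f (insert r A)) + (1 - q' r) * slope_mean W0 q' f)" for q' f
    unfolding W0(1) using W0(2-4) by (subst slope_mean_insert; simp add: slope_mean_insert)
  have Q: "slope_mean W0 ?q f = slope_mean W0 q f" for f by (rule slope_mean_cong) (auto simp: W0_def)
  let ?f = "\<lambda>A. (1 - e) * c A + e * (if lmin r A then c (swp r A) else c A)"
  define c0 c1 c2 c3 where "c0 = slope_mean W0 q c" and "c1 = slope_mean W0 q (\<lambda>A. c (insert (r - 1) A))"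
    and "c2 = slope_mean W0 q (\<lambda>A. c (insert r A))" and "c3 = slope_mean W0 q (\<lambda>A. c (insert (r - 1) (insert r A)))"
  have s: "swp r (insert r A) = insert (r - 1) A" if "A \<subseteq> W0" for A using that W0 by (auto simp: swp_def)
  have f3: "slope_mean W0 q (\<lambda>A. ?f (insert (r - 1) (insert r A))) = c3"
    unfolding c3_def by (rule slope_mean_cong) (auto simp: lmin_def algebra_simps)
  have f1: "slope_mean W0 q (\<lambda>A. ?f (insert (r - 1) A)) = c1"
    unfolding c1_def by (rule slope_mean_cong) (auto simp: lmin_def algebra_simps)
  have f0: "slope_mean W0 q ?f = c0"
    unfolding c0_def by (rule slope_mean_cong) (use W0 in \<open>auto simp: lmin_def algebra_simps\<close>)
  have "slope_mean W0 q (\<lambda>A. ?f (insert r A)) = slope_mean W0 q (\<lambda>A. (1 - e) * c (insert r A) + e * c (insert (r - 1) A))"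
    by (rule slope_mean_cong[OF refl]) (use W0 s in \<open>auto simp: lmin_def\<close>)
  then have f2: "slope_mean W0 q (\<lambda>A. ?f (insert r A)) = (1 - e) * c2 + e * c1"
    unfolding c1_def c2_def slope_mean_lin .
  have "slope_mean W q ?f = al * (rh * c3 + (1 - rh) * c1) + (1 - al) * (rh * ((1 - e) * c2 + e * c1) + (1 - rh) * c0)"
    unfolding X[of q ?f] f0 f1 f2 f3 q ..
  \<comment> \<open>The deviation from the exchanged product measure is a multiple of
    \<open>c2 - c1\<close>, and \<open>bal\<close> is the vanishing of its coefficient.\<close>
  also have "\<dots> = rh * (al * c3 + (1 - al) * c1) + (1 - rh) * (al * c2 + (1 - al) * c0) + (((1 - al) * rh * (1 - e) - al * (1 - rh)) * (c2 - c1))"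
    by algebra
  also have "\<dots> = slope_mean W ?q c"
    unfolding X[of ?q c] Q using bal by (simp add: c0_def c1_def c2_def c3_def)
  finally show "slope_mean W q ?f = slope_mean W ?q c" .
  let ?g = "\<lambda>A. of_bool (lmin r A) :: real"
  have g: "slope_mean W0 q (\<lambda>A. ?g (insert (r - 1) (insert r A))) = slope_mean W0 q (\<lambda>_. 0)" "slope_mean W0 q (\<lambda>A. ?g (insert (r - 1) A)) = slope_mean W0 q (\<lambda>_. 0)"
    "slope_mean W0 q ?g = slope_mean W0 q (\<lambda>_. 0)" "slope_mean W0 q (\<lambda>A. ?g (insert r A)) = slope_mean W0 q (\<lambda>_. 1)"
    by (rule slope_mean_cong; use W0 in \<open>auto simp: lmin_def\<close>)+
  show "slope_mean W q ?g = (1 - al) * rh" unfolding X[of q ?g] g slope_mean_const[OF W0(2)] by (simp add: q)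
qed

subsection \<open>The counting process along a list of edges\<close>

definition row :: "edge \<Rightarrow> int" where
  "row e = snd (fst e)"

text \<open>The height gained in row 0 while the edges are processed in the given order; by
  \<open>run_cnt\<close> it depends on the initial profile only through its slopes.\<close>

primrec cnt :: "config \<Rightarrow> edge list \<Rightarrow> int set \<Rightarrow> int" where
  "cnt w [] A = 0"
| "cnt w (e # es) A = (if \<not> w e \<and> lmin (row e) A then (if row e = 0 then 2 else 0) + cnt w es (swp (row e) A) else cnt w es A)"

text \<open>Every edge, when its turn comes, finds the densities \<open>al\<close> below and
  \<open>rh\<close> above its row. By \<open>burke\<close> it leaves them exchanged, which is the
  product measure for the next edge.\<close>

primrec compat :: "int set \<Rightarrow> real \<Rightarrow> real \<Rightarrow> (int \<Rightarrow> real) \<Rightarrow> edge list \<Rightarrow> bool" where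
  "compat W al rh q [] = True"
| "compat W al rh q (e # es) = (row e - 1 \<in> W \<and> row e \<in> W \<and> q (row e - 1) = al \<and> q (row e) = rh \<and>
     compat W al rh (q(row e - 1 := rh, row e := al)) es)"

lemma dep_cnt: "dep (set es) (\<lambda>w. cnt w es A)"
proof (induction es arbitrary: A)
  case (Cons e es)
  show ?case unfolding dep_def
  proof (intro allI impI)
    fix w w' :: config assume ag: "\<forall>e'\<in>set (e # es). w e' = w' e'"
    have "cnt w es B = cnt w' es B" for B by (rule depD[OF Cons.IH]) (use ag in auto)
    then show "cnt w (e # es) A = cnt w' (e # es) A" using ag by simp
  qed
qed simp

lemma cnt_bounds: "0 \<le> cnt w es A \<and> cnt w es A \<le> 2 * int (length (filter (\<lambda>e. row e = 0) es))"
proof (induction es arbitrary: A)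
  case (Cons e es)
  show ?case using Cons.IH[of A] Cons.IH[of "swp (row e) A"] by auto
qed simp

lemma expected_cnt:
  assumes p: "0 \<le> p" "p \<le> 1" and W: "finite W" and bal: "(1 - al) * rh * p = al * (1 - rh)"
  shows "distinct es \<Longrightarrow> compat W al rh q es \<Longrightarrow>
    slope_mean W q (\<lambda>A. EE p (\<lambda>w. real_of_int (cnt w es A))) = real (length (filter (\<lambda>e. row e = 0) es)) * (2 * (1 - p) * (1 - al) * rh)"
proof (induction es arbitrary: q)
  case Nil
  show ?case by (simp add: EE_def slope_mean_const[OF W])
next
  case (Cons e es)
  let ?r = "row e"
  define c where "c A = EE p (\<lambda>w. real_of_int (cnt w es A))" for A
  have e: "e \<notin> set es" using Cons.prems by simp
  have dc: "dep (set es) (\<lambda>w. real_of_int (cnt w es A))" for A by (rule dep_comp[OF dep_cnt])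
  have ic: "integrable (perc p) (\<lambda>w. real_of_int (cnt w es A))" for A by (rule dep_finite_integrable[OF _ dc]) simp
  interpret P: prob_space "perc p" by (rule prob_space_perc)
  have cu: "cnt (upd e b w) es A = cnt w es A" for b w A using dep_upd_notin[OF dep_cnt e] .
  have EC: "EE p (\<lambda>w. real_of_int (cnt w (e # es) A)) =
      ((1 - (1 - p)) * c A + (1 - p) * (if lmin ?r A then c (swp ?r A) else c A)) + (1 - p) * (if ?r = 0 then 2 else 0) * of_bool (lmin ?r A)" for A
  proof -
    have "EE p (\<lambda>w. real_of_int (cnt w (e # es) A)) = p * EE p (\<lambda>w. real_of_int (cnt (upd e True w) (e # es) A)) + (1 - p) * EE p (\<lambda>w. real_of_int (cnt (upd e False w) (e # es) A))"
      by (rule resample_fin[OF _ dep_comp[OF dep_cnt] p]) simp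
    also have "EE p (\<lambda>w. real_of_int (cnt (upd e True w) (e # es) A)) = c A" by (simp add: cu c_def)
    also have "EE p (\<lambda>w. real_of_int (cnt (upd e False w) (e # es) A)) = (if lmin ?r A then (if ?r = 0 then 2 else 0) + c (swp ?r A) else c A)"
      using ic P.prob_space by (auto simp: cu c_def EE_def)
    finally show ?thesis by (cases "lmin ?r A") (simp_all add: algebra_simps del: cnt.simps)
  qed
  have cp: "?r - 1 \<in> W" "?r \<in> W" "q (?r - 1) = al" "q ?r = rh" "compat W al rh (q(?r - 1 := rh, ?r := al)) es"
    using Cons.prems by auto
  have bal': "(1 - al) * rh * (1 - (1 - p)) = al * (1 - rh)" using bal by simp
  note b = burke[OF W cp(1-4) bal']
  let ?f = "\<lambda>A. (1 - (1 - p)) * c A + (1 - p) * (if lmin ?r A then c (swp ?r A) else c A)"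
  have "slope_mean W q (\<lambda>A. EE p (\<lambda>w. real_of_int (cnt w (e # es) A))) = slope_mean W q (\<lambda>A. 1 * ?f A + ((1 - p) * (if ?r = 0 then 2 else 0)) * of_bool (lmin ?r A))"
    by (rule slope_mean_cong) (simp_all only: EC mult_1)
  also have "\<dots> = 1 * slope_mean W q ?f + ((1 - p) * (if ?r = 0 then 2 else 0)) * slope_mean W q (\<lambda>A. of_bool (lmin ?r A))"
    by (rule slope_mean_lin)
  also have "\<dots> = slope_mean W (q(?r - 1 := rh, ?r := al)) c + ((1 - p) * (if ?r = 0 then 2 else 0)) * ((1 - al) * rh)"
    unfolding b by simp
  also have "slope_mean W (q(?r - 1 := rh, ?r := al)) c = real (length (filter (\<lambda>e. row e = 0) es)) * (2 * (1 - p) * (1 - al) * rh)"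
    unfolding c_def[abs_def] by (rule Cons.IH[OF _ cp(5)]) (use Cons.prems in simp)
  finally show ?case by (cases "?r = 0") (simp_all add: algebra_simps del: cnt.simps)
qed

text \<open>Rows of equal parity use disjoint pairs of slopes, so one round simply exchanges the
  densities in each pair.\<close>

lemma compat_rows:
  assumes "distinct ls" "\<And>r. r \<in> set ls \<Longrightarrow> even (r + s) \<and> q (r - 1) = al \<and> q r = rh \<and> r - 1 \<in> W \<and> r \<in> W"
  shows "compat W al rh q (map (\<lambda>r. ((x, r), True)) ls @ es) =
    compat W al rh (\<lambda>i. if i \<in> set ls then al else if i + 1 \<in> set ls then rh else q i) es"
  using assms
proof (induction ls arbitrary: q)
  case (Cons r ls)
  let ?q = "q(r - 1 := rh, r := al)"
  have r: "even (r + s)" "q (r - 1) = al" "q r = rh" "r - 1 \<in> W" "r \<in> W" using Cons.prems(2)[of r] by auto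
  have far: "r' \<noteq> r \<and> r' \<noteq> r - 1 \<and> r' - 1 \<noteq> r \<and> r' - 1 \<noteq> r - 1" if "r' \<in> set ls" for r'
  proof -
    have "even (r' + s)" "r' \<noteq> r" using Cons.prems that by auto
    then have "r' - r \<noteq> 1" "r' - r \<noteq> - 1" using r(1) by presburger+
    then show ?thesis using \<open>r' \<noteq> r\<close> by auto
  qed
  have IH: "compat W al rh ?q (map (\<lambda>r. ((x, r), True)) ls @ es) =
    compat W al rh (\<lambda>i. if i \<in> set ls then al else if i + 1 \<in> set ls then rh else ?q i) es"
    by (rule Cons.IH) (use Cons.prems far in auto)
  have eq: "(\<lambda>i. if i \<in> set ls then al else if i + 1 \<in> set ls then rh else ?q i) =
    (\<lambda>i. if i \<in> set (r # ls) then al else if i + 1 \<in> set (r # ls) then rh else q i)"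
  proof
    fix i
    have "i \<in> set ls \<Longrightarrow> i \<noteq> r - 1" using far by blast
    moreover have "i + 1 \<in> set ls \<Longrightarrow> i \<noteq> r" using far[of "i + 1"] by auto
    ultimately show "(if i \<in> set ls then al else if i + 1 \<in> set ls then rh else ?q i) =
      (if i \<in> set (r # ls) then al else if i + 1 \<in> set (r # ls) then rh else q i)" by auto
  qed
  show ?case using r IH unfolding eq by (simp add: row_def)
qed simp

text \<open>The window shrinks by two rows at each of the two flipping rounds of a column, so no boundary condition is needed.\<close>

definition rows :: "int \<Rightarrow> int \<Rightarrow> int list" where
  "rows m s = filter (\<lambda>r. even (r + s)) [- (m - 1)..m - 1]"

text \<open>Even rows and then odd rows: each round exchanges \<open>al\<close> and
  \<open>rh\<close> between the two parities, so after a column the densities are restored on the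
  smaller window.\<close>

definition col :: "nat \<Rightarrow> nat \<Rightarrow> edge list" where
  "col n x = map (\<lambda>r. ((int x, r), True)) (rows (4 * (int n - int x)) 0) @ map (\<lambda>r. ((int x, r), True)) (rows (4 * (int n - int x) - 2) 1)"

definition cols :: "nat \<Rightarrow> nat \<Rightarrow> nat \<Rightarrow> edge list" where
  "cols n x k = concat (map (col n) [x..<x + k])"

lemma set_rows: "r \<in> set (rows m s) \<longleftrightarrow> \<bar>r\<bar> \<le> m - 1 \<and> even (r + s)"
  by (auto simp: rows_def)

lemma distinct_rows: "distinct (rows m s)"
  by (simp add: rows_def)

lemma compat_stage:
  assumes q: "\<And>i. \<bar>i\<bar> \<le> m \<Longrightarrow> q i = (if even (i + s) then rh else al)" and W: "{- m..m} \<subseteq> W"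
    and nxt: "\<And>q'. (\<And>i. \<bar>i\<bar> \<le> m - 2 \<Longrightarrow> q' i = (if even (i + s) then al else rh)) \<Longrightarrow> compat W al rh q' es"
  shows "compat W al rh q (map (\<lambda>r. ((x, r), True)) (rows m s) @ es)"
proof (subst compat_rows[OF distinct_rows, where s = s])
  fix r assume r: "r \<in> set (rows m s)"
  then have b: "\<bar>r\<bar> \<le> m" "\<bar>r - 1\<bar> \<le> m" "even (r + s)" by (auto simp: set_rows)
  then have "odd (r - 1 + s)" by (metis add.commute add_diff_eq dvd_add_right_iff even_diff odd_one)
  moreover have "r \<in> {- m..m}" "r - 1 \<in> {- m..m}" using b unfolding atLeastAtMost_iff by linarith+
  then have "r \<in> W" "r - 1 \<in> W" using W by blast+
  ultimately show "even (r + s) \<and> q (r - 1) = al \<and> q r = rh \<and> r - 1 \<in> W \<and> r \<in> W"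
    using q[OF b(1)] q[OF b(2)] b by auto
next
  show "compat W al rh (\<lambda>i. if i \<in> set (rows m s) then al else if i + 1 \<in> set (rows m s) then rh else q i) es"
  proof (rule nxt)
    fix i :: int assume i: "\<bar>i\<bar> \<le> m - 2"
    show "(if i \<in> set (rows m s) then al else if i + 1 \<in> set (rows m s) then rh else q i) = (if even (i + s) then al else rh)"
    proof (cases "even (i + s)")
      case True
      then show ?thesis using i by (auto simp: set_rows)
    next
      case False
      then have "even (i + 1 + s)" by simp
      then show ?thesis using i False by (auto simp: set_rows)
    qed
  qed
qed

lemma compat_cols:
  assumes "x + k = n" and q: "\<And>i. \<bar>i\<bar> \<le> 4 * int k \<Longrightarrow> q i = (if even i then rh else al)" and W: "{- 4 * int n..4 * int n} \<subseteq> W"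
  shows "compat W al rh q (cols n x k)"
  using assms(1,2)
proof (induction k arbitrary: x q)
  case 0 then show ?case by (simp add: cols_def)
next
  case (Suc k)
  let ?m = "4 * int (Suc k)"
  have m: "4 * (int n - int x) = ?m" using Suc.prems(1) by auto
  have sub: "{- ?m..?m} \<subseteq> W" "{- (?m - 2)..?m - 2} \<subseteq> W" using W Suc.prems(1) by auto
  have c: "cols n x (Suc k) = map (\<lambda>r. ((int x, r), True)) (rows ?m 0) @ (map (\<lambda>r. ((int x, r), True)) (rows (?m - 2) 1) @ cols n (Suc x) k)"
  proof -
    have "[x..<x + Suc k] = x # [Suc x..<Suc x + k]" by (simp add: upt_conv_Cons)
    then show ?thesis by (simp only: cols_def col_def m list.map concat.simps append_assoc)
  qed
  show ?case unfolding c
  proof (rule compat_stage[OF _ sub(1)])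
    show "q i = (if even (i + 0) then rh else al)" if "\<bar>i\<bar> \<le> ?m" for i using Suc.prems(2) that by simp
  next
    fix q' assume q': "\<And>i. \<bar>i\<bar> \<le> ?m - 2 \<Longrightarrow> q' i = (if even (i + 0) then al else rh)"
    show "compat W al rh q' (map (\<lambda>r. ((int x, r), True)) (rows (?m - 2) 1) @ cols n (Suc x) k)"
    proof (rule compat_stage[OF _ sub(2)])
      show "q' i = (if even (i + 1) then rh else al)" if "\<bar>i\<bar> \<le> ?m - 2" for i using q'[OF that] by simp
    next
      fix q'' assume q'': "\<And>i. \<bar>i\<bar> \<le> ?m - 2 - 2 \<Longrightarrow> q'' i = (if even (i + 1) then al else rh)"
      show "compat W al rh q'' (cols n (Suc x) k)"
        by (rule Suc.IH) (use Suc.prems q'' in auto)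
    qed
  qed
qed

lemma set_col: "e \<in> set (col n x) \<Longrightarrow> \<exists>r. e = ((int x, r), True)"
  by (auto simp: col_def)

lemma distinct_col: "distinct (col n x)"
  unfolding col_def using distinct_rows
  by (auto simp: distinct_map inj_on_def set_rows)

lemma distinct_cols: "distinct (cols n x k)"
proof (induction k)
  case (Suc k)
  have "cols n x (Suc k) = cols n x k @ col n (x + k)" by (simp add: cols_def)
  moreover have "set (cols n x k) \<inter> set (col n (x + k)) = {}" unfolding cols_def by (auto dest!: set_col)
  ultimately show ?case using Suc distinct_col by simp
qed (simp add: cols_def)

lemma row0_col: "length (filter (\<lambda>e. row e = 0) (col n x)) \<le> 1" "x < n \<Longrightarrow> length (filter (\<lambda>e. row e = 0) (col n x)) = 1"
proof -
  have f: "length (filter (\<lambda>e. row e = 0) (map (\<lambda>r. ((int x, r), True)) ls)) = length (filter (\<lambda>r. r = 0) ls)" for ls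
    by (induction ls) (auto simp: row_def)
  have g: "length (filter (\<lambda>r. r = 0) ls) = of_bool (0 \<in> set ls)" if "distinct ls" for ls :: "int list"
    using that by (induction ls) (auto simp: filter_empty_conv)
  have "length (filter (\<lambda>e. row e = 0) (col n x)) = of_bool (0 \<in> set (rows (4 * (int n - int x)) 0)) + of_bool (0 \<in> set (rows (4 * (int n - int x) - 2) 1))"
    unfolding col_def filter_append length_append f g[OF distinct_rows] ..
  then show "length (filter (\<lambda>e. row e = 0) (col n x)) \<le> 1" "x < n \<Longrightarrow> length (filter (\<lambda>e. row e = 0) (col n x)) = 1"
    by (auto simp: set_rows)
qed

lemma row0_cols: "x + k \<le> n \<Longrightarrow> length (filter (\<lambda>e. row e = 0) (cols n x k)) = k"
proof (induction k)
  case (Suc k)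
  have "cols n x (Suc k) = cols n x k @ col n (x + k)" by (simp add: cols_def)
  then show ?case using Suc row0_col(2)[of "x + k" n] by simp
qed (simp add: cols_def)

subsection \<open>Height functions below the chemical distance\<close>

definition zig :: "(int \<Rightarrow> int) \<Rightarrow> bool" where
  "zig h \<longleftrightarrow> (\<forall>j. \<bar>h (j + 1) - h j\<bar> = 1)"

definition slopes :: "(int \<Rightarrow> int) \<Rightarrow> int set" where
  "slopes h = {j. h (j + 1) = h j + 1}"

definition flp :: "int \<Rightarrow> (int \<Rightarrow> int) \<Rightarrow> int \<Rightarrow> int" where
  "flp r h = (if h (r - 1) = h r + 1 \<and> h (r + 1) = h r + 1 then h(r := h r + 2) else h)"

primrec run :: "config \<Rightarrow> edge list \<Rightarrow> (int \<Rightarrow> int) \<Rightarrow> int \<Rightarrow> int" where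
  "run w [] h = h"
| "run w (e # es) h = run w es (if w e then h else flp (row e) h)"

lemma run_append: "run w (es @ fs) h = run w fs (run w es h)"
  by (induction es arbitrary: h) auto

lemma zig_step: "zig h \<Longrightarrow> h (j + 1) = h j + 1 \<or> h (j + 1) = h j - 1"
  unfolding zig_def by (drule spec[of _ j]) arith

lemma flp_lmin: "zig h \<Longrightarrow> (h (r - 1) = h r + 1 \<and> h (r + 1) = h r + 1) \<longleftrightarrow> lmin r (slopes h)"
  using zig_step[of h "r - 1"] unfolding lmin_def slopes_def mem_Collect_eq by (simp only: diff_add_cancel) arith

lemma zig_flp: assumes "zig h" shows "zig (flp r h)"
proof (cases "h (r - 1) = h r + 1 \<and> h (r + 1) = h r + 1")
  case True
  have "\<bar>(h(r := h r + 2)) (j + 1) - (h(r := h r + 2)) j\<bar> = 1" for j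
  proof -
    consider "j = r" | "j = r - 1" | "j \<noteq> r" "j + 1 \<noteq> r" by force
    then show ?thesis by cases (use True assms in \<open>auto simp: zig_def\<close>)
  qed
  then show ?thesis using True by (simp add: flp_def zig_def)
qed (use assms in \<open>simp only: flp_def if_False\<close>)

lemma slopes_flp: assumes "zig h" "lmin r (slopes h)" shows "slopes (flp r h) = swp r (slopes h)"
proof -
  have m: "h (r - 1) = h r + 1 \<and> h (r + 1) = h r + 1" using flp_lmin assms by blast
  have "j \<in> slopes (flp r h) \<longleftrightarrow> j \<in> swp r (slopes h)" for j
  proof -
    consider "j = r" | "j = r - 1" | "j \<noteq> r" "j + 1 \<noteq> r" by force
    then show ?thesis by cases (use m in \<open>auto simp: slopes_def swp_def flp_def\<close>)
  qed
  then show ?thesis by blast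
qed

lemma flp_notmin: "zig h \<Longrightarrow> \<not> lmin r (slopes h) \<Longrightarrow> flp r h = h"
  using flp_lmin[of h r] by (simp only: flp_def if_False)

lemma zig_run: "zig h \<Longrightarrow> zig (run w es h)"
  by (induction es arbitrary: h) (auto simp: zig_flp)

lemma flp_0: "lmin r (slopes h) \<Longrightarrow> zig h \<Longrightarrow> flp r h 0 = h 0 + (if r = 0 then 2 else 0)"
  using flp_lmin[of h r] by (auto simp: flp_def)

lemma run_cnt: "zig h \<Longrightarrow> run w es h 0 = h 0 + cnt w es (slopes h)"
proof (induction es arbitrary: h)
  case (Cons e es)
  show ?case
  proof (cases "\<not> w e \<and> lmin (row e) (slopes h)")
    case True
    have "run w (e # es) h 0 = flp (row e) h 0 + cnt w es (slopes (flp (row e) h))"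
      using True Cons.IH[OF zig_flp[OF Cons.prems]] by simp
    then show ?thesis using True slopes_flp[OF Cons.prems] flp_0[OF _ Cons.prems, of "row e"] by simp
  next
    case False
    then have "(if w e then h else flp (row e) h) = h" using flp_notmin[OF Cons.prems] by auto
    then show ?thesis using Cons.IH[OF Cons.prems] False by (simp only: run.simps cnt.simps if_False)
  qed
qed simp

lemma run_ge: "h j \<le> run w es h j"
proof (induction es arbitrary: h)
  case (Cons e es)
  have "h j \<le> (if w e then h else flp (row e) h) j" by (auto simp: flp_def)
  also have "\<dots> \<le> run w (e # es) h j" using Cons.IH[of "if w e then h else flp (row e) h"] by simp
  finally show ?case .
qed simp

lemma run_open: "(\<And>e. e \<in> set es \<Longrightarrow> row e = j \<Longrightarrow> w e) \<Longrightarrow> run w es h j = h j"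
proof (induction es arbitrary: h)
  case (Cons e es)
  have "run w (e # es) h j = (if w e then h else flp (row e) h) j" using Cons by simp
  also have "\<dots> = h j" using Cons.prems[of e] by (auto simp: flp_def)
  finally show ?case .
qed simp

text \<open>Along an open edge, \<open>x + potential_height w n h x j\<close> grows by at most 1, which makes it a lower bound for the chemical distance.\<close>

definition potential_height :: "config \<Rightarrow> nat \<Rightarrow> (int \<Rightarrow> int) \<Rightarrow> int \<Rightarrow> int \<Rightarrow> int" where
  "potential_height w n h x j = run w (cols n 0 (nat x)) h j"

lemma potential_height_step: "x \<ge> 0 \<Longrightarrow> potential_height w n h (x + 1) j = run w (col n (nat x)) (potential_height w n h x) j"
  by (simp add: potential_height_def[abs_def] cols_def nat_add_distrib run_append)

lemma potential_height_mono: "potential_height w n h x j \<le> potential_height w n h (x + 1) j"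
proof (cases "x \<ge> 0")
  case True show ?thesis unfolding potential_height_step[OF True] by (rule run_ge)
qed (simp add: potential_height_def)

lemma potential_height_right: "w ((x, j), True) \<Longrightarrow> potential_height w n h (x + 1) j = potential_height w n h x j"
proof (cases "x \<ge> 0")
  case True
  assume o: "w ((x, j), True)"
  show ?thesis unfolding potential_height_step[OF True]
  proof (rule run_open)
    fix e assume "e \<in> set (col n (nat x))" "row e = j"
    then show "w e" using set_col[of e n "nat x"] o True by (auto simp: row_def)
  qed
qed (simp add: potential_height_def)

lemma potential_height_zig: "zig h \<Longrightarrow> zig (potential_height w n h x)"
  unfolding potential_height_def[abs_def] by (rule zig_run)

text \<open>A vertical step changes the height by 1 whether its edge is open or not. A step to the
  right along an open edge keeps the height, and a step to the left lowers \<open>x\<close> without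
  raising the height, which is nondecreasing in \<open>x\<close>.\<close>

lemma potential_height_adj:
  assumes z: "zig h" and a: "open_adj w u v"
  shows "fst v + potential_height w n h (fst v) (snd v) \<le> fst u + potential_height w n h (fst u) (snd u) + 1"
proof -
  have zz: "\<bar>potential_height w n h x (j + 1) - potential_height w n h x j\<bar> = 1" for x j using potential_height_zig[OF z, of w n x] by (simp add: zig_def)
  from a consider "v = (fst u + 1, snd u)" "w (u, True)" | "u = (fst v + 1, snd v)" "w (v, True)"
    | "v = (fst u, snd u + 1)" | "u = (fst v, snd v + 1)"
    unfolding open_adj_def by blast
  then show ?thesis
  proof cases
    case 1
    then show ?thesis using potential_height_right[of w "fst u" "snd u" n h] by simp
  next
    case 2
    have "potential_height w n h (fst v) (snd v) \<le> potential_height w n h (fst v + 1) (snd v)" by (rule potential_height_mono)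
    moreover have "fst u = fst v + 1" "snd u = snd v" using 2 by auto
    ultimately show ?thesis by simp
  next
    case 3
    then have "fst v = fst u" "snd v = snd u + 1" by auto
    then show ?thesis using zz[of "fst u" "snd u"] by simp
  next
    case 4
    then have "fst u = fst v" "snd u = snd v + 1" by auto
    then show ?thesis using zz[of "fst v" "snd v"] by simp
  qed
qed

lemma potential_height_path:
  assumes z: "zig h"
  shows "rtrancl_path (open_adj w) u xs v \<Longrightarrow> fst v + potential_height w n h (fst v) (snd v) \<le> fst u + potential_height w n h (fst u) (snd u) + int (length xs)"
proof (induction rule: rtrancl_path.induct)
  case (step x y ys z')
  then show ?case using potential_height_adj[OF z step(1), of n] by simp
qed simp

lemma potential_height_le: "zig h \<Longrightarrow> potential_height w n h (int k) 0 \<le> h 0 + 2 * int k"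
proof (induction k)
  case 0 then show ?case by (simp add: potential_height_def cols_def)
next
  case (Suc k)
  have "potential_height w n h (int k + 1) 0 = run w (col n k) (potential_height w n h (int k)) 0" using potential_height_step[of "int k" w n h 0] by simp
  also have "\<dots> = potential_height w n h (int k) 0 + cnt w (col n k) (slopes (potential_height w n h (int k)))"
    by (rule run_cnt[OF potential_height_zig[OF Suc.prems]])
  also have "cnt w (col n k) (slopes (potential_height w n h (int k))) \<le> 2"
    using cnt_bounds[of w "col n k" "slopes (potential_height w n h (int k))"] row0_col(1)[of n k] by linarith
  finally show ?case using Suc by (simp add: add.commute)
qed

lemma potential_height_mono': "x \<le> y \<Longrightarrow> potential_height w n h x j \<le> potential_height w n h y j"
proof (induction y rule: int_ge_induct)
  case (step i) then show ?case using potential_height_mono[of w n h i j] by simp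
qed simp

lemma exists_zig: "\<exists>h. zig h \<and> slopes h = A"
proof -
  define h where "h j = (if j \<ge> 0 then (\<Sum>i\<in>{0..<j}. if i \<in> A then 1 else -1) else - (\<Sum>i\<in>{j..<0}. if i \<in> A then 1 else -1 :: int))" for j :: int
  have st: "h (j + 1) - h j = (if j \<in> A then 1 else -1)" for j
  proof (cases "j \<ge> 0")
    case True
    then have "{0..<j + 1} = insert j {0..<j}" by auto
    then show ?thesis using True by (simp add: h_def)
  next
    case False
    then have "{j..<0} = insert j {j + 1..<0}" by auto
    then show ?thesis using False by (cases "j = - 1") (simp_all add: h_def)
  qed
  have "zig h" unfolding zig_def using st by auto
  moreover have "slopes h = A" unfolding slopes_def
  proof (intro equalityI subsetI)
    fix j assume "j \<in> {j. h (j + 1) = h j + 1}" then show "j \<in> A" using st[of j] by (auto split: if_splits)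
  next
    fix j assume "j \<in> A" then show "j \<in> {j. h (j + 1) = h j + 1}" using st[of j] by simp
  qed
  ultimately show ?thesis by blast
qed

text \<open>The path starts at column \<open>first_cluster w\<close> instead of 0. There the
  potential may already have grown by 3 per column, 1 from \<open>x\<close> and at most 2 from the
  height. The bound holds for every slope set \<open>A\<close>, so it can be averaged over the
  stationary one.\<close>

lemma cluster_dist_lower:
  assumes g: "good w"
  shows "cluster_dist n w + 3 * real (first_cluster w) \<ge> real n + real_of_int (cnt w (cols n 0 n) A)"
proof -
  obtain h where h: "zig h" "slopes h = A" using exists_zig by blast
  let ?k = "first_cluster w" and ?l = "first_cluster (sft n w)"
  obtain N where N: "chem_dist w (int ?k, 0) (int (n + ?l), 0) = enat N" using cluster_dist_eq[OF g, of n] by auto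
  obtain xs where xs: "rtrancl_path (open_adj w) (int ?k, 0) xs (int (n + ?l), 0)" "length xs = N" using chem_dist_obtain[OF N] .
  have X: "cluster_dist n w = real N" using g N by (simp add: cluster_dist_def)
  have "int (n + ?l) + potential_height w n h (int (n + ?l)) 0 \<le> int ?k + potential_height w n h (int ?k) 0 + int N"
    using potential_height_path[OF h(1) xs(1), of n] xs(2) by simp
  moreover have "potential_height w n h (int ?k) 0 \<le> h 0 + 2 * int ?k" by (rule potential_height_le[OF h(1)])
  moreover have "potential_height w n h (int n) 0 \<le> potential_height w n h (int (n + ?l)) 0" by (rule potential_height_mono') simp
  moreover have "potential_height w n h (int n) 0 = h 0 + cnt w (cols n 0 n) A"
    unfolding potential_height_def using run_cnt[OF h(1)] h(2) by simp
  ultimately have "int n + cnt w (cols n 0 n) A \<le> int N + 3 * int ?k" by linarith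
  then have "real_of_int (int n + cnt w (cols n 0 n) A) \<le> real_of_int (int N + 3 * int ?k)" by (simp only: of_int_le_iff)
  then show ?thesis by (simp add: X)
qed

theorem lower_bound:
  assumes p: "1 / 2 < p" "p < 1" and good: "AE w in perc p. good w"
    and lim: "AE w in perc p. (\<lambda>n. cluster_dist n w / real n) \<longlonglongrightarrow> \<mu>"
  shows "\<mu> \<ge> 1 + (1 - p) / 2"
proof -
  interpret P: prob_space "perc p" by (rule prob_space_perc)
  \<comment> \<open>With \<open>rh = 1 / 2\<close> the balance condition of \<open>burke\<close>
    forces this density, which tends to 1/2 as \<open>p\<close> tends to 1. The growth rate becomes
    \<open>(1 - p) / (1 + p)\<close>, at least \<open>(1 - p) / 2\<close>.\<close>
  define al where "al = p / (1 + p)"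
  have bal: "(1 - al) * (1 / 2) * p = al * (1 - 1 / 2)" using p by (simp add: al_def field_simps)
  have rate: "2 * (1 - p) * (1 - al) * (1 / 2) = (1 - p) / (1 + p)" using p by (simp add: al_def field_simps)
  define q where "q i = (if even i then 1 / 2 else al)" for i :: int
  define W where "W n = {- 4 * int n..4 * int n}" for n
  have q01: "0 \<le> q i" "q i \<le> 1" for i using p by (auto simp: q_def al_def field_simps)
  define wt where "wt n A = (\<Prod>i\<in>W n. if i \<in> A then q i else 1 - q i)" for n A
  have wt0: "wt n A \<ge> 0" for n A unfolding wt_def using q01 by (intro prod_nonneg) auto
  have finW: "finite (W n)" for n by (simp add: W_def)
  have wt1: "(\<Sum>A\<in>Pow (W n). wt n A) = 1" for n using slope_mean_const[OF finW, of n q 1] by (simp add: slope_mean_def wt_def)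
  define C where "C n w = (\<Sum>A\<in>Pow (W n). wt n A * real_of_int (cnt w (cols n 0 n) A))" for n w
  have ic: "integrable (perc p) (\<lambda>w. real_of_int (cnt w (cols n 0 n) A))" for n A
    by (rule dep_finite_integrable[OF _ dep_comp[OF dep_cnt]]) simp
  have iC: "integrable (perc p) (C n)" for n
    unfolding C_def using ic by (intro Bochner_Integration.integrable_sum integrable_mult_right)
  have EC: "EE p (C n) = real n * ((1 - p) / (1 + p))" for n
  proof -
    have "EE p (C n) = slope_mean (W n) q (\<lambda>A. EE p (\<lambda>w. real_of_int (cnt w (cols n 0 n) A)))"
      unfolding C_def slope_mean_def wt_def[symmetric] using finW ic by (subst EE_sum) (auto simp: EE_def)
    also have "\<dots> = real (length (filter (\<lambda>e. row e = 0) (cols n 0 n))) * (2 * (1 - p) * (1 - al) * (1 / 2))"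
    proof (rule expected_cnt[OF _ _ finW bal distinct_cols])
      show "compat (W n) al (1 / 2) q (cols n 0 n)" by (rule compat_cols) (auto simp: q_def W_def)
    qed (use p in auto)
    finally show ?thesis unfolding rate by (simp add: row0_cols)
  qed
  have C_le: "C n w \<le> 2 * real n" for n w
  proof -
    have "real_of_int (cnt w (cols n 0 n) A) \<le> 2 * real n" for A
    proof -
      have "cnt w (cols n 0 n) A \<le> 2 * int n" using cnt_bounds[of w "cols n 0 n" A] by (simp add: row0_cols)
      then have "real_of_int (cnt w (cols n 0 n) A) \<le> real_of_int (2 * int n)" by (simp only: of_int_le_iff)
      then show ?thesis by simp
    qed
    then have "C n w \<le> (\<Sum>A\<in>Pow (W n). wt n A * (2 * real n))"
      unfolding C_def using wt0 by (intro sum_mono mult_left_mono)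
    also have "\<dots> = 2 * real n" by (simp only: sum_distrib_right[symmetric] wt1 mult_1)
    finally show ?thesis .
  qed
  have XC: "cluster_dist n w + 3 * real (first_cluster w) \<ge> real n + C n w" if "good w" for n w
  proof -
    have "real n + C n w = (\<Sum>A\<in>Pow (W n). wt n A * (real n + real_of_int (cnt w (cols n 0 n) A)))"
      unfolding C_def by (simp add: distrib_left sum.distrib sum_distrib_right[symmetric] wt1)
    also have "\<dots> \<le> (\<Sum>A\<in>Pow (W n). wt n A * (cluster_dist n w + 3 * real (first_cluster w)))"
      using wt0 cluster_dist_lower[OF that] by (intro sum_mono mult_left_mono)
    also have "\<dots> = cluster_dist n w + 3 * real (first_cluster w)" by (simp only: sum_distrib_right[symmetric] wt1 mult_1)
    finally show ?thesis .
  qed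
  \<comment> \<open>Truncation allows dominated convergence. The level 3 costs nothing, because the
    lower bound \<open>1 + C n w / n\<close> is at most 3.\<close>
  define f where "f n w = min 3 (cluster_dist n w / real n + 3 * real (first_cluster w) / real n)" for n w
  have fm: "f n \<in> borel_measurable (perc p)" for n
  proof -
    have "(\<lambda>w. real (first_cluster w)) \<in> borel_measurable (perc p)" by (rule measurable_compose[OF measurable_first_cluster]) simp
    then show ?thesis unfolding f_def using measurable_cluster_dist[of n p]
      by (intro borel_measurable_min borel_measurable_add borel_measurable_divide borel_measurable_times) auto
  qed
  have f0: "\<bar>f n w\<bar> \<le> 3" for n w by (auto simp: f_def cluster_dist_def min_def abs_le_iff)
  have "(\<lambda>n. EE p (f n)) \<longlonglongrightarrow> EE p (\<lambda>_. min 3 \<mu>)"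
    unfolding EE_def
  proof (rule integral_dominated_convergence[where w = "\<lambda>_. 3"])
    show "AE w in perc p. (\<lambda>n. f n w) \<longlonglongrightarrow> min 3 \<mu>"
      using lim
    proof eventually_elim
      case (elim w)
      have "(\<lambda>n. 3 * real (first_cluster w) / real n) \<longlonglongrightarrow> 0" by (rule lim_const_over_n)
      from tendsto_min[OF tendsto_const[of 3] tendsto_add[OF elim this]] show ?case by (simp add: f_def)
    qed
  qed (use fm f0 in auto)
  then have l: "(\<lambda>n. EE p (f n)) \<longlonglongrightarrow> min 3 \<mu>" by simp
  have "1 + (1 - p) / (1 + p) \<le> EE p (f n)" if n: "n \<ge> 1" for n
  proof -
    have "1 + (1 - p) / (1 + p) = EE p (\<lambda>w. 1 + C n w / real n)"
      unfolding EE_def using iC P.prob_space EC[of n] n by (simp add: EE_def)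
    also have "\<dots> \<le> EE p (f n)"
      unfolding EE_def
    proof (rule integral_mono_AE)
      show "integrable (perc p) (\<lambda>w. 1 + C n w / real n)" using iC by simp
      show "integrable (perc p) (f n)" by (rule integrable_bdd[OF fm f0])
      show "AE w in perc p. 1 + C n w / real n \<le> f n w"
        using good
      proof eventually_elim
        case (elim w)
        have "(real n + C n w) / real n \<le> (cluster_dist n w + 3 * real (first_cluster w)) / real n" using XC[OF elim] by (rule divide_right_mono) simp
        moreover have "C n w / real n \<le> 2" using C_le[of n w] n by (simp add: divide_le_eq)
        ultimately show ?case using n by (simp add: f_def add_divide_distrib)
      qed
    qed
    finally show ?thesis .
  qed
  then have "1 + (1 - p) / (1 + p) \<le> min 3 \<mu>" by (intro LIMSEQ_le_const[OF l]) blast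
  moreover have "(1 - p) / 2 \<le> (1 - p) / (1 + p)" using p by (intro divide_left_mono) auto
  ultimately show ?thesis by linarith
qed

subsection \<open>The open exclusion process and its stationary weights\<close>

primrec row_height :: "bool list \<Rightarrow> int \<Rightarrow> nat \<Rightarrow> int" where
  "row_height [] a j = a"
| "row_height (x # s) a j = (case j of 0 \<Rightarrow> a | Suc i \<Rightarrow> row_height s (a + (if x then 1 else -1)) i)"

text \<open>Raises row \<open>j + 1\<close>. The top row has a neighbour only below, so its last
  step becomes up in any case; for the exclusion process this is a reservoir with the same rate as
  the bulk.\<close>

fun raise_bulk :: "nat \<Rightarrow> bool list \<Rightarrow> bool list" where
  "raise_bulk j [] = []"
| "raise_bulk 0 [x] = [True]"
| "raise_bulk 0 (x # y # b) = (if \<not> x \<and> y then True # False # b else x # y # b)"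
| "raise_bulk (Suc j) (x # s) = x # raise_bulk j s"

text \<open>A slope list describes a height profile on rows \<open>0, \<dots>, K\<close>, with \<open>True\<close> for an upward step.\<close>

primrec raise_min :: "nat \<Rightarrow> bool list \<Rightarrow> bool list" where
  "raise_min 0 s = False # tl s"
| "raise_min (Suc j) s = raise_bulk j s"

lemma row_height_0 [simp]: "row_height s a 0 = a"
  by (cases s) auto

lemma length_raise_bulk [simp]: "length (raise_bulk j s) = length s"
  by (induction j s rule: raise_bulk.induct) auto

lemma length_raise_min [simp]: "s \<noteq> [] \<Longrightarrow> length (raise_min j s) = length s"
  by (cases j) auto

lemma row_height_ge: "row_height s a j \<ge> a - int j"
proof (induction s arbitrary: a j)
  case (Cons x s)
  show ?case
  proof (cases j)
    case (Suc i)
    then show ?thesis using Cons.IH[of "a + (if x then 1 else -1)" i] by (simp split: if_splits)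
  qed simp
qed simp

lemma row_height_raise_bulk: "i \<noteq> Suc j \<Longrightarrow> i \<le> length s \<Longrightarrow> row_height (raise_bulk j s) a i = row_height s a i"
proof (induction j s arbitrary: a i rule: raise_bulk.induct)
  case (2 x) then show ?case by (cases i) auto
next
  case (3 x y b)
  then show ?case
  proof (cases i)
    case (Suc k)
    then show ?thesis using 3 by (cases k) auto
  qed simp
next
  case (4 j x s)
  then show ?case by (cases i) auto
qed simp

lemma row_height_raise_bulk_Suc:
  "j < length s \<Longrightarrow> \<exists>i\<le>length s. (i = j \<or> i = j + 2) \<and> row_height (raise_bulk j s) a (Suc j) = row_height s a i + 1"
proof (induction j s arbitrary: a rule: raise_bulk.induct)
  case (2 x) then show ?case by (intro exI[of _ 0]) simp
next
  case (3 x y b)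
  show ?case
  proof (cases "x \<or> y")
    case True
    then show ?thesis by (intro exI[of _ 0]) auto
  next
    case False
    then show ?thesis by (intro exI[of _ 2]) (simp add: numeral_2_eq_2)
  qed
next
  case (4 j x s)
  then obtain i where i: "i \<le> length s" "i = j \<or> i = j + 2" "row_height (raise_bulk j s) (a + (if x then 1 else -1)) (Suc j) = row_height s (a + (if x then 1 else -1)) i + 1"
    by (metis Suc_less_SucD length_Cons)
  show ?case by (rule exI[of _ "Suc i"]) (use i in auto)
qed simp

text \<open>Profiles are measured from row 0, so a flip in that row appears as a change of the base
  while the other rows keep their heights.\<close>

definition gain :: "nat \<Rightarrow> bool list \<Rightarrow> int" where
  "gain j s = (if j = 0 \<and> hd s then 2 else 0)"

lemma row_height_raise_min:
  assumes "s \<noteq> []" "i \<noteq> j" "i \<le> length s"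
  shows "row_height (raise_min j s) (a + gain j s) i = row_height s a i"
proof (cases j)
  case 0
  then obtain k where "i = Suc k" using assms(2) by (cases i) auto
  then show ?thesis using 0 assms(1) by (cases s) (auto simp: gain_def add.commute)
next
  case (Suc k)
  then show ?thesis using row_height_raise_bulk[of i k s a] assms by (simp add: gain_def)
qed

text \<open>True whether or not a flip takes place: a raised minimum lies one above its neighbours,
  and a row that is no local minimum already has a neighbour one below. The row can thus be entered
  from that neighbour at the cost of one step.\<close>

lemma row_height_raise_min_same:
  assumes "s \<noteq> []" "j \<le> length s"
  shows "\<exists>i\<le>length s. (j = Suc i \<or> i = Suc j) \<and> row_height (raise_min j s) (a + gain j s) j = row_height s a i + 1"
proof (cases j)
  case 0
  then show ?thesis using assms by (intro exI[of _ 1]) (cases s; auto simp: gain_def)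
next
  case (Suc k)
  then show ?thesis using row_height_raise_bulk_Suc[of k s a] assms by (auto simp: gain_def)
qed

section \<open>Sums over slope lists and the matrix product stationary weights\<close>

primrec lsum :: "nat \<Rightarrow> (bool list \<Rightarrow> real) \<Rightarrow> real" where
  "lsum 0 G = G []"
| "lsum (Suc n) G = lsum n (\<lambda>s. G (True # s)) + lsum n (\<lambda>s. G (False # s))"

lemma lsum_add: "lsum n (\<lambda>s. F s + G s) = lsum n F + lsum n G"
  by (induction n arbitrary: F G) auto

lemma lsum_cmul: "lsum n (\<lambda>s. c * F s) = c * lsum n F"
  by (induction n arbitrary: F) (auto simp: distrib_left)

lemma lsum_0 [simp]: "lsum n (\<lambda>s. 0) = 0"
  by (induction n) auto

lemma lsum_cong: "(\<And>s. length s = n \<Longrightarrow> F s = G s) \<Longrightarrow> lsum n F = lsum n G"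
proof (induction n arbitrary: F G)
  case (Suc n)
  have "lsum n (\<lambda>s. F (b # s)) = lsum n (\<lambda>s. G (b # s))" for b by (rule Suc.IH) (simp add: Suc.prems)
  then show ?case by simp
qed simp

lemma lsum_mono: "(\<And>s. length s = n \<Longrightarrow> F s \<le> G s) \<Longrightarrow> lsum n F \<le> lsum n G"
proof (induction n arbitrary: F G)
  case (Suc n)
  have "lsum n (\<lambda>s. F (b # s)) \<le> lsum n (\<lambda>s. G (b # s))" for b by (rule Suc.IH) (simp add: Suc.prems)
  then show ?case by (simp add: add_mono)
qed simp

text \<open>Matrix product weights: \<open>D v k = v k + v (k + 1)\<close> and \<open>E v k = v k + v (k - 1)\<close> satisfy
  \<open>D E = D + E\<close>.\<close>

primrec wt :: "bool list \<Rightarrow> nat \<Rightarrow> real" where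
  "wt [] k = (if k = 0 then 1 else 0)"
| "wt (x # s) k = (if x then wt s k + (if k = 0 then 0 else wt s (k - 1)) else wt s k + wt s (k + 1))"

lemma wt_nonneg: "wt s k \<ge> 0"
  by (induction s arbitrary: k) auto

lemma wt_DE: "wt (False # True # b) k = wt (False # b) k + wt (True # b) k"
  by simp

text \<open>By \<open>D E = D + E\<close> the contributions of the bonds telescope.\<close>

lemma bulk_sum:
  "lsum (Suc n) (\<lambda>s. wt s k * (\<Sum>j<Suc n. G (raise_bulk j s) - G s)) = lsum n (\<lambda>b. wt b k * (G (True # b) - G (False # b)))"
proof (induction n arbitrary: k G)
  case 0
  show ?case by simp
next
  case (Suc n)
  let ?S = "\<lambda>x s. \<Sum>j<Suc n. G (x # raise_bulk j s) - G (x # s)"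
  have split: "(\<Sum>j<Suc (Suc n). G (raise_bulk j (x # s)) - G (x # s)) = (G (raise_bulk 0 (x # s)) - G (x # s)) + ?S x s" for x s
    by (simp only: sum.lessThan_Suc_shift raise_bulk.simps)
  have IH: "lsum (Suc n) (\<lambda>s. wt s k * ?S x s) = lsum n (\<lambda>b. wt b k * (G (x # True # b) - G (x # False # b)))" for x k
    by (rule Suc.IH)
  have T: "lsum (Suc n) (\<lambda>s. wt (True # s) k * ?S True s) = lsum n (\<lambda>b. wt (True # b) k * (G (True # True # b) - G (True # False # b)))"
  proof (cases k)
    case 0
    show ?thesis by (simp only: 0 wt.simps if_True add_0_right simp_thms IH)
  next
    case (Suc i)
    have w: "wt (True # s) k = wt s k + wt s i" for s using Suc by simp
    show ?thesis by (simp only: w distrib_right lsum_add IH)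
  qed
  have F: "lsum (Suc n) (\<lambda>s. wt (False # s) k * ?S False s) = lsum n (\<lambda>b. wt (False # b) k * (G (False # True # b) - G (False # False # b)))"
  proof -
    have w: "wt (False # s) k = wt s k + wt s (k + 1)" for s by simp
    show ?thesis by (simp only: w distrib_right lsum_add IH)
  qed
  have b1: "G (raise_bulk 0 (True # s)) - G (True # s) = 0" if "length s = Suc n" for s using that by (cases s) auto
  have "lsum (Suc (Suc n)) (\<lambda>s. wt s k * (\<Sum>j<Suc (Suc n). G (raise_bulk j s) - G s)) =
      lsum (Suc n) (\<lambda>s. wt (True # s) k * (G (raise_bulk 0 (True # s)) - G (True # s)) + wt (True # s) k * ?S True s)
      + lsum (Suc n) (\<lambda>s. wt (False # s) k * (G (raise_bulk 0 (False # s)) - G (False # s)) + wt (False # s) k * ?S False s)"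
    unfolding lsum.simps(2)[of "Suc n"] split distrib_left ..
  also have "lsum (Suc n) (\<lambda>s. wt (True # s) k * (G (raise_bulk 0 (True # s)) - G (True # s)) + wt (True # s) k * ?S True s)
      = lsum (Suc n) (\<lambda>s. wt (True # s) k * ?S True s)"
    by (rule lsum_cong) (simp only: b1 mult_zero_right add_0_left)
  also have "lsum (Suc n) (\<lambda>s. wt (False # s) k * (G (raise_bulk 0 (False # s)) - G (False # s)) + wt (False # s) k * ?S False s)
      = lsum n (\<lambda>b. wt (False # True # b) k * (G (True # False # b) - G (False # True # b))) + lsum (Suc n) (\<lambda>s. wt (False # s) k * ?S False s)"
    unfolding lsum_add by simp
  also have "lsum (Suc n) (\<lambda>s. wt (True # s) k * ?S True s) + (lsum n (\<lambda>b. wt (False # True # b) k * (G (True # False # b) - G (False # True # b))) + lsum (Suc n) (\<lambda>s. wt (False # s) k * ?S False s))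
      = lsum n (\<lambda>b. wt (True # b) k * (G (True # True # b) - G (True # False # b)) + ((wt (False # b) k + wt (True # b) k) * (G (True # False # b) - G (False # True # b)) + wt (False # b) k * (G (False # True # b) - G (False # False # b))))"
    unfolding T F wt_DE by (simp only: lsum_add)
  also have "\<dots> = lsum n (\<lambda>b. wt (True # b) k * (G (True # True # b) - G (False # True # b)) + wt (False # b) k * (G (True # False # b) - G (False # False # b)))"
    by (rule lsum_cong) (simp only: algebra_simps)
  finally show ?case by (simp only: lsum.simps lsum_add)
qed

text \<open>At index 0 the operator \<open>D\<close> acts trivially,
  \<open>wt (True # b) 0 = wt b 0\<close>. The flips of the bottom row therefore cancel exactly what
  is left of the telescoping sum in \<open>bulk_sum\<close>.\<close>

lemma stationary:
  "lsum (Suc n) (\<lambda>s. wt s 0 * (\<Sum>j\<le>Suc n. G (raise_min j s) - G s)) = 0"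
proof -
  have "(\<Sum>j\<le>Suc n. G (raise_min j s) - G s) = (G (False # tl s) - G s) + (\<Sum>j<Suc n. G (raise_bulk j s) - G s)" for s
    by (simp only: lessThan_Suc_atMost[symmetric] sum.lessThan_Suc_shift raise_min.simps)
  then have "lsum (Suc n) (\<lambda>s. wt s 0 * (\<Sum>j\<le>Suc n. G (raise_min j s) - G s))
      = lsum (Suc n) (\<lambda>s. wt s 0 * (G (False # tl s) - G s)) + lsum (Suc n) (\<lambda>s. wt s 0 * (\<Sum>j<Suc n. G (raise_bulk j s) - G s))"
    by (simp only: distrib_left lsum_add)
  also have "lsum (Suc n) (\<lambda>s. wt s 0 * (G (False # tl s) - G s)) = lsum n (\<lambda>b. wt b 0 * (G (False # b) - G (True # b)))"
    by simp
  also have "\<dots> + lsum (Suc n) (\<lambda>s. wt s 0 * (\<Sum>j<Suc n. G (raise_bulk j s) - G s)) = lsum n (\<lambda>b. 0 * 0)"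
    unfolding bulk_sum lsum_add[symmetric] by (rule lsum_cong) (simp add: algebra_simps)
  also have "\<dots> = 0" by (simp only: lsum_cmul)
  finally show ?thesis .
qed

text \<open>The Catalan number of index \<open>n + 1\<close>.\<close>

definition total_weight :: "nat \<Rightarrow> real" where
  "total_weight n = lsum n (\<lambda>s. wt s 0)"

lemma lsum_hd: "lsum (Suc n) (\<lambda>s. wt s 0 * of_bool (hd s)) = total_weight n"
  by (simp add: total_weight_def)

text \<open>Summed over both letters, the recursion is two half steps of a random walk with a
  barrier, and a difference of binomial coefficients solves it by reflection. At
  \<open>k = 0\<close> the barrier is accounted for by the symmetry of the two middle
  coefficients.\<close>

lemma lsum_wt: "lsum n (\<lambda>s. wt s k) = real ((2 * n) choose (n + k)) - real ((2 * n) choose (n + k + 2))"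
proof (induction n arbitrary: k)
  case 0 show ?case by simp
next
  case (Suc n)
  define c where "c i = real ((2 * n) choose i)" for i
  have two: "real ((2 * Suc n) choose Suc (Suc i)) = c i + 2 * c (Suc i) + c (Suc (Suc i))" for i
    by (simp add: c_def)
  have IH: "lsum n (\<lambda>s. wt s k) = c (n + k) - c (n + k + 2)" for k by (simp add: Suc.IH c_def)
  show ?case
  proof (cases k)
    case 0
    have sym: "real ((2 * Suc n) choose Suc n) = 2 * c n + 2 * c (Suc n)"
    proof -
      have "real ((2 * Suc n) choose Suc n) = real (Suc (2 * n) choose n) + real (Suc (2 * n) choose Suc n)" by simp
      also have "Suc (2 * n) choose n = Suc (2 * n) choose Suc n" using binomial_symmetric[of n "Suc (2 * n)"] by (simp add: Suc_diff_le)
      finally show ?thesis by (simp add: c_def)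
    qed
    have "lsum (Suc n) (\<lambda>s. wt s k) = 2 * (c n - c (n + 2)) + (c (n + 1) - c (n + 3))"
      using 0 IH[of 0] IH[of 1] by (simp add: lsum_add numeral_3_eq_3)
    then show ?thesis using 0 sym two[of "Suc n"] by (simp add: numeral_2_eq_2 numeral_3_eq_3)
  next
    case (Suc i)
    have "lsum (Suc n) (\<lambda>s. wt s k) = 2 * lsum n (\<lambda>s. wt s k) + lsum n (\<lambda>s. wt s i) + lsum n (\<lambda>s. wt s (k + 1))"
      using Suc by (simp add: lsum_add)
    then show ?thesis using Suc IH[of i] IH[of k] IH[of "k + 1"] two[of "n + i"] two[of "n + i + 2"]
      by (simp add: numeral_2_eq_2 algebra_simps)
  qed
qed

lemma total_weight_formula: "total_weight n * (real (n + 1) * real (n + 2)) = real ((2 * n) choose n) * (4 * real n + 2)"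
proof -
  have a: "real (Suc i) * real (m choose Suc i) = (real m - real i) * real (m choose i)" if "i \<le> m" for m i
  proof -
    have "Suc i * (m choose Suc i) = (m - i) * (m choose i)" by (metis binomial_absorb_comp binomial_absorption)
    then show ?thesis using that by (metis of_nat_diff of_nat_mult)
  qed
  let ?c = "\<lambda>i. real ((2 * n) choose i)"
  have 1: "real (n + 1) * ?c (n + 1) = real n * ?c n" using a[of n "2 * n"] by simp
  have 2: "real (n + 2) * ?c (n + 2) = (real n - 1) * ?c (n + 1)"
  proof (cases "n = 0")
    case False
    then show ?thesis using a[of "n + 1" "2 * n"] by simp
  qed simp
  have "real (n + 1) * real (n + 2) * ?c (n + 2) = (real n - 1) * (real n * ?c n)"
    using 1 2 by (metis mult.left_commute mult.assoc)
  then show ?thesis unfolding total_weight_def lsum_wt by (simp add: algebra_simps)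
qed

lemma total_weight_pos: "total_weight n > 0"
proof -
  have "0 < total_weight n * (real (n + 1) * real (n + 2))" unfolding total_weight_formula by simp
  then show ?thesis by (rule zero_less_mult_pos2) simp
qed

text \<open>The stationary current of the open process on \<open>Suc n\<close> slopes. It exceeds
  its limit 1/4 by half of \<open>3 / (4 * real n + 6)\<close>, the error term in
  \<open>time_constant\<close>.\<close>

lemma total_weight_ratio: "total_weight n / total_weight (Suc n) = real (n + 3) / (4 * real n + 6)"
proof -
  let ?c = "real ((2 * n) choose n)" and ?d = "real ((2 * Suc n) choose Suc n)"
  have c: "?d * real (n + 1) = ?c * (2 * (2 * real n + 1))"
  proof -
    have "Suc n * ((2 * Suc n) choose Suc n) = (2 * Suc n) * (Suc (2 * n) choose n)" using binomial_absorption[of n "2 * Suc n"] by simp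
    moreover have "Suc n * (Suc (2 * n) choose n) = Suc (2 * n) * ((2 * n) choose n)"
      using binomial_absorb_comp[of "Suc (2 * n)" n] by (simp add: Suc_diff_le)
    ultimately have "Suc n * (Suc n * ((2 * Suc n) choose Suc n)) = (2 * Suc n) * (Suc (2 * n) * ((2 * n) choose n))"
      by (metis mult.left_commute)
    then have "Suc n * (Suc n * ((2 * Suc n) choose Suc n)) = Suc n * (2 * (Suc (2 * n) * ((2 * n) choose n)))"
      by (simp only: mult.left_commute mult.assoc)
    then have "Suc n * ((2 * Suc n) choose Suc n) = 2 * (Suc (2 * n) * ((2 * n) choose n))"
      by (simp only: mult_left_cancel nat.distinct(2) simp_thms)
    then have "real (Suc n * ((2 * Suc n) choose Suc n)) = real (2 * (Suc (2 * n) * ((2 * n) choose n)))" by (simp only:)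
    then show ?thesis by (simp add: algebra_simps del: binomial_Suc_Suc)
  qed
  have "?c > 0" by simp
  have f1: "total_weight n = ?c * (4 * real n + 2) / (real (n + 1) * real (n + 2))"
    using total_weight_formula[of n] by (subst eq_divide_eq) simp
  have f2: "total_weight (Suc n) = ?d * (4 * real n + 6) / (real (n + 2) * real (n + 3))"

  proof (rule nonzero_eq_divide_eq[THEN iffD2])
    show "total_weight (Suc n) * (real (n + 2) * real (n + 3)) = ?d * (4 * real n + 6)"
      using total_weight_formula[of "Suc n"] by (simp add: algebra_simps del: binomial_Suc_Suc)
  qed simp
  have d: "?d = ?c * (4 * real n + 2) / real (n + 1)" 
  proof (rule nonzero_eq_divide_eq[THEN iffD2])
    show "?d * real (n + 1) = ?c * (4 * real n + 2)" unfolding c by argo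
  qed (rule of_nat_neq_0[of n, unfolded Suc_eq_plus1])
  have gen: "(c * a / (b * e)) / ((c * a / b) * g / (e * h)) = h / g" if "c \<noteq> 0" "a \<noteq> 0" "b \<noteq> 0" "e \<noteq> 0" for a b c e g h :: real
    using that by simp
  have "total_weight n / total_weight (Suc n) = real (n + 3) / (4 * real n + 6)"
    unfolding f1 f2 d by (rule gen) (use \<open>?c > 0\<close> in auto)
  then show ?thesis .
qed

subsection \<open>Paths in a strip\<close>

text \<open>The horizontal edges leaving column \<open>x\<close> and the vertical edges of column
  \<open>x + 1\<close>: a blocked row is entered vertically after the crossing. Different columns
  get disjoint sets, hence are independent.\<close>

definition column_edges :: "nat \<Rightarrow> nat \<Rightarrow> edge set" where
  "column_edges K x = (\<lambda>j. ((int x, int j), True)) ` {..K} \<union> (\<lambda>j. ((int x + 1, int j), False)) ` {..<K}"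

definition only :: "nat \<Rightarrow> config \<Rightarrow> nat \<Rightarrow> nat \<Rightarrow> bool" where
  "only K w x j \<longleftrightarrow> (\<forall>e\<in>column_edges K x. w e = (e \<noteq> ((int x, int j), True)))"

definition multi :: "nat \<Rightarrow> config \<Rightarrow> nat \<Rightarrow> bool" where
  "multi K w x \<longleftrightarrow> (\<exists>e\<in>column_edges K x. \<exists>e'\<in>column_edges K x. e \<noteq> e' \<and> \<not> w e \<and> \<not> w e')"

lemma finite_column_edges [simp]: "finite (column_edges K x)"
  by (simp add: column_edges_def)

lemma column_edges_disjoint: "x \<noteq> y \<Longrightarrow> column_edges K x \<inter> column_edges K y = {}"
  by (auto simp: column_edges_def)

lemma card_column_edges: "card (column_edges K x) \<le> 2 * K + 1"
proof -
  have "card (column_edges K x) \<le> card {..K} + card {..<K}"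
    unfolding column_edges_def by (intro order_trans[OF card_Un_le] add_mono card_image_le) auto
  then show ?thesis by simp
qed

lemma column_edges_hor: "j \<le> K \<Longrightarrow> ((int x, int j), True) \<in> column_edges K x"
  by (auto simp: column_edges_def)

lemma column_edges_ver: "j < K \<Longrightarrow> ((int x + 1, int j), False) \<in> column_edges K x"
  by (auto simp: column_edges_def)

lemma only_closed: "only K w x j \<Longrightarrow> j \<le> K \<Longrightarrow> \<not> w ((int x, int j), True)"
  using column_edges_hor unfolding only_def by blast

lemma only_open: "only K w x j \<Longrightarrow> i \<le> K \<Longrightarrow> i \<noteq> j \<Longrightarrow> w ((int x, int i), True)"
  using column_edges_hor unfolding only_def by fastforce

lemma only_ver: "only K w x j \<Longrightarrow> i < K \<Longrightarrow> w ((int x + 1, int i), False)"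
  using column_edges_ver unfolding only_def by fastforce

lemma only_unique: "only K w x j \<Longrightarrow> only K w x i \<Longrightarrow> i \<le> K \<Longrightarrow> i = j"
  using only_closed only_open by blast

lemma only_multi: "multi K w x \<Longrightarrow> \<not> only K w x j"
  unfolding multi_def only_def by metis

lemma closed_cases: "j \<le> K \<Longrightarrow> \<not> w ((int x, int j), True) \<Longrightarrow> multi K w x \<or> only K w x j"
  using column_edges_hor[of j K x] unfolding multi_def only_def by metis

text \<open>The slopes move only in columns whose single closed edge is horizontal. Elsewhere all
  rows are crossed straight, along open edges or charged to \<open>multi_cost\<close>.\<close>

definition nxt :: "nat \<Rightarrow> config \<Rightarrow> nat \<Rightarrow> bool list \<Rightarrow> bool list" where
  "nxt K w x s = (if \<exists>j\<le>K. only K w x j then raise_min (THE j. j \<le> K \<and> only K w x j) s else s)"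

lemma nxt_only: "only K w x j \<Longrightarrow> j \<le> K \<Longrightarrow> nxt K w x s = raise_min j s"
proof -
  assume j: "only K w x j" "j \<le> K"
  then have "(THE j. j \<le> K \<and> only K w x j) = j" using only_unique by (intro the_equality) blast+
  then show ?thesis unfolding nxt_def using j by auto
qed

lemma nxt_none: "\<not> (\<exists>j\<le>K. only K w x j) \<Longrightarrow> nxt K w x s = s"
  by (simp only: nxt_def if_False)

lemma nxt_sum: "G (nxt K w x s) = G s + (\<Sum>j\<le>K. of_bool (only K w x j) * (G (raise_min j s) - G s :: real))"
proof (cases "\<exists>j\<le>K. only K w x j")
  case True
  then obtain j where j: "j \<le> K" "only K w x j" by blast
  have "(\<Sum>i\<le>K. of_bool (only K w x i) * (G (raise_min i s) - G s)) = (\<Sum>i\<in>{j}. of_bool (only K w x i) * (G (raise_min i s) - G s))"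
    by (rule sum.mono_neutral_right) (use j only_unique in auto)
  then show ?thesis using j by (simp add: nxt_only)
next
  case False
  then show ?thesis by (auto simp: nxt_none)
qed

primrec slope_state :: "nat \<Rightarrow> config \<Rightarrow> bool list \<Rightarrow> nat \<Rightarrow> bool list" where
  "slope_state K w s 0 = s"
| "slope_state K w s (Suc n) = nxt K w n (slope_state K w s n)"

text \<open>Starting at \<open>K\<close> keeps the heights of all rows up to \<open>K\<close>
  nonnegative, so they can enter costs in \<open>ennreal\<close>.\<close>

primrec base_height :: "nat \<Rightarrow> config \<Rightarrow> bool list \<Rightarrow> nat \<Rightarrow> int" where
  "base_height K w s 0 = int K"
| "base_height K w s (Suc n) = base_height K w s n + (if only K w n 0 then gain 0 (slope_state K w s n) else 0)"

lemma base_height_ge: "base_height K w s n \<ge> int K"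
  by (induction n) (auto simp: gain_def)

lemma length_nxt: "s \<noteq> [] \<Longrightarrow> length (nxt K w x s) = length s"
  by (simp add: nxt_def)

lemma length_slope_state: "s \<noteq> [] \<Longrightarrow> length (slope_state K w s n) = length s"
proof (induction n)
  case (Suc n)
  then have "slope_state K w s n \<noteq> []" by auto
  then show ?case using Suc by (simp add: length_nxt)
qed simp

definition multi_cost :: "nat \<Rightarrow> config \<Rightarrow> nat \<Rightarrow> ennreal" where
  "multi_cost K w x = (if multi K w x then \<Sum>j\<le>K. cluster_size (dual w) (int x, int j) else 0)"

definition axis_cost :: "nat \<Rightarrow> config \<Rightarrow> ennreal" where
  "axis_cost K w = (\<Sum>j<K. 1 + 4 * cluster_size (dual w) (0, int j))"

lemma detour_cost_sym: "detour_cost w u v = detour_cost w v u"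
  by (simp add: detour_cost_def basept_def open_adj_sym[of w u v] min.commute)

lemma route_cost_sym: "route_cost w x y c \<Longrightarrow> route_cost w y x c"
proof (induction rule: route_cost.induct)
  case (route_cost_step x y c z d)
  have "open_adj (\<lambda>_. True) z y" using route_cost_step.hyps(2) by (simp add: open_adj_sym)
  then have "route_cost w z y (1 + 4 * detour_cost w y z)" by (rule route_cost_adj) (simp add: detour_cost_sym)
  from route_cost_trans[OF route_cost_step.IH this] have "route_cost w z x ((1 + 4 * detour_cost w y z) + c)" .
  then show ?case by (rule route_cost_mono) (use route_cost_step.hyps(3) in \<open>simp add: add.commute\<close>)
qed (rule route_cost_refl)

lemma route_cost_column: "j \<le> K \<Longrightarrow> route_cost w (0, 0) (0, int j) (axis_cost K w)"
proof -
  have "route_cost w (0, 0) (0, int j) (\<Sum>i<j. 1 + 4 * cluster_size (dual w) (0, int i))"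
  proof (induction j)
    case 0 show ?case by (simp add: route_cost_refl)
  next
    case (Suc j)
    have "detour_cost w (0, int j) (0, int (Suc j)) \<le> cluster_size (dual w) (0, int j)" by (simp add: detour_cost_def basept_def)
    then have "(\<Sum>i<j. 1 + 4 * cluster_size (dual w) (0, int i)) + (1 + 4 * detour_cost w (0, int j) (0, int (Suc j))) \<le> (\<Sum>i<Suc j. 1 + 4 * cluster_size (dual w) (0, int i))"
      unfolding sum.lessThan_Suc by (intro add_left_mono mult_left_mono) auto
    moreover have "open_adj (\<lambda>_. True) (0, int j) (0, int (Suc j))" by (simp add: open_adj_def)
    ultimately show ?case using Suc route_cost_step by blast
  qed
  moreover assume "j \<le> K"
  ultimately show ?thesis unfolding axis_cost_def by (elim route_cost_mono) (auto intro!: sum_mono2)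
qed

lemma cost_step:
  assumes "0 \<le> a" "a + 1 \<le> a'" "P \<le> b"
  shows "U + ennreal (real_of_int a) + 4 * S + (1 + 4 * P) \<le> U + ennreal (real_of_int a') + 4 * (S + b)"
proof -
  have "U + ennreal (real_of_int a) + 4 * S + (1 + 4 * P) = U + (ennreal (real_of_int a) + 1) + 4 * (S + P)"
    by (simp add: ac_simps distrib_left)
  also have "ennreal (real_of_int a) + 1 = ennreal (real_of_int (a + 1))"
    using assms(1) ennreal_plus[of "real_of_int a" 1] by simp
  also have "U + ennreal (real_of_int (a + 1)) + 4 * (S + P) \<le> U + ennreal (real_of_int a') + 4 * (S + b)"
    using assms(2,3) by (intro add_mono mult_left_mono ennreal_leI) auto
  finally show ?thesis .
qed

text \<open>A single closed edge in a local minimum is bypassed through a neighbouring row, whose vertical edges are then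
  open; columns with several closed edges are crossed straight and charged to \<open>multi_cost\<close>.\<close>

lemma strip_path:
  assumes s: "length s = K" "K > 0"
  shows "j \<le> K \<Longrightarrow> route_cost w (0, 0) (int n, int j) (axis_cost K w + ennreal (real_of_int (int n + row_height (slope_state K w s n) (base_height K w s n) j)) + 4 * (\<Sum>x<n. multi_cost K w x))"
proof (induction n arbitrary: j)
  case 0
  have "route_cost w (0, 0) (int 0, int j) (axis_cost K w)" using route_cost_column[OF 0] by simp
  then show ?case by (rule route_cost_mono) (simp add: add_increasing2)
next
  case (Suc n)
  let ?s = "slope_state K w s n" and ?a = "base_height K w s n" and ?S = "\<Sum>x<n. multi_cost K w x"
  let ?H = "row_height ?s ?a" and ?H' = "row_height (slope_state K w s (Suc n)) (base_height K w s (Suc n))"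
  let ?c = "\<lambda>j. axis_cost K w + ennreal (real_of_int (int n + ?H j)) + 4 * ?S"
  let ?d = "\<lambda>j. axis_cost K w + ennreal (real_of_int (int (Suc n) + ?H' j)) + 4 * (?S + multi_cost K w n)"
  have s': "length ?s = K" "?s \<noteq> []" using length_slope_state[of s K w n] s by auto
  have H0: "0 \<le> int n + ?H i" if "i \<le> K" for i using row_height_ge[of ?a i ?s] base_height_ge[of K w s n] that by linarith
  have right: "route_cost w (0, 0) (int (Suc n), int i) (?d i)" if i: "i \<le> K" "?H i \<le> ?H' i" "detour_cost w (int n, int i) (int (Suc n), int i) \<le> multi_cost K w n" for i
  proof (rule route_cost_step[OF Suc.IH[OF i(1)]])
    show "open_adj (\<lambda>_. True) (int n, int i) (int (Suc n), int i)" by (simp add: open_adj_def)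
    show "?c i + (1 + 4 * detour_cost w (int n, int i) (int (Suc n), int i)) \<le> ?d i"
      by (rule cost_step) (use H0 i in auto)
  qed
  have pen0: "detour_cost w (int n, int i) (int (Suc n), int i) \<le> multi_cost K w n" if "w ((int n, int i), True)" for i
    using that by (simp add: detour_cost_def open_adj_def add.commute)
  consider (m) "multi K w n" | (o) k where "k \<le> K" "only K w n k" | (n) "\<not> multi K w n" "\<not> (\<exists>k\<le>K. only K w n k)" by blast
  then have "route_cost w (0, 0) (int (Suc n), int j) (?d j)"
  proof cases
    case m
    then have "\<not> (\<exists>k\<le>K. only K w n k)" "\<not> only K w n 0" using only_multi by blast+
    then have eq: "?H' = ?H" by (simp add: nxt_none)
    have "detour_cost w (int n, int j) (int (Suc n), int j) \<le> cluster_size (dual w) (int n, int j)" by (simp add: detour_cost_def basept_def)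
    also have "\<dots> \<le> (\<Sum>j\<le>K. cluster_size (dual w) (int n, int j))" using Suc.prems by (intro member_le_sum) auto
    finally show ?thesis using m eq Suc.prems by (intro right) (auto simp: multi_cost_def)
  next
    case n
    then have "\<not> only K w n 0" by blast
    then have eq: "?H' = ?H" using n by (simp add: nxt_none)
    have "w ((int n, int j), True)" using closed_cases[OF Suc.prems] n Suc.prems by blast
    then show ?thesis using eq Suc.prems by (intro right pen0) auto
  next
    case o
    have "base_height K w s (Suc n) = ?a + gain k ?s"
      using o only_unique[of K w n 0 k] by (cases "k = 0") (auto simp: gain_def)
    then have H': "?H' = row_height (raise_min k ?s) (?a + gain k ?s)" using o by (simp add: nxt_only)
    have other: "route_cost w (0, 0) (int (Suc n), int i) (?d i) \<and> ?H' i = ?H i" if i: "i \<le> K" "i \<noteq> k" for i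
    proof -
      have "?H' i = ?H i" unfolding H' using s' i by (intro row_height_raise_min) auto
      then show ?thesis using right[OF i(1) _ pen0[OF only_open[OF o(2) i]]] by simp
    qed
    show ?thesis
    proof (cases "j = k")
      case True
      obtain i where i: "i \<le> K" "k = Suc i \<or> i = Suc k" "row_height (raise_min k ?s) (?a + gain k ?s) k = ?H i + 1"
        using row_height_raise_min_same[of ?s k ?a] s' o(1) by auto
      have ik: "i \<noteq> k" using i(2) by auto
      have h: "?H' j = ?H' i + 1" using i(3) other[OF i(1) ik] unfolding H' True by simp
      have oa: "open_adj w (int (Suc n), int i) (int (Suc n), int j)"
        using i(2)
      proof
        assume k: "k = Suc i"
        then have "w ((int n + 1, int i), False)" using only_ver[OF o(2), of i] o(1) by simp
        then show ?thesis using k True by (simp add: open_adj_def add.commute)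
      next
        assume k: "i = Suc k"
        then have "w ((int n + 1, int k), False)" using only_ver[OF o(2), of k] i(1) by simp
        then show ?thesis using k True by (simp add: open_adj_def add.commute)
      qed
      have "?d i + (1 + 4 * detour_cost w (int (Suc n), int i) (int (Suc n), int j)) \<le> axis_cost K w + ennreal (real_of_int (int (Suc n) + ?H' j)) + 4 * ((?S + multi_cost K w n) + 0)"
        by (rule cost_step) (use h H0[OF i(1)] other[OF i(1) ik] oa in \<open>auto simp: detour_cost_def\<close>)
      moreover have "open_adj (\<lambda>_. True) (int (Suc n), int i) (int (Suc n), int j)" using i(2) True by (auto simp: open_adj_def)
      ultimately show ?thesis using other[OF i(1) ik] route_cost_step by fastforce
    next
      case False
      then show ?thesis using other Suc.prems by blast
    qed
  qed
  then show ?case by simp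
qed

subsection \<open>Expectations in a strip\<close>

lemma dep_only: "dep (column_edges K x) (\<lambda>w. only K w x j)"
  unfolding dep_def only_def by auto

lemma dep_nxt: "dep (column_edges K x) (\<lambda>w. nxt K w x s)"
proof -
  have "only K w x = only K w' x" if "\<forall>e\<in>column_edges K x. w e = w' e" for w w'
    by (rule ext, rule depD[OF dep_only]) (use that in auto)
  then show ?thesis unfolding dep_def nxt_def by (intro allI impI) (simp only:)
qed

lemma dep_slope_state_base_height:
  "dep (\<Union>x<n. column_edges K x) (\<lambda>w. slope_state K w s n)" (is "?P n")
  "dep (\<Union>x<n. column_edges K x) (\<lambda>w. base_height K w s n)" (is "?Q n")
proof -
  show P: "?P n" for n
  proof (induction n)
    case (Suc n)
    show ?case unfolding dep_def
    proof (intro allI impI)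
      fix w w' :: config assume a: "\<forall>e\<in>(\<Union>x<Suc n. column_edges K x). w e = w' e"
      have "slope_state K w s n = slope_state K w' s n" by (rule depD[OF Suc]) (use a in auto)
      moreover have "nxt K w n r = nxt K w' n r" for r by (rule depD[OF dep_nxt]) (use a in auto)
      ultimately show "slope_state K w s (Suc n) = slope_state K w' s (Suc n)" by simp
    qed
  qed simp
  show "?Q n"
  proof (induction n)
    case (Suc n)
    show ?case unfolding dep_def
    proof (intro allI impI)
      fix w w' :: config assume a: "\<forall>e\<in>(\<Union>x<Suc n. column_edges K x). w e = w' e"
      have "slope_state K w s n = slope_state K w' s n" by (rule depD[OF P]) (use a in auto)
      moreover have "base_height K w s n = base_height K w' s n" by (rule depD[OF Suc]) (use a in auto)
      moreover have "only K w n 0 = only K w' n 0" by (rule depD[OF dep_only]) (use a in auto)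
      ultimately show "base_height K w s (Suc n) = base_height K w' s (Suc n)" by simp
    qed
  qed simp
qed

lemma dep_only_slope_state: "dep (\<Union>x<Suc n. column_edges K x) (\<lambda>w. of_bool (only K w n j) * F (slope_state K w s n) :: real)"
proof (rule dep_comp2[where g = "(*)"])
  show "dep (\<Union>x<Suc n. column_edges K x) (\<lambda>w. of_bool (only K w n j) :: real)"
    by (rule dep_mono[OF dep_of_bool[OF dep_only[of K n j]]]) (rule UN_upper, simp)
  show "dep (\<Union>x<Suc n. column_edges K x) (\<lambda>w. F (slope_state K w s n))"
    by (rule dep_mono[OF dep_comp[OF dep_slope_state_base_height(1)[where n = n and K = K and s = s], where g = F]]) (rule UN_mono, auto)
qed

lemma pattern_prob_eq:
  assumes p: "0 \<le> p" "p \<le> 1" and "finite J"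
  shows "Pr p (\<lambda>w. \<forall>e\<in>J. w e = \<eta> e) = (\<Prod>e\<in>J. if \<eta> e then p else 1 - p)"
  using assms(3)
proof (induction J rule: finite_induct)
  case empty
  show ?case by simp
next
  case (insert e J)
  have d: "dep (insert e J) (\<lambda>w. of_bool (\<forall>e\<in>insert e J. w e = \<eta> e) :: real)" by (rule dep_of_bool) (auto simp: dep_def)
  have u: "of_bool (\<forall>e'\<in>insert e J. upd e b w e' = \<eta> e') = (of_bool (b = \<eta> e) * of_bool (\<forall>e'\<in>J. w e' = \<eta> e') :: real)" for b w
    using insert.hyps by (auto simp: upd_apply)
  have c: "EE p (\<lambda>w. of_bool (b = \<eta> e) * of_bool (\<forall>e'\<in>J. w e' = \<eta> e')) = of_bool (b = \<eta> e) * Pr p (\<lambda>w. \<forall>e\<in>J. w e = \<eta> e)" for b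
    by (simp add: EE_def)
  show ?case unfolding resample_fin[OF _ d p, of e, simplified insert.hyps finite_insert, OF TrueI] u c insert.IH
    using insert.hyps by auto
qed

definition rate :: "real \<Rightarrow> nat \<Rightarrow> nat \<Rightarrow> real" where
  "rate p K x = (1 - p) * p ^ (card (column_edges K x) - 1)"

lemma Pr_only: "0 \<le> p \<Longrightarrow> p \<le> 1 \<Longrightarrow> j \<le> K \<Longrightarrow> Pr p (\<lambda>w. only K w x j) = rate p K x"
proof -
  assume p: "0 \<le> p" "p \<le> 1" and j: "j \<le> K"
  have "Pr p (\<lambda>w. only K w x j) = (\<Prod>e\<in>column_edges K x. if e \<noteq> ((int x, int j), True) then p else 1 - p)"
    unfolding only_def by (rule pattern_prob_eq[OF p finite_column_edges])
  also have "\<dots> = (1 - p) * (\<Prod>e\<in>column_edges K x - {((int x, int j), True)}. p)"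
    by (subst prod.remove[OF finite_column_edges column_edges_hor[OF j]]) (auto intro!: prod.cong)
  finally show ?thesis using column_edges_hor[OF j] by (simp add: rate_def)
qed

lemma rate_le: "0 \<le> p \<Longrightarrow> p \<le> 1 \<Longrightarrow> rate p K x \<le> 1 - p"
  unfolding rate_def by (intro mult_left_le power_le_one) auto

lemma EE_only:
  assumes p: "0 \<le> p" "p \<le> 1" and j: "j \<le> K" and d: "dep (\<Union>x<n. column_edges K x) (F :: config \<Rightarrow> real)"
  shows "EE p (\<lambda>w. of_bool (only K w n j) * F w) = rate p K n * EE p F"
proof -
  have fin: "finite (\<Union>x<n. column_edges K x)" by simp
  obtain B where B: "\<And>w. \<bar>F w\<bar> \<le> B" using dep_finite_bounded[OF fin d] by blast
  have "EE p (\<lambda>w. of_bool (only K w n j) * F w) = Pr p (\<lambda>w. only K w n j) * EE p F"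
  proof (rule indep_finite[OF finite_column_edges dep_of_bool[OF dep_only] _ _ B p])
    have "(\<Union>x<n. column_edges K x) \<subseteq> - column_edges K n" using column_edges_disjoint[of _ n K] by fastforce
    then show "dep (- column_edges K n) F" using d dep_mono by blast
    show "F \<in> borel_measurable (perc p)" by (rule dep_finite_measurable[OF fin d]) simp
  qed
  then show ?thesis by (simp add: Pr_only[OF p j])
qed

lemma EE_add: "integrable (perc p) F \<Longrightarrow> integrable (perc p) G \<Longrightarrow> EE p (\<lambda>w. F w + G w) = EE p F + EE p G"
  by (simp add: EE_def)

text \<open>In every column each row is flipped with the same probability, independently of the
  past. The mean change is that probability times the generator, whose stationary mean vanishes by
  \<open>stationary\<close>.\<close>

lemma slope_state_expect:
  assumes p: "0 \<le> p" "p \<le> 1"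
  shows "lsum (Suc m) (\<lambda>s. wt s 0 * EE p (\<lambda>w. G (slope_state (Suc m) w s n))) = lsum (Suc m) (\<lambda>s. wt s 0 * G s)"
proof (induction n arbitrary: G)
  case 0 show ?case by simp
next
  case (Suc n)
  let ?K = "Suc m"
  define H where "H j s = G (raise_min j s) - G s" for j s
  have dst: "dep (\<Union>x<n. column_edges ?K x) (\<lambda>w. F (slope_state ?K w s n) :: real)" for F s by (rule dep_comp[OF dep_slope_state_base_height(1)])
  have int: "integrable (perc p) (\<lambda>w. F (slope_state ?K w s n) :: real)" for F s by (rule dep_finite_integrable[OF _ dst]) simp
  have int2: "integrable (perc p) (\<lambda>w. of_bool (only ?K w n j) * H j (slope_state ?K w s n))" for j s
    by (rule dep_finite_integrable[OF _ dep_only_slope_state]) simp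
  have E: "EE p (\<lambda>w. G (slope_state ?K w s (Suc n))) = EE p (\<lambda>w. G (slope_state ?K w s n)) + rate p ?K n * EE p (\<lambda>w. \<Sum>j\<le>?K. H j (slope_state ?K w s n))" for s
  proof -
    have "EE p (\<lambda>w. G (slope_state ?K w s (Suc n))) = EE p (\<lambda>w. G (slope_state ?K w s n) + (\<Sum>j\<le>?K. of_bool (only ?K w n j) * H j (slope_state ?K w s n)))"
      unfolding slope_state.simps nxt_sum H_def ..
    also have "\<dots> = EE p (\<lambda>w. G (slope_state ?K w s n)) + EE p (\<lambda>w. \<Sum>j\<le>?K. of_bool (only ?K w n j) * H j (slope_state ?K w s n))"
      by (rule EE_add[OF int[where F = G] Bochner_Integration.integrable_sum[OF int2]])
    also have "EE p (\<lambda>w. \<Sum>j\<le>?K. of_bool (only ?K w n j) * H j (slope_state ?K w s n)) = (\<Sum>j\<le>?K. EE p (\<lambda>w. of_bool (only ?K w n j) * H j (slope_state ?K w s n)))"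
      by (rule EE_sum[OF finite_atMost int2])
    also have "(\<Sum>j\<le>?K. EE p (\<lambda>w. of_bool (only ?K w n j) * H j (slope_state ?K w s n))) = (\<Sum>j\<le>?K. rate p ?K n * EE p (\<lambda>w. H j (slope_state ?K w s n)))"
      by (intro sum.cong refl EE_only[OF p _ dst]) auto
    also have "\<dots> = rate p ?K n * EE p (\<lambda>w. \<Sum>j\<le>?K. H j (slope_state ?K w s n))"
      using int by (subst EE_sum) (auto simp: sum_distrib_left distrib_left)
    finally show ?thesis .
  qed
  have "lsum ?K (\<lambda>s. wt s 0 * EE p (\<lambda>w. G (slope_state ?K w s (Suc n)))) =
    lsum ?K (\<lambda>s. wt s 0 * EE p (\<lambda>w. G (slope_state ?K w s n))) + rate p ?K n * lsum ?K (\<lambda>s. wt s 0 * EE p (\<lambda>w. \<Sum>j\<le>?K. H j (slope_state ?K w s n)))"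
    unfolding E lsum_cmul[symmetric] lsum_add[symmetric] by (rule lsum_cong) (simp only: algebra_simps)
  also have "\<dots> = lsum ?K (\<lambda>s. wt s 0 * G s) + rate p ?K n * lsum ?K (\<lambda>s. wt s 0 * (\<Sum>j\<le>?K. H j s))"
    by (simp only: Suc.IH Suc.IH[of "\<lambda>s. \<Sum>j\<le>?K. H j s"])
  also have "lsum ?K (\<lambda>s. wt s 0 * (\<Sum>j\<le>?K. H j s)) = 0" unfolding H_def by (rule stationary)
  finally show ?case by simp
qed

text \<open>Row 0 gains 2 when it is flipped below an up step. Under the stationary weights the
  first step is up with total weight \<open>total_weight m\<close> (\<open>lsum_hd\<close>), and the
  flip has probability at most \<open>1 - p\<close>.\<close>

lemma base_height_expect:
  assumes p: "0 \<le> p" "p \<le> 1"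
  shows "lsum (Suc m) (\<lambda>s. wt s 0 * EE p (\<lambda>w. real_of_int (base_height (Suc m) w s n))) \<le> real (Suc m) * total_weight (Suc m) + real n * (2 * (1 - p) * total_weight m)"
proof (induction n)
  case 0
  show ?case unfolding base_height.simps EE_const total_weight_def lsum_cmul[symmetric] by (simp add: mult.commute)
next
  case (Suc n)
  let ?K = "Suc m"
  let ?g = "\<lambda>s. real_of_int (gain 0 s)"
  have dst: "dep (\<Union>x<n. column_edges ?K x) (\<lambda>w. F (slope_state ?K w s n) :: real)" for F s by (rule dep_comp[OF dep_slope_state_base_height(1)])
  have i1: "integrable (perc p) (\<lambda>w. real_of_int (base_height ?K w s n))" for s
    by (rule dep_finite_integrable[OF _ dep_comp[OF dep_slope_state_base_height(2)]]) simp
  have i2: "integrable (perc p) (\<lambda>w. of_bool (only ?K w n 0) * ?g (slope_state ?K w s n))" for s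
    by (rule dep_finite_integrable[OF _ dep_only_slope_state[where F = ?g]]) simp
  have E: "EE p (\<lambda>w. real_of_int (base_height ?K w s (Suc n))) = EE p (\<lambda>w. real_of_int (base_height ?K w s n)) + rate p ?K n * EE p (\<lambda>w. ?g (slope_state ?K w s n))" for s
  proof -
    have "EE p (\<lambda>w. real_of_int (base_height ?K w s (Suc n))) = EE p (\<lambda>w. real_of_int (base_height ?K w s n) + of_bool (only ?K w n 0) * ?g (slope_state ?K w s n))"
      by (rule arg_cong[where f = "EE p"]) auto
    also have "\<dots> = EE p (\<lambda>w. real_of_int (base_height ?K w s n)) + EE p (\<lambda>w. of_bool (only ?K w n 0) * ?g (slope_state ?K w s n))"
      by (rule EE_add[OF i1 i2])
    finally show ?thesis by (simp only: EE_only[OF p zero_le dst[where F = ?g]])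
  qed
  have "lsum ?K (\<lambda>s. wt s 0 * EE p (\<lambda>w. real_of_int (base_height ?K w s (Suc n)))) =
    lsum ?K (\<lambda>s. wt s 0 * EE p (\<lambda>w. real_of_int (base_height ?K w s n))) + rate p ?K n * lsum ?K (\<lambda>s. wt s 0 * EE p (\<lambda>w. ?g (slope_state ?K w s n)))"
    unfolding E lsum_cmul[symmetric] lsum_add[symmetric] by (rule lsum_cong) (simp only: algebra_simps)
  also have "lsum ?K (\<lambda>s. wt s 0 * EE p (\<lambda>w. ?g (slope_state ?K w s n))) = lsum ?K (\<lambda>s. wt s 0 * ?g s)" by (rule slope_state_expect[OF p])
  also have "\<dots> = lsum ?K (\<lambda>s. 2 * (wt s 0 * of_bool (hd s)))" by (rule lsum_cong) (simp add: gain_def)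
  also have "\<dots> = 2 * total_weight m" unfolding lsum_cmul lsum_hd ..
  also have "rate p ?K n * (2 * total_weight m) \<le> (1 - p) * (2 * total_weight m)" using rate_le[OF p] total_weight_pos[of m] by (intro mult_right_mono) auto
  finally show ?case using Suc by (simp add: algebra_simps)
qed

subsection \<open>Columns with several closed edges\<close>

text \<open>After each use of the new edge a path continues in the old cluster of one of its
  ends.\<close>

lemma cluster_size_upd: "cluster_size (upd d True w) x \<le> cluster_size w x + cluster_size w (fst d) + cluster_size w (tip d)"
proof -
  let ?C = "\<lambda>x. {y. conn w x y}"
  have "y \<in> ?C x \<union> ?C (fst d) \<union> ?C (tip d)" if "conn (upd d True w) x y" for y
    using that
  proof (induction rule: rtranclp_induct)
    case (step y z)
    from step.hyps(2) obtain e where e: "upd d True w e" "y = fst e \<and> z = tip e \<or> y = tip e \<and> z = fst e"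
      unfolding open_adj_iff by blast
    show ?case
    proof (cases "e = d")
      case True
      then show ?thesis using e by auto
    next
      case False
      then have "open_adj w y z" using e unfolding open_adj_iff by auto
      then show ?thesis using step.IH by (auto intro: rtranclp.rtrancl_into_rtrancl)
    qed
  qed auto
  then have "{y. conn (upd d True w) x y} \<subseteq> ?C x \<union> ?C (fst d) \<union> ?C (tip d)" by blast
  then have "cluster_size (upd d True w) x \<le> emeasure (count_space UNIV) (?C x \<union> ?C (fst d) \<union> ?C (tip d))"
    unfolding cluster_size_def by (intro emeasure_mono) auto
  also have "\<dots> \<le> emeasure (count_space UNIV) (?C x \<union> ?C (fst d)) + emeasure (count_space UNIV) (?C (tip d))"
    by (rule emeasure_subadditive) auto
  also have "\<dots> \<le> cluster_size w x + cluster_size w (fst d) + cluster_size w (tip d)"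
    unfolding cluster_size_def by (intro add_mono emeasure_subadditive) auto
  finally show ?thesis .
qed

lemma dual_upd: "dual (upd e False w) = upd (ud e) True (dual w)"
  by (rule ext) (metis (full_types) dl_ud dual_def ud_dl upd_apply)

text \<open>The singleton has at most four boundary edges, so \<open>q * phi q S\<close> is at most
  \<open>4 * (1 - p)\<close>. The threshold 7/8 makes this at most 1/2, and the susceptibility bound
  becomes \<open>1 / (1 - 1 / 2)\<close>.\<close>

lemma cluster_size_dual_small:
  assumes p: "7 / 8 \<le> p" "p < 1"
  shows "(\<integral>\<^sup>+w. cluster_size (dual w) x \<partial>perc p) \<le> 2"
proof -
  let ?S = "{(0, 0)} :: vertex set" and ?q = "1 - p"
  let ?L = "[((0, 0), True), ((0, 0), False), ((- 1, 0), True), ((0, - 1), False)] :: edge list"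
  have "bd ?S \<subseteq> set ?L"
  proof
    fix e assume "e \<in> bd ?S"
    moreover obtain a b d where "e = ((a, b), d)" by (metis surj_pair)
    ultimately show "e \<in> set ?L" by (cases d) (auto simp: bd_def)
  qed
  then have "card (bd ?S) \<le> card (set ?L)" by (rule card_mono[rotated]) simp
  also have "\<dots> \<le> 4" by (rule order_trans[OF card_length]) simp
  finally have c: "card (bd ?S) \<le> 4" .
  have "phi ?q ?S \<le> (\<Sum>e\<in>bd ?S. 1)" unfolding phi_def by (intro sum_mono Pr_le1 pred_conn_Ein) simp
  also have "\<dots> \<le> 4" using c by simp
  finally have "?q * phi ?q ?S \<le> ?q * 4" using p by (intro mult_left_mono) auto
  also have "\<dots> \<le> 1 / 2" using p by simp
  finally have h: "?q * phi ?q ?S \<le> 1 / 2" .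
  have "(\<integral>\<^sup>+w. cluster_size (dual w) x \<partial>perc p) \<le> ennreal (card ?S / (1 - ?q * phi ?q ?S))"
    using nn_dual[of p "\<lambda>w. cluster_size w x"] susceptibility[of ?q ?S x] p h by (simp add: cluster_size_measurable)
  also have "\<dots> \<le> ennreal 2" using h by (intro ennreal_leI) (simp add: divide_le_eq)
  finally show ?thesis by simp
qed

lemma measurable_cluster_size_upd: "(\<lambda>w. cluster_size (dual (upd e b w)) x) \<in> borel_measurable (perc p)"
  by (rule measurable_compose[OF measurable_upd measurable_cluster_size_dual])

lemma nn_cluster_size_upd:
  assumes g [measurable]: "g \<in> measurable (perc p) (perc p)"
    and b: "\<And>x. (\<integral>\<^sup>+w. cluster_size (dual (g w)) x \<partial>perc p) \<le> b"
  shows "(\<integral>\<^sup>+w. cluster_size (dual (upd e False (g w))) x \<partial>perc p) \<le> 3 * b"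
proof -
  have m [measurable]: "(\<lambda>w. cluster_size (dual (g w)) x) \<in> borel_measurable (perc p)" for x
    by (rule measurable_compose[OF g measurable_cluster_size_dual])
  have "(\<integral>\<^sup>+w. cluster_size (dual (upd e False (g w))) x \<partial>perc p) \<le>
    (\<integral>\<^sup>+w. cluster_size (dual (g w)) x + cluster_size (dual (g w)) (fst (ud e)) + cluster_size (dual (g w)) (tip (ud e)) \<partial>perc p)"
    unfolding dual_upd by (intro nn_integral_mono cluster_size_upd)
  also have "\<dots> = (\<integral>\<^sup>+w. cluster_size (dual (g w)) x \<partial>perc p) + (\<integral>\<^sup>+w. cluster_size (dual (g w)) (fst (ud e)) \<partial>perc p) + (\<integral>\<^sup>+w. cluster_size (dual (g w)) (tip (ud e)) \<partial>perc p)"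
    by (simp add: nn_integral_add)
  also have "\<dots> \<le> b + b + b" by (intro add_mono b)
  also have "\<dots> = (1 + 1 + 1) * b" by (simp only: distrib_right mult_1)
  also have "\<dots> = 3 * b" by simp
  finally show ?thesis .
qed

lemma nn_closed:
  assumes p: "0 \<le> p" "p \<le> 1" and F: "F \<in> borel_measurable (perc p)"
  shows "(\<integral>\<^sup>+w. of_bool (\<not> w e) * F w \<partial>perc p) = ennreal (1 - p) * (\<integral>\<^sup>+w. F (upd e False w) \<partial>perc p)"
proof -
  have m: "(\<lambda>w. of_bool (\<not> w e) * F w) \<in> borel_measurable (perc p)"
  proof -
    have [measurable]: "Measurable.pred (perc p) (\<lambda>w. w e)" by (rule measurable_coord)
    note F[measurable]
    have "(\<lambda>w. if w e then 0 else F w) \<in> borel_measurable (perc p)" by measurable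
    then show ?thesis by (rule measurable_cong[THEN iffD1, rotated]) simp
  qed
  show ?thesis by (subst nn_resample[OF p m, of e]) simp
qed

text \<open>Forcing an edge to be closed costs a factor \<open>1 - p\<close> and at most triples the
  bound on the mean cluster size; two edges turn 2 into 18.\<close>

lemma nn_pair:
  assumes p: "7 / 8 \<le> p" "p < 1" and e: "e \<noteq> e'"
  shows "(\<integral>\<^sup>+w. of_bool (\<not> w e) * (of_bool (\<not> w e') * cluster_size (dual w) x) \<partial>perc p) \<le> ennreal (18 * (1 - p)\<^sup>2)"
proof -
  have p': "0 \<le> p" "p \<le> 1" using p by auto
  have [measurable]: "Measurable.pred (perc p) (\<lambda>w. \<not> w e')" by (intro pred_intros_logic measurable_coord)
  have m: "(\<lambda>w. of_bool (\<not> w e') * cluster_size (dual w) x) \<in> borel_measurable (perc p)"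
  proof -
    have "(\<lambda>w. if \<not> w e' then cluster_size (dual w) x else 0) \<in> borel_measurable (perc p)" by measurable
    then show ?thesis by (rule measurable_cong[THEN iffD1, rotated]) simp
  qed
  have "(\<integral>\<^sup>+w. of_bool (\<not> w e) * (of_bool (\<not> w e') * cluster_size (dual w) x) \<partial>perc p)
      = ennreal (1 - p) * (\<integral>\<^sup>+w. of_bool (\<not> w e') * cluster_size (dual (upd e False w)) x \<partial>perc p)"
    using e by (subst nn_closed[OF p' m]) simp
  also have "\<dots> = ennreal (1 - p) * (ennreal (1 - p) * (\<integral>\<^sup>+w. cluster_size (dual (upd e False (upd e' False w))) x \<partial>perc p))"
    by (subst nn_closed[OF p' measurable_cluster_size_upd]) simp
  also have "\<dots> \<le> ennreal (1 - p) * (ennreal (1 - p) * ennreal 18)"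
  proof (intro mult_left_mono)
    have "(\<integral>\<^sup>+w. cluster_size (dual (upd e False (upd e' False w))) x \<partial>perc p) \<le> 3 * (3 * 2)"
    proof (rule nn_cluster_size_upd[OF measurable_upd])
      fix y
      show "(\<integral>\<^sup>+w. cluster_size (dual (upd e' False w)) y \<partial>perc p) \<le> 3 * 2"
        by (rule nn_cluster_size_upd[where g = "\<lambda>w. w"]) (use cluster_size_dual_small[OF p] in auto)
    qed
    then show "(\<integral>\<^sup>+w. cluster_size (dual (upd e False (upd e' False w))) x \<partial>perc p) \<le> ennreal 18" by simp
  qed auto
  also have "\<dots> = ennreal (18 * (1 - p)\<^sup>2)"
    using p by (simp add: ennreal_mult[symmetric] power2_eq_square ac_simps del: ennreal_numeral)
  finally show ?thesis .
qed

lemma measurable_multi_cost: "(\<lambda>w. multi_cost K w x) \<in> borel_measurable (perc p)"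
proof -
  have [measurable]: "Measurable.pred (perc p) (\<lambda>w. multi K w x)"
    by (rule pred_fin[OF finite_column_edges[of K x]]) (unfold dep_def multi_def, metis)
  show ?thesis unfolding multi_cost_def by measurable
qed

text \<open>A union bound over at most \<open>(2 * K + 1)^2\<close> pairs of closed edges and
  \<open>K + 1\<close> rows, with \<open>nn_pair\<close> for each.\<close>

lemma multi_cost_expect:
  assumes p: "7 / 8 \<le> p" "p < 1"
  shows "(\<integral>\<^sup>+w. multi_cost K w x \<partial>perc p) \<le> ennreal (real ((K + 1) * (2 * K + 1)\<^sup>2 * 18) * (1 - p)\<^sup>2)"
proof -
  define P where "P = {q \<in> column_edges K x \<times> column_edges K x. fst q \<noteq> snd q}"
  have finP: "finite P" unfolding P_def by simp
  have "card P \<le> card (column_edges K x \<times> column_edges K x)" unfolding P_def by (intro card_mono) auto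
  also have "\<dots> \<le> (2 * K + 1)\<^sup>2" unfolding card_cartesian_product power2_eq_square by (intro mult_mono card_column_edges) auto
  finally have cP: "card P \<le> (2 * K + 1)\<^sup>2" .
  let ?f = "\<lambda>q j w. of_bool (\<not> w (fst q)) * (of_bool (\<not> w (snd q)) * cluster_size (dual w) (int x, int j)) :: ennreal"
  have m: "(\<lambda>w. ?f q j w) \<in> borel_measurable (perc p)" for q :: "edge \<times> edge" and j
  proof -
    have [measurable]: "Measurable.pred (perc p) (\<lambda>w. \<not> w (fst q) \<and> \<not> w (snd q))" by (intro pred_intros_logic measurable_coord)
    have "(\<lambda>w. if \<not> w (fst q) \<and> \<not> w (snd q) then cluster_size (dual w) (int x, int j) else 0) \<in> borel_measurable (perc p)" by measurable
    then show ?thesis by (rule measurable_cong[THEN iffD1, rotated]) simp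
  qed
  have le: "multi_cost K w x \<le> (\<Sum>q\<in>P. \<Sum>j\<le>K. ?f q j w)" for w
  proof (cases "multi K w x")
    case True
    then obtain e e' where e: "e \<in> column_edges K x" "e' \<in> column_edges K x" "e \<noteq> e'" "\<not> w e" "\<not> w e'" unfolding multi_def by blast
    then have "(e, e') \<in> P" by (simp add: P_def)
    then have "(\<Sum>j\<le>K. ?f (e, e') j w) \<le> (\<Sum>q\<in>P. \<Sum>j\<le>K. ?f q j w)" using finP by (intro member_le_sum) auto
    then show ?thesis using True e by (simp add: multi_cost_def)
  qed (simp add: multi_cost_def)
  have "(\<integral>\<^sup>+w. multi_cost K w x \<partial>perc p) \<le> (\<integral>\<^sup>+w. (\<Sum>q\<in>P. \<Sum>j\<le>K. ?f q j w) \<partial>perc p)" by (intro nn_integral_mono le)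
  also have "\<dots> = (\<Sum>q\<in>P. \<Sum>j\<le>K. (\<integral>\<^sup>+w. ?f q j w \<partial>perc p))"
    by (simp only: nn_integral_sum[OF m] nn_integral_sum[OF borel_measurable_sum[OF m]])
  also have "\<dots> \<le> (\<Sum>q\<in>P. \<Sum>j\<le>K. ennreal (18 * (1 - p)\<^sup>2))"
    by (intro sum_mono nn_pair[OF p]) (simp add: P_def)
  also have "\<dots> = ennreal (real (card P * (K + 1)) * (18 * (1 - p)\<^sup>2))"
    by (simp add: ennreal_of_nat_eq_real_of_nat ennreal_mult[symmetric] algebra_simps)
  also have "\<dots> \<le> ennreal (real ((K + 1) * (2 * K + 1)\<^sup>2 * 18) * (1 - p)\<^sup>2)"
  proof (intro ennreal_leI)
    have "real (card P * (K + 1)) \<le> real ((2 * K + 1)\<^sup>2 * (K + 1))" using cP by (intro of_nat_mono mult_right_mono) auto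
    then have "real (card P * (K + 1)) * (18 * (1 - p)\<^sup>2) \<le> real ((2 * K + 1)\<^sup>2 * (K + 1)) * (18 * (1 - p)\<^sup>2)"
      by (rule mult_right_mono) simp
    also have "\<dots> = real ((K + 1) * (2 * K + 1)\<^sup>2 * 18) * (1 - p)\<^sup>2" by (simp add: ac_simps)
    finally show "real (card P * (K + 1)) * (18 * (1 - p)\<^sup>2) \<le> real ((K + 1) * (2 * K + 1)\<^sup>2 * 18) * (1 - p)\<^sup>2" .
  qed
  finally show ?thesis .
qed

subsection \<open>The upper bound for the time constant\<close>

text \<open>Cost of walking along the axis from the origin to the first cluster point.\<close>

definition entry_cost :: "config \<Rightarrow> ennreal" where
  "entry_cost w = (\<Sum>i<first_cluster w. Y (sft i w))"

lemma entry_cost_finite: "good w \<Longrightarrow> entry_cost w < \<infinity>"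
  by (simp add: entry_cost_def Y_sft good_def ennreal_mult_less_top)

lemma axis_cost_finite: "good w \<Longrightarrow> axis_cost K w < \<infinity>"
  by (simp add: axis_cost_def good_def ennreal_mult_less_top)

lemma multi_cost_finite: "good w \<Longrightarrow> multi_cost K w x < \<infinity>"
  by (simp add: multi_cost_def good_def)

lemma measurable_entry_cost: "entry_cost \<in> borel_measurable (perc p)"
proof -
  have "(\<lambda>w. \<Sum>i<k. Y (sft i w)) \<in> borel_measurable (perc p)" for k
    by (intro borel_measurable_sum measurable_compose[OF measurable_sft measurable_Y])
  then have "(\<lambda>w. \<Sum>i<first_cluster w. Y (sft i w)) \<in> borel_measurable (perc p)"
    by (rule measurable_compose_countable[OF _ measurable_first_cluster])
  then show ?thesis by (simp add: entry_cost_def[abs_def])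
qed

lemma measurable_axis_cost: "axis_cost K \<in> borel_measurable (perc p)"
  unfolding axis_cost_def[abs_def] by measurable

text \<open>Route: from the first cluster point back to the origin, through the strip to
  \<open>(n, 0)\<close>, and on to the next cluster point. The intermediate points may lie off the
  infinite cluster; only the two ends have to be in it.\<close>

lemma cluster_dist_upper:
  assumes g: "good w" and s: "length s = K" "K > 0"
  shows "ennreal (cluster_dist n w) \<le> entry_cost w + (axis_cost K w + ennreal (real_of_int (int n + base_height K w s n)) + 4 * (\<Sum>x<n. multi_cost K w x)) + entry_cost (sft n w)"
proof -
  let ?k = "first_cluster w" and ?l = "first_cluster (sft n w)"
  have "route_cost w (0, 0) (int ?k, 0) (entry_cost w)" using route_cost_row[of w 0 ?k] by (simp add: entry_cost_def)
  then have 1: "route_cost w (int ?k, 0) (0, 0) (entry_cost w)" by (rule route_cost_sym)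
  have 2: "route_cost w (0, 0) (int n, 0) (axis_cost K w + ennreal (real_of_int (int n + base_height K w s n)) + 4 * (\<Sum>x<n. multi_cost K w x))"
    using strip_path[OF s, of 0 w n] by simp
  have 3: "route_cost w (int n, 0) (int (n + ?l), 0) (entry_cost (sft n w))"
    using route_cost_row[of w n ?l] by (simp add: entry_cost_def sft_add add.commute)
  have "route_cost w (int ?k, 0) (int (n + ?l), 0) (entry_cost w + (axis_cost K w + ennreal (real_of_int (int n + base_height K w s n)) + 4 * (\<Sum>x<n. multi_cost K w x)) + entry_cost (sft n w))"
    by (rule route_cost_trans[OF 3 route_cost_trans[OF 2 1]])
  from route_cost_chem_dist[OF this _ conn_inf_first_cluster[OF g] conn_inf_first_cluster_sft[OF g]] g
  obtain N where N: "chem_dist w (int ?k, 0) (int (n + ?l), 0) = enat N"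
    "ennreal (real N) \<le> entry_cost w + (axis_cost K w + ennreal (real_of_int (int n + base_height K w s n)) + 4 * (\<Sum>x<n. multi_cost K w x)) + entry_cost (sft n w)"
    unfolding good_def by blast
  then show ?thesis using g by (simp add: cluster_dist_def)
qed

lemma cluster_dist_upper_real:
  assumes g: "good w" and s: "length s = K" "K > 0"
  shows "cluster_dist n w \<le> enn2real (entry_cost w) + enn2real (axis_cost K w) + real n + real_of_int (base_height K w s n) + 4 * (\<Sum>x<n. enn2real (multi_cost K w x)) + enn2real (entry_cost (sft n w))"
proof -
  have r: "ennreal (enn2real a) = a" if "a < \<infinity>" for a using that by simp
  have h: "0 \<le> real_of_int (base_height K w s n)" using base_height_ge[of K w s n] by linarith
  have B: "(\<Sum>x<n. multi_cost K w x) = ennreal (\<Sum>x<n. enn2real (multi_cost K w x))"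
    using r[OF multi_cost_finite[OF g]] by (subst sum_ennreal[symmetric]) auto
  have g': "good (sft n w)" using g by (simp add: good_sft)
  have b0: "0 \<le> (\<Sum>x<n. enn2real (multi_cost K w x))" by (intro sum_nonneg) simp
  have "ennreal (cluster_dist n w) \<le> ennreal (enn2real (entry_cost w)) + (ennreal (enn2real (axis_cost K w)) + ennreal (real_of_int (int n + base_height K w s n)) + ennreal 4 * ennreal (\<Sum>x<n. enn2real (multi_cost K w x))) + ennreal (enn2real (entry_cost (sft n w)))"
    using cluster_dist_upper[OF g s, of n] unfolding r[OF entry_cost_finite[OF g]] r[OF entry_cost_finite[OF g']] r[OF axis_cost_finite[OF g]] B by simp
  also have "\<dots> = ennreal (enn2real (entry_cost w) + (enn2real (axis_cost K w) + real_of_int (int n + base_height K w s n) + 4 * (\<Sum>x<n. enn2real (multi_cost K w x))) + enn2real (entry_cost (sft n w)))"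
    using h b0 by (simp add: ennreal_mult[symmetric] ennreal_plus[symmetric] del: ennreal_plus ennreal_numeral)
  finally show ?thesis using h b0 by (subst (asm) ennreal_le_iff) auto
qed

lemma min_add_le: "0 \<le> (a::real) \<Longrightarrow> 0 \<le> b \<Longrightarrow> 0 \<le> c \<Longrightarrow> 0 \<le> L \<Longrightarrow> min L (a + b + c) \<le> min L a + min L b + c"
  by (auto simp: min_def)

lemma EE_min_over_n:
  assumes f: "f \<in> borel_measurable (perc p)" "\<And>w. 0 \<le> f w" and L: "0 \<le> L"
  shows "(\<lambda>n. EE p (\<lambda>w. min L (f w / real n))) \<longlonglongrightarrow> 0"
proof -
  have "(\<lambda>n. EE p (\<lambda>w. min L (f w / real n))) \<longlonglongrightarrow> EE p (\<lambda>w. 0)"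
    unfolding EE_def
  proof (rule integral_dominated_convergence[where w = "\<lambda>_. L"])
    interpret P: prob_space "perc p" by (rule prob_space_perc)
    show "integrable (perc p) (\<lambda>_. L)" by simp
    show "AE w in perc p. (\<lambda>n. min L (f w / real n)) \<longlonglongrightarrow> 0"
    proof (rule AE_I2)
      fix w
      from tendsto_min[OF tendsto_const[of L] lim_const_over_n[of "f w"]]
      show "(\<lambda>n. min L (f w / real n)) \<longlonglongrightarrow> 0" using L by (simp add: min_absorb2)
    qed
    show "AE w in perc p. norm (min L (f w / real n)) \<le> L" for n
      using L f(2) by (auto simp: min_def)
  qed (use f(1) in measurable)
  then show ?thesis by simp
qed

theorem upper_bound:
  assumes p: "7 / 8 \<le> p" "p < 1" and good: "AE w in perc p. good w"
    and lim: "AE w in perc p. (\<lambda>n. cluster_dist n w / real n) \<longlonglongrightarrow> \<mu>"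
  shows "\<mu> \<le> 1 + 2 * (1 - p) * (total_weight m / total_weight (Suc m)) + 4 * (real ((Suc m + 1) * (2 * Suc m + 1)\<^sup>2 * 18) * (1 - p)\<^sup>2)"
    (is "_ \<le> 1 + ?A + 4 * ?B")
proof -
  interpret P: prob_space "perc p" by (rule prob_space_perc)
  have p': "0 \<le> p" "p \<le> 1" using p by auto
  define K where "K = Suc m"
  \<comment> \<open>Above the limit, so truncation at \<open>L\<close> leaves \<open>\<mu>\<close>
    unchanged, while the truncated entry costs have expectations that vanish after division by
    \<open>n\<close>.\<close>
  define L where "L = \<bar>\<mu>\<bar> + 1"
  define f where "f n w = min L (cluster_dist n w / real n)" for n w
  define u where "u w = enn2real (entry_cost w) + enn2real (axis_cost K w)" for w
  define v where "v w = enn2real (entry_cost w)" for w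
  define b where "b x w = enn2real (multi_cost K w x)" for x w
  \<comment> \<open>The height averaged over stationary initial profiles. The comparison holds for
    each profile separately, so the average may be taken before the expectation.\<close>
  define C where "C n w = lsum K (\<lambda>s. wt s 0 * real_of_int (base_height K w s n)) / total_weight K" for n w
  have L: "0 \<le> L" "min L \<mu> = \<mu>" by (auto simp: L_def)
  have fm: "f n \<in> borel_measurable (perc p)" for n unfolding f_def using measurable_cluster_dist[of n p] by measurable
  have f0: "\<bar>f n w\<bar> \<le> L" for n w using L(1) by (auto simp: f_def cluster_dist_def min_def)
  have um: "u \<in> borel_measurable (perc p)" unfolding u_def[abs_def] using measurable_entry_cost measurable_axis_cost by measurable
  have vm: "v \<in> borel_measurable (perc p)" unfolding v_def[abs_def] using measurable_entry_cost by measurable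
  have vsm: "(\<lambda>w. v (sft n w)) \<in> borel_measurable (perc p)" for n by (rule measurable_compose[OF measurable_sft vm])
  have uv0: "0 \<le> u w" "0 \<le> v w" "0 \<le> b x w" for w x by (auto simp: u_def v_def b_def)
  have Zd: "total_weight K > 0" by (rule total_weight_pos)
  have hint: "integrable (perc p) (\<lambda>w. real_of_int (base_height K w s n))" for s n
    by (rule dep_finite_integrable[OF _ dep_comp[OF dep_slope_state_base_height(2)]]) simp
  have ls: "integrable (perc p) (\<lambda>w. lsum k (\<lambda>s. F s w)) \<and> EE p (\<lambda>w. lsum k (\<lambda>s. F s w)) = lsum k (\<lambda>s. EE p (F s))"
    if "\<And>s. integrable (perc p) (F s)" for k and F :: "bool list \<Rightarrow> config \<Rightarrow> real"
    using that
  proof (induction k arbitrary: F)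
    case (Suc k)
    then show ?case using Suc.IH[of "\<lambda>s. F (True # s)"] Suc.IH[of "\<lambda>s. F (False # s)"] by (simp add: EE_add)
  qed simp
  have iC: "integrable (perc p) (C n)" for n
    unfolding C_def[abs_def] using ls[of "\<lambda>s w. wt s 0 * real_of_int (base_height K w s n)" K] hint by simp
  have EC: "EE p (C n) \<le> real K + real n * ?A" for n
  proof -
    have "EE p (C n) = lsum K (\<lambda>s. wt s 0 * EE p (\<lambda>w. real_of_int (base_height K w s n))) / total_weight K"
      unfolding C_def using ls[of "\<lambda>s w. wt s 0 * real_of_int (base_height K w s n)" K] hint by (simp add: EE_def)
    also have "\<dots> \<le> (real K * total_weight K + real n * (2 * (1 - p) * total_weight m)) / total_weight K"
      using base_height_expect[OF p', of m n] Zd unfolding K_def by (intro divide_right_mono) auto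
    also have "\<dots> = real K + real n * ?A" using Zd by (simp add: add_divide_distrib K_def)
    finally show ?thesis .
  qed
  have nb: "(\<integral>\<^sup>+w. ennreal (b x w) \<partial>perc p) \<le> ennreal ?B" for x
  proof -
    have "(\<integral>\<^sup>+w. ennreal (b x w) \<partial>perc p) \<le> (\<integral>\<^sup>+w. multi_cost K w x \<partial>perc p)"
      unfolding b_def by (intro nn_integral_mono) (metis ennreal_enn2real_if ennreal_zero_less_top infinity_ennreal_def le_less less_imp_le order_refl top_greatest zero_le)
    also have "\<dots> \<le> ennreal ?B" unfolding K_def by (rule multi_cost_expect[OF p])
    finally show ?thesis .
  qed
  have bm: "b x \<in> borel_measurable (perc p)" for x unfolding b_def[abs_def] using measurable_multi_cost[of K x p] by measurable
  have ib: "integrable (perc p) (b x)" for x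
  proof (rule integrableI_bounded[OF bm])
    show "(\<integral>\<^sup>+w. ennreal (norm (b x w)) \<partial>perc p) < \<infinity>"
      using le_less_trans[OF nb[of x], of \<infinity>] uv0(3)[of x] by simp
  qed
  have Eb: "EE p (b x) \<le> ?B" for x
  proof -
    have "ennreal (EE p (b x)) \<le> ennreal ?B"
      unfolding EE_def using nb[of x] by (subst nn_integral_eq_integral[OF ib, symmetric]) (auto simp: uv0)
    then show ?thesis by (subst (asm) ennreal_le_iff) auto
  qed
  have key: "f n w \<le> min L (u w / real n) + min L (v (sft n w) / real n) + (1 + C n w / real n + 4 * (\<Sum>x<n. b x w) / real n)"
    if w: "good w" and n: "n \<ge> 1" for n w
  proof -
    have K0: "K > 0" by (simp add: K_def)
    define R where "R = u w + real n + 4 * (\<Sum>x<n. b x w) + v (sft n w)"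
    have X: "cluster_dist n w - R \<le> real_of_int (base_height K w s n)" if "length s = K" for s
      using cluster_dist_upper_real[OF w that K0, of n] by (simp add: R_def u_def v_def b_def)
    have "(cluster_dist n w - R) * total_weight K = lsum K (\<lambda>s. (cluster_dist n w - R) * wt s 0)" by (simp only: lsum_cmul total_weight_def)
    also have "\<dots> \<le> lsum K (\<lambda>s. wt s 0 * real_of_int (base_height K w s n))"
      using X wt_nonneg by (intro lsum_mono) (metis mult.commute mult_left_mono)
    finally have le: "cluster_dist n w - R \<le> C n w" using Zd by (simp add: C_def pos_le_divide_eq)
    have C0: "0 \<le> C n w"
    proof -
      have "lsum K (\<lambda>s. 0) \<le> lsum K (\<lambda>s. wt s 0 * real_of_int (base_height K w s n))"
      proof (intro lsum_mono mult_nonneg_nonneg wt_nonneg)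
        fix s show "0 \<le> real_of_int (base_height K w s n)" using base_height_ge[of K w s n] by linarith
      qed
      then show ?thesis using Zd by (simp add: C_def)
    qed
    have S0: "0 \<le> (\<Sum>x<n. b x w)" using uv0 by (intro sum_nonneg) auto
    have "cluster_dist n w / real n \<le> (R + C n w) / real n" using le by (intro divide_right_mono) auto
    also have "\<dots> = u w / real n + v (sft n w) / real n + (1 + C n w / real n + 4 * (\<Sum>x<n. b x w) / real n)"
      using n by (simp add: R_def add_divide_distrib)
    finally have "f n w \<le> min L (u w / real n + v (sft n w) / real n + (1 + C n w / real n + 4 * (\<Sum>x<n. b x w) / real n))"
      unfolding f_def by (rule min.mono[OF order_refl])
    also have "\<dots> \<le> min L (u w / real n) + min L (v (sft n w) / real n) + (1 + C n w / real n + 4 * (\<Sum>x<n. b x w) / real n)"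
      using uv0 C0 S0 L(1) by (intro min_add_le) auto
    finally show ?thesis .
  qed
  have lhs: "(\<lambda>n. EE p (f n)) \<longlonglongrightarrow> \<mu>"
  proof -
    have "(\<lambda>n. EE p (f n)) \<longlonglongrightarrow> EE p (\<lambda>_. min L \<mu>)"
      unfolding EE_def
    proof (rule integral_dominated_convergence[where w = "\<lambda>_. L"])
      show "AE w in perc p. (\<lambda>n. f n w) \<longlonglongrightarrow> min L \<mu>"
        using lim by eventually_elim (simp only: f_def, intro tendsto_min tendsto_const)
    qed (use fm f0 in auto)
    then show ?thesis by (simp add: L(2))
  qed
  define g1 where "g1 n = EE p (\<lambda>w. min L (u w / real n))" for n
  define g2 where "g2 n = EE p (\<lambda>w. min L (v w / real n))" for n
  have g: "g1 \<longlonglongrightarrow> 0" "g2 \<longlonglongrightarrow> 0"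
    unfolding g1_def[abs_def] g2_def[abs_def] using um vm uv0 L(1) by (auto intro: EE_min_over_n)
  have main: "EE p (f n) \<le> g1 n + g2 n + (1 + (real K / real n + ?A) + 4 * ?B)" if n: "n \<ge> 1" for n
  proof -
    have im: "integrable (perc p) (\<lambda>w. min L (h w / real n))" if "h \<in> borel_measurable (perc p)" "\<And>w. 0 \<le> h w" for h
      by (rule integrable_bdd[where B = L]) (use that L(1) in \<open>measurable, auto simp: min_def\<close>)
    have i1: "integrable (perc p) (\<lambda>w. min L (u w / real n))" by (rule im[OF um]) (rule uv0)
    have i2: "integrable (perc p) (\<lambda>w. min L (v (sft n w) / real n))" by (rule im[OF vsm]) (rule uv0)
    have i3: "integrable (perc p) (\<lambda>w. 1 + C n w / real n + 4 * (\<Sum>x<n. b x w) / real n)" using iC ib by simp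
    have "EE p (f n) \<le> EE p (\<lambda>w. min L (u w / real n) + min L (v (sft n w) / real n) + (1 + C n w / real n + 4 * (\<Sum>x<n. b x w) / real n))"
      unfolding EE_def
    proof (rule integral_mono_AE)
      show "integrable (perc p) (f n)" by (rule integrable_bdd[OF fm f0])
      show "integrable (perc p) (\<lambda>w. min L (u w / real n) + min L (v (sft n w) / real n) + (1 + C n w / real n + 4 * (\<Sum>x<n. b x w) / real n))"
        by (rule Bochner_Integration.integrable_add[OF Bochner_Integration.integrable_add[OF i1 i2] i3])
      show "AE w in perc p. f n w \<le> min L (u w / real n) + min L (v (sft n w) / real n) + (1 + C n w / real n + 4 * (\<Sum>x<n. b x w) / real n)"
        using good by eventually_elim (rule key[OF _ n])
    qed
    also have "\<dots> = g1 n + EE p (\<lambda>w. min L (v (sft n w) / real n)) + EE p (\<lambda>w. 1 + C n w / real n + 4 * (\<Sum>x<n. b x w) / real n)"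
      unfolding g1_def by (simp only: EE_add[OF Bochner_Integration.integrable_add[OF i1 i2] i3] EE_add[OF i1 i2])
    also have "EE p (\<lambda>w. min L (v (sft n w) / real n)) = g2 n"
      unfolding g2_def by (rule EE_sft[where F = "\<lambda>w. min L (v w / real n)"]) (use vm in measurable)
    also have "EE p (\<lambda>w. 1 + C n w / real n + 4 * (\<Sum>x<n. b x w) / real n) = 1 + EE p (C n) / real n + 4 * (\<Sum>x<n. EE p (b x)) / real n"
      unfolding EE_def using iC ib P.prob_space by simp
    also have "\<dots> \<le> 1 + (real K / real n + ?A) + 4 * ?B"
    proof -
      have "EE p (C n) / real n \<le> (real K + real n * ?A) / real n" using EC[of n] by (rule divide_right_mono) simp
      also have "\<dots> = real K / real n + ?A" using n by (simp add: add_divide_distrib)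
      finally have 1: "EE p (C n) / real n \<le> real K / real n + ?A" .
      have "(\<Sum>x<n. EE p (b x)) \<le> (\<Sum>x<n. ?B)" by (intro sum_mono Eb)
      then have "(\<Sum>x<n. EE p (b x)) \<le> real n * ?B" by simp
      then have 2: "(\<Sum>x<n. EE p (b x)) / real n \<le> ?B" using n by (simp add: divide_le_eq mult.commute)
      have 3: "4 * (\<Sum>x<n. EE p (b x)) / real n = 4 * ((\<Sum>x<n. EE p (b x)) / real n)" by simp
      show ?thesis unfolding 3 using 1 2 by linarith
    qed
    finally show ?thesis by simp
  qed
  have rhs: "(\<lambda>n. g1 n + g2 n + (1 + (real K / real n + ?A) + 4 * ?B)) \<longlonglongrightarrow> 0 + 0 + (1 + (0 + ?A) + 4 * ?B)"
    by (intro tendsto_intros g lim_const_over_n)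
  have "\<mu> \<le> 0 + 0 + (1 + (0 + ?A) + 4 * ?B)"
    by (rule LIMSEQ_le[OF lhs rhs]) (use main in blast)
  then show ?thesis by simp
qed

definition quad_const :: "nat \<Rightarrow> real" where
  "quad_const m = 4 * real ((Suc m + 1) * (2 * Suc m + 1)\<^sup>2 * 18)"

lemma quad_const_pos: "quad_const m > 0"
  unfolding quad_const_def by (intro mult_pos_pos, simp) (simp only: of_nat_0_less_iff, intro mult_pos_pos zero_less_power, simp_all)

lemma time_constant:
  assumes p: "1 / 2 < p" "p < 1"
  shows "\<exists>\<mu>. (AE w in perc p. conn_inf w (0, 0) \<longrightarrow>
          ((\<lambda>k. ereal_of_enat (chem_dist w (0, 0) (int (T1 w k), 0)) / ereal (real (T1 w k))) \<longlonglongrightarrow> ereal \<mu>))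
      \<and> 1 + (1 - p) / 2 \<le> \<mu> \<and> (7 / 8 \<le> p \<longrightarrow> (\<forall>m. \<mu> \<le> 1 + (1 - p) / 2 + (1 - p) * (3 / (4 * real m + 6)) + quad_const m * (1 - p)\<^sup>2))"
proof (cases "Pr p (\<lambda>w. conn_inf w (0, 0)) > 0")
  case True
  interpret S: subadditive p cluster_dist by (rule cluster_dist_subadditive[OF p])
  have good: "AE w in perc p. good w" by (rule AE_good[OF p True])
  have lim: "AE w in perc p. (\<lambda>n. cluster_dist n w / real n) \<longlonglongrightarrow> S.gam" by (rule S.kingman)
  have "AE w in perc p. conn_inf w (0, 0) \<longrightarrow>
          ((\<lambda>k. ereal_of_enat (chem_dist w (0, 0) (int (T1 w k), 0)) / ereal (real (T1 w k))) \<longlonglongrightarrow> ereal S.gam)"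
    using good lim by eventually_elim (blast intro: T1_limit)
  moreover have "1 + (1 - p) / 2 \<le> S.gam" by (rule lower_bound[OF p good lim])
  moreover have "S.gam \<le> 1 + (1 - p) / 2 + (1 - p) * (3 / (4 * real m + 6)) + quad_const m * (1 - p)\<^sup>2" if "7 / 8 \<le> p" for m
  proof -
    have "2 * (real (m + 3) / (4 * real m + 6)) = 1 / 2 + 3 / (4 * real m + 6)" by (simp add: field_simps)
    then have "2 * (1 - p) * (total_weight m / total_weight (Suc m)) = (1 - p) * (1 / 2 + 3 / (4 * real m + 6))"
      unfolding total_weight_ratio by (metis mult.assoc mult.commute)
    also have "\<dots> = (1 - p) / 2 + (1 - p) * (3 / (4 * real m + 6))"
      using distrib_left[of "1 - p" "1 / 2" "3 / (4 * real m + 6)"] by simp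
    finally show ?thesis using upper_bound[OF that p(2) good lim, of m] unfolding quad_const_def by (simp only: mult.assoc add.assoc)
  qed
  ultimately show ?thesis by blast
next
  case False
  have "AE w in perc p. \<not> conn_inf w (0, 0)"
  proof -
    interpret P: prob_space "perc p" by (rule prob_space_perc)
    have "measure (perc p) {w. conn_inf w (0, 0)} = 0"
      using False Pr_nonneg[of p "\<lambda>w. conn_inf w (0, 0)"] Pr_measure[OF pred_conn_inf[where p = p and x = "(0, 0)"]] by linarith
    moreover have "{w. conn_inf w (0, 0)} \<in> sets (perc p)" using pred_conn_inf[where p = p and x = "(0, 0)"] by (simp add: pred_def)
    ultimately show ?thesis by (subst AE_iff_measurable[where N = "{w. conn_inf w (0, 0)}"]) (auto simp: P.emeasure_eq_measure)
  qed
  then have "AE w in perc p. conn_inf w (0, 0) \<longrightarrow>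
          ((\<lambda>k. ereal_of_enat (chem_dist w (0, 0) (int (T1 w k), 0)) / ereal (real (T1 w k))) \<longlonglongrightarrow> ereal (1 + (1 - p) / 2))"
    by eventually_elim blast
  moreover have "0 \<le> (1 - p) * (3 / (4 * real m + 6)) + quad_const m * (1 - p)\<^sup>2" for m
    using p by (intro add_nonneg_nonneg mult_nonneg_nonneg) (auto intro: less_imp_le quad_const_pos)
  \<comment> \<open>With the limit statement void, \<open>\<mu>\<close> is given its first-order
    value so that both bounds hold in this case too.\<close>
  ultimately show ?thesis by (intro exI[of _ "1 + (1 - p) / 2"]) (auto simp: add.assoc)
qed

theorem theorem1:
  "\<exists>\<mu> :: real \<Rightarrow> real.
     (\<forall>p\<in>{1/2<..<1}.
        AE \<omega> in perc p. conn_inf \<omega> (0, 0) \<longrightarrow>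
          ((\<lambda>k. ereal_of_enat (chem_dist \<omega> (0, 0) (int (T1 \<omega> k), 0)) / ereal (real (T1 \<omega> k)))
             \<longlonglongrightarrow> ereal (\<mu> p))) \<and>
     (\<lambda>p. \<mu> p - (1 + (1 - p) / 2)) \<in> o[at_left (1::real)](\<lambda>p. 1 - p)"
proof -
  have "\<forall>p\<in>{1/2<..<1::real}. \<exists>\<mu>. (AE w in perc p. conn_inf w (0, 0) \<longrightarrow>
          ((\<lambda>k. ereal_of_enat (chem_dist w (0, 0) (int (T1 w k), 0)) / ereal (real (T1 w k))) \<longlonglongrightarrow> ereal \<mu>))
      \<and> 1 + (1 - p) / 2 \<le> \<mu> \<and> (7 / 8 \<le> p \<longrightarrow> (\<forall>m. \<mu> \<le> 1 + (1 - p) / 2 + (1 - p) * (3 / (4 * real m + 6)) + quad_const m * (1 - p)\<^sup>2))"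
    by (intro ballI time_constant) auto
  from bchoice[OF this] obtain \<mu> where \<mu>: "\<forall>p\<in>{1/2<..<1}. (AE w in perc p. conn_inf w (0, 0) \<longrightarrow>
          ((\<lambda>k. ereal_of_enat (chem_dist w (0, 0) (int (T1 w k), 0)) / ereal (real (T1 w k))) \<longlonglongrightarrow> ereal (\<mu> p)))
      \<and> 1 + (1 - p) / 2 \<le> \<mu> p \<and> (7 / 8 \<le> p \<longrightarrow> (\<forall>m. \<mu> p \<le> 1 + (1 - p) / 2 + (1 - p) * (3 / (4 * real m + 6)) + quad_const m * (1 - p)\<^sup>2))"
    by (elim exE)
  have "(\<lambda>p. \<mu> p - (1 + (1 - p) / 2)) \<in> o[at_left (1::real)](\<lambda>p. 1 - p)"
  proof (rule landau_o.smallI)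
    fix c :: real assume c: "c > 0"
    \<comment> \<open>The width comes first: it brings the linear error below \<open>c / 2\<close>.
      Then \<open>p\<close> is taken so close to 1 that the quadratic error, whose constant depends
      on \<open>m\<close>, is also below \<open>c / 2\<close> times \<open>1 - p\<close>.\<close>
    obtain m :: nat where m: "6 / c \<le> real m" using real_arch_simple by blast
    have m': "3 / (4 * real m + 6) \<le> c / 2" using m c by (simp add: field_simps)
    have D: "quad_const m > 0" by (rule quad_const_pos)
    let ?b = "max (7 / 8) (1 - c / (2 * quad_const m))"
    have b: "?b < 1" using c D by simp
    have "norm (\<mu> p - (1 + (1 - p) / 2)) \<le> c * norm (1 - p)" if "p > ?b" "p < 1" for p
    proof -
      have p: "p \<in> {1/2<..<1}" "7 / 8 \<le> p" using that by auto
      have lo: "1 + (1 - p) / 2 \<le> \<mu> p" using \<mu> p by blast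
      have up: "\<mu> p \<le> 1 + (1 - p) / 2 + (1 - p) * (3 / (4 * real m + 6)) + quad_const m * (1 - p)\<^sup>2" using \<mu> p by blast
      have "1 - p \<le> c / (2 * quad_const m)" using that by auto
      then have "quad_const m * (1 - p) \<le> c / 2" using D by (simp add: field_simps)
      then have "(quad_const m * (1 - p)) * (1 - p) \<le> c / 2 * (1 - p)" using that by (intro mult_right_mono) auto
      moreover have "(1 - p) * (3 / (4 * real m + 6)) \<le> (1 - p) * (c / 2)" using that by (intro mult_left_mono m') auto
      moreover have "quad_const m * (1 - p)\<^sup>2 = (quad_const m * (1 - p)) * (1 - p)" by (simp add: power2_eq_square)
      moreover have "c / 2 * (1 - p) + (1 - p) * (c / 2) = c * (1 - p)" by (simp add: field_simps)
      ultimately have "\<mu> p - (1 + (1 - p) / 2) \<le> c * (1 - p)" using up by linarith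
      then show ?thesis using lo that by simp
    qed
    then show "\<forall>\<^sub>F p in at_left 1. norm (\<mu> p - (1 + (1 - p) / 2)) \<le> c * norm (1 - p)"
      unfolding eventually_at_left_field using b by blast
  qed
  then show ?thesis using \<mu> by blast
qed

end
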